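(* For $i=1,2$ let $\eta_i:\mathbb{D}\to\mathbb{D}$ be a continuous map which is analytic on the interior of $\mathbb{D}$. Assume further that $\eta_1$ is elliptic. Then: (1) If $\eta_1$ is a homeomorphism, then there are topological conjugacy algebras $\mathcal{A}_i$ for $(\mathbb{D},\eta_i)$, $i=1,2$, such that $\mathcal{A}_1(A(\mathbb{D}))$ and $\mathcal{A}_2(A(\mathbb{D}))$ are isomorphic (as algebras) if and only if there exists a homeomorphism $\gamma_s:\mathbb{D}\to\mathbb{D}$ which is analytic on the interior and satisfies either $\gamma_s\circ\eta_1=\eta_2\circ\gamma_s$, or ($\eta_2$ is a homeomorphism and) $\gamma_s\circ\eta_1=\eta_2^{-1}\circ\gamma_s$. (2) If $\eta_1$ is not a homeomorphism, then there are topological conjugacy algebras $\mathcal{A}_i$ for $(\mathbb{D},\eta_i)$, $i=1,2$, such that $\mathcal{A}_1(A(\mathbb{D}))$ and $\mathcal{A}_2(A(\mathbb{D}))$ are isomorphic (as algebras) if and only if there exists a homeomorphism $\gamma_s:\mathbb{D}\to\mathbb{D}$ which is analytic on the interior and satisfies $\gamma_s\circ\eta_1=\eta_2\circ\gamma_s$.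
   Context: $\mathbb{D}$ is the closed unit disc in $\mathbb{C}$ and $A(\mathbb{D})$ the disc algebra (functions continuous on $\mathbb{D}$ and analytic on its interior). A continuous map $\eta:\mathbb{D}\to\mathbb{D}$ which is analytic on the interior is called elliptic if $\eta$ has exactly one fixed point which is located in the interior of $\mathbb{D}$. Isomorphisms of algebras are bijective complex algebra homomorphisms; no continuity is assumed. Topological conjugacy algebra: let $\mathcal{X}$ be compact Hausdorff and $\eta:\mathcal{X}\to\mathcal{X}$ continuous. The skew polynomial algebra $P(\mathcal{X},\eta)$ consists of all polynomials $\sum_n f_nU^n$, $f_n\in C(\mathcal{X})$, with multiplication determined by $Uf=(f\circ\eta)U$. A topological conjugacy algebra for $(\mathcal{X},\eta)$ is a complex Banach algebra $\mathcal{A}$ such that: (1) $P(\mathcal{X},\eta)$ is contained in $\mathcal{A}$ as a dense subalgebra and the constant function $1$ is the identity of $\mathcal{A}$; (2) $C(\mathcal{X})\subseteq\mathcal{A}$ is closed and there is an algebra homomorphism $E_0:\mathcal{A}\to C(\mathcal{X})$ with $E_0(f)=f$ for all $f\in C(\mathcal{X})$ and $\ker E_0=\mathcal{A}U$; (3) $U$ is not a right divisor of $0$ (i.e. $aU=0$ implies $a=0$); (4) $\limsup_n(\|E_n\|\,\|U^n\|)^{1/n}\le 1$, where the coefficient maps $E_n:\mathcal{A}\to C(\mathcal{X})$ (automatically bounded) are defined inductively: each $a\in\mathcal{A}$ can be written uniquely as $a=E_0(a)+bU$ with $b\in\mathcal{A}$, and $E_{n+1}(a)=E_n(b)$ for $n\ge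 0$. If $\mathcal{S}\subseteq C(\mathcal{X})$ is a uniform algebra with $f\circ\eta\in\mathcal{S}$ for all $f\in\mathcal{S}$, then $\mathcal{A}(\mathcal{S})$ denotes the norm closed subalgebra of $\mathcal{A}$ generated by all polynomials $\sum_n f_nU^n$ with $f_n\in\mathcal{S}$ for all $n\ge0$. Here $\mathcal{X}=\mathbb{D}$, $\mathcal{S}=A(\mathbb{D})$. *)

theory Defs
  imports
    "HOL-Complex_Analysis.Complex_Analysis"
    "HOL-Algebra.Algebraic_Closure_Type"
begin

section \<open>Complex algebras and Banach algebras on a carrier set\<close>

text \<open>
  The scalars are the complex numbers, packaged as a ring record by the library constant
  \<open>ring_of_type_algebra\<close>. (The library locale \<open>algebra\<close> is restricted to commutative
  algebras, hence the locale below.)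
\<close>

locale complex_algebra =
  ring A + Module.module "ring_of_type_algebra :: complex ring" A
  for A :: "(complex, 'a, 'm) module_scheme" (structure) +
  assumes smult_mult_left:
      "x \<in> carrier A \<Longrightarrow> y \<in> carrier A \<Longrightarrow> (c \<odot>\<^bsub>A\<^esub> x) \<otimes> y = c \<odot>\<^bsub>A\<^esub> (x \<otimes> y)"
    and smult_mult_right:
      "x \<in> carrier A \<Longrightarrow> y \<in> carrier A \<Longrightarrow> x \<otimes> (c \<odot>\<^bsub>A\<^esub> y) = c \<odot>\<^bsub>A\<^esub> (x \<otimes> y)"

definition alg_hom ::
    "(complex, 'a, 'm) module_scheme \<Rightarrow> (complex, 'b, 'n) module_scheme \<Rightarrow> ('a \<Rightarrow> 'b) set" where
  "alg_hom A B =
     {h \<in> ring_hom A B. \<forall>c. \<forall>x\<in>carrier A. h (c \<odot>\<^bsub>A\<^esub> x) = c \<odot>\<^bsub>B\<^esub> h x}"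

definition alg_isomorphic ::
    "(complex, 'a, 'm) module_scheme \<Rightarrow> (complex, 'b, 'n) module_scheme \<Rightarrow> bool" where
  "alg_isomorphic A B \<longleftrightarrow> (\<exists>h\<in>alg_hom A B. bij_betw h (carrier A) (carrier B))"

definition subalgebra_of :: "'a set \<Rightarrow> (complex, 'a, 'm) module_scheme \<Rightarrow> bool" where
  "subalgebra_of B A \<longleftrightarrow> subring B A \<and> (\<forall>c. \<forall>x\<in>B. c \<odot>\<^bsub>A\<^esub> x \<in> B)"

record 'a normed_alg = "(complex, 'a) module" +
  nrm :: "'a \<Rightarrow> real"

text \<open>
  The distance is set to 0 off the carrier because the locale \<open>Metric_space\<close> demands
  nonnegativity and symmetry of the distance on the whole type.
\<close>

definition nrm_dist :: "('a, 'm) normed_alg_scheme \<Rightarrow> 'a \<Rightarrow> 'a \<Rightarrow> real" where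
  "nrm_dist A x y =
     (if x \<in> carrier A \<and> y \<in> carrier A then nrm A (x \<ominus>\<^bsub>A\<^esub> y) else 0)"

abbreviation nrm_topology :: "('a, 'm) normed_alg_scheme \<Rightarrow> 'a topology" where
  "nrm_topology A \<equiv> Metric_space.mtopology (carrier A) (nrm_dist A)"

locale banach_alg = complex_algebra A
  for A :: "('a, 'm) normed_alg_scheme" (structure) +
  assumes nrm_nonneg: "x \<in> carrier A \<Longrightarrow> 0 \<le> nrm A x"
    and nrm_eq_0_iff: "x \<in> carrier A \<Longrightarrow> nrm A x = 0 \<longleftrightarrow> x = \<zero>"
    and nrm_triangle: "x \<in> carrier A \<Longrightarrow> y \<in> carrier A \<Longrightarrow> nrm A (x \<oplus> y) \<le> nrm A x + nrm A y"
    and nrm_smult: "x \<in> carrier A \<Longrightarrow> nrm A (c \<odot>\<^bsub>A\<^esub> x) = cmod c * nrm A x"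
    and nrm_mult: "x \<in> carrier A \<Longrightarrow> y \<in> carrier A \<Longrightarrow> nrm A (x \<otimes> y) \<le> nrm A x * nrm A y"
    and complete: "Metric_space.mcomplete (carrier A) (nrm_dist A)"


section \<open>Continuous functions and the skew polynomial algebra\<close>

text \<open>
  Functions on the space \<open>K\<close> are represented by extensional functions, so that two of them are
  equal as soon as they agree on \<open>topspace K\<close>.
\<close>

definition cont_alg :: "'x topology \<Rightarrow> ('x \<Rightarrow> complex) normed_alg" where
  "cont_alg K =
     \<lparr>carrier = {f \<in> extensional (topspace K). continuous_map K euclidean f},
      monoid.mult = (\<lambda>f g. \<lambda>x\<in>topspace K. f x * g x),
      monoid.one = (\<lambda>x\<in>topspace K. 1),
      ring.zero = (\<lambda>x\<in>topspace K. 0),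
      ring.add = (\<lambda>f g. \<lambda>x\<in>topspace K. f x + g x),
      module.smult = (\<lambda>c f. \<lambda>x\<in>topspace K. c * f x),
      nrm = (\<lambda>f. SUP x\<in>topspace K. cmod (f x))\<rparr>"

text \<open>
  A polynomial \<open>\<Sum>n. f\<^sub>n U\<^sup>n\<close> is its coefficient sequence. Iterating \<open>U f = (f \<circ> \<eta>) U\<close> gives
  \<open>(f U\<^sup>i) (g U\<^sup>j) = (f \<cdot> (g \<circ> \<eta>\<^sup>i)) U\<^sup>i\<^sup>+\<^sup>j\<close>.
\<close>

definition skew_poly ::
    "'x topology \<Rightarrow> ('x \<Rightarrow> 'x) \<Rightarrow> (complex, nat \<Rightarrow> 'x \<Rightarrow> complex) module" where
  "skew_poly K \<eta> =
     \<lparr>carrier = {p. (\<forall>n. p n \<in> carrier (cont_alg K)) \<and> finite {n. p n \<noteq> \<zero>\<^bsub>cont_alg K\<^esub>}},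
      monoid.mult = (\<lambda>p q n. \<lambda>x\<in>topspace K. \<Sum>i\<le>n. p i x * q (n - i) ((\<eta> ^^ i) x)),
      monoid.one = (\<lambda>n. if n = 0 then \<one>\<^bsub>cont_alg K\<^esub> else \<zero>\<^bsub>cont_alg K\<^esub>),
      ring.zero = (\<lambda>n. \<zero>\<^bsub>cont_alg K\<^esub>),
      ring.add = (\<lambda>p q n. p n \<oplus>\<^bsub>cont_alg K\<^esub> q n),
      module.smult = (\<lambda>c p n. c \<odot>\<^bsub>cont_alg K\<^esub> p n)\<rparr>"

definition const_poly :: "'x topology \<Rightarrow> ('x \<Rightarrow> complex) \<Rightarrow> nat \<Rightarrow> 'x \<Rightarrow> complex" where
  "const_poly K f = (\<lambda>n. if n = 0 then f else \<zero>\<^bsub>cont_alg K\<^esub>)"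

definition var_poly :: "'x topology \<Rightarrow> nat \<Rightarrow> 'x \<Rightarrow> complex" where
  "var_poly K = (\<lambda>n. if n = 1 then \<one>\<^bsub>cont_alg K\<^esub> else \<zero>\<^bsub>cont_alg K\<^esub>)"

lemma var_poly_mult_const_poly:
  assumes "\<eta> \<in> topspace K \<rightarrow> topspace K"
  shows "var_poly K \<otimes>\<^bsub>skew_poly K \<eta>\<^esub> const_poly K f =
         const_poly K (restrict (f \<circ> \<eta>) (topspace K)) \<otimes>\<^bsub>skew_poly K \<eta>\<^esub> var_poly K"
proof (intro ext)
  fix n x
  let ?c = "const_poly K (restrict (f \<circ> \<eta>) (topspace K))"
  have eq: "(\<Sum>i\<le>n. var_poly K i x * const_poly K f (n - i) ((\<eta> ^^ i) x)) =
        (\<Sum>i\<le>n. ?c i x * var_poly K (n - i) ((\<eta> ^^ i) x))" if x: "x \<in> topspace K"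
  proof -
    have y: "\<eta> x \<in> topspace K" using assms x by auto
    have it: "(\<eta> ^^ i) x \<in> topspace K" for i
      by (induction i) (use x assms in auto)
    have "(\<Sum>i\<le>n. var_poly K i x * const_poly K f (n - i) ((\<eta> ^^ i) x)) =
          (\<Sum>i\<le>n. if i = 1 then (if n = 1 then f (\<eta> x) else 0) else 0)"
      by (intro sum.cong refl) (use x y it in \<open>auto simp: var_poly_def const_poly_def cont_alg_def\<close>)
    moreover have "(\<Sum>i\<le>n. ?c i x * var_poly K (n - i) ((\<eta> ^^ i) x)) =
          (\<Sum>i\<le>n. if i = 0 then (if n = 1 then f (\<eta> x) else 0) else 0)"
      by (intro sum.cong refl) (use x y it in \<open>auto simp: var_poly_def const_poly_def cont_alg_def\<close>)
    ultimately show ?thesis by (simp add: sum.delta)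
  qed
  show "(var_poly K \<otimes>\<^bsub>skew_poly K \<eta>\<^esub> const_poly K f) n x =
        (?c \<otimes>\<^bsub>skew_poly K \<eta>\<^esub> var_poly K) n x"
    using eq by (simp add: skew_poly_def restrict_def)
qed


section \<open>Topological conjugacy algebras\<close>

text \<open>
  For \<open>j\<close> the embedding of the functions, \<open>u\<close> the image of \<open>U\<close> and \<open>E\<^sub>0\<close> the homomorphism onto
  the functions, \<open>coeff_map A j u E\<^sub>0 n\<close> is the \<open>n\<close>-th coefficient map; the description operator
  picks the unique \<open>b\<close> with \<open>a = E\<^sub>0(a) + b U\<close>.
\<close>

primrec coeff_map ::
    "(complex, 'a, 'm) module_scheme \<Rightarrow> ('f \<Rightarrow> 'a) \<Rightarrow> 'a \<Rightarrow> ('a \<Rightarrow> 'f) \<Rightarrow> nat \<Rightarrow> 'a \<Rightarrow> 'f" where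
  "coeff_map A j u E\<^sub>0 0 a = E\<^sub>0 a"
| "coeff_map A j u E\<^sub>0 (Suc n) a =
     coeff_map A j u E\<^sub>0 n (THE b. b \<in> carrier A \<and> a = j (E\<^sub>0 a) \<oplus>\<^bsub>A\<^esub> b \<otimes>\<^bsub>A\<^esub> u)"

text \<open>
  The coefficient maps are automatically bounded. Extended real operator norms avoid having to
  put this into the definition: an unbounded map has norm \<open>\<infinity>\<close>, and \<open>\<infinity>\<close> is its own \<open>n\<close>-th root.
\<close>

definition op_nrm ::
    "('a, 'm) normed_alg_scheme \<Rightarrow> ('b, 'n) normed_alg_scheme \<Rightarrow> ('a \<Rightarrow> 'b) \<Rightarrow> ereal" where
  "op_nrm A B T = (SUP a\<in>{a \<in> carrier A. nrm A a \<le> 1}. ereal (nrm B (T a)))"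

definition ereal_root :: "nat \<Rightarrow> ereal \<Rightarrow> ereal" where
  "ereal_root n x = (if x = \<infinity> then \<infinity> else ereal (root n (real_of_ereal x)))"

text \<open>
  \<open>\<iota>\<close> is the inclusion of the skew polynomial algebra into \<open>A\<close>. As \<open>\<iota>\<close> is a unital homomorphism,
  the constant function 1 is sent to the identity of \<open>A\<close>.
\<close>

locale topological_conjugacy_algebra = banach_alg A
  for K :: "'x topology"
    and \<eta> :: "'x \<Rightarrow> 'x"
    and A :: "('a, 'm) normed_alg_scheme" (structure)
    and \<iota> :: "(nat \<Rightarrow> 'x \<Rightarrow> complex) \<Rightarrow> 'a"
    and E\<^sub>0 :: "'a \<Rightarrow> 'x \<Rightarrow> complex" +
  assumes compact: "compact_space K"
    and Hausdorff: "Hausdorff_space K"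
    and continuous: "continuous_map K K \<eta>"
    and poly_hom: "\<iota> \<in> alg_hom (skew_poly K \<eta>) A"
    and poly_inj: "inj_on \<iota> (carrier (skew_poly K \<eta>))"
    and poly_dense:
      "nrm_topology A closure_of (\<iota> ` carrier (skew_poly K \<eta>)) = carrier A"
    and functions_closed:
      "closedin (nrm_topology A) ((\<lambda>f. \<iota> (const_poly K f)) ` carrier (cont_alg K))"
    and E0_hom: "E\<^sub>0 \<in> alg_hom A (cont_alg K)"
    and E0_functions: "f \<in> carrier (cont_alg K) \<Longrightarrow> E\<^sub>0 (\<iota> (const_poly K f)) = f"
    and E0_kernel:
      "{a \<in> carrier A. E\<^sub>0 a = \<zero>\<^bsub>cont_alg K\<^esub>} = (\<lambda>b. b \<otimes> \<iota> (var_poly K)) ` carrier A"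
    and not_right_zero_divisor:
      "a \<in> carrier A \<Longrightarrow> a \<otimes> \<iota> (var_poly K) = \<zero> \<Longrightarrow> a = \<zero>"
    and limsup_coeff:
      "limsup (\<lambda>n. ereal_root n
         (op_nrm A (cont_alg K) (coeff_map A (\<lambda>f. \<iota> (const_poly K f)) (\<iota> (var_poly K)) E\<^sub>0 n)
          * ereal (nrm A (\<iota> (var_poly K) [^] n)))) \<le> 1"

definition uniform_subalgebra ::
    "('a, 'm) normed_alg_scheme \<Rightarrow> ((nat \<Rightarrow> 'x \<Rightarrow> complex) \<Rightarrow> 'a) \<Rightarrow> 'x topology \<Rightarrow> ('x \<Rightarrow> 'x) \<Rightarrow>
     ('x \<Rightarrow> complex) set \<Rightarrow> ('a, 'm) normed_alg_scheme" where
  "uniform_subalgebra A \<iota> K \<eta> S =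
     A\<lparr>carrier := \<Inter>{B. subalgebra_of B A \<and> closedin (nrm_topology A) B \<and>
        \<iota> ` {p \<in> carrier (skew_poly K \<eta>). \<forall>n. p n \<in> S} \<subseteq> B}\<rparr>"


section \<open>The disc\<close>

abbreviation disc :: "complex set" where "disc \<equiv> cball 0 1"

abbreviation disc_space :: "complex topology" where "disc_space \<equiv> top_of_set disc"

definition disc_algebra :: "(complex \<Rightarrow> complex) set" where
  "disc_algebra = {f \<in> carrier (cont_alg disc_space). f holomorphic_on ball 0 1}"

definition disc_map :: "(complex \<Rightarrow> complex) \<Rightarrow> bool" where
  "disc_map \<eta> \<longleftrightarrow> continuous_on disc \<eta> \<and> \<eta> ` disc \<subseteq> disc \<and> \<eta> holomorphic_on ball 0 1"

text \<open>
  The interior fixed point is the only fixed point in the closed disc; thus \<open>z \<mapsto> z\<^sup>2\<close>, which also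
  fixes 1, is not elliptic.
\<close>

definition elliptic :: "(complex \<Rightarrow> complex) \<Rightarrow> bool" where
  "elliptic \<eta> \<longleftrightarrow> disc_map \<eta> \<and> (\<exists>z\<in>ball 0 1. {w \<in> disc. \<eta> w = w} = {z})"

definition disc_homeo :: "(complex \<Rightarrow> complex) \<Rightarrow> bool" where
  "disc_homeo f \<longleftrightarrow> (\<exists>g. homeomorphism disc disc f g)"

text \<open>
  Since HOL cannot quantify over types, the carriers of the two algebras are subsets of one ambient
  type \<open>'u\<close>. A topological conjugacy algebra for the disc is a separable metric space, hence has
  the cardinality of the continuum; so no generality is lost for any \<open>'u\<close> into which
  \<open>complex\<close> injects.
\<close>

definition conjugacy_algebras_isomorphic ::
    "'u itself \<Rightarrow> (complex \<Rightarrow> complex) \<Rightarrow> (complex \<Rightarrow> complex) \<Rightarrow> bool" where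
  "conjugacy_algebras_isomorphic _ \<eta>\<^sub>1 \<eta>\<^sub>2 \<longleftrightarrow>
     (\<exists>(A\<^sub>1 :: 'u normed_alg) \<iota>\<^sub>1 E\<^sub>1 (A\<^sub>2 :: 'u normed_alg) \<iota>\<^sub>2 E\<^sub>2.
        topological_conjugacy_algebra disc_space \<eta>\<^sub>1 A\<^sub>1 \<iota>\<^sub>1 E\<^sub>1 \<and>
        topological_conjugacy_algebra disc_space \<eta>\<^sub>2 A\<^sub>2 \<iota>\<^sub>2 E\<^sub>2 \<and>
        alg_isomorphic (uniform_subalgebra A\<^sub>1 \<iota>\<^sub>1 disc_space \<eta>\<^sub>1 disc_algebra)
                       (uniform_subalgebra A\<^sub>2 \<iota>\<^sub>2 disc_space \<eta>\<^sub>2 disc_algebra))"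

end

theory Submission
  imports Defs
begin

text \<open>
  An isomorphism \<open>h\<close> pulls the character \<open>a \<mapsto> E\<^sub>0(a)(x)\<close> of the second algebra back to a character
  of the first one, which is determined by its values \<open>\<alpha>(x)\<close> on the coordinate function and
  \<open>\<beta>(x)\<close> on \<open>U\<close>; if \<open>\<beta>(x) \<noteq> 0\<close>, then \<open>\<alpha>(x)\<close> is a fixed point of \<open>\<eta>\<^sub>1\<close>. If \<open>\<beta> = 0\<close>, then
  \<open>\<alpha>\<close> conjugates the two maps. Otherwise the identity theorem forces \<open>\<alpha> = z\<^sub>1\<close>, the interior fixed
  point; then \<open>\<beta>\<close> is injective, and
  comparing the representations by upper triangular \<open>2 \<times> 2\<close> matrices yields
  \<open>\<beta> = \<eta>\<^sub>1'(z\<^sub>1) \<cdot> (\<beta> \<circ> \<eta>\<^sub>2)\<close>, so \<open>\<eta>\<^sub>2\<close> and, by symmetry, \<open>\<eta>\<^sub>1\<close> are conjugate to mutually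
  inverse rotations.

  Conversely, the semicrossed product norm is invariant under conjugacy. Elliptic homeomorphisms are
  conjugate to rotations, and for the rotation by \<open>l\<close> the exchange of \<open>z\<close> and \<open>U\<close> is, by
  Parseval's identity on roots of unity, isometric onto the algebra of the rotation by \<open>l\<^sup>-\<^sup>1\<close>.
\<close>

section \<open>Banach algebras on a carrier set\<close>

text \<open>Continuity is needed only of the pulled back characters, and these are contractive on a
  closed subalgebra whatever the isomorphism is; hence two of them that agree on polynomials agree
  everywhere. Such a character is thus determined by \<open>(alpha x, beta x)\<close>, and since
  preimages of functions separate points, \<open>beta\<close> is injective as soon as
  \<open>alpha\<close> is constant. The first obstacle in this case is that comparing derivations
  relates \<open>beta\<close> to \<open>beta \<circ> \<eta>\<^sub>2\<close> only where the
  derivation does not vanish on \<open>z - z\<^sub>1\<close>. Total vanishing is excluded with the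
  preimage of \<open>U\<close>: the growth condition on the coefficient maps turns it into a power
  series in \<open>beta\<close>, whose constant term must be 0. The second obstacle is a fixed point
  of \<open>\<eta>\<^sub>2\<close> on the circle, where the Schwarz lemma says nothing. There
  \<open>beta\<close> would have a square root in the disc algebra, and a product of two elements
  killed by the character at a fixed point has no off-diagonal entry, unlike \<open>U\<close>. That
  the multiplier has modulus one comes from iterating the relation.\<close>

primrec psum :: "('a, 'm) ring_scheme \<Rightarrow> (nat \<Rightarrow> 'a) \<Rightarrow> nat \<Rightarrow> 'a" where
  "psum A t 0 = \<zero>\<^bsub>A\<^esub>"
| "psum A t (Suc n) = psum A t n \<oplus>\<^bsub>A\<^esub> t n"

context complex_algebra
begin

lemma A_ring: "ring A" and A_group: "abelian_group A" and A_monoid: "abelian_monoid A"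
    and A_semiring: "semiring A"
  by unfold_locales

text \<open>
  Unqualified names such as \<open>l_distr\<close> denote facts about the ring of scalars here.
\<close>

lemmas A_simprules = ring.ring_simprules[OF A_ring]
lemmas minus_eq = abelian_group.minus_eq[OF A_group]
lemmas r_neg1 = abelian_group.r_neg1[OF A_group]
lemmas r_neg2 = abelian_group.r_neg2[OF A_group]
lemmas minus_add = abelian_group.minus_add[OF A_group]
lemmas minus_equality = abelian_group.minus_equality[OF A_group]
lemmas r_neg = abelian_group.r_neg[OF A_group]
lemmas l_neg = abelian_group.l_neg[OF A_group]
lemmas r_right_minus_eq = ring.r_right_minus_eq[OF A_ring]
lemmas a_ac = abelian_monoid.a_ac[OF A_monoid]
lemmas a_assoc = abelian_monoid.a_assoc[OF A_monoid]
lemmas a_comm = abelian_monoid.a_comm[OF A_monoid]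
lemmas a_inv_closed = abelian_group.a_inv_closed[OF A_group]
lemmas minus_closed [simp, intro] = abelian_group.minus_closed[OF A_group]
lemmas l_distr = semiring.l_distr[OF A_semiring]
lemmas r_distr = semiring.r_distr[OF A_semiring]
lemmas l_minus = ring.l_minus[OF A_ring]
lemmas r_minus = ring.r_minus[OF A_ring]
lemmas m_closed = monoid.m_closed[OF ring.is_monoid[OF A_ring]]
lemmas m_assoc = monoid.m_assoc[OF ring.is_monoid[OF A_ring]]
lemmas nat_pow_Suc = monoid.nat_pow_Suc[OF ring.is_monoid[OF A_ring]]
lemmas nat_pow_Suc2 = monoid.nat_pow_Suc2[OF ring.is_monoid[OF A_ring]]

lemma scalar_simps [simp]:
  "carrier (ring_of_type_algebra :: complex ring) = UNIV"
  "a \<oplus>\<^bsub>ring_of_type_algebra\<^esub> b = a + (b :: complex)"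
  "a \<otimes>\<^bsub>ring_of_type_algebra\<^esub> b = a * (b :: complex)"
  "\<one>\<^bsub>ring_of_type_algebra\<^esub> = (1 :: complex)"
  "\<zero>\<^bsub>ring_of_type_algebra\<^esub> = (0 :: complex)"
  by (simp_all add: ring_of_type_algebra_def)

lemma smult_in [simp, intro]: "x \<in> carrier A \<Longrightarrow> c \<odot>\<^bsub>A\<^esub> x \<in> carrier A"
  using smult_closed[of c x] by simp

lemma smult_add_left: "x \<in> carrier A \<Longrightarrow> (a + b) \<odot>\<^bsub>A\<^esub> x = a \<odot>\<^bsub>A\<^esub> x \<oplus> b \<odot>\<^bsub>A\<^esub> x"
  using smult_l_distr[of a b x] by simp

lemma smult_add_right:
  "x \<in> carrier A \<Longrightarrow> y \<in> carrier A \<Longrightarrow> a \<odot>\<^bsub>A\<^esub> (x \<oplus> y) = a \<odot>\<^bsub>A\<^esub> x \<oplus> a \<odot>\<^bsub>A\<^esub> y"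
  using smult_r_distr[of a x y] by simp

lemma smult_smult: "x \<in> carrier A \<Longrightarrow> a \<odot>\<^bsub>A\<^esub> (b \<odot>\<^bsub>A\<^esub> x) = (a * b) \<odot>\<^bsub>A\<^esub> x"
  using smult_assoc1[of a b x] by simp

lemma smult_1 [simp]: "x \<in> carrier A \<Longrightarrow> 1 \<odot>\<^bsub>A\<^esub> x = x"
  using smult_one[of x] by simp

lemma smult_0 [simp]: "x \<in> carrier A \<Longrightarrow> 0 \<odot>\<^bsub>A\<^esub> x = \<zero>"
proof -
  assume x: "x \<in> carrier A"
  have "0 \<odot>\<^bsub>A\<^esub> x \<oplus> 0 \<odot>\<^bsub>A\<^esub> x = 0 \<odot>\<^bsub>A\<^esub> x"
    using smult_add_left[OF x, of 0 0] by simp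
  then show ?thesis using r_neg1[of "0 \<odot>\<^bsub>A\<^esub> x" "0 \<odot>\<^bsub>A\<^esub> x"] x by (simp add: l_neg)
qed

lemma smult_minus_1: "x \<in> carrier A \<Longrightarrow> (-1) \<odot>\<^bsub>A\<^esub> x = \<ominus> x"
proof -
  assume x: "x \<in> carrier A"
  have "(-1) \<odot>\<^bsub>A\<^esub> x \<oplus> x = \<zero>"
    using smult_add_left[OF x, of "-1" 1] x by simp
  then show ?thesis using x by (intro minus_equality[symmetric]) auto
qed

lemma smult_minus_right: "x \<in> carrier A \<Longrightarrow> a \<odot>\<^bsub>A\<^esub> (\<ominus> x) = \<ominus> (a \<odot>\<^bsub>A\<^esub> x)"
  by (simp add: smult_minus_1[symmetric] smult_smult)

lemma smult_diff_right:
  "x \<in> carrier A \<Longrightarrow> y \<in> carrier A \<Longrightarrow> a \<odot>\<^bsub>A\<^esub> (x \<ominus> y) = a \<odot>\<^bsub>A\<^esub> x \<ominus> a \<odot>\<^bsub>A\<^esub> y"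
  by (simp add: minus_eq smult_add_right smult_minus_right)

lemma psum_closed: "(\<And>n. t n \<in> carrier A) \<Longrightarrow> psum A t n \<in> carrier A"
  by (induction n) auto

lemma diff_left_distr:
  "\<lbrakk>x \<in> carrier A; y \<in> carrier A; z \<in> carrier A\<rbrakk> \<Longrightarrow> (x \<ominus> y) \<otimes> z = x \<otimes> z \<ominus> y \<otimes> z"
  by (simp add: minus_eq l_distr l_minus)

lemma diff_right_distr:
  "\<lbrakk>x \<in> carrier A; y \<in> carrier A; z \<in> carrier A\<rbrakk> \<Longrightarrow> z \<otimes> (x \<ominus> y) = z \<otimes> x \<ominus> z \<otimes> y"
  by (simp add: minus_eq r_distr r_minus)

lemma add_diff_add:
  "\<lbrakk>a \<in> carrier A; b \<in> carrier A; c \<in> carrier A; d \<in> carrier A\<rbrakk>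
   \<Longrightarrow> (a \<oplus> b) \<ominus> (c \<oplus> d) = (a \<ominus> c) \<oplus> (b \<ominus> d)"
  by (simp add: minus_eq minus_add a_ac)

lemma diff_add_diff:
  "\<lbrakk>a \<in> carrier A; b \<in> carrier A; c \<in> carrier A\<rbrakk> \<Longrightarrow> (a \<ominus> b) \<oplus> (b \<ominus> c) = a \<ominus> c"
  by (simp add: minus_eq a_assoc r_neg2 r_neg1)

lemma diff_eq_0: "\<lbrakk>a \<in> carrier A; b \<in> carrier A; a \<ominus> b = \<zero>\<rbrakk> \<Longrightarrow> a = b"
  using r_right_minus_eq by blast

lemma diff_add_cancel': "\<lbrakk>a \<in> carrier A; b \<in> carrier A\<rbrakk> \<Longrightarrow> (a \<ominus> b) \<oplus> b = a"
  by (simp add: minus_eq a_assoc l_neg)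

lemma add_diff_cancel': "\<lbrakk>a \<in> carrier A; b \<in> carrier A\<rbrakk> \<Longrightarrow> (b \<oplus> a) \<ominus> b = a"
  using a_comm[of "b \<oplus> a" "\<ominus> b"] by (simp add: minus_eq r_neg1)

end

section \<open>Sequences, series and automatic continuity of characters in a Banach algebra\<close>

context banach_alg
begin

lemma nrm_0 [simp]: "nrm A \<zero> = 0"
  by (simp add: nrm_eq_0_iff)

lemma nrm_minus [simp]: "x \<in> carrier A \<Longrightarrow> nrm A (\<ominus> x) = nrm A x"
  by (simp add: smult_minus_1[symmetric] nrm_smult)

lemma nrm_diff_le: "\<lbrakk>x \<in> carrier A; y \<in> carrier A\<rbrakk> \<Longrightarrow> nrm A (x \<ominus> y) \<le> nrm A x + nrm A y"
  by (metis a_inv_closed minus_eq nrm_minus nrm_triangle)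

lemma nrm_diff_commute: "\<lbrakk>x \<in> carrier A; y \<in> carrier A\<rbrakk> \<Longrightarrow> nrm A (x \<ominus> y) = nrm A (y \<ominus> x)"
proof -
  assume "x \<in> carrier A" "y \<in> carrier A"
  then have "\<ominus> (y \<ominus> x) = x \<ominus> y" by (simp add: minus_eq minus_add a_comm)
  then show ?thesis using \<open>x \<in> carrier A\<close> \<open>y \<in> carrier A\<close> by (metis minus_closed nrm_minus)
qed

lemma nrm_diff_triangle:
  "\<lbrakk>x \<in> carrier A; y \<in> carrier A; z \<in> carrier A\<rbrakk>
   \<Longrightarrow> nrm A (x \<ominus> z) \<le> nrm A (x \<ominus> y) + nrm A (y \<ominus> z)"
  using nrm_triangle[of "x \<ominus> y" "y \<ominus> z"] by (simp add: diff_add_diff)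

lemma nrm_le_diff:
  "\<lbrakk>x \<in> carrier A; y \<in> carrier A\<rbrakk> \<Longrightarrow> nrm A x \<le> nrm A (x \<ominus> y) + nrm A y"
  using nrm_triangle[of "x \<ominus> y" y] by (simp add: diff_add_cancel')

sublocale MS: Metric_space "carrier A" "nrm_dist A"
proof
  show "0 \<le> nrm_dist A x y" for x y by (simp add: nrm_dist_def nrm_nonneg)
  show "nrm_dist A x y = nrm_dist A y x" for x y
    by (simp add: nrm_dist_def nrm_diff_commute)
  show "x \<in> carrier A \<Longrightarrow> y \<in> carrier A \<Longrightarrow> (nrm_dist A x y = 0) = (x = y)" for x y
    using r_right_minus_eq[of x y] by (simp add: nrm_dist_def nrm_eq_0_iff)
  show "nrm_dist A x z \<le> nrm_dist A x y + nrm_dist A y z"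
    if "x \<in> carrier A" "y \<in> carrier A" "z \<in> carrier A" for x y z
    using that by (simp add: nrm_dist_def nrm_diff_triangle)
qed

lemma closure_iff:
  assumes "S \<subseteq> carrier A"
  shows "a \<in> nrm_topology A closure_of S \<longleftrightarrow>
    a \<in> carrier A \<and> (\<forall>e>0. \<exists>s\<in>S. nrm A (a \<ominus> s) < e)"
  using assms by (fastforce simp: MS.metric_closure_of nrm_dist_def subset_iff)

lemma closed_iff:
  "closedin (nrm_topology A) S \<longleftrightarrow>
   S \<subseteq> carrier A \<and> (\<forall>a\<in>carrier A. (\<forall>e>0. \<exists>s\<in>S. nrm A (a \<ominus> s) < e) \<longrightarrow> a \<in> S)"
proof -
  have "S \<subseteq> carrier A \<Longrightarrow> closedin (nrm_topology A) S \<longleftrightarrow> nrm_topology A closure_of S \<subseteq> S"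
    by (metis MS.topspace_mtopology closure_of_subset_eq)
  moreover have "closedin (nrm_topology A) S \<Longrightarrow> S \<subseteq> carrier A"
    by (metis MS.topspace_mtopology closedin_subset)
  ultimately show ?thesis using closure_iff by blast
qed

lemma closedD:
  assumes "closedin (nrm_topology A) S" "a \<in> carrier A" "\<And>n. s n \<in> S"
    and "(\<lambda>n. nrm A (s n \<ominus> a)) \<longlonglongrightarrow> 0"
  shows "a \<in> S"
proof -
  have S: "S \<subseteq> carrier A" using assms(1) closed_iff by blast
  have "\<exists>x\<in>S. nrm A (a \<ominus> x) < e" if "e > 0" for e
  proof -
    have "eventually (\<lambda>n. nrm A (s n \<ominus> a) < e) sequentially"
      using order_tendstoD(2)[OF assms(4) that] .
    then obtain n where "nrm A (s n \<ominus> a) < e" by (auto simp: eventually_sequentially)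
    then show ?thesis using assms S nrm_diff_commute[of "s n" a] by (metis subsetD)
  qed
  then show ?thesis using assms(1,2) closed_iff by blast
qed

lemma Cauchy_limit:
  assumes s: "\<And>n. s n \<in> carrier A"
    and C: "\<And>e. e > 0 \<Longrightarrow> \<exists>N. \<forall>m\<ge>N. \<forall>n\<ge>N. nrm A (s m \<ominus> s n) < e"
  obtains l where "l \<in> carrier A" "(\<lambda>n. nrm A (s n \<ominus> l)) \<longlonglongrightarrow> 0"
proof -
  have "MS.MCauchy s"
    unfolding MS.MCauchy_def using s C by (fastforce simp: nrm_dist_def)
  then obtain l where "limitin MS.mtopology s l sequentially"
    using complete MS.mcomplete_def by blast
  then have "l \<in> carrier A" "(\<lambda>n. nrm_dist A (s n) l) \<longlonglongrightarrow> 0"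
    by (auto simp: MS.limitin_metric_dist_null)
  moreover have "nrm_dist A (s n) l = nrm A (s n \<ominus> l)" for n
    using s calculation by (simp add: nrm_dist_def)
  ultimately show ?thesis using that by auto
qed

lemma nrm_limit_le:
  assumes "\<And>n. s n \<in> carrier A" "l \<in> carrier A" "(\<lambda>n. nrm A (s n \<ominus> l)) \<longlonglongrightarrow> 0"
    and "\<And>n. nrm A (s n) \<le> c"
  shows "nrm A l \<le> c"
proof (rule LIMSEQ_le_const)
  show "(\<lambda>n. c + nrm A (s n \<ominus> l)) \<longlonglongrightarrow> c"
    using tendsto_add[OF tendsto_const assms(3)] by simp
  show "\<exists>N. \<forall>n\<ge>N. nrm A l \<le> c + nrm A (s n \<ominus> l)"
  proof (intro exI allI impI)
    fix n
    have "nrm A l \<le> nrm A (l \<ominus> s n) + nrm A (s n)" using assms nrm_le_diff by blast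
    then show "nrm A l \<le> c + nrm A (s n \<ominus> l)"
      using assms(4)[of n] nrm_diff_commute[OF assms(1)[of n] assms(2)] by linarith
  qed
qed

lemma limit_unique:
  assumes "\<And>n. s n \<in> carrier A" "l \<in> carrier A" "l' \<in> carrier A"
    and "(\<lambda>n. nrm A (s n \<ominus> l)) \<longlonglongrightarrow> 0" "(\<lambda>n. nrm A (s n \<ominus> l')) \<longlonglongrightarrow> 0"
  shows "l = l'"
proof -
  have "nrm A (l \<ominus> l') \<le> 0"
  proof (rule LIMSEQ_le_const)
    show "(\<lambda>n. nrm A (s n \<ominus> l) + nrm A (s n \<ominus> l')) \<longlonglongrightarrow> 0"
      using tendsto_add[OF assms(4,5)] by simp
    show "\<exists>N. \<forall>n\<ge>N. nrm A (l \<ominus> l') \<le> nrm A (s n \<ominus> l) + nrm A (s n \<ominus> l')"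
      using assms nrm_diff_commute nrm_diff_triangle by metis
  qed
  then show ?thesis using assms nrm_nonneg nrm_eq_0_iff diff_eq_0
    by (metis minus_closed order_antisym)
qed

lemma psum_diff:
  assumes t: "\<And>n. t n \<in> carrier A" and "\<And>n. nrm A (t n) \<le> g n" and "m \<le> n"
  shows "nrm A (psum A t n \<ominus> psum A t m) \<le> sum g {m..<n}"
  using \<open>m \<le> n\<close>
proof (induction n rule: dec_induct)
  case base
  then show ?case using psum_closed[OF t] by (simp add: minus_eq r_neg)
next
  case (step n)
  have "psum A t (Suc n) \<ominus> psum A t m = (psum A t n \<ominus> psum A t m) \<oplus> t n"
    using psum_closed[of t] t by (simp add: minus_eq a_ac)
  then have "nrm A (psum A t (Suc n) \<ominus> psum A t m) \<le> nrm A (psum A t n \<ominus> psum A t m) + nrm A (t n)"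
    using psum_closed[of t] t nrm_triangle by (metis minus_closed)
  also have "\<dots> \<le> sum g {m..<Suc n}" using step assms(2)[of n] by simp
  finally show ?case .
qed

lemma series_converges:
  assumes t: "\<And>n. t n \<in> carrier A" and le: "\<And>n. nrm A (t n) \<le> g n" and g: "summable g"
  obtains l where "l \<in> carrier A" "(\<lambda>n. nrm A (psum A t n \<ominus> l)) \<longlonglongrightarrow> 0" "nrm A l \<le> suminf g"
proof -
  have g0: "g n \<ge> 0" for n using le[of n] nrm_nonneg[OF t[of n]] by linarith
  have "\<exists>N. \<forall>m\<ge>N. \<forall>n\<ge>N. nrm A (psum A t m \<ominus> psum A t n) < e" if "e > 0" for e
  proof -
    obtain N where N: "\<And>m n. m \<ge> N \<Longrightarrow> norm (sum g {m..<n}) < e"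
      using g \<open>e > 0\<close> summable_Cauchy by metis
    have "nrm A (psum A t m \<ominus> psum A t n) < e" if "m \<ge> N" "n \<ge> N" for m n
    proof (cases "m \<le> n")
      case True
      then show ?thesis
        using psum_diff[of t g, OF t le True] N[OF that(1), of n] g0 psum_closed[of t] t nrm_diff_commute
        by (smt (verit) real_norm_def)
    next
      case False
      then show ?thesis
        using psum_diff[of t g n m, OF t le] N[OF that(2), of m] g0 by (smt (verit) nat_le_linear real_norm_def)
    qed
    then show ?thesis by blast
  qed
  then obtain l where l: "l \<in> carrier A" "(\<lambda>n. nrm A (psum A t n \<ominus> l)) \<longlonglongrightarrow> 0"
    using Cauchy_limit[of "psum A t"] psum_closed[of t] t by metis
  have "nrm A (psum A t n) \<le> suminf g" for n
  proof -
    have "nrm A (psum A t n) \<le> sum g {0..<n}"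
      using psum_diff[of t g, OF t le, of 0 n] psum_closed[of t n] t by (simp add: minus_eq)
    also have "\<dots> \<le> suminf g" using g g0 by (simp add: sum_le_suminf)
    finally show ?thesis .
  qed
  then show ?thesis using that l nrm_limit_le[OF _ l] psum_closed t by metis
qed

lemma subalgebra_ofD:
  assumes "subalgebra_of B A"
  shows "B \<subseteq> carrier A" "\<zero> \<in> B" "\<one> \<in> B"
    "x \<in> B \<Longrightarrow> y \<in> B \<Longrightarrow> x \<oplus> y \<in> B" "x \<in> B \<Longrightarrow> y \<in> B \<Longrightarrow> x \<otimes> y \<in> B"
    "x \<in> B \<Longrightarrow> c \<odot>\<^bsub>A\<^esub> x \<in> B" "x \<in> B \<Longrightarrow> \<ominus> x \<in> B" "x \<in> B \<Longrightarrow> y \<in> B \<Longrightarrow> x \<ominus> y \<in> B"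
proof -
  have S: "subring B A" and c: "\<And>c x. x \<in> B \<Longrightarrow> c \<odot>\<^bsub>A\<^esub> x \<in> B"
    using assms by (auto simp: subalgebra_of_def)
  show "B \<subseteq> carrier A" "\<zero> \<in> B" "\<one> \<in> B" "x \<in> B \<Longrightarrow> y \<in> B \<Longrightarrow> x \<oplus> y \<in> B"
    "x \<in> B \<Longrightarrow> y \<in> B \<Longrightarrow> x \<otimes> y \<in> B" "x \<in> B \<Longrightarrow> \<ominus> x \<in> B" "x \<in> B \<Longrightarrow> y \<in> B \<Longrightarrow> x \<ominus> y \<in> B"
    using S subringE[OF S] by (auto simp: minus_eq)
  show "x \<in> B \<Longrightarrow> c \<odot>\<^bsub>A\<^esub> x \<in> B" using c by blast
qed

text \<open>
  If \<open>\<phi> c = 1\<close> with \<open>\<parallel>c\<parallel> < 1\<close>, then \<open>s = \<Sum>n. c\<^sup>n\<^sup>+\<^sup>1\<close> satisfies \<open>s = c + c s\<close>, hence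
  \<open>\<phi> s = 1 + \<phi> s\<close>.
\<close>

lemma character_contractive:
  assumes B: "subalgebra_of B A" "closedin (nrm_topology A) B"
    and add: "\<And>x y. x \<in> B \<Longrightarrow> y \<in> B \<Longrightarrow> \<phi> (x \<oplus> y) = \<phi> x + (\<phi> y :: complex)"
    and mult: "\<And>x y. x \<in> B \<Longrightarrow> y \<in> B \<Longrightarrow> \<phi> (x \<otimes> y) = \<phi> x * \<phi> y"
    and smult: "\<And>c x. x \<in> B \<Longrightarrow> \<phi> (c \<odot>\<^bsub>A\<^esub> x) = c * \<phi> x"
    and b: "b \<in> B"
  shows "cmod (\<phi> b) \<le> nrm A b"
proof (rule ccontr)
  note BD = subalgebra_ofD[OF B(1)]
  assume "\<not> cmod (\<phi> b) \<le> nrm A b"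
  then have less: "nrm A b < cmod (\<phi> b)" by simp
  define c where "c = (1 / \<phi> b) \<odot>\<^bsub>A\<^esub> b"
  have bA: "b \<in> carrier A" using b BD by blast
  have "\<phi> b \<noteq> 0" using less nrm_nonneg[OF bA] by auto
  have cB: "c \<in> B" using BD b by (simp add: c_def)
  then have cA: "c \<in> carrier A" using BD by blast
  have \<phi>c: "\<phi> c = 1" using \<open>\<phi> b \<noteq> 0\<close> b smult by (simp add: c_def)
  have nc: "nrm A c < 1" using bA less \<open>\<phi> b \<noteq> 0\<close> by (simp add: c_def nrm_smult norm_divide divide_simps)
  \<comment> \<open>The powers start at exponent 1: then \<open>s = c + c s\<close> suffices, and
    the value of \<open>\<phi>\<close> at the identity never enters.\<close>
  define t where "t n = c [^] Suc n" for n
  have tB: "t n \<in> B" for n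
  proof (induction n)
    case 0 show ?case using cA cB by (simp add: t_def)
  next
    case (Suc n) then show ?case using BD(5)[OF Suc cB] by (simp add: t_def)
  qed
  then have tA: "t n \<in> carrier A" for n using BD by blast
  have nt: "nrm A (t n) \<le> nrm A c ^ Suc n" for n
  proof (induction n)
    case 0 then show ?case using cA by (simp add: t_def)
  next
    case (Suc n)
    have "nrm A (t (Suc n)) \<le> nrm A (t n) * nrm A c"
      using nrm_mult[OF tA[of n] cA] by (simp add: t_def)
    also have "\<dots> \<le> nrm A c ^ Suc n * nrm A c"
      using Suc nrm_nonneg[OF cA] by (intro mult_right_mono) auto
    finally show ?case by (simp add: mult_ac)
  qed
  have "summable (\<lambda>n. nrm A c ^ Suc n)"
    using nc nrm_nonneg[OF cA] by (subst summable_Suc_iff) (simp add: summable_geometric)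
  from series_converges[OF tA nt this] obtain s where
    s: "s \<in> carrier A" "(\<lambda>n. nrm A (psum A t n \<ominus> s)) \<longlonglongrightarrow> 0" by blast
  have pB: "psum A t n \<in> B" for n by (induction n) (use tB BD in auto)
  then have pA: "psum A t n \<in> carrier A" for n using BD by blast
  have sB: "s \<in> B" using closedD[OF B(2) s(1) pB s(2)] .
  have step: "psum A t (Suc n) = c \<oplus> c \<otimes> psum A t n" for n
  proof (induction n)
    case 0 then show ?case using cA by (simp add: t_def)
  next
    case (Suc n)
    have "psum A t (Suc (Suc n)) = psum A t (Suc n) \<oplus> t (Suc n)" by simp
    also have "\<dots> = (c \<oplus> c \<otimes> psum A t n) \<oplus> c \<otimes> t n"
      unfolding Suc.IH t_def nat_pow_Suc2[OF cA, of "Suc n"] ..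
    also have "\<dots> = c \<oplus> c \<otimes> psum A t (Suc n)"
      using cA pA[of n] tA[of n] by (simp add: r_distr a_assoc)
    finally show ?case .
  qed
  have "(\<lambda>n. nrm A (psum A t (Suc n) \<ominus> (c \<oplus> c \<otimes> s))) \<longlonglongrightarrow> 0"
  proof (rule tendsto_sandwich[of "\<lambda>_. 0" _ _ "\<lambda>n. nrm A c * nrm A (psum A t n \<ominus> s)"])
    show "\<forall>\<^sub>F n in sequentially. 0 \<le> nrm A (psum A t (Suc n) \<ominus> (c \<oplus> c \<otimes> s))"
      using pA cA s by (intro always_eventually allI nrm_nonneg minus_closed) (auto simp del: psum.simps)
    have "psum A t (Suc n) \<ominus> (c \<oplus> c \<otimes> s) = c \<otimes> (psum A t n \<ominus> s)" for n
    proof -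
      have "psum A t (Suc n) \<ominus> (c \<oplus> c \<otimes> s) = (c \<ominus> c) \<oplus> (c \<otimes> psum A t n \<ominus> c \<otimes> s)"
        unfolding step using pA[of n] cA s(1) by (intro add_diff_add) auto
      also have "\<dots> = c \<otimes> (psum A t n \<ominus> s)"
        using pA[of n] cA s(1) by (simp add: diff_right_distr)
      finally show ?thesis .
    qed
    then show "\<forall>\<^sub>F n in sequentially. nrm A (psum A t (Suc n) \<ominus> (c \<oplus> c \<otimes> s))
        \<le> nrm A c * nrm A (psum A t n \<ominus> s)"
      using pA cA s(1) by (intro always_eventually allI) (simp only: nrm_mult minus_closed)
    show "(\<lambda>n. nrm A c * nrm A (psum A t n \<ominus> s)) \<longlonglongrightarrow> 0"
      using tendsto_mult_left[OF s(2)] by simp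
  qed auto
  moreover have "(\<lambda>n. nrm A (psum A t (Suc n) \<ominus> s)) \<longlonglongrightarrow> 0"
    using LIMSEQ_Suc[OF s(2)] .
  ultimately have "s = c \<oplus> c \<otimes> s"
    using cA s(1) by (intro limit_unique[of "\<lambda>n. psum A t (Suc n)", OF pA]) auto
  then have "\<phi> s = \<phi> c + \<phi> c * \<phi> s"
    using add[OF cB BD(5)[OF cB sB]] mult[OF cB sB] by simp
  then show False using \<phi>c by simp
qed


text \<open>
  The open mapping theorem for \<open>(c, b) \<mapsto> c + b u\<close> on \<open>C \<times> A\<close>.
\<close>

lemma open_mapping_split:
  assumes C: "C \<subseteq> carrier A" "closedin (nrm_topology A) C"
    and Cadd: "\<And>x y. x \<in> C \<Longrightarrow> y \<in> C \<Longrightarrow> x \<oplus> y \<in> C"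
    and Csm: "\<And>x k. x \<in> C \<Longrightarrow> k \<odot>\<^bsub>A\<^esub> x \<in> C"
    and u: "u \<in> carrier A"
    and surj: "\<And>a. a \<in> carrier A \<Longrightarrow> \<exists>c\<in>C. \<exists>b\<in>carrier A. a = c \<oplus> b \<otimes> u"
  obtains K where "K \<ge> 0" "\<And>a. a \<in> carrier A \<Longrightarrow>
     \<exists>c\<in>C. \<exists>b\<in>carrier A. a = c \<oplus> b \<otimes> u \<and> nrm A c \<le> K * nrm A a \<and> nrm A b \<le> K * nrm A a"
proof -
  \<comment> \<open>The image of the pairs of norm at most \<open>r\<close>. By Baire the closure of
    some \<open>V n\<close> has interior points; the rest of the proof removes the closure.\<close>
  define V where "V r = {c \<oplus> b \<otimes> u | c b. c \<in> C \<and> b \<in> carrier A \<and> nrm A c \<le> r \<and> nrm A b \<le> r}" for r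
  have VA: "V r \<subseteq> carrier A" for r using C(1) u by (auto simp: V_def)
  have C0: "\<zero> \<in> C" using surj[of \<zero>] Csm[of _ 0] C(1) by (auto simp: subset_iff)
  have Cm: "x \<ominus> y \<in> C" if "x \<in> C" "y \<in> C" for x y
    using that Cadd Csm[of y "-1"] C(1) by (auto simp: minus_eq smult_minus_1)
  have cover: "(\<Union>n. nrm_topology A closure_of V (real n)) = carrier A"
  proof
    show "(\<Union>n. nrm_topology A closure_of V (real n)) \<subseteq> carrier A"
      using closure_iff[OF VA] by blast
    show "carrier A \<subseteq> (\<Union>n. nrm_topology A closure_of V (real n))"
    proof
      fix a assume a: "a \<in> carrier A"
      then obtain c b where cb: "c \<in> C" "b \<in> carrier A" "a = c \<oplus> b \<otimes> u" using surj by blast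
      obtain n :: nat where "real n \<ge> max (nrm A c) (nrm A b)" using real_arch_simple by blast
      then have "a \<in> V (real n)" using cb by (auto simp: V_def)
      moreover have "V (real n) \<subseteq> nrm_topology A closure_of V (real n)"
        using VA by (simp add: closure_of_subset)
      ultimately show "a \<in> (\<Union>n. nrm_topology A closure_of V (real n))" by blast
    qed
  qed
  have "\<exists>n. MS.mtopology interior_of (MS.mtopology closure_of V (real n)) \<noteq> {}"
  proof (rule ccontr)
    assume "\<nexists>n. MS.mtopology interior_of (MS.mtopology closure_of V (real n)) \<noteq> {}"
    then have "MS.mtopology interior_of \<Union>(range (\<lambda>n. MS.mtopology closure_of V (real n))) = {}"
      using complete by (intro MS.metric_Baire_category_alt) auto
    moreover have "MS.mtopology interior_of (carrier A) = carrier A"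
      by (metis MS.topspace_mtopology interior_of_topspace)
    ultimately show False using cover by auto
  qed
  then obtain n x0 r where r: "r > 0" and x0: "x0 \<in> carrier A"
    and sub: "MS.mball x0 r \<subseteq> MS.mtopology closure_of V (real n)"
    by (fastforce simp: MS.metric_interior_of)
  \<comment> \<open>The ball around \<open>x0\<close> is moved to the origin:
    \<open>x0 \<oplus> a\<close> and \<open>x0\<close> are approximated separately and subtracted,
    which doubles the radius of \<open>V\<close>.\<close>
  have small: "\<exists>v\<in>V (2 * real n). nrm A (a \<ominus> v) < e"
    if a: "a \<in> carrier A" and ar: "nrm A a < r" and e: "e > 0" for a e
  proof -
    have "(x0 \<oplus> a) \<in> MS.mball x0 r" "x0 \<in> MS.mball x0 r"
      using a ar x0 r nrm_diff_commute[of x0 "x0 \<oplus> a"] MS.centre_in_mball_iff[of x0 r]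
      by (auto simp: nrm_dist_def add_diff_cancel' simp del: MS.centre_in_mball_iff)
    then have "(x0 \<oplus> a) \<in> MS.mtopology closure_of V (real n)" "x0 \<in> MS.mtopology closure_of V (real n)"
      using sub by auto
    then obtain v w where v: "v \<in> V (real n)" "nrm A ((x0 \<oplus> a) \<ominus> v) < e/2"
      and w: "w \<in> V (real n)" "nrm A (x0 \<ominus> w) < e/2"
      using e half_gt_zero[OF e] unfolding closure_iff[OF VA] by blast
    have vw: "v \<in> carrier A" "w \<in> carrier A" using v w VA by auto
    obtain c b where cb: "v = c \<oplus> b \<otimes> u" "c \<in> C" "b \<in> carrier A" "nrm A c \<le> n" "nrm A b \<le> n"
      using v(1) unfolding V_def by blast
    obtain c' b' where cb': "w = c' \<oplus> b' \<otimes> u" "c' \<in> C" "b' \<in> carrier A" "nrm A c' \<le> n" "nrm A b' \<le> n"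
      using w(1) unfolding V_def by blast
    have cc: "c \<in> carrier A" "c' \<in> carrier A" using cb cb' C by auto
    have eq: "v \<ominus> w = (c \<ominus> c') \<oplus> (b \<ominus> b') \<otimes> u"
      using cb cb' cc u by (simp add: add_diff_add diff_left_distr)
    have "nrm A (c \<ominus> c') \<le> 2 * real n" "nrm A (b \<ominus> b') \<le> 2 * real n"
      using nrm_diff_le[of c c'] nrm_diff_le[of b b'] cb cb' cc by linarith+
    then have "v \<ominus> w \<in> V (2 * real n)"
      unfolding V_def using eq Cm[OF cb(2) cb'(2)] minus_closed[OF cb(3) cb'(3)] by blast
    moreover have "x0 \<oplus> (\<ominus> v \<oplus> \<ominus> x0) = \<ominus> v"
      using r_neg2[of x0 "\<ominus> v"] a_comm[of "\<ominus> v" "\<ominus> x0"] x0 vw by simp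
    then have "a \<ominus> (v \<ominus> w) = ((x0 \<oplus> a) \<ominus> v) \<ominus> (x0 \<ominus> w)"
      using a x0 vw by (simp add: minus_eq minus_add a_ac r_neg1 r_neg2)
    then have "nrm A (a \<ominus> (v \<ominus> w)) < e"
      using nrm_diff_le[of "(x0 \<oplus> a) \<ominus> v" "x0 \<ominus> w"] v w a x0 vw by auto
    ultimately show ?thesis by blast
  qed
  \<comment> \<open>Scaling \<open>a\<close> by \<open>k = r / (2 * nrm A a)\<close> brings it to
    norm \<open>r / 2\<close>; dividing data of size \<open>2 * n\<close> by \<open>k\<close> again
    gives \<open>2 * n / k = K * nrm A a\<close>.\<close>
  define K where "K = 4 * real n / r"
  have K0: "K \<ge> 0" using r by (simp add: K_def)
  have approx: "\<exists>c b. c \<in> C \<and> b \<in> carrier A \<and> nrm A c \<le> K * nrm A a \<and> nrm A b \<le> K * nrm A a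
      \<and> nrm A (a \<ominus> (c \<oplus> b \<otimes> u)) \<le> nrm A a / 2" if a: "a \<in> carrier A" for a
  proof (cases "a = \<zero>")
    case True
    then show ?thesis using C0 u by (intro exI[of _ \<zero>]) (auto simp: minus_eq)
  next
    case False
    define k where "k = r / (2 * nrm A a)"
    have na: "nrm A a > 0" using False a nrm_nonneg[OF a] nrm_eq_0_iff[OF a] by linarith
    then have k: "k > 0" using r by (simp add: k_def)
    have "nrm A (complex_of_real k \<odot>\<^bsub>A\<^esub> a) < r"
      using a k na r by (simp add: nrm_smult) (simp add: k_def)
    then obtain v where v: "v \<in> V (2 * real n)" "nrm A (complex_of_real k \<odot>\<^bsub>A\<^esub> a \<ominus> v) < k * nrm A a / 2"
      using small[of "complex_of_real k \<odot>\<^bsub>A\<^esub> a" "k * nrm A a / 2"] a k na by auto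
    obtain c b where cb: "v = c \<oplus> b \<otimes> u" "c \<in> C" "b \<in> carrier A" "nrm A c \<le> 2 * n" "nrm A b \<le> 2 * n"
      using v(1) unfolding V_def by auto
    have cA: "c \<in> carrier A" using cb C by auto
    let ?c = "complex_of_real (1/k) \<odot>\<^bsub>A\<^esub> c" and ?b = "complex_of_real (1/k) \<odot>\<^bsub>A\<^esub> b"
    have "nrm A ?c \<le> 2 * n / k" "nrm A ?b \<le> 2 * n / k"
      using cb cA k by (auto simp: nrm_smult norm_divide divide_right_mono)
    moreover have "2 * n / k = K * nrm A a" using r by (simp add: k_def K_def)
    moreover have "a \<ominus> (?c \<oplus> ?b \<otimes> u) = complex_of_real (1/k) \<odot>\<^bsub>A\<^esub> (complex_of_real k \<odot>\<^bsub>A\<^esub> a \<ominus> v)"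
      using a cA cb u k
      by (simp add: smult_diff_right smult_add_right smult_smult smult_mult_left)
    then have "nrm A (a \<ominus> (?c \<oplus> ?b \<otimes> u)) = nrm A (complex_of_real k \<odot>\<^bsub>A\<^esub> a \<ominus> v) / k"
      using a cA cb u k by (simp add: nrm_smult norm_divide)
    moreover have "nrm A (complex_of_real k \<odot>\<^bsub>A\<^esub> a \<ominus> v) / k \<le> nrm A a / 2"
      using v(2) unfolding pos_divide_le_eq[OF k] by (simp add: mult.commute)
    ultimately have "nrm A (a \<ominus> (?c \<oplus> ?b \<otimes> u)) \<le> nrm A a / 2"
      "nrm A ?c \<le> K * nrm A a" "nrm A ?b \<le> K * nrm A a"
      by (simp_all only:)
    then show ?thesis using Csm[OF cb(2)] cb(3) by (metis smult_in)
  qed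
  define cf where "cf a = (SOME c. \<exists>b. c \<in> C \<and> b \<in> carrier A \<and> nrm A c \<le> K * nrm A a \<and> nrm A b \<le> K * nrm A a
      \<and> nrm A (a \<ominus> (c \<oplus> b \<otimes> u)) \<le> nrm A a / 2)" for a
  define bf where "bf a = (SOME b. cf a \<in> C \<and> b \<in> carrier A \<and> nrm A (cf a) \<le> K * nrm A a \<and> nrm A b \<le> K * nrm A a
      \<and> nrm A (a \<ominus> (cf a \<oplus> b \<otimes> u)) \<le> nrm A a / 2)" for a
  have f: "cf a \<in> C \<and> bf a \<in> carrier A \<and> nrm A (cf a) \<le> K * nrm A a \<and> nrm A (bf a) \<le> K * nrm A a
      \<and> nrm A (a \<ominus> (cf a \<oplus> bf a \<otimes> u)) \<le> nrm A a / 2" if "a \<in> carrier A" for a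
    unfolding bf_def by (rule someI_ex, unfold cf_def, rule someI_ex) (use approx[OF that] in blast)
  have cfA: "a \<in> carrier A \<Longrightarrow> cf a \<in> carrier A" for a using f C by blast
  show ?thesis
  proof (rule that[of "2 * K"])
    show "2 * K \<ge> 0" using K0 by simp
    fix a assume a: "a \<in> carrier A"
    \<comment> \<open>\<open>s n\<close> is what is left of \<open>a\<close> after \<open>n\<close>
      approximate solutions. Its norm halves each time, so the solutions add up to convergent series
      of size at most \<open>2 * K * nrm A a\<close>.\<close>
    define s where "s n = ((\<lambda>a. a \<ominus> (cf a \<oplus> bf a \<otimes> u)) ^^ n) a" for n
    have s0: "s 0 = a" and sS: "s (Suc n) = s n \<ominus> (cf (s n) \<oplus> bf (s n) \<otimes> u)" for n
      by (auto simp: s_def)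
    have sA: "s n \<in> carrier A" for n
      by (induction n) (use a f cfA u in \<open>auto simp: s0 sS\<close>)
    have sn: "nrm A (s n) \<le> nrm A a * (1/2) ^ n" for n
    proof (induction n)
      case 0 then show ?case by (simp add: s0)
    next
      case (Suc n)
      have "nrm A (s (Suc n)) \<le> nrm A (s n) / 2" unfolding sS using f[OF sA] by blast
      then show ?case using Suc by simp
    qed
    have cn: "cf (s n) \<in> C" "nrm A (cf (s n)) \<le> K * (nrm A a * (1/2) ^ n)" 
      and bn: "bf (s n) \<in> carrier A" "nrm A (bf (s n)) \<le> K * (nrm A a * (1/2) ^ n)" for n
      using f[OF sA[of n]] mult_left_mono[OF sn[of n] K0] by auto
    have sums: "(\<lambda>n. K * (nrm A a * (1/2::real) ^ n)) sums (2 * K * nrm A a)"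
    proof -
      have "2 * K * nrm A a = K * (nrm A a * (1 / (1 - 1/2)))" by simp
      then show ?thesis
        using sums_mult[OF sums_mult[OF geometric_sums[of "1/2::real"], of "nrm A a"], of K]
        by (simp only: norm_divide norm_one) simp
    qed
    have scA: "cf (s n) \<in> carrier A" for n using cn(1) C(1) by auto
    obtain c where c: "c \<in> carrier A" "(\<lambda>n. nrm A (psum A (\<lambda>n. cf (s n)) n \<ominus> c)) \<longlonglongrightarrow> 0"
       and c2: "nrm A c \<le> (\<Sum>n. K * (nrm A a * (1/2) ^ n))"
      by (rule series_converges[of "\<lambda>n. cf (s n)", OF scA cn(2) sums_summable[OF sums]])
    obtain b where b: "b \<in> carrier A" "(\<lambda>n. nrm A (psum A (\<lambda>n. bf (s n)) n \<ominus> b)) \<longlonglongrightarrow> 0"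
       and b2: "nrm A b \<le> (\<Sum>n. K * (nrm A a * (1/2) ^ n))"
      by (rule series_converges[of "\<lambda>n. bf (s n)", OF bn(1) bn(2) sums_summable[OF sums]])
    have cb2: "nrm A c \<le> 2 * K * nrm A a" "nrm A b \<le> 2 * K * nrm A a"
      using b2 c2 unfolding sums_unique[OF sums, symmetric] by auto
    define pc where "pc = psum A (\<lambda>n. cf (s n))"
    define pb where "pb = psum A (\<lambda>n. bf (s n))"
    have pcC: "pc n \<in> C" for n
    proof (induction n)
      case 0 then show ?case using C0 by (simp add: pc_def)
    next
      case (Suc n) then show ?case using Cadd[OF Suc cn(1)] by (simp add: pc_def)
    qed
    then have pcA: "pc n \<in> carrier A" for n using C by blast
    have pbA: "pb n \<in> carrier A" for n unfolding pb_def by (intro psum_closed bn(1))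
    have cC: "c \<in> C" using closedD[OF C(2) c(1), of pc] pcC c(2) by (simp add: pc_def)
    have dec: "a = (pc n \<oplus> pb n \<otimes> u) \<oplus> s n" for n
    proof (induction n)
      case 0 then show ?case using a u by (simp add: pc_def pb_def s0)
    next
      case (Suc n)
      have cs: "cf (s n) \<in> carrier A" using cn C by blast
      have "(pc (Suc n) \<oplus> pb (Suc n) \<otimes> u) \<oplus> s (Suc n)
          = ((pc n \<oplus> cf (s n)) \<oplus> (pb n \<otimes> u \<oplus> bf (s n) \<otimes> u)) \<oplus> s (Suc n)"
        using pbA[of n] bn(1)[of n] u by (simp add: pc_def pb_def l_distr)
      also have "\<dots> = (pc n \<oplus> pb n \<otimes> u) \<oplus> (s (Suc n) \<oplus> (cf (s n) \<oplus> bf (s n) \<otimes> u))"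
        using pcA[of n] m_closed[OF pbA[of n] u] cs m_closed[OF bn(1)[of n] u] sA[of "Suc n"]
        by (simp add: a_ac)
      also have "\<dots> = (pc n \<oplus> pb n \<otimes> u) \<oplus> s n"
        using cs bn(1)[of n] sA[of n] u by (simp add: sS diff_add_cancel')
      finally show ?case using Suc by simp
    qed
    have "a = c \<oplus> b \<otimes> u"
    proof (rule limit_unique[of "\<lambda>n. pc n \<oplus> pb n \<otimes> u"])
      show "(\<lambda>n. nrm A (pc n \<oplus> pb n \<otimes> u \<ominus> a)) \<longlonglongrightarrow> 0"
      proof (rule tendsto_sandwich[of "\<lambda>_. 0" _ _ "\<lambda>n. nrm A a * (1/2) ^ n"])
        have "nrm A (pc n \<oplus> pb n \<otimes> u \<ominus> a) = nrm A (s n)" for n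
          using dec[of n] pcA[of n] pbA[of n] sA[of n] u a nrm_diff_commute[of "pc n \<oplus> pb n \<otimes> u" a]
            add_diff_cancel'[of "s n" "pc n \<oplus> pb n \<otimes> u"] by auto
        then show "\<forall>\<^sub>F n in sequentially. nrm A (pc n \<oplus> pb n \<otimes> u \<ominus> a) \<le> nrm A a * (1/2) ^ n"
          using sn by simp
        show "(\<lambda>n. nrm A a * (1/2) ^ n) \<longlonglongrightarrow> 0"
          using tendsto_mult_left[OF LIMSEQ_realpow_zero[of "1/2::real"], of "nrm A a"] by simp
      qed (use pcA pbA u a in \<open>auto intro!: always_eventually nrm_nonneg\<close>)
      show "(\<lambda>n. nrm A (pc n \<oplus> pb n \<otimes> u \<ominus> (c \<oplus> b \<otimes> u))) \<longlonglongrightarrow> 0"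
      proof (rule tendsto_sandwich[of "\<lambda>_. 0" _ _ "\<lambda>n. nrm A (pc n \<ominus> c) + nrm A (pb n \<ominus> b) * nrm A u"])
        have "nrm A (pc n \<oplus> pb n \<otimes> u \<ominus> (c \<oplus> b \<otimes> u)) \<le> nrm A (pc n \<ominus> c) + nrm A (pb n \<ominus> b) * nrm A u" for n
        proof -
          have "pc n \<oplus> pb n \<otimes> u \<ominus> (c \<oplus> b \<otimes> u) = (pc n \<ominus> c) \<oplus> (pb n \<ominus> b) \<otimes> u"
            using pcA[of n] pbA[of n] u c(1) b(1) by (simp add: add_diff_add diff_left_distr)
          then show ?thesis
            using nrm_triangle[of "pc n \<ominus> c" "(pb n \<ominus> b) \<otimes> u"] nrm_mult[of "pb n \<ominus> b" u]
              pcA[of n] pbA[of n] u c(1) b(1) by (auto simp: m_closed)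
        qed
        then show "\<forall>\<^sub>F n in sequentially. nrm A (pc n \<oplus> pb n \<otimes> u \<ominus> (c \<oplus> b \<otimes> u))
            \<le> nrm A (pc n \<ominus> c) + nrm A (pb n \<ominus> b) * nrm A u" by simp
        show "(\<lambda>n. nrm A (pc n \<ominus> c) + nrm A (pb n \<ominus> b) * nrm A u) \<longlonglongrightarrow> 0"
          using tendsto_add[OF c(2) tendsto_mult_right[OF b(2), of "nrm A u"]]
          by (simp add: pc_def pb_def)
      qed (use pcA pbA u c b in \<open>auto intro!: always_eventually nrm_nonneg\<close>)
    qed (use pcA pbA u a c b in auto)
    then show "\<exists>c\<in>C. \<exists>b\<in>carrier A. a = c \<oplus> b \<otimes> u \<and> nrm A c \<le> 2 * K * nrm A a \<and> nrm A b \<le> 2 * K * nrm A a"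
      using cC b(1) cb2 by blast
  qed
qed

end

section \<open>Structure of topological conjugacy algebras\<close>

context topological_conjugacy_algebra
begin

abbreviation "XK \<equiv> topspace K"
abbreviation "CK \<equiv> carrier (cont_alg K)"
abbreviation "emb f \<equiv> \<iota> (const_poly K f)"
abbreviation "U \<equiv> \<iota> (var_poly K)"

text \<open>Division by \<open>U\<close> with remainder \<open>E\<^sub>0 a\<close>. Its iterates
  followed by \<open>E\<^sub>0\<close> are the coefficient maps
  (\<open>coeff_map_eq\<close>).\<close>

definition quot :: "'a \<Rightarrow> 'a" where
  "quot a = (THE b. b \<in> carrier A \<and> a = emb (E\<^sub>0 a) \<oplus> b \<otimes> U)"

lemma eta_in: "x \<in> XK \<Longrightarrow> \<eta> x \<in> XK"
  using continuous by (auto simp: continuous_map_def Pi_iff)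

lemma eta_pow_in: "x \<in> XK \<Longrightarrow> (\<eta> ^^ n) x \<in> XK"
  by (induction n) (auto simp: eta_in)

lemma CK_E: "f \<in> CK \<Longrightarrow> f \<in> extensional XK" "f \<in> CK \<Longrightarrow> continuous_map K euclidean f"
  by (auto simp: cont_alg_def)

lemma CK_I: "f \<in> extensional XK \<Longrightarrow> continuous_map K euclidean f \<Longrightarrow> f \<in> CK"
  by (auto simp: cont_alg_def)

lemma cont_const [simp]: "(\<lambda>x\<in>XK. c) \<in> CK"
proof (rule CK_I)
  show "continuous_map K euclidean (\<lambda>x\<in>XK. c)"
    by (rule continuous_map_eq[of K euclidean "\<lambda>_. c"]) auto
qed auto

lemma const_poly_in [simp]: "f \<in> CK \<Longrightarrow> const_poly K f \<in> carrier (skew_poly K \<eta>)"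
proof -
  assume "f \<in> CK"
  moreover have "{n. const_poly K f n \<noteq> \<zero>\<^bsub>cont_alg K\<^esub>} \<subseteq> {0}" by (auto simp: const_poly_def)
  then have "finite {n. const_poly K f n \<noteq> \<zero>\<^bsub>cont_alg K\<^esub>}" using finite_subset by blast
  moreover have "\<zero>\<^bsub>cont_alg K\<^esub> \<in> CK" using cont_const[of 0] by (simp add: cont_alg_def)
  ultimately show ?thesis by (auto simp: skew_poly_def const_poly_def)
qed

lemma var_poly_in [simp]: "var_poly K \<in> carrier (skew_poly K \<eta>)"
proof -
  have "{n. var_poly K n \<noteq> \<zero>\<^bsub>cont_alg K\<^esub>} \<subseteq> {1}" by (auto simp: var_poly_def)
  then have "finite {n. var_poly K n \<noteq> \<zero>\<^bsub>cont_alg K\<^esub>}" using finite_subset by blast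
  moreover have "\<zero>\<^bsub>cont_alg K\<^esub> \<in> CK" "\<one>\<^bsub>cont_alg K\<^esub> \<in> CK"
    using cont_const[of 0] cont_const[of 1] by (simp_all add: cont_alg_def)
  ultimately show ?thesis by (auto simp: skew_poly_def var_poly_def)
qed

lemma iota_hom: "\<iota> \<in> ring_hom (skew_poly K \<eta>) A"
  using poly_hom by (auto simp: alg_hom_def)

lemma iota_closed [simp]: "p \<in> carrier (skew_poly K \<eta>) \<Longrightarrow> \<iota> p \<in> carrier A"
  by (rule ring_hom_closed[OF iota_hom])

lemma emb_closed [simp]: "f \<in> CK \<Longrightarrow> emb f \<in> carrier A"
  by (intro iota_closed const_poly_in)

lemma U_closed [simp]: "U \<in> carrier A"
  by (intro iota_closed var_poly_in)

lemma emb_add: "f \<in> CK \<Longrightarrow> g \<in> CK \<Longrightarrow> emb (f \<oplus>\<^bsub>cont_alg K\<^esub> g) = emb f \<oplus> emb g"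
proof -
  assume fg: "f \<in> CK" "g \<in> CK"
  have "const_poly K f \<oplus>\<^bsub>skew_poly K \<eta>\<^esub> const_poly K g = const_poly K (f \<oplus>\<^bsub>cont_alg K\<^esub> g)"
    by (auto simp: const_poly_def skew_poly_def cont_alg_def fun_eq_iff)
  then show ?thesis using ring_hom_add[OF iota_hom, of "const_poly K f" "const_poly K g"] fg by simp
qed

lemma emb_smult: "f \<in> CK \<Longrightarrow> emb (c \<odot>\<^bsub>cont_alg K\<^esub> f) = c \<odot>\<^bsub>A\<^esub> emb f"
proof -
  assume f: "f \<in> CK"
  have "c \<odot>\<^bsub>skew_poly K \<eta>\<^esub> const_poly K f = const_poly K (c \<odot>\<^bsub>cont_alg K\<^esub> f)"
    by (auto simp: const_poly_def skew_poly_def cont_alg_def fun_eq_iff)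
  moreover have "\<iota> (c \<odot>\<^bsub>skew_poly K \<eta>\<^esub> const_poly K f) = c \<odot>\<^bsub>A\<^esub> emb f"
    using poly_hom const_poly_in[OF f] unfolding alg_hom_def by blast
  ultimately show ?thesis by simp
qed

lemma emb_mult: "f \<in> CK \<Longrightarrow> g \<in> CK \<Longrightarrow> emb (f \<otimes>\<^bsub>cont_alg K\<^esub> g) = emb f \<otimes> emb g"
proof -
  assume fg: "f \<in> CK" "g \<in> CK"
  have "(\<Sum>i\<le>n. const_poly K f i x * const_poly K g (n - i) ((\<eta> ^^ i) x))
      = const_poly K (f \<otimes>\<^bsub>cont_alg K\<^esub> g) n x" if x: "x \<in> XK" for n x
  proof -
    have "(\<Sum>i\<le>n. const_poly K f i x * const_poly K g (n - i) ((\<eta> ^^ i) x))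
       = (\<Sum>i\<le>n. if i = 0 then (if n = 0 then f x * g x else 0) else 0)"
      using x eta_pow_in[OF x] by (intro sum.cong refl) (auto simp: const_poly_def cont_alg_def)
    then show ?thesis using x by (simp add: const_poly_def cont_alg_def)
  qed
  then have "const_poly K f \<otimes>\<^bsub>skew_poly K \<eta>\<^esub> const_poly K g = const_poly K (f \<otimes>\<^bsub>cont_alg K\<^esub> g)"
    by (auto simp: skew_poly_def fun_eq_iff restrict_def) (auto simp: const_poly_def cont_alg_def)
  then show ?thesis using ring_hom_mult[OF iota_hom, of "const_poly K f" "const_poly K g"] fg by simp
qed

lemma emb_one: "emb \<one>\<^bsub>cont_alg K\<^esub> = \<one>"
proof -
  have "\<one>\<^bsub>skew_poly K \<eta>\<^esub> = const_poly K \<one>\<^bsub>cont_alg K\<^esub>"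
    by (auto simp: skew_poly_def const_poly_def)
  then show ?thesis using ring_hom_one[OF iota_hom] by simp
qed

lemma comp_in: "f \<in> CK \<Longrightarrow> restrict (f \<circ> \<eta>) XK \<in> CK"
proof -
  assume f: "f \<in> CK"
  have "continuous_map K euclidean (f \<circ> \<eta>)"
    using continuous_map_compose[OF continuous CK_E(2)[OF f]] .
  then have "continuous_map K euclidean (restrict (f \<circ> \<eta>) XK)"
    by (rule continuous_map_eq) auto
  then show ?thesis by (intro CK_I) auto
qed

lemma U_emb: "f \<in> CK \<Longrightarrow> U \<otimes> emb f = emb (restrict (f \<circ> \<eta>) XK) \<otimes> U"
proof -
  assume f: "f \<in> CK"
  have "\<eta> \<in> XK \<rightarrow> XK" using eta_in by auto
  from var_poly_mult_const_poly[OF this, of f] show ?thesis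
    using ring_hom_mult[OF iota_hom, of "var_poly K" "const_poly K f"]
      ring_hom_mult[OF iota_hom, of "const_poly K (restrict (f \<circ> \<eta>) XK)" "var_poly K"] f comp_in[OF f]
    by simp
qed

lemma E0_rh: "E\<^sub>0 \<in> ring_hom A (cont_alg K)"
  using E0_hom by (auto simp: alg_hom_def)

lemma E0_closed [simp]: "a \<in> carrier A \<Longrightarrow> E\<^sub>0 a \<in> CK"
  by (rule ring_hom_closed[OF E0_rh])

lemma E0_add: "\<lbrakk>a \<in> carrier A; b \<in> carrier A\<rbrakk> \<Longrightarrow> E\<^sub>0 (a \<oplus> b) = E\<^sub>0 a \<oplus>\<^bsub>cont_alg K\<^esub> E\<^sub>0 b"
  by (rule ring_hom_add[OF E0_rh])

lemma E0_smult: "a \<in> carrier A \<Longrightarrow> E\<^sub>0 (c \<odot>\<^bsub>A\<^esub> a) = c \<odot>\<^bsub>cont_alg K\<^esub> E\<^sub>0 a"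
  using E0_hom by (auto simp: alg_hom_def)

lemma E0_add_at: "\<lbrakk>a \<in> carrier A; b \<in> carrier A; x \<in> XK\<rbrakk> \<Longrightarrow> E\<^sub>0 (a \<oplus> b) x = E\<^sub>0 a x + E\<^sub>0 b x"
  by (simp add: E0_add) (simp add: cont_alg_def)

lemma E0_mult_at: "\<lbrakk>a \<in> carrier A; b \<in> carrier A; x \<in> XK\<rbrakk> \<Longrightarrow> E\<^sub>0 (a \<otimes> b) x = E\<^sub>0 a x * E\<^sub>0 b x"
  by (simp add: ring_hom_mult[OF E0_rh]) (simp add: cont_alg_def)

lemma E0_smult_at: "\<lbrakk>a \<in> carrier A; x \<in> XK\<rbrakk> \<Longrightarrow> E\<^sub>0 (c \<odot>\<^bsub>A\<^esub> a) x = c * E\<^sub>0 a x"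
  by (simp add: E0_smult) (simp add: cont_alg_def)

lemma E0_minus_at: "\<lbrakk>a \<in> carrier A; x \<in> XK\<rbrakk> \<Longrightarrow> E\<^sub>0 (\<ominus> a) x = - E\<^sub>0 a x"
  by (simp add: E0_smult_at smult_minus_1[symmetric])

lemma E0_diff_at: "\<lbrakk>a \<in> carrier A; b \<in> carrier A; x \<in> XK\<rbrakk> \<Longrightarrow> E\<^sub>0 (a \<ominus> b) x = E\<^sub>0 a x - E\<^sub>0 b x"
  by (simp add: minus_eq E0_add_at E0_minus_at)

lemma CK_eqI: "\<lbrakk>f \<in> CK; g \<in> CK; \<And>x. x \<in> XK \<Longrightarrow> f x = g x\<rbrakk> \<Longrightarrow> f = g"
  using CK_E(1) extensionalityI by blast

lemma zero_CK [simp]: "\<zero>\<^bsub>cont_alg K\<^esub> \<in> CK" and one_CK [simp]: "\<one>\<^bsub>cont_alg K\<^esub> \<in> CK"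
  using cont_const[of 0] cont_const[of 1] by (simp_all add: cont_alg_def)

lemma zero_at: "x \<in> XK \<Longrightarrow> \<zero>\<^bsub>cont_alg K\<^esub> x = 0" and one_at: "x \<in> XK \<Longrightarrow> \<one>\<^bsub>cont_alg K\<^esub> x = 1"
  by (simp_all add: cont_alg_def)

lemma E0_multU: "b \<in> carrier A \<Longrightarrow> E\<^sub>0 (b \<otimes> U) = \<zero>\<^bsub>cont_alg K\<^esub>"
  using E0_kernel by blast

lemma E0_multU_at: "b \<in> carrier A \<Longrightarrow> x \<in> XK \<Longrightarrow> E\<^sub>0 (b \<otimes> U) x = 0"
  using E0_multU zero_at by simp

lemma E0_U_at: "x \<in> XK \<Longrightarrow> E\<^sub>0 U x = 0"
  using E0_multU_at[of \<one> x] by (simp add: A_simprules)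

lemma decomposition: "a \<in> carrier A \<Longrightarrow> \<exists>b\<in>carrier A. a = emb (E\<^sub>0 a) \<oplus> b \<otimes> U"
proof -
  assume a: "a \<in> carrier A"
  have "E\<^sub>0 (a \<ominus> emb (E\<^sub>0 a)) = \<zero>\<^bsub>cont_alg K\<^esub>"
    using a by (intro CK_eqI) (auto simp: E0_diff_at E0_functions zero_at)
  then have "a \<ominus> emb (E\<^sub>0 a) \<in> {a \<in> carrier A. E\<^sub>0 a = \<zero>\<^bsub>cont_alg K\<^esub>}" using a by simp
  then obtain b where b: "b \<in> carrier A" "a \<ominus> emb (E\<^sub>0 a) = b \<otimes> U"
    unfolding E0_kernel by blast
  then have "a = emb (E\<^sub>0 a) \<oplus> b \<otimes> U"
    using diff_add_cancel'[of a "emb (E\<^sub>0 a)"] a a_comm by (simp add: m_closed)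
  then show ?thesis using b by blast
qed

lemma multU_inj: "\<lbrakk>b \<in> carrier A; c \<in> carrier A; b \<otimes> U = c \<otimes> U\<rbrakk> \<Longrightarrow> b = c"
  by (rule diff_eq_0, assumption+, rule not_right_zero_divisor) (auto simp: diff_left_distr)

lemma decomposition_unique:
  assumes "f \<in> CK" "b \<in> carrier A" "a = emb f \<oplus> b \<otimes> U"
  shows "E\<^sub>0 a = f" "quot a = b"
proof -
  have a: "a \<in> carrier A" using assms by simp
  show E: "E\<^sub>0 a = f"
    using assms a by (intro CK_eqI) (auto simp: E0_add_at E0_functions E0_multU_at)
  show "quot a = b"
    unfolding quot_def
  proof (rule the_equality)
    show "b \<in> carrier A \<and> a = emb (E\<^sub>0 a) \<oplus> b \<otimes> U" using assms E by simp
    fix c assume c: "c \<in> carrier A \<and> a = emb (E\<^sub>0 a) \<oplus> c \<otimes> U"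
    then have "emb f \<oplus> b \<otimes> U = emb f \<oplus> c \<otimes> U" using assms E by simp
    then have "b \<otimes> U = c \<otimes> U"
      using c assms r_neg1[of "emb f" "b \<otimes> U"] r_neg1[of "emb f" "c \<otimes> U"] by simp
    then show "c = b" using multU_inj c assms by blast
  qed
qed

lemma quot: "a \<in> carrier A \<Longrightarrow> quot a \<in> carrier A" "a \<in> carrier A \<Longrightarrow> a = emb (E\<^sub>0 a) \<oplus> quot a \<otimes> U"
  using decomposition decomposition_unique(2) E0_closed by metis+

lemmas quot_closed [simp] = quot(1)

lemma quot_add: "\<lbrakk>a \<in> carrier A; b \<in> carrier A\<rbrakk> \<Longrightarrow> quot (a \<oplus> b) = quot a \<oplus> quot b"
proof -
  assume ab: "a \<in> carrier A" "b \<in> carrier A"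
  have "a \<oplus> b = (emb (E\<^sub>0 a) \<oplus> quot a \<otimes> U) \<oplus> (emb (E\<^sub>0 b) \<oplus> quot b \<otimes> U)" using quot ab by simp
  also have "\<dots> = emb (E\<^sub>0 (a \<oplus> b)) \<oplus> (quot a \<oplus> quot b) \<otimes> U"
    using ab by (simp add: E0_add emb_add l_distr a_ac)
  finally show ?thesis using ab by (intro decomposition_unique(2)[of "E\<^sub>0 (a \<oplus> b)"]) auto
qed

lemma quot_smult: "a \<in> carrier A \<Longrightarrow> quot (c \<odot>\<^bsub>A\<^esub> a) = c \<odot>\<^bsub>A\<^esub> quot a"
proof -
  assume a: "a \<in> carrier A"
  have "c \<odot>\<^bsub>A\<^esub> a = c \<odot>\<^bsub>A\<^esub> (emb (E\<^sub>0 a) \<oplus> quot a \<otimes> U)" using quot a by simp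
  also have "\<dots> = emb (E\<^sub>0 (c \<odot>\<^bsub>A\<^esub> a)) \<oplus> (c \<odot>\<^bsub>A\<^esub> quot a) \<otimes> U"
    using a by (simp add: E0_smult emb_smult smult_add_right smult_mult_left)
  finally show ?thesis using a by (intro decomposition_unique(2)[of "E\<^sub>0 (c \<odot>\<^bsub>A\<^esub> a)"]) auto
qed

lemma quot_diff: "\<lbrakk>a \<in> carrier A; b \<in> carrier A\<rbrakk> \<Longrightarrow> quot (a \<ominus> b) = quot a \<ominus> quot b"
  by (simp add: minus_eq quot_add smult_minus_1[symmetric] quot_smult)

text \<open>Moving \<open>U\<close> past the function \<open>E\<^sub>0 b\<close> composes it with
  \<open>\<eta>\<close>. So \<open>quot\<close> is a twisted derivation, which is the source of the
  off-diagonal entry in \<open>E1_mult\<close>.\<close>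

lemma quot_mult:
  "\<lbrakk>a \<in> carrier A; b \<in> carrier A\<rbrakk>
   \<Longrightarrow> quot (a \<otimes> b) = quot a \<otimes> emb (restrict (E\<^sub>0 b \<circ> \<eta>) XK) \<oplus> a \<otimes> quot b"
proof -
  assume ab: "a \<in> carrier A" "b \<in> carrier A"
  let ?g = "restrict (E\<^sub>0 b \<circ> \<eta>) XK"
  have gC: "emb ?g \<in> carrier A" using ab comp_in by simp
  have "a \<otimes> b = a \<otimes> (emb (E\<^sub>0 b) \<oplus> quot b \<otimes> U)" using quot ab by simp
  also have "\<dots> = a \<otimes> emb (E\<^sub>0 b) \<oplus> a \<otimes> quot b \<otimes> U" using ab by (simp add: r_distr m_assoc)
  also have "a \<otimes> emb (E\<^sub>0 b) = (emb (E\<^sub>0 a) \<oplus> quot a \<otimes> U) \<otimes> emb (E\<^sub>0 b)" using quot ab by simp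
  also have "\<dots> = emb (E\<^sub>0 a) \<otimes> emb (E\<^sub>0 b) \<oplus> quot a \<otimes> emb ?g \<otimes> U"
    using ab gC by (simp add: l_distr m_assoc U_emb)
  also have "\<dots> = emb (E\<^sub>0 (a \<otimes> b)) \<oplus> quot a \<otimes> emb ?g \<otimes> U"
    using ab by (simp add: emb_mult ring_hom_mult[OF E0_rh])
  also have "\<dots> \<oplus> a \<otimes> quot b \<otimes> U = emb (E\<^sub>0 (a \<otimes> b)) \<oplus> (quot a \<otimes> emb ?g \<oplus> a \<otimes> quot b) \<otimes> U"
    using ab gC by (simp add: l_distr a_assoc)
  finally show ?thesis
    using ab gC by (intro decomposition_unique(2)[of "E\<^sub>0 (a \<otimes> b)"]) auto
qed

text \<open>
  \<open>a \<mapsto> (E\<^sub>0 a x, E\<^sub>1 a x, E\<^sub>0 a (\<eta> x))\<close> is a representation by upper triangular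
  \<open>2 \<times> 2\<close> matrices.
\<close>

lemma E1_mult:
  assumes "a \<in> carrier A" "b \<in> carrier A" "x \<in> XK"
  shows "E\<^sub>0 (quot (a \<otimes> b)) x = E\<^sub>0 (quot a) x * E\<^sub>0 b (\<eta> x) + E\<^sub>0 a x * E\<^sub>0 (quot b) x"
  using assms comp_in[of "E\<^sub>0 b"]
  by (simp add: quot_mult E0_add_at E0_mult_at E0_functions)

lemma quot_U: "quot U = \<one>" and quot_emb: "f \<in> CK \<Longrightarrow> quot (emb f) = \<zero>"
proof -
  have "emb \<zero>\<^bsub>cont_alg K\<^esub> = \<zero>"
  proof -
    have "0 \<odot>\<^bsub>cont_alg K\<^esub> \<zero>\<^bsub>cont_alg K\<^esub> = \<zero>\<^bsub>cont_alg K\<^esub>"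
      by (auto simp: cont_alg_def)
    then show ?thesis using emb_smult[of "\<zero>\<^bsub>cont_alg K\<^esub>" 0] by simp
  qed
  then have "U = emb \<zero>\<^bsub>cont_alg K\<^esub> \<oplus> \<one> \<otimes> U" by (simp add: A_simprules)
  then show "quot U = \<one>" by (intro decomposition_unique(2)[of "\<zero>\<^bsub>cont_alg K\<^esub>"]) auto
  show "f \<in> CK \<Longrightarrow> quot (emb f) = \<zero>"
    by (rule decomposition_unique(2)[of f]) (auto simp: A_simprules)
qed

lemma E0_one_at: "x \<in> XK \<Longrightarrow> E\<^sub>0 \<one> x = 1"
  using ring_hom_one[OF E0_rh] one_at by simp

text \<open>Evaluating \<open>E\<^sub>0\<close> at a point is a character of the whole algebra,
  hence contractive; boundedness of \<open>E\<^sub>0\<close> is not among the axioms.\<close>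

lemma E0_bound: "\<lbrakk>a \<in> carrier A; x \<in> XK\<rbrakk> \<Longrightarrow> cmod (E\<^sub>0 a x) \<le> nrm A a"
proof (rule character_contractive)
  show "subalgebra_of (carrier A) A"
    by (auto simp: subalgebra_of_def intro!: ring.subringI[OF A_ring])
qed (auto simp: E0_add_at E0_mult_at E0_smult_at)

lemma CK_add: "f \<in> CK \<Longrightarrow> g \<in> CK \<Longrightarrow> f \<oplus>\<^bsub>cont_alg K\<^esub> g \<in> CK"
  using E0_closed[of "emb f \<oplus> emb g"] by (simp add: E0_add E0_functions)

lemma CK_smult: "f \<in> CK \<Longrightarrow> c \<odot>\<^bsub>cont_alg K\<^esub> f \<in> CK"
  using E0_closed[of "c \<odot>\<^bsub>A\<^esub> emb f"] by (simp add: E0_smult E0_functions)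

text \<open>The open mapping theorem yields some decomposition with controlled parts, and uniqueness
  identifies these with \<open>emb (E\<^sub>0 a)\<close> and \<open>quot a\<close>. Closedness of
  the functions in the algebra enters here.\<close>

lemma quot_bounded:
  obtains M where "M \<ge> 0" "\<And>a. a \<in> carrier A \<Longrightarrow> nrm A (emb (E\<^sub>0 a)) \<le> M * nrm A a"
    "\<And>a. a \<in> carrier A \<Longrightarrow> nrm A (quot a) \<le> M * nrm A a"
proof -
  let ?C = "emb ` CK"
  have 1: "?C \<subseteq> carrier A" by auto
  have 2: "x \<oplus> y \<in> ?C" if "x \<in> ?C" "y \<in> ?C" for x y
    using that by (auto simp: emb_add[symmetric] CK_add)
  have 3: "k \<odot>\<^bsub>A\<^esub> x \<in> ?C" if "x \<in> ?C" for k x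
    using that by (auto simp: emb_smult[symmetric] CK_smult)
  have 4: "\<exists>c\<in>?C. \<exists>b\<in>carrier A. a = c \<oplus> b \<otimes> U" if "a \<in> carrier A" for a
    using quot[OF that] E0_closed[OF that] by blast
  have "\<exists>M\<ge>0. \<forall>a\<in>carrier A. \<exists>c\<in>?C. \<exists>b\<in>carrier A.
      a = c \<oplus> b \<otimes> U \<and> nrm A c \<le> M * nrm A a \<and> nrm A b \<le> M * nrm A a"
    by (rule open_mapping_split[OF 1 functions_closed 2 3 U_closed 4]) (assumption+, blast)
  then obtain M where M: "M \<ge> 0" "\<And>a. a \<in> carrier A \<Longrightarrow>
     \<exists>c\<in>?C. \<exists>b\<in>carrier A. a = c \<oplus> b \<otimes> U \<and> nrm A c \<le> M * nrm A a \<and> nrm A b \<le> M * nrm A a"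
    by blast
  have "nrm A (emb (E\<^sub>0 a)) \<le> M * nrm A a \<and> nrm A (quot a) \<le> M * nrm A a" if "a \<in> carrier A" for a
  proof -
    from M(2)[OF that] obtain f b where "f \<in> CK" "b \<in> carrier A" "a = emb f \<oplus> b \<otimes> U"
      "nrm A (emb f) \<le> M * nrm A a" "nrm A b \<le> M * nrm A a" by blast
    then show ?thesis using decomposition_unique[of f b a] by simp
  qed
  then show ?thesis using that M(1) by blast
qed

lemma quot_pow_closed: "a \<in> carrier A \<Longrightarrow> (quot ^^ n) a \<in> carrier A"
  by (induction n) auto

lemma coeff_map_eq: "coeff_map A (\<lambda>f. emb f) U E\<^sub>0 n a = E\<^sub>0 ((quot ^^ n) a)"
proof (induction n arbitrary: a)
  case (Suc n)
  have "coeff_map A (\<lambda>f. emb f) U E\<^sub>0 (Suc n) a = coeff_map A (\<lambda>f. emb f) U E\<^sub>0 n (quot a)"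
    by (simp add: quot_def)
  then show ?case using Suc by (simp add: funpow_swap1)
qed simp

lemma quot_pow_add: "\<lbrakk>a \<in> carrier A; b \<in> carrier A\<rbrakk> \<Longrightarrow> (quot ^^ n) (a \<oplus> b) = (quot ^^ n) a \<oplus> (quot ^^ n) b"
  by (induction n) (auto simp: quot_add quot_pow_closed)

lemma quot_pow_smult: "a \<in> carrier A \<Longrightarrow> (quot ^^ n) (c \<odot>\<^bsub>A\<^esub> a) = c \<odot>\<^bsub>A\<^esub> (quot ^^ n) a"
  by (induction n) (auto simp: quot_smult quot_pow_closed)

lemma quot_pow_bound:
  assumes M: "M \<ge> 0" "\<And>a. a \<in> carrier A \<Longrightarrow> nrm A (quot a) \<le> M * nrm A a" and a: "a \<in> carrier A"
  shows "nrm A ((quot ^^ n) a) \<le> M ^ n * nrm A a"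
proof (induction n)
  case (Suc n)
  have "nrm A ((quot ^^ Suc n) a) \<le> M * nrm A ((quot ^^ n) a)"
    using M(2)[OF quot_pow_closed[OF a]] by simp
  also have "\<dots> \<le> M * (M ^ n * nrm A a)" using Suc M(1) by (rule mult_left_mono)
  finally show ?case by (simp add: mult.assoc)
qed simp

text \<open>The limsup axiom in usable form: once the root is below \<open>e\<close> it can be
  undone, and homogeneity extends the estimate from the unit ball to all \<open>a\<close>.\<close>

lemma coeff_growth:
  assumes e: "e > 1"
  shows "\<forall>\<^sub>F n in sequentially. \<forall>a\<in>carrier A. \<forall>x\<in>XK.
    cmod (E\<^sub>0 ((quot ^^ n) a) x) * nrm A (U [^] n) \<le> e ^ n * nrm A a"
proof -
  let ?op = "\<lambda>n. op_nrm A (cont_alg K) (\<lambda>a. E\<^sub>0 ((quot ^^ n) a))"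
  let ?P = "\<lambda>n. ?op n * ereal (nrm A (U [^] n))"
  have "limsup (\<lambda>n. ereal_root n (?P n)) \<le> 1"
    using limsup_coeff unfolding coeff_map_eq .
  also have "(1::ereal) < ereal e" using e by (simp add: one_ereal_def)
  finally have "\<forall>\<^sub>F n in sequentially. ereal_root n (?P n) < ereal e"
    by (rule Limsup_lessD)
  moreover have "\<forall>\<^sub>F n in sequentially. n \<ge> (1::nat)" by (rule eventually_ge_at_top)
  ultimately show ?thesis
  proof eventually_elim
    case (elim n)
    have Un: "U [^] n \<in> carrier A" by (simp add: monoid.nat_pow_closed[OF ring.is_monoid[OF A_ring]])
    have nu: "nrm A (U [^] n) \<ge> 0" using nrm_nonneg[OF Un] .
    have sup: "cmod (E\<^sub>0 ((quot ^^ n) a) x) \<le> nrm (cont_alg K) (E\<^sub>0 ((quot ^^ n) a))"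
      if "a \<in> carrier A" "x \<in> XK" for a x
    proof -
      have "bdd_above ((\<lambda>x. cmod (E\<^sub>0 ((quot ^^ n) a) x)) ` XK)"
        using E0_bound[OF quot_pow_closed[OF that(1), of n]] by (intro bdd_aboveI2)
      then show ?thesis using cSUP_upper[OF that(2)] by (simp add: cont_alg_def)
    qed
    have op_ge: "ereal (nrm (cont_alg K) (E\<^sub>0 ((quot ^^ n) a))) \<le> ?op n"
      if "a \<in> carrier A" "nrm A a \<le> 1" for a
      unfolding op_nrm_def using that by (intro SUP_upper) auto
    show ?case
    proof (intro ballI)
      fix a x assume a: "a \<in> carrier A" and x: "x \<in> XK"
      \<comment> \<open>The zero element lies in the unit ball, so the supremum is not negative and
        passing from the root to its power is monotone.\<close>
      have "0 \<le> ereal (nrm (cont_alg K) (E\<^sub>0 ((quot ^^ n) \<zero>)))"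
        using order_trans[OF norm_ge_zero sup[of \<zero> x]] x by simp
      then have op0: "0 \<le> ?op n" using op_ge[of \<zero>, THEN order_trans[rotated]] by simp
      have P0: "0 \<le> ?P n" using op0 nu by simp
      \<comment> \<open>\<open>ereal_root\<close> leaves \<open>\<infinity>\<close> fixed, so a root
        below \<open>e\<close> forces the product to be finite.\<close>
      have "?P n \<noteq> \<infinity>" using elim by (auto simp: ereal_root_def)
      then obtain r where r: "?P n = ereal r" "r \<ge> 0" using P0 by (cases "?P n") auto
      have "root n r < e" using elim r by (simp add: ereal_root_def)
      then have "root n r ^ n \<le> e ^ n" using r elim by (intro power_mono) auto
      then have re: "r \<le> e ^ n" using r elim by (simp add: real_root_pow_pos2)
      have unit: "cmod (E\<^sub>0 ((quot ^^ n) b) x) * nrm A (U [^] n) \<le> e ^ n"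
        if b: "b \<in> carrier A" "nrm A b \<le> 1" for b
      proof -
        have "ereal (cmod (E\<^sub>0 ((quot ^^ n) b) x)) \<le> ?op n"
          using sup[OF b(1) x] op_ge[OF b] by (meson ereal_less_eq(3) order_trans)
        then have "ereal (cmod (E\<^sub>0 ((quot ^^ n) b) x)) * ereal (nrm A (U [^] n)) \<le> ?P n"
          using nu by (intro ereal_mult_right_mono) auto
        then show ?thesis using r re by simp
      qed
      show "cmod (E\<^sub>0 ((quot ^^ n) a) x) * nrm A (U [^] n) \<le> e ^ n * nrm A a"
      proof (cases "a = \<zero>")
        case True
        have "cmod (E\<^sub>0 ((quot ^^ n) \<zero>) x) = 0"
          using quot_pow_smult[of \<zero> n 0] E0_smult_at[OF quot_pow_closed[of \<zero> n] x, of 0] by simp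
        then show ?thesis using True by simp
      next
        case False
        then have na: "nrm A a > 0" using nrm_nonneg[OF a] nrm_eq_0_iff[OF a] by linarith
        let ?b = "complex_of_real (1 / nrm A a) \<odot>\<^bsub>A\<^esub> a"
        have "cmod (E\<^sub>0 ((quot ^^ n) ?b) x) * nrm A (U [^] n) \<le> e ^ n"
          using na a by (intro unit) (auto simp: nrm_smult norm_divide)
        then have "cmod (E\<^sub>0 ((quot ^^ n) ?b) x) * nrm A (U [^] n) * nrm A a \<le> e ^ n * nrm A a"
          using na by (intro mult_right_mono) auto
        moreover have "cmod (E\<^sub>0 ((quot ^^ n) ?b) x) = cmod (E\<^sub>0 ((quot ^^ n) a) x) / nrm A a"
          using a x na by (simp add: quot_pow_smult E0_smult_at quot_pow_closed norm_divide)
        ultimately have le: "cmod (E\<^sub>0 ((quot ^^ n) a) x) / nrm A a * nrm A (U [^] n) * nrm A a \<le> e ^ n * nrm A a"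
          by (simp only:)
        have "cmod (E\<^sub>0 ((quot ^^ n) a) x) * nrm A (U [^] n)
            = cmod (E\<^sub>0 ((quot ^^ n) a) x) / nrm A a * nrm A (U [^] n) * nrm A a"
          using na by simp
        then show ?thesis using le by (simp only:)
      qed
    qed
  qed
qed

text \<open>Horner's rule. Coefficients stand to the left of \<open>U\<close>, so right
  multiplication by \<open>U\<close> only shifts them and no composition with \<open>\<eta>\<close>
  appears.\<close>

lemma iota_decomposition:
  assumes p: "p \<in> carrier (skew_poly K \<eta>)"
  shows "(\<lambda>n. p (Suc n)) \<in> carrier (skew_poly K \<eta>)" "\<iota> p = emb (p 0) \<oplus> \<iota> (\<lambda>n. p (Suc n)) \<otimes> U"
proof -
  have pC: "p n \<in> CK" for n using p by (auto simp: skew_poly_def)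
  have "finite {n. p n \<noteq> \<zero>\<^bsub>cont_alg K\<^esub>}" using p by (auto simp: skew_poly_def)
  then have "finite (Suc -` {n. p n \<noteq> \<zero>\<^bsub>cont_alg K\<^esub>})" by (rule finite_vimageI) simp
  then show s: "(\<lambda>n. p (Suc n)) \<in> carrier (skew_poly K \<eta>)"
    using pC by (auto simp: skew_poly_def vimage_def)
  have "((\<lambda>n. p (Suc n)) \<otimes>\<^bsub>skew_poly K \<eta>\<^esub> var_poly K) n x = (if n = 0 then 0 else p n x)"
    if x: "x \<in> XK" for n x
  proof (cases n)
    case 0 then show ?thesis using x by (simp add: skew_poly_def var_poly_def cont_alg_def)
  next
    case (Suc m)
    have "((\<lambda>n. p (Suc n)) \<otimes>\<^bsub>skew_poly K \<eta>\<^esub> var_poly K) n x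
       = (\<Sum>i\<le>n. p (Suc i) x * var_poly K (n - i) ((\<eta> ^^ i) x))"
      using x by (simp add: skew_poly_def)
    also have "\<dots> = (\<Sum>i\<le>n. if i = m then p (Suc m) x else 0)"
      using eta_pow_in[OF x] Suc by (intro sum.cong refl) (auto simp: var_poly_def cont_alg_def)
    also have "\<dots> = p n x" using Suc by simp
    finally show ?thesis using Suc by simp
  qed
  then have "p n x = (const_poly K (p 0) \<oplus>\<^bsub>skew_poly K \<eta>\<^esub> ((\<lambda>n. p (Suc n)) \<otimes>\<^bsub>skew_poly K \<eta>\<^esub> var_poly K)) n x" for n x
  proof (cases "x \<in> XK")
    case True
    then show ?thesis
      using \<open>\<And>n x. x \<in> XK \<Longrightarrow> _ n x = (if n = 0 then 0 else p n x)\<close>[OF True, of n]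
      by (simp add: skew_poly_def cont_alg_def const_poly_def)
  next
    case False
    then show ?thesis using CK_E(1)[OF pC[of n]]
      by (simp add: skew_poly_def cont_alg_def extensional_def)
  qed
  then have "p = const_poly K (p 0) \<oplus>\<^bsub>skew_poly K \<eta>\<^esub> ((\<lambda>n. p (Suc n)) \<otimes>\<^bsub>skew_poly K \<eta>\<^esub> var_poly K)"
    by (simp add: fun_eq_iff)
  moreover have "(\<lambda>n. p (Suc n)) \<otimes>\<^bsub>skew_poly K \<eta>\<^esub> var_poly K \<in> carrier (skew_poly K \<eta>)"
  proof -
    have eq: "(\<lambda>n. p (Suc n)) \<otimes>\<^bsub>skew_poly K \<eta>\<^esub> var_poly K = (\<lambda>n. if n = 0 then \<zero>\<^bsub>cont_alg K\<^esub> else p n)"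
    proof (intro ext)
      fix n x
      show "((\<lambda>n. p (Suc n)) \<otimes>\<^bsub>skew_poly K \<eta>\<^esub> var_poly K) n x = (if n = 0 then \<zero>\<^bsub>cont_alg K\<^esub> else p n) x"
      proof (cases "x \<in> XK")
        case True
        then show ?thesis
          using \<open>\<And>n x. x \<in> XK \<Longrightarrow> _ n x = (if n = 0 then 0 else p n x)\<close>[OF True, of n]
          by (simp add: cont_alg_def)
      next
        case False
        then show ?thesis using CK_E(1)[OF pC[of n]]
          by (simp add: skew_poly_def cont_alg_def extensional_def)
      qed
    qed
    have "{n. (if n = 0 then \<zero>\<^bsub>cont_alg K\<^esub> else p n) \<noteq> \<zero>\<^bsub>cont_alg K\<^esub>} \<subseteq> {n. p n \<noteq> \<zero>\<^bsub>cont_alg K\<^esub>}" by auto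
    then have "finite {n. (if n = 0 then \<zero>\<^bsub>cont_alg K\<^esub> else p n) \<noteq> \<zero>\<^bsub>cont_alg K\<^esub>}"
      using \<open>finite {n. p n \<noteq> \<zero>\<^bsub>cont_alg K\<^esub>}\<close> finite_subset by blast
    then show ?thesis unfolding eq using pC by (auto simp: skew_poly_def)
  qed
  ultimately have "\<iota> p = emb (p 0) \<oplus> \<iota> ((\<lambda>n. p (Suc n)) \<otimes>\<^bsub>skew_poly K \<eta>\<^esub> var_poly K)"
    using ring_hom_add[OF iota_hom, of "const_poly K (p 0)"] pC by (metis const_poly_in)
  then show "\<iota> p = emb (p 0) \<oplus> \<iota> (\<lambda>n. p (Suc n)) \<otimes> U"
    using ring_hom_mult[OF iota_hom s var_poly_in] by simp
qed

lemma iota_quot: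
  assumes p: "p \<in> carrier (skew_poly K \<eta>)"
  shows "E\<^sub>0 (\<iota> p) = p 0" "quot (\<iota> p) = \<iota> (\<lambda>n. p (Suc n))"
  using decomposition_unique[OF _ _ iota_decomposition(2)[OF p]] iota_decomposition(1)[OF p] p
  by (auto simp: skew_poly_def)

end

section \<open>The subalgebra of a uniform algebra\<close>

locale conjugacy_subalgebra = topological_conjugacy_algebra K \<eta> A \<iota> E\<^sub>0
  for K :: "'x topology" and \<eta> :: "'x \<Rightarrow> 'x" and A :: "('a, 'm) normed_alg_scheme" (structure)
    and \<iota> :: "(nat \<Rightarrow> 'x \<Rightarrow> complex) \<Rightarrow> 'a" and E\<^sub>0 :: "'a \<Rightarrow> 'x \<Rightarrow> complex" +
  fixes S :: "('x \<Rightarrow> complex) set"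
  assumes S_sub: "S \<subseteq> carrier (cont_alg K)"
    and S_one: "\<one>\<^bsub>cont_alg K\<^esub> \<in> S"
    and S_add: "f \<in> S \<Longrightarrow> g \<in> S \<Longrightarrow> f \<oplus>\<^bsub>cont_alg K\<^esub> g \<in> S"
    and S_mult: "f \<in> S \<Longrightarrow> g \<in> S \<Longrightarrow> f \<otimes>\<^bsub>cont_alg K\<^esub> g \<in> S"
    and S_smult: "f \<in> S \<Longrightarrow> c \<odot>\<^bsub>cont_alg K\<^esub> f \<in> S"
    and S_comp: "f \<in> S \<Longrightarrow> restrict (f \<circ> \<eta>) (topspace K) \<in> S"
    and S_closed: "f \<in> carrier (cont_alg K) \<Longrightarrow>
        (\<And>e. e > 0 \<Longrightarrow> \<exists>g\<in>S. \<forall>x\<in>topspace K. cmod (f x - g x) < e) \<Longrightarrow> f \<in> S"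
begin

definition PS :: "(nat \<Rightarrow> 'x \<Rightarrow> complex) set" where
  "PS = {p \<in> carrier (skew_poly K \<eta>). \<forall>n. p n \<in> S}"

text \<open>Polynomials over \<open>S\<close> already form an algebra, so this closure is the
  generated closed subalgebra (\<open>uniform_subalgebra_eq\<close>), and its elements can be
  approximated directly.\<close>

definition B :: "'a set" where
  "B = nrm_topology A closure_of (\<iota> ` PS)"

lemma S_CK: "f \<in> S \<Longrightarrow> f \<in> CK" using S_sub by blast

lemma S_zero: "\<zero>\<^bsub>cont_alg K\<^esub> \<in> S"
proof -
  have "0 \<odot>\<^bsub>cont_alg K\<^esub> \<one>\<^bsub>cont_alg K\<^esub> = \<zero>\<^bsub>cont_alg K\<^esub>" by (auto simp: cont_alg_def)
  then show ?thesis using S_smult[OF S_one, of 0] by simp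
qed

lemma PS_sub: "p \<in> PS \<Longrightarrow> p \<in> carrier (skew_poly K \<eta>)" by (simp add: PS_def)

lemma PS_I: "(\<And>n. p n \<in> S) \<Longrightarrow> (\<And>n. n \<ge> N \<Longrightarrow> p n = \<zero>\<^bsub>cont_alg K\<^esub>) \<Longrightarrow> p \<in> PS"
proof -
  assume p: "\<And>n. p n \<in> S" "\<And>n. n \<ge> N \<Longrightarrow> p n = \<zero>\<^bsub>cont_alg K\<^esub>"
  then have "{n. p n \<noteq> \<zero>\<^bsub>cont_alg K\<^esub>} \<subseteq> {..<N}" by (auto simp: not_le[symmetric])
  then have "finite {n. p n \<noteq> \<zero>\<^bsub>cont_alg K\<^esub>}" using finite_subset by blast
  then show ?thesis using p S_CK by (auto simp: PS_def skew_poly_def)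
qed

lemma PS_E:
  assumes "p \<in> PS"
  obtains N where "\<And>n. p n \<in> S" "\<And>n. n \<ge> N \<Longrightarrow> p n = \<zero>\<^bsub>cont_alg K\<^esub>"
proof -
  have "finite {n. p n \<noteq> \<zero>\<^bsub>cont_alg K\<^esub>}" using assms by (auto simp: PS_def skew_poly_def)
  then obtain N where "\<forall>n\<in>{n. p n \<noteq> \<zero>\<^bsub>cont_alg K\<^esub>}. n < N" using finite_nat_set_iff_bounded by blast
  then show ?thesis using that[of N] assms by (force simp: PS_def)
qed

lemma PS_const: "f \<in> S \<Longrightarrow> const_poly K f \<in> PS"
  by (intro PS_I[of _ 1]) (auto simp: const_poly_def S_zero)

lemma PS_var: "var_poly K \<in> PS"
  by (intro PS_I[of _ 2]) (auto simp: var_poly_def S_zero S_one)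

lemma PS_shift: "p \<in> PS \<Longrightarrow> (\<lambda>n. p (Suc n)) \<in> PS"
proof -
  assume "p \<in> PS"
  then obtain N where "\<And>n. p n \<in> S" "\<And>n. n \<ge> N \<Longrightarrow> p n = \<zero>\<^bsub>cont_alg K\<^esub>" using PS_E by blast
  then show ?thesis by (intro PS_I[of _ N]) auto
qed

lemma PS_add: "p \<in> PS \<Longrightarrow> q \<in> PS \<Longrightarrow> p \<oplus>\<^bsub>skew_poly K \<eta>\<^esub> q \<in> PS"
proof -
  assume "p \<in> PS" "q \<in> PS"
  then obtain N M where "\<And>n. p n \<in> S" "\<And>n. n \<ge> N \<Longrightarrow> p n = \<zero>\<^bsub>cont_alg K\<^esub>"
    "\<And>n. q n \<in> S" "\<And>n. n \<ge> M \<Longrightarrow> q n = \<zero>\<^bsub>cont_alg K\<^esub>" using PS_E by metis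
  then show ?thesis
    by (intro PS_I[of _ "max N M"]) (auto simp: skew_poly_def S_add, auto simp: cont_alg_def)
qed

lemma PS_smult: "p \<in> PS \<Longrightarrow> c \<odot>\<^bsub>skew_poly K \<eta>\<^esub> p \<in> PS"
proof -
  assume "p \<in> PS"
  then obtain N where "\<And>n. p n \<in> S" "\<And>n. n \<ge> N \<Longrightarrow> p n = \<zero>\<^bsub>cont_alg K\<^esub>" using PS_E by metis
  then show ?thesis
    by (intro PS_I[of _ N]) (auto simp: skew_poly_def S_smult, auto simp: cont_alg_def)
qed

lemma S_comp_pow: "f \<in> S \<Longrightarrow> (\<lambda>x\<in>XK. f ((\<eta> ^^ i) x)) \<in> S"
proof (induction i)
  case 0
  have "(\<lambda>x\<in>XK. f x) = f" using CK_E(1)[OF S_CK[OF 0]] by (simp add: extensional_restrict)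
  then show ?case using 0 by simp
next
  case (Suc i)
  have "restrict ((\<lambda>x\<in>XK. f ((\<eta> ^^ i) x)) \<circ> \<eta>) XK = (\<lambda>x\<in>XK. f ((\<eta> ^^ Suc i) x))"
    using eta_in by (auto simp: fun_eq_iff restrict_def funpow_swap1)
  then show ?case using S_comp[OF Suc.IH[OF Suc.prems]] by (simp only:)
qed

lemma S_sum:
  fixes F :: "nat \<Rightarrow> 'x \<Rightarrow> complex"
  shows "(\<And>i. F i \<in> S) \<Longrightarrow> (\<lambda>x\<in>XK. \<Sum>i<n. F i x) \<in> S"
proof (induction n)
  case 0
  have "(\<lambda>x\<in>XK. \<Sum>i<0. F i x) = \<zero>\<^bsub>cont_alg K\<^esub>" by (simp add: cont_alg_def)
  then show ?case using S_zero by (simp only:)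
next
  case (Suc n)
  have "(\<lambda>x\<in>XK. \<Sum>i<Suc n. F i x) = (\<lambda>x\<in>XK. \<Sum>i<n. F i x) \<oplus>\<^bsub>cont_alg K\<^esub> F n"
    by (auto simp: cont_alg_def fun_eq_iff)
  then show ?case using S_add[OF Suc.IH Suc.prems] Suc.prems by (simp only:)
qed

text \<open>Moving \<open>U\<^sup>i\<close> past a coefficient composes it with
  \<open>\<eta>\<^sup>i\<close>; invariance of \<open>S\<close> under composition keeps the product
  in \<open>PS\<close>.\<close>

lemma PS_mult: "p \<in> PS \<Longrightarrow> q \<in> PS \<Longrightarrow> p \<otimes>\<^bsub>skew_poly K \<eta>\<^esub> q \<in> PS"
proof -
  assume "p \<in> PS" "q \<in> PS"
  then obtain N M where p: "\<And>n. p n \<in> S" "\<And>n. n \<ge> N \<Longrightarrow> p n = \<zero>\<^bsub>cont_alg K\<^esub>"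
    and q: "\<And>n. q n \<in> S" "\<And>n. n \<ge> M \<Longrightarrow> q n = \<zero>\<^bsub>cont_alg K\<^esub>" using PS_E by metis
  show ?thesis
  proof (rule PS_I[of _ "N + M"])
    fix n
    have "(\<lambda>x\<in>XK. \<Sum>i<Suc n. (p i \<otimes>\<^bsub>cont_alg K\<^esub> (\<lambda>x\<in>XK. q (n - i) ((\<eta> ^^ i) x))) x) \<in> S"
      by (intro S_sum S_mult S_comp_pow p q)
    also have "(\<lambda>x\<in>XK. \<Sum>i<Suc n. (p i \<otimes>\<^bsub>cont_alg K\<^esub> (\<lambda>x\<in>XK. q (n - i) ((\<eta> ^^ i) x))) x)
       = (p \<otimes>\<^bsub>skew_poly K \<eta>\<^esub> q) n"
      unfolding lessThan_Suc_atMost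
      by (auto simp: fun_eq_iff skew_poly_def restrict_def cont_alg_def intro!: sum.cong)
    finally show "(p \<otimes>\<^bsub>skew_poly K \<eta>\<^esub> q) n \<in> S" .
  next
    fix n assume n: "n \<ge> N + M"
    have "p i x * q (n - i) ((\<eta> ^^ i) x) = 0" if "x \<in> XK" for i x
    proof (cases "i \<ge> N")
      case True then show ?thesis using p(2)[OF True] zero_at that by simp
    next
      case False
      then have "n - i \<ge> M" using n by simp
      then show ?thesis using q(2) zero_at eta_pow_in[OF that] by simp
    qed
    then have "(\<Sum>i\<le>n. p i x * q (n - i) ((\<eta> ^^ i) x)) = 0" if "x \<in> XK" for x
      using that by (intro sum.neutral ballI) blast
    then show "(p \<otimes>\<^bsub>skew_poly K \<eta>\<^esub> q) n = \<zero>\<^bsub>cont_alg K\<^esub>"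
      by (auto simp: skew_poly_def cont_alg_def restrict_def fun_eq_iff)
  qed
qed

lemma iota_PS: "\<iota> ` PS \<subseteq> carrier A" using PS_sub by auto

lemma B_iff: "a \<in> B \<longleftrightarrow> a \<in> carrier A \<and> (\<forall>e>0. \<exists>p\<in>PS. nrm A (a \<ominus> \<iota> p) < e)"
  unfolding B_def closure_iff[OF iota_PS] by blast

lemma B_carrier: "a \<in> B \<Longrightarrow> a \<in> carrier A" by (simp add: B_iff)

lemma B_approx:
  assumes "a \<in> B" "e > 0"
  obtains p where "p \<in> PS" "\<iota> p \<in> carrier A" "nrm A (a \<ominus> \<iota> p) < e"
  using assms unfolding B_iff by (meson PS_sub iota_closed)

lemma B_closed: "closedin (nrm_topology A) B"
  unfolding B_def by simp

lemma iota_B: "p \<in> PS \<Longrightarrow> \<iota> p \<in> B"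
  using closure_of_subset[of "\<iota> ` PS" "nrm_topology A"] iota_PS unfolding B_def by auto

lemma emb_B: "f \<in> S \<Longrightarrow> emb f \<in> B" by (intro iota_B PS_const)

lemma U_B: "U \<in> B" by (intro iota_B PS_var)

lemma B_add: "a \<in> B \<Longrightarrow> b \<in> B \<Longrightarrow> a \<oplus> b \<in> B"
  unfolding B_iff
proof (intro conjI allI impI; (elim conjE)?)
  fix e :: real assume ab: "a \<in> carrier A" "\<forall>e>0. \<exists>p\<in>PS. nrm A (a \<ominus> \<iota> p) < e"
    "b \<in> carrier A" "\<forall>e>0. \<exists>p\<in>PS. nrm A (b \<ominus> \<iota> p) < e" and e: "e > 0"
  obtain p q where p: "p \<in> PS" "nrm A (a \<ominus> \<iota> p) < e/2" and q: "q \<in> PS" "nrm A (b \<ominus> \<iota> q) < e/2"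
    using ab e half_gt_zero by blast
  have c: "\<iota> p \<in> carrier A" "\<iota> q \<in> carrier A" using p q PS_sub by auto
  have "(a \<oplus> b) \<ominus> \<iota> (p \<oplus>\<^bsub>skew_poly K \<eta>\<^esub> q) = (a \<ominus> \<iota> p) \<oplus> (b \<ominus> \<iota> q)"
    using ring_hom_add[OF iota_hom] p q PS_sub ab c by (simp add: add_diff_add)
  then have "nrm A ((a \<oplus> b) \<ominus> \<iota> (p \<oplus>\<^bsub>skew_poly K \<eta>\<^esub> q)) < e"
    using nrm_triangle[of "a \<ominus> \<iota> p" "b \<ominus> \<iota> q"] p q ab c by auto
  then show "\<exists>p\<in>PS. nrm A (a \<oplus> b \<ominus> \<iota> p) < e" using PS_add p q by blast
qed auto

lemma B_smult: "a \<in> B \<Longrightarrow> c \<odot>\<^bsub>A\<^esub> a \<in> B"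
  unfolding B_iff
proof (intro conjI allI impI; (elim conjE)?)
  fix e :: real assume a: "a \<in> carrier A" "\<forall>e>0. \<exists>p\<in>PS. nrm A (a \<ominus> \<iota> p) < e" and e: "e > 0"
  then obtain p where p: "p \<in> PS" "nrm A (a \<ominus> \<iota> p) < e / (cmod c + 1)"
    by (metis add_pos_nonneg add.commute divide_pos_pos norm_ge_zero zero_less_one)
  have pc: "\<iota> p \<in> carrier A" using p PS_sub by auto
  have "\<iota> (c \<odot>\<^bsub>skew_poly K \<eta>\<^esub> p) = c \<odot>\<^bsub>A\<^esub> \<iota> p"
    using poly_hom PS_sub[OF p(1)] unfolding alg_hom_def by blast
  then have "nrm A (c \<odot>\<^bsub>A\<^esub> a \<ominus> \<iota> (c \<odot>\<^bsub>skew_poly K \<eta>\<^esub> p)) = cmod c * nrm A (a \<ominus> \<iota> p)"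
    using a(1) pc by (simp add: smult_diff_right[symmetric] nrm_smult)
  also have "\<dots> \<le> (cmod c + 1) * nrm A (a \<ominus> \<iota> p)"
    using nrm_nonneg[of "a \<ominus> \<iota> p"] a(1) pc by (intro mult_right_mono) auto
  also have "\<dots> < e"
  proof -
    have "cmod c + 1 > 0" by (simp add: add_nonneg_pos)
    from mult_strict_left_mono[OF p(2) this] show ?thesis using \<open>cmod c + 1 > 0\<close> by simp
  qed
  finally show "\<exists>p\<in>PS. nrm A (c \<odot>\<^bsub>A\<^esub> a \<ominus> \<iota> p) < e" using PS_smult p by blast
qed auto

lemma B_mult: "a \<in> B \<Longrightarrow> b \<in> B \<Longrightarrow> a \<otimes> b \<in> B"
  unfolding B_iff
proof (intro conjI allI impI; (elim conjE)?)
  fix e :: real assume ab: "a \<in> carrier A" "\<forall>e>0. \<exists>p\<in>PS. nrm A (a \<ominus> \<iota> p) < e"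
    "b \<in> carrier A" "\<forall>e>0. \<exists>p\<in>PS. nrm A (b \<ominus> \<iota> p) < e" and e: "e > 0"
  have nb: "nrm A b + 1 > 0" using nrm_nonneg[OF ab(3)] by simp
  obtain p where p: "p \<in> PS" "nrm A (a \<ominus> \<iota> p) < e / 2 / (nrm A b + 1)"
    using ab(2) e nb by (metis divide_pos_pos half_gt_zero)
  have pc: "\<iota> p \<in> carrier A" using p PS_sub by auto
  have np: "nrm A (\<iota> p) + 1 > 0" using nrm_nonneg[OF pc] by simp
  \<comment> \<open>\<open>q\<close> is chosen after \<open>p\<close>, because its error gets
    multiplied by the norm of \<open>\<iota> p\<close>.\<close>
  obtain q where q: "q \<in> PS" "nrm A (b \<ominus> \<iota> q) < e / 2 / (nrm A (\<iota> p) + 1)"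
    using ab(4) e np by (metis divide_pos_pos half_gt_zero)
  have qc: "\<iota> q \<in> carrier A" using q PS_sub by auto
  have n1: "nrm A (a \<ominus> \<iota> p) * nrm A b < e/2"
  proof -
    have "nrm A (a \<ominus> \<iota> p) * nrm A b \<le> nrm A (a \<ominus> \<iota> p) * (nrm A b + 1)"
      using nrm_nonneg[of "a \<ominus> \<iota> p"] ab(1) pc by (intro mult_left_mono) auto
    also have "\<dots> < e/2" using p(2) unfolding pos_less_divide_eq[OF nb] .
    finally show ?thesis .
  qed
  have n2: "nrm A (\<iota> p) * nrm A (b \<ominus> \<iota> q) < e/2"
  proof -
    have "nrm A (\<iota> p) * nrm A (b \<ominus> \<iota> q) \<le> (nrm A (\<iota> p) + 1) * nrm A (b \<ominus> \<iota> q)"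
      using nrm_nonneg[of "b \<ominus> \<iota> q"] ab(3) qc by (intro mult_right_mono) auto
    also have "\<dots> < e/2" using q(2) unfolding pos_less_divide_eq[OF np] by (simp only: mult.commute)
    finally show ?thesis .
  qed
  have "a \<otimes> b \<ominus> \<iota> (p \<otimes>\<^bsub>skew_poly K \<eta>\<^esub> q) = (a \<ominus> \<iota> p) \<otimes> b \<oplus> \<iota> p \<otimes> (b \<ominus> \<iota> q)"
    using ring_hom_mult[OF iota_hom PS_sub[OF p(1)] PS_sub[OF q(1)]] ab pc qc
    by (simp add: diff_left_distr diff_right_distr diff_add_diff)
  then have "nrm A (a \<otimes> b \<ominus> \<iota> (p \<otimes>\<^bsub>skew_poly K \<eta>\<^esub> q)) < e"
    using nrm_triangle[of "(a \<ominus> \<iota> p) \<otimes> b" "\<iota> p \<otimes> (b \<ominus> \<iota> q)"] nrm_mult[of "a \<ominus> \<iota> p" b]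
      nrm_mult[of "\<iota> p" "b \<ominus> \<iota> q"] n1 n2 ab(1,3) pc qc by (simp add: m_closed)
  then show "\<exists>p\<in>PS. nrm A (a \<otimes> b \<ominus> \<iota> p) < e" using PS_mult p q by blast
qed auto

lemma B_one: "\<one> \<in> B" using emb_B[OF S_one] emb_one by simp

lemma B_minus: "a \<in> B \<Longrightarrow> \<ominus> a \<in> B"
  using B_smult[of a "-1"] B_carrier smult_minus_1 by simp

lemma B_subalgebra: "subalgebra_of B A"
  unfolding subalgebra_of_def
  using B_add B_mult B_smult B_one B_minus B_carrier by (auto intro!: ring.subringI[OF A_ring])

lemma uniform_subalgebra_eq: "uniform_subalgebra A \<iota> K \<eta> S = A\<lparr>carrier := B\<rparr>"
proof -
  have "\<Inter>{B. subalgebra_of B A \<and> closedin (nrm_topology A) B \<and> \<iota> ` PS \<subseteq> B} = B"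
  proof
    show "\<Inter>{B. subalgebra_of B A \<and> closedin (nrm_topology A) B \<and> \<iota> ` PS \<subseteq> B} \<subseteq> B"
      using B_subalgebra B_closed iota_B by blast
    show "B \<subseteq> \<Inter>{B. subalgebra_of B A \<and> closedin (nrm_topology A) B \<and> \<iota> ` PS \<subseteq> B}"
      unfolding B_def using closure_of_minimal by blast
  qed
  then show ?thesis by (simp add: uniform_subalgebra_def PS_def)
qed

text \<open>\<open>quot\<close> is bounded and shifts the coefficients of a polynomial, so it
  preserves \<open>PS\<close> and its closure. With \<open>E0_S\<close>, all coefficient functions
  of elements of \<open>B\<close> lie in \<open>S\<close>.\<close>

lemma quot_B: "a \<in> B \<Longrightarrow> quot a \<in> B"
proof -
  assume a: "a \<in> B"
  obtain M where M: "M \<ge> 0" "\<And>a. a \<in> carrier A \<Longrightarrow> nrm A (quot a) \<le> M * nrm A a"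
    using quot_bounded by metis
  have "\<exists>p\<in>PS. nrm A (quot a \<ominus> \<iota> p) < e" if e: "e > 0" for e
  proof -
    obtain p where p: "p \<in> PS" "\<iota> p \<in> carrier A" "nrm A (a \<ominus> \<iota> p) < e / (M + 1)"
      using B_approx[OF a, of "e / (M + 1)"] e M(1) by auto
    have "nrm A (quot a \<ominus> \<iota> (\<lambda>n. p (Suc n))) = nrm A (quot (a \<ominus> \<iota> p))"
      using quot_diff[of a "\<iota> p"] iota_quot[OF PS_sub[OF p(1)]] B_carrier[OF a] p by simp
    also have "\<dots> \<le> M * nrm A (a \<ominus> \<iota> p)" using M(2) B_carrier[OF a] p by simp
    also have "\<dots> \<le> (M + 1) * nrm A (a \<ominus> \<iota> p)"
      using nrm_nonneg B_carrier[OF a] p by (intro mult_right_mono) auto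
    also have "\<dots> < e" using p(3) M(1) by (simp add: pos_less_divide_eq mult.commute)
    finally show ?thesis using PS_shift p by blast
  qed
  then show ?thesis using a by (simp add: B_iff)
qed

text \<open>\<open>E\<^sub>0\<close> is contractive into the supremum norm, the constant
  coefficients of the approximating polynomials lie in \<open>S\<close>, and \<open>S\<close> is
  uniformly closed.\<close>

lemma E0_S: "a \<in> B \<Longrightarrow> E\<^sub>0 a \<in> S"
proof (rule S_closed)
  assume a: "a \<in> B"
  then show "E\<^sub>0 a \<in> CK" using B_carrier by simp
  fix e :: real assume "e > 0"
  then obtain p where p: "p \<in> PS" "\<iota> p \<in> carrier A" "nrm A (a \<ominus> \<iota> p) < e"
    using B_approx[OF a] by blast
  have "cmod (E\<^sub>0 a x - p 0 x) < e" if "x \<in> XK" for x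
    using E0_bound[of "a \<ominus> \<iota> p" x] p that B_carrier[OF a] iota_quot(1)[OF PS_sub[OF p(1)]]
    by (simp add: E0_diff_at)
  then show "\<exists>g\<in>S. \<forall>x\<in>XK. cmod (E\<^sub>0 a x - g x) < e"
    using p(1) by (auto simp: PS_def)
qed

lemma PS_induct [consumes 1, case_names zero step]:
  assumes p: "p \<in> PS"
    and zero: "Q \<zero>"
    and step: "\<And>f p. f \<in> S \<Longrightarrow> p \<in> PS \<Longrightarrow> Q (\<iota> p) \<Longrightarrow> Q (emb f \<oplus> \<iota> p \<otimes> U)"
  shows "Q (\<iota> p)"
proof -
  obtain N where "\<And>n. n \<ge> N \<Longrightarrow> p n = \<zero>\<^bsub>cont_alg K\<^esub>" using p PS_E by metis
  then show ?thesis using p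
  proof (induction N arbitrary: p)
    case 0
    then have "p = const_poly K \<zero>\<^bsub>cont_alg K\<^esub>" by (auto simp: const_poly_def fun_eq_iff)
    moreover have "0 \<odot>\<^bsub>cont_alg K\<^esub> \<zero>\<^bsub>cont_alg K\<^esub> = \<zero>\<^bsub>cont_alg K\<^esub>"
      by (auto simp: cont_alg_def)
    ultimately have "\<iota> p = \<zero>" using emb_smult[OF zero_CK, of 0] by simp
    then show ?case using zero by simp
  next
    case (Suc N)
    have "Q (\<iota> (\<lambda>n. p (Suc n)))" using Suc by (intro Suc.IH PS_shift) auto
    then have "Q (emb (p 0) \<oplus> \<iota> (\<lambda>n. p (Suc n)) \<otimes> U)"
      using Suc.prems(2) by (intro step PS_shift) (auto simp: PS_def)
    then show ?case using iota_decomposition(2)[OF PS_sub[OF Suc.prems(2)]] by simp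
  qed
qed

text \<open>
  Both functionals are determined by \<open>y\<close> and \<open>w\<close>, first on polynomials and then by continuity.
\<close>

lemma functionals_agree:
  fixes F G :: "'a \<Rightarrow> complex"
  assumes a: "a \<in> B"
    and F: "\<And>a b. a \<in> B \<Longrightarrow> b \<in> B \<Longrightarrow> F (a \<oplus> b) = F a + F b" "\<And>a. a \<in> B \<Longrightarrow> cmod (F a) \<le> c * nrm A a"
    and G: "\<And>a b. a \<in> B \<Longrightarrow> b \<in> B \<Longrightarrow> G (a \<oplus> b) = G a + G b" "\<And>a. a \<in> B \<Longrightarrow> cmod (G a) \<le> d * nrm A a"
    and FG: "\<And>f. f \<in> S \<Longrightarrow> F (emb f) = G (emb f)"
    and FU: "\<And>b. b \<in> B \<Longrightarrow> F (b \<otimes> U) = F b * w" and GU: "\<And>b. b \<in> B \<Longrightarrow> G (b \<otimes> U) = G b * w"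
  shows "F a = G a"
proof -
  have B0: "\<zero> \<in> B" using B_subalgebra subalgebra_ofD(2) by blast
  have z: "F \<zero> = 0" "G \<zero> = 0" using F(2)[OF B0] G(2)[OF B0] by auto
  have poly: "F (\<iota> p) = G (\<iota> p)" if "p \<in> PS" for p
    using that
  proof (induction rule: PS_induct)
    case zero then show ?case using z by simp
  next
    case (step f p)
    then show ?case using F(1) G(1) FG FU GU emb_B iota_B B_mult U_B by simp
  qed
  have F1: "F (a \<ominus> b) = F a - F b" and G1: "G (a \<ominus> b) = G a - G b" if "a \<in> B" "b \<in> B" for a b
  proof -
    have "a = (a \<ominus> b) \<oplus> b" "a \<ominus> b \<in> B"
      using that B_carrier diff_add_cancel' B_subalgebra subalgebra_ofD(8) by auto
    then show "F (a \<ominus> b) = F a - F b" "G (a \<ominus> b) = G a - G b"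
      using F(1)[of "a \<ominus> b" b] G(1)[of "a \<ominus> b" b] that by auto
  qed
  have "cmod (F a - G a) \<le> e" if e: "e > 0" for e
  proof -
    \<comment> \<open>Positive whatever the signs of \<open>c\<close> and \<open>d\<close>, and at
      least \<open>c + d\<close>.\<close>
    define k where "k = max c 0 + max d 0 + 1"
    have k: "k > 0" by (simp add: k_def add_nonneg_pos)
    obtain p where p: "p \<in> PS" "\<iota> p \<in> carrier A" "nrm A (a \<ominus> \<iota> p) < e / k"
      using B_approx[OF a, of "e / k"] e k by auto
    have pB: "\<iota> p \<in> B" "a \<ominus> \<iota> p \<in> B"
      using iota_B p a B_subalgebra subalgebra_ofD(8) by auto
    have nn: "nrm A (a \<ominus> \<iota> p) \<ge> 0" using nrm_nonneg B_carrier[OF pB(2)] .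
    have "F a - G a = F (a \<ominus> \<iota> p) - G (a \<ominus> \<iota> p)"
      using F1[OF a pB(1)] G1[OF a pB(1)] poly[OF p(1)] by simp
    then have "cmod (F a - G a) \<le> cmod (F (a \<ominus> \<iota> p)) + cmod (G (a \<ominus> \<iota> p))"
      by (simp add: norm_triangle_ineq4)
    also have "\<dots> \<le> (c + d) * nrm A (a \<ominus> \<iota> p)"
      using F(2)[OF pB(2)] G(2)[OF pB(2)] by (simp add: distrib_right)
    also have "\<dots> \<le> k * nrm A (a \<ominus> \<iota> p)"
      using nn by (intro mult_right_mono) (auto simp: k_def)
    also have "\<dots> \<le> e" using p(3) k by (simp add: pos_less_divide_eq mult.commute)
    finally show ?thesis .
  qed
  then have "cmod (F a - G a) \<le> 0 + e" if "e > 0" for e using that by simp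
  then have "cmod (F a - G a) \<le> 0" by (rule field_le_epsilon)
  then show ?thesis by simp
qed

end

section \<open>Analytic functions on the closed disc\<close>

text \<open>Membership in the disc algebra without extensionality, so that it applies to
  compositions and formulas before they are restricted to \<open>disc\<close>.\<close>

definition disc_hol :: "(complex \<Rightarrow> complex) \<Rightarrow> bool" where
  "disc_hol f \<longleftrightarrow> continuous_on disc f \<and> f holomorphic_on ball 0 1"

lemma disc_hol_cong: "disc_hol f \<Longrightarrow> (\<And>z. z \<in> disc \<Longrightarrow> f z = g z) \<Longrightarrow> disc_hol g"
  unfolding disc_hol_def
  by (metis (no_types, lifting) ball_subset_cball continuous_on_cong holomorphic_transform subsetD)

lemma carrier_disc: "carrier (cont_alg disc_space) = {f \<in> extensional disc. continuous_on disc f}"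
  by (simp add: cont_alg_def continuous_map_iff_continuous)

lemma disc_algebra_iff: "f \<in> disc_algebra \<longleftrightarrow> f \<in> extensional disc \<and> disc_hol f"
  by (auto simp: disc_algebra_def carrier_disc disc_hol_def)

lemma restrict_disc_algebra: "disc_hol f \<Longrightarrow> restrict f disc \<in> disc_algebra"
  by (simp add: disc_algebra_iff) (rule disc_hol_cong, auto)

lemma eq_on_disc:
  fixes f g :: "complex \<Rightarrow> complex"
  assumes "continuous_on disc f" "continuous_on disc g" "\<And>z. z \<in> ball 0 1 \<Longrightarrow> f z = g z" "z \<in> disc"
  shows "f z = g z"
  using continuous_constant_on_closure[of "ball 0 1" "\<lambda>z. f z - g z" 0 z] assms
  by (auto intro: continuous_intros)

text \<open>Analytic continuation reaches the open ball, continuity its boundary.\<close>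

lemma disc_hol_identity:
  assumes f: "disc_hol f" and g: "disc_hol g" and V: "open V" "V \<noteq> {}" "V \<subseteq> ball 0 1"
    and eq: "\<And>z. z \<in> V \<Longrightarrow> f z = g z" and z: "z \<in> disc"
  shows "f z = g z"
proof (rule eq_on_disc[OF _ _ _ z])
  show "continuous_on disc f" "continuous_on disc g" using f g by (auto simp: disc_hol_def)
  fix w :: complex assume w: "w \<in> ball 0 1"
  show "f w = g w"
    by (rule analytic_continuation_open[of V "ball 0 1" f g])
      (use f g V w eq in \<open>simp_all add: disc_hol_def\<close>)
qed

lemma disc_point_near_ball:
  assumes "z \<in> disc" "open V" "z \<in> V"
  obtains w where "w \<in> V" "w \<in> ball (0::complex) 1"
proof -
  have "z \<in> closure (ball 0 1)" using assms(1) by (simp add: closure_ball)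
  then have "V \<inter> ball 0 1 \<noteq> {}" using assms by (metis closure_iff_nhds_not_empty order_refl disjoint_iff)
  then show ?thesis using that by blast
qed

text \<open>\<open>z\<close> may be a boundary point; the relatively open set where \<open>f\<close>
  does not vanish still meets the open ball, where the identity theorem can be applied.\<close>

lemma disc_hol_nonzero_open:
  assumes f: "continuous_on disc f" and z: "z \<in> disc" "f z \<noteq> (0::complex)"
  obtains V where "open V" "V \<noteq> {}" "V \<subseteq> ball 0 1" "\<And>w. w \<in> V \<Longrightarrow> f w \<noteq> 0"
proof -
  have "openin (top_of_set disc) (disc \<inter> f -` (- {0}))"
    using continuous_openin_preimage_gen[OF f, of "- {0}"] by (simp add: open_Compl)
  then obtain W where W: "open W" "disc \<inter> f -` (- {0}) = disc \<inter> W" by (auto simp: openin_open)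
  then have Wd: "w \<in> W \<longleftrightarrow> f w \<noteq> 0" if "w \<in> disc" for w using that by blast
  obtain w where "w \<in> W" "w \<in> ball 0 1"
    using disc_point_near_ball[OF z(1) W(1)] Wd[OF z(1)] z(2) by blast
  then have "W \<inter> ball 0 1 \<noteq> {}" by blast
  moreover have "f w \<noteq> 0" if "w \<in> W \<inter> ball 0 1" for w using Wd[of w] that by auto
  ultimately show ?thesis using W(1) by (intro that[of "W \<inter> ball 0 1"]) auto
qed

section \<open>Analytic self-maps of the disc\<close>

lemma disc_map_hol: "disc_map \<eta> \<Longrightarrow> disc_hol \<eta>"
  by (auto simp: disc_map_def disc_hol_def)

lemma disc_map_in: "disc_map \<eta> \<Longrightarrow> z \<in> disc \<Longrightarrow> \<eta> z \<in> disc"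
  unfolding disc_map_def by blast

text \<open>Maximum modulus principle: the modulus of \<open>\<eta>\<close> has an interior maximum
  at \<open>z0\<close>.\<close>

lemma disc_map_boundary_constant:
  assumes h: "disc_map \<eta>" and z0: "z0 \<in> ball 0 1" "cmod (\<eta> z0) = 1" and z: "z \<in> disc"
  shows "\<eta> z = \<eta> z0"
proof -
  have "\<eta> constant_on ball 0 1"
    using h z0 disc_map_in[OF h]
    by (intro maximum_modulus_principle[of \<eta> "ball 0 1" "ball 0 1" z0]) (auto simp: disc_map_def)
  then have "\<eta> w = \<eta> z0" if "w \<in> ball 0 1" for w using that z0 by (metis constant_on_def)
  then show ?thesis using h z by (rule_tac eq_on_disc[of \<eta> "\<lambda>_. \<eta> z0"]) (auto simp: disc_map_def)
qed

text \<open>The delicate case is that \<open>\<eta>\<close> sends an interior point to the circle,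
  where \<open>f\<close> need not be analytic. Then \<open>\<eta>\<close> is constant by maximum
  modulus, and so is the composition.\<close>

lemma disc_hol_comp:
  assumes f: "disc_hol f" and h: "disc_map \<eta>"
  shows "disc_hol (\<lambda>z. f (\<eta> z))"
proof (cases "\<exists>z0\<in>ball 0 1. cmod (\<eta> z0) = 1")
  case True
  then obtain z0 where z0: "z0 \<in> ball 0 1" "cmod (\<eta> z0) = 1" by blast
  have "disc_hol (\<lambda>z. f (\<eta> z0))" by (auto simp: disc_hol_def)
  then show ?thesis by (rule disc_hol_cong) (simp add: disc_map_boundary_constant[OF h z0])
next
  case False
  have "\<eta> ` ball 0 1 \<subseteq> ball 0 1"
    using False disc_map_in[OF h] by (force simp: less_le)
  then have "f \<circ> \<eta> holomorphic_on ball 0 1"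
    using f h by (intro holomorphic_on_compose_gen[of \<eta> _ f "ball 0 1"]) (auto simp: disc_map_def disc_hol_def)
  moreover have "continuous_on disc (\<lambda>z. f (\<eta> z))"
    using f h by (intro continuous_on_compose2[of disc f disc \<eta>]) (auto simp: disc_map_def disc_hol_def)
  ultimately show ?thesis by (simp add: disc_hol_def o_def)
qed

section \<open>Closure properties of the disc algebra: limits, polynomials, division, square
  roots\<close>

lemma disc_hol_ops:
  assumes "disc_hol f" "disc_hol g"
  shows "disc_hol (\<lambda>z. f z + g z)" "disc_hol (\<lambda>z. f z * g z)" "disc_hol (\<lambda>z. f z - g z)"
    "disc_hol (\<lambda>z. c)" "disc_hol (\<lambda>z. z)"
  using assms by (auto simp: disc_hol_def intro!: holomorphic_intros continuous_intros)

lemma disc_hol_uniform_limit: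
  assumes f: "\<And>e. e > 0 \<Longrightarrow> \<exists>g. disc_hol g \<and> (\<forall>z\<in>disc. cmod (f z - g z) < e)"
  shows "disc_hol f"
proof -
  obtain g where g: "\<And>n::nat. disc_hol (g n) \<and> (\<forall>z\<in>disc. cmod (f z - g n z) < 1 / real (Suc n))"
    using f[of "1 / real (Suc n)" for n] by (metis divide_pos_pos of_nat_0_less_iff zero_less_Suc zero_less_one)
  have ul: "uniform_limit disc g f sequentially"
  proof (rule uniform_limitI)
    fix e :: real assume "e > 0"
    then obtain N where N: "inverse (real (Suc N)) < e" using reals_Archimedean by blast
    have "dist (g n z) (f z) < e" if "n \<ge> N" "z \<in> disc" for n z
    proof -
      have "dist (g n z) (f z) < 1 / real (Suc n)" using g that by (simp add: dist_norm norm_minus_commute)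
      also have "\<dots> \<le> inverse (real (Suc N))" using that by (simp add: field_simps)
      finally show ?thesis using N by simp
    qed
    then show "\<forall>\<^sub>F n in sequentially. \<forall>x\<in>disc. dist (g n x) (f x) < e"
      unfolding eventually_sequentially by blast
  qed
  have "continuous_on disc f"
    by (rule uniform_limit_theorem[OF _ ul]) (use g in \<open>auto simp: disc_hol_def\<close>)
  moreover have "f holomorphic_on ball 0 1"
    by (rule holomorphic_uniform_limit[where f = g and F = sequentially])
      (use g ul in \<open>auto simp: disc_hol_def\<close>)
  ultimately show ?thesis by (simp add: disc_hol_def)
qed

text \<open>By uniform continuity a dilation \<open>f (r * z)\<close> with \<open>r < 1\<close> is
  close to \<open>f\<close>, and its Taylor series converges absolutely on the closed disc.\<close>

lemma disc_hol_polynomial_approx: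
  assumes f: "disc_hol f" and e: "e > 0"
  obtains c :: "nat \<Rightarrow> complex" and N where "\<And>z. z \<in> disc \<Longrightarrow> cmod (f z - (\<Sum>n<N. c n * z ^ n)) < e"
proof -
  have "uniformly_continuous_on disc f"
    using f by (intro compact_uniformly_continuous) (auto simp: disc_hol_def)
  then obtain d where d: "d > 0"
    "\<And>x y. x \<in> disc \<Longrightarrow> y \<in> disc \<Longrightarrow> dist y x < d \<Longrightarrow> dist (f y) (f x) < e/2"
    using e unfolding uniformly_continuous_on_def by (metis half_gt_zero)
  \<comment> \<open>\<open>1 - d/2\<close> puts \<open>r * z\<close> within \<open>d\<close> of
    \<open>z\<close>; the bound \<open>1/2\<close> keeps \<open>r\<close> positive when
    \<open>d\<close> is large.\<close>
  define r where "r = max (1/2) (1 - d/2)"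
  have r: "0 < r" "r < 1" "1 - r < d" using d by (auto simp: r_def)
  define a where "a n = (deriv ^^ n) f 0 / fact n" for n
  have ps: "(\<lambda>n. a n * w ^ n) sums f w" if "w \<in> ball 0 1" for w
    using holomorphic_power_series[of f 0 1 w] f that by (simp add: a_def disc_hol_def)
  \<comment> \<open>A radius between \<open>r\<close> and 1: convergence at \<open>s\<close> gives
    absolute convergence at \<open>r\<close>.\<close>
  define s where "s = (r + 1) / 2"
  have s: "r < s" "s < 1" "s > 0" using r by (auto simp: s_def)
  have "summable (\<lambda>n. a n * complex_of_real s ^ n)" using ps[of "complex_of_real s"] s by (auto simp: sums_iff)
  then have abs: "summable (\<lambda>n. cmod (a n * complex_of_real r ^ n))"
    using s r by (intro powser_insidea[of a "complex_of_real s"]) auto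
  then obtain N where N: "\<And>n. n \<ge> N \<Longrightarrow> norm (\<Sum>i. cmod (a (i + n) * complex_of_real r ^ (i + n))) < e/2"
    using suminf_exist_split[OF half_gt_zero[OF e] abs] by blast
  show ?thesis
  proof (rule that[where N = N and c = "\<lambda>n. a n * complex_of_real r ^ n"])
    fix z :: complex assume z: "z \<in> disc"
    have rz: "cmod (complex_of_real r * z) \<le> r" using z r by (simp add: norm_mult mult_left_le)
    have "dist (complex_of_real r * z) z < d"
    proof -
      have "complex_of_real r * z - z = - (complex_of_real (1 - r) * z)" by (simp add: algebra_simps)
      then have "dist (complex_of_real r * z) z = (1 - r) * cmod z"
        using r by (simp only: dist_norm norm_minus_cancel norm_mult norm_of_real)
      also have "\<dots> \<le> 1 - r" using z r by (simp add: mult_left_le)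
      finally show ?thesis using r by simp
    qed
    then have 1: "cmod (f z - f (complex_of_real r * z)) < e/2"
      using d(2)[of z "complex_of_real r * z"] z rz r by (simp add: dist_norm norm_minus_commute)
    have sm: "(\<lambda>n. a n * complex_of_real r ^ n * z ^ n) sums f (complex_of_real r * z)"
      using ps[of "complex_of_real r * z"] rz r by (simp add: power_mult_distrib mult.assoc)
    have le: "cmod (a n * complex_of_real r ^ n * z ^ n) \<le> cmod (a n * complex_of_real r ^ n)" for n
      using z by (simp add: norm_mult norm_power mult_left_le power_le_one)
    have abs': "summable (\<lambda>n. cmod (a n * complex_of_real r ^ n * z ^ n))"
      by (rule summable_comparison_test[OF _ abs]) (use le in auto)
    have "f (complex_of_real r * z) - (\<Sum>n<N. a n * complex_of_real r ^ n * z ^ n)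
        = (\<Sum>i. a (i + N) * complex_of_real r ^ (i + N) * z ^ (i + N))"
      using suminf_minus_initial_segment[OF sums_summable[OF sm], of N] sums_unique[OF sm] by simp
    also have "cmod \<dots> \<le> (\<Sum>i. cmod (a (i + N) * complex_of_real r ^ (i + N) * z ^ (i + N)))"
      by (rule summable_norm) (use summable_ignore_initial_segment[OF abs'] in auto)
    also have "\<dots> \<le> (\<Sum>i. cmod (a (i + N) * complex_of_real r ^ (i + N)))"
      by (intro suminf_le le summable_ignore_initial_segment[OF abs] summable_ignore_initial_segment[OF abs'])
    also have "\<dots> < e/2" using N[of N] by simp
    finally have 2: "cmod (f (complex_of_real r * z) - (\<Sum>n<N. a n * complex_of_real r ^ n * z ^ n)) < e/2" .
    show "cmod (f z - (\<Sum>n<N. a n * complex_of_real r ^ n * z ^ n)) < e"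
      using norm_triangle_lt[of "f z - f (complex_of_real r * z)" "f (complex_of_real r * z) - (\<Sum>n<N. a n * complex_of_real r ^ n * z ^ n)" e] 1 2
      by simp
  qed
qed

text \<open>The difference quotient has a removable singularity at the interior point
  \<open>a\<close> and is continuous elsewhere up to the boundary. Its value at \<open>a\<close>
  later produces the multiplier \<open>deriv \<eta>\<^sub>1 z1\<close>.\<close>

lemma disc_hol_division:
  assumes f: "disc_hol f" and a: "a \<in> ball 0 1" "f a = 0"
  obtains k where "disc_hol k" "\<And>z. z \<in> disc \<Longrightarrow> f z = (z - a) * k z" "k a = deriv f a"
proof -
  define k where "k z = (if z = a then deriv f a else (f z - f a) / (z - a))" for z
  have hol: "k holomorphic_on ball 0 1"
    using pole_lemma_open[of f "ball 0 1" a] f unfolding k_def disc_hol_def by simp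
  have ck: "continuous_on (disc - {a}) k"
  proof -
    have "continuous_on (disc - {a}) (\<lambda>z. (f z - f a) / (z - a))"
      using f by (auto simp: disc_hol_def intro!: continuous_intros intro: continuous_on_subset)
    then show ?thesis by (rule continuous_on_cong[THEN iffD1, rotated 2]) (auto simp: k_def)
  qed
  have c1: "continuous (at x within disc) k" if "x \<in> disc" "x \<noteq> a" for x
  proof -
    have "continuous (at x within (disc - {a})) k"
      using ck that by (simp add: continuous_on_eq_continuous_within)
    moreover have "at x within (disc - {a}) = at x within disc"
      using that by (intro at_within_nhd[of _ "- {a}"]) auto
    ultimately show ?thesis by simp
  qed
  have c2: "continuous (at a within disc) k"
    using holomorphic_on_imp_continuous_on[OF hol] a(1)
    by (metis continuous_at_imp_continuous_within continuous_on_eq_continuous_at open_ball)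
  have "continuous_on disc k" using c1 c2 unfolding continuous_on_eq_continuous_within by blast
  then show ?thesis
    using hol a by (intro that[of k]) (auto simp: disc_hol_def k_def)
qed

text \<open>The disc without the boundary point \<open>p\<close> is star-shaped about 0, so the
  nonvanishing \<open>f\<close> has a continuous root there. This serves to exclude a zero of
  \<open>beta\<close> on the circle; at a simple zero in the interior no such root exists.\<close>

lemma disc_hol_sqrt:
  assumes f: "disc_hol f" and p: "cmod p = 1" "f p = 0" and nz: "\<And>z. z \<in> disc \<Longrightarrow> z \<noteq> p \<Longrightarrow> f z \<noteq> 0"
  obtains s where "disc_hol s" "\<And>z. z \<in> disc \<Longrightarrow> f z = s z * s z" "s p = 0"
proof -
  have "starlike (disc - {p})"
    unfolding starlike_def
  proof (intro bexI[of _ 0] ballI)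
    fix x assume x: "x \<in> disc - {p}"
    show "closed_segment 0 x \<subseteq> disc - {p}"
    proof
      fix y assume "y \<in> closed_segment 0 x"
      then obtain u where u: "0 \<le> u" "u \<le> 1" "y = u *\<^sub>R x" by (auto simp: closed_segment_def)
      have ny: "cmod y = u * cmod x" using u by simp
      \<comment> \<open>On a segment starting at 0, modulus one can be reached only at the other
        endpoint.\<close>
      have "y \<noteq> p"
      proof
        assume "y = p"
        then have "u * cmod x = 1" using ny p by simp
        moreover have "u * cmod x \<le> u * 1" using u x by (intro mult_left_mono) auto
          ultimately have "u = 1" using u by simp
        then show False using u x \<open>y = p\<close> by simp
      qed
      moreover have "cmod y \<le> 1" using ny u x by (simp add: mult_le_one)
      ultimately show "y \<in> disc - {p}" by simp
    qed
  qed (use p in auto)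
  then have "contractible (disc - {p})" by (rule starlike_imp_contractible)
  moreover have "continuous_on (disc - {p}) f" using f by (auto simp: disc_hol_def intro: continuous_on_subset)
  ultimately obtain g where g: "continuous_on (disc - {p}) g" "\<And>x. x \<in> disc - {p} \<Longrightarrow> f x = (g x)\<^sup>2"
    using continuous_sqrt_on_contractible[of "disc - {p}" f] nz by auto
  define s where "s z = (if z = p then 0 else g z)" for z
  have sq: "f z = s z * s z" if "z \<in> disc" for z
    using g(2)[of z] that p by (auto simp: s_def power2_eq_square)
  have cs: "continuous_on (disc - {p}) s"
    using g(1) by (rule continuous_on_cong[THEN iffD1, rotated 2]) (auto simp: s_def)
  have c1: "continuous (at x within disc) s" if "x \<in> disc" "x \<noteq> p" for x
  proof -
    have "continuous (at x within (disc - {p})) s" using cs that by (simp add: continuous_on_eq_continuous_within)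
    moreover have "at x within (disc - {p}) = at x within disc"
      using that by (intro at_within_nhd[of _ "- {p}"]) auto
    ultimately show ?thesis by simp
  qed
  have c2: "continuous (at p within disc) s"
  proof -
    have "(f \<longlongrightarrow> 0) (at p within disc)"
      using f p unfolding disc_hol_def continuous_on_def by (metis mem_cball_0 order_refl)
    \<comment> \<open>Near \<open>p\<close> nothing is known about the chosen branch of the root,
      but its modulus is \<open>sqrt (cmod (f z))\<close>, which tends to 0.\<close>
    then have "((\<lambda>z. sqrt (cmod (f z))) \<longlongrightarrow> sqrt (cmod 0)) (at p within disc)"
      by (intro tendsto_intros)
    moreover have "\<forall>\<^sub>F z in at p within disc. sqrt (cmod (f z)) = cmod (s z)"
      unfolding eventually_at_filter by (intro always_eventually) (auto simp: sq norm_mult)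
    ultimately have "((\<lambda>z. cmod (s z)) \<longlongrightarrow> 0) (at p within disc)"
      by (simp add: tendsto_cong)
    then have "(s \<longlongrightarrow> 0) (at p within disc)" by (rule tendsto_norm_zero_cancel)
    then show ?thesis by (simp add: continuous_within s_def)
  qed
  have cont: "continuous_on disc s" using c1 c2 unfolding continuous_on_eq_continuous_within by blast
  have "s holomorphic_on ball 0 1"
  proof (rule holomorphic_on_open[THEN iffD2, OF open_ball], intro ballI)
    fix z0 :: complex assume z0: "z0 \<in> ball 0 1"
    then have z0d: "z0 \<in> disc" "z0 \<noteq> p" using p by auto
    have s0: "s z0 \<noteq> 0" using nz[OF z0d] sq[OF z0d(1)] by auto
    have fd: "(f has_field_derivative deriv f z0) (at z0)"
      using f z0 holomorphic_derivI[of f "ball 0 1" z0] by (auto simp: disc_hol_def)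
    have sc: "isCont s z0"
      using cont z0 by (meson ball_subset_cball continuous_on_eq_continuous_at continuous_on_subset open_ball)
    then have "((\<lambda>z. s z + s z0) \<longlongrightarrow> s z0 + s z0) (at z0)" by (intro tendsto_intros) (simp add: isCont_def)
    \<comment> \<open>The difference quotient of the continuous root is that of \<open>f\<close>
      divided by \<open>s z + s z0\<close>, whose limit \<open>2 * s z0\<close> is not 0.\<close>
    then have lim: "((\<lambda>z. ((f z - f z0) / (z - z0)) / (s z + s z0)) \<longlongrightarrow> deriv f z0 / (s z0 + s z0)) (at z0)"
      using fd s0 by (intro tendsto_divide) (auto simp: has_field_derivative_iff mult_2[symmetric])
    have "\<forall>\<^sub>F z in at z0. z \<in> ball 0 1" using z0 by (intro eventually_at_in_open') auto
    moreover have "\<forall>\<^sub>F z in at z0. s z + s z0 \<noteq> 0"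
      using tendsto_imp_eventually_ne[OF \<open>((\<lambda>z. s z + s z0) \<longlongrightarrow> s z0 + s z0) (at z0)\<close>, of 0] s0
      by (simp add: mult_2[symmetric])
    ultimately have "\<forall>\<^sub>F z in at z0. ((f z - f z0) / (z - z0)) / (s z + s z0) = (s z - s z0) / (z - z0)"
    proof eventually_elim
      case (elim z)
      then have "f z - f z0 = (s z - s z0) * (s z + s z0)"
        using sq[of z] sq[of z0] z0 by (simp add: algebra_simps)
      then show ?case using elim by simp
    qed
    then have "((\<lambda>z. (s z - s z0) / (z - z0)) \<longlongrightarrow> deriv f z0 / (s z0 + s z0)) (at z0)"
      by (rule Lim_transform_eventually[OF lim])
    then show "\<exists>f'. (s has_field_derivative f') (at z0)" by (auto simp: has_field_derivative_iff)
  qed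
  then show ?thesis using that[of s] cont sq by (auto simp: disc_hol_def s_def)
qed


lemma disc_hol_image_open:
  assumes f: "disc_hol f" and nc: "\<not> f constant_on ball 0 1"
  shows "open (f ` ball 0 1)"
  using f nc by (intro open_mapping_thm[of f "ball 0 1" "ball 0 1"]) (auto simp: disc_hol_def)

lemma inj_not_constant:
  assumes "inj_on f (disc :: complex set)"
  shows "\<not> f constant_on ball 0 1"
proof
  assume "f constant_on ball 0 1"
  then have "f 0 = f (1/2)" unfolding constant_on_def
    by (metis centre_in_ball mem_ball_0 norm_divide norm_numeral norm_one one_less_numeral_iff semiring_norm(76) zero_less_one half_gt_zero divide_less_eq_1_pos zero_less_numeral)
  then show False using inj_onD[OF assms, of 0 "1/2"] by (simp add: norm_divide)
qed

subsection \<open>Schwarz lemma at an interior fixed point\<close>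

text \<open>With rotation angle 0 this is the disc automorphism
  \<open>z \<mapsto> (z - a) / (1 - cnj a * z)\<close>, which takes \<open>a\<close> to 0 and has
  the inverse \<open>moeb (- a)\<close>.\<close>

abbreviation moeb :: "complex \<Rightarrow> complex \<Rightarrow> complex" where
  "moeb \<equiv> Moebius_function 0"

lemma moeb_denominator: "cmod a < 1 \<Longrightarrow> cmod z \<le> 1 \<Longrightarrow> 1 - cnj a * z \<noteq> 0"
proof
  assume a: "cmod a < 1" "cmod z \<le> 1" "1 - cnj a * z = 0"
  then have "cmod (cnj a * z) = 1" by simp
  moreover have "cmod (cnj a * z) \<le> cmod a * 1" unfolding norm_mult complex_mod_cnj
    using a by (intro mult_left_mono) auto
  ultimately show False using a by simp
qed

lemma moeb_disc_hol:
  assumes "cmod a < 1"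
  shows "disc_hol (moeb a)"
proof -
  have "continuous_on disc (\<lambda>z. (z - a) / (1 - cnj a * z))"
    using moeb_denominator[OF assms] by (intro continuous_intros) auto
  then show ?thesis using Moebius_function_holomorphic[OF assms, of 0]
    by (simp add: disc_hol_def Moebius_function_simple[abs_def])
qed

lemma moeb_disc_map:
  assumes a: "cmod a < 1"
  shows "disc_map (moeb a)"
proof -
  have "moeb a ` closure (ball 0 1) \<subseteq> disc"
    using moeb_disc_hol[OF a] Moebius_function_norm_lt_1[OF a, of _ 0]
    by (intro image_closure_subset) (force simp: disc_hol_def)+
  then show ?thesis using moeb_disc_hol[OF a] by (simp add: disc_map_def disc_hol_def)
qed

lemma moeb_inverse:
  assumes a: "cmod a < 1" and z: "z \<in> disc"
  shows "moeb (-a) (moeb a z) = z"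
proof (rule eq_on_disc[of "\<lambda>z. moeb (-a) (moeb a z)" "\<lambda>z. z", OF _ _ _ z])
  show "continuous_on disc (\<lambda>z. moeb (-a) (moeb a z))"
    using disc_hol_comp[OF moeb_disc_hol moeb_disc_map] a by (simp add: disc_hol_def)
  show "moeb (-a) (moeb a w) = w" if "w \<in> ball 0 1" for w
    using Moebius_function_compose[of "-a" a w] a that by simp
qed auto

lemma moeb_zero [simp]: "moeb a a = 0" by (rule Moebius_function_eq_zero)

lemma moeb_homeo: "cmod a < 1 \<Longrightarrow> homeomorphism disc disc (moeb a) (moeb (-a))"
proof (rule homeomorphismI)
  assume a: "cmod a < 1"
  then have na: "cmod (-a) < 1" by simp
  show "continuous_on disc (moeb a)" "continuous_on disc (moeb (-a))"
    "moeb a ` disc \<subseteq> disc" "moeb (-a) ` disc \<subseteq> disc"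
    using moeb_disc_map[OF a] moeb_disc_map[OF na] by (auto simp only: disc_map_def)
  show "moeb (-a) (moeb a z) = z" if "z \<in> disc" for z using moeb_inverse[OF a that] .
  show "moeb a (moeb (-a) z) = z" if "z \<in> disc" for z using moeb_inverse[OF na that] by simp
qed

text \<open>Conjugation by \<open>moeb a\<close> moves the fixed point to 0 without changing the
  derivative there; then the Schwarz lemma and its equality case apply.\<close>

lemma schwarz_fixed_point:
  assumes f: "f holomorphic_on ball 0 1" "f ` ball 0 1 \<subseteq> ball 0 1" and a: "cmod a < 1" "f a = a"
  shows "cmod (deriv f a) \<le> 1"
    "cmod (deriv f a) = 1 \<Longrightarrow> z \<in> ball 0 1 \<Longrightarrow> moeb a (f z) = deriv f a * moeb a z"
proof -
  let ?g = "moeb (-a)"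
  define F where "F = moeb a \<circ> f \<circ> ?g"
  have mh: "moeb b holomorphic_on ball 0 1" "moeb b ` ball 0 1 \<subseteq> ball 0 1" if "cmod b < 1" for b
    using Moebius_function_holomorphic[OF that] Moebius_function_norm_lt_1[OF that, of _ 0] by force+
  have na: "cmod (-a) < 1" using a by simp
  have g0: "?g 0 = a" by (simp add: Moebius_function_simple)
  have Fh: "F holomorphic_on ball 0 1"
    unfolding F_def using mh[OF a(1)] mh[OF na] f
    by (intro holomorphic_on_compose_gen[of _ _ _ "ball 0 1"] holomorphic_on_compose_gen[of _ _ f "ball 0 1"]) auto
  have F0: "F 0 = 0" by (simp add: F_def g0 a)
  have Fn: "cmod (F z) < 1" if "cmod z < 1" for z
    using mh(2)[OF a(1)] mh(2)[OF na] f that unfolding F_def o_def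
    by (metis (no_types, lifting) image_subset_iff mem_ball_0)
  have d: "(h has_field_derivative deriv h z) (at z)" if "h holomorphic_on ball 0 1" "cmod z < 1" for h z
    using holomorphic_derivI[OF that(1) open_ball, of z] that by auto
  have dF: "(F has_field_derivative deriv (moeb a) a * deriv f a * deriv ?g 0) (at 0)"
  proof -
    have "(f \<circ> ?g has_field_derivative deriv f a * deriv ?g 0) (at 0)"
      using DERIV_chain[of f "deriv f a" ?g 0 "deriv ?g 0" UNIV] d[OF f(1) a(1)] d[OF mh(1)[OF na], of 0] g0 by simp
    moreover have "(moeb a has_field_derivative deriv (moeb a) a) (at ((f \<circ> ?g) 0))"
      using d[OF mh(1)[OF a(1)] a(1)] g0 a by simp
    ultimately have "(moeb a \<circ> (f \<circ> ?g) has_field_derivative deriv (moeb a) a * (deriv f a * deriv ?g 0)) (at 0)"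
      by (rule DERIV_chain[rotated])
    then show ?thesis by (simp add: F_def o_assoc mult.assoc)
  qed
  \<comment> \<open>Chain rule for \<open>moeb a \<circ> moeb (- a)\<close>, which is the identity
    near 0.\<close>
  have d1: "deriv (moeb a) a * deriv ?g 0 = 1"
  proof -
    have "(moeb a has_field_derivative deriv (moeb a) a) (at (?g 0))"
      using d[OF mh(1)[OF a(1)] a(1)] g0 by simp
    then have "(moeb a \<circ> ?g has_field_derivative deriv (moeb a) a * deriv ?g 0) (at 0)"
      using d[OF mh(1)[OF na], of 0] by (intro DERIV_chain) auto
    moreover have "((\<lambda>z. z) has_field_derivative 1) (at (0::complex))" by (rule DERIV_ident)
    moreover have "\<forall>\<^sub>F z in nhds 0. (moeb a \<circ> ?g) z = z"
    proof -
      have "\<forall>\<^sub>F z in nhds 0. z \<in> ball (0::complex) 1" by (intro eventually_nhds_in_open) auto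
      then show ?thesis
        by eventually_elim (use moeb_inverse[OF na] in auto)
    qed
    ultimately show ?thesis using DERIV_cong_ev[of 0 0 "moeb a \<circ> ?g" "\<lambda>z. z"] DERIV_unique by metis
  qed
  have dF': "deriv F 0 = deriv f a"
    using DERIV_imp_deriv[OF dF] d1 by (simp add: mult.assoc mult.left_commute)
  show "cmod (deriv f a) \<le> 1"
    using Schwarz_Lemma(2)[OF Fh F0 Fn, of 0] dF' by simp
  show "moeb a (f z) = deriv f a * moeb a z" if one: "cmod (deriv f a) = 1" and z: "z \<in> ball 0 1"
  proof -
    obtain \<alpha> where al: "\<And>z. cmod z < 1 \<Longrightarrow> F z = \<alpha> * z"
      using Schwarz_Lemma(3)[OF Fh F0 Fn, of 0] dF' one by auto
    have "\<forall>\<^sub>F z in nhds 0. F z = \<alpha> * z"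
    proof -
      have "\<forall>\<^sub>F z in nhds 0. z \<in> ball (0::complex) 1" by (intro eventually_nhds_in_open) auto
      then show ?thesis by eventually_elim (use al in auto)
    qed
    then have "deriv F 0 = deriv (\<lambda>z. \<alpha> * z) 0" by (rule deriv_cong_ev) simp
    then have "\<alpha> = deriv f a" using dF' by simp
    moreover have mz: "moeb a z \<in> ball 0 1" using mh(2)[OF a(1)] z by blast
    then have "F (moeb a z) = \<alpha> * moeb a z" using al by simp
    moreover have "?g (moeb a z) = z" using moeb_inverse[OF a(1), of z] z by auto
    ultimately show ?thesis by (simp add: F_def)
  qed
qed

text \<open>Otherwise \<open>\<eta>\<close> would be a constant of modulus one and could not fix
  \<open>a\<close>.\<close>

lemma disc_map_interior:
  assumes h: "disc_map \<eta>" and a: "cmod a < 1" "\<eta> a = a"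
  shows "\<eta> ` ball 0 1 \<subseteq> ball 0 1"
proof
  fix w assume "w \<in> \<eta> ` ball 0 1"
  then obtain z where z: "z \<in> ball 0 1" "w = \<eta> z" by blast
  have "cmod (\<eta> z) \<noteq> 1"
    using disc_map_boundary_constant[OF h z(1), of a] a by auto
  moreover have "\<eta> z \<in> disc" using disc_map_in[OF h] z by auto
  ultimately show "w \<in> ball 0 1" using z by simp
qed

text \<open>The equality case of the Schwarz lemma, extended to the circle by continuity.\<close>

lemma disc_map_rotation:
  assumes h: "disc_map \<eta>" and a: "cmod a < 1" "\<eta> a = a"
    and one: "cmod (deriv \<eta> a) = 1" and z: "z \<in> disc"
  shows "moeb a (\<eta> z) = deriv \<eta> a * moeb a z"
proof (rule eq_on_disc[of "\<lambda>z. moeb a (\<eta> z)" "\<lambda>z. deriv \<eta> a * moeb a z", OF _ _ _ z])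
  show "continuous_on disc (\<lambda>z. moeb a (\<eta> z))"
    using disc_hol_comp[OF moeb_disc_hol[OF a(1)] h] by (simp add: disc_hol_def)
  show "continuous_on disc (\<lambda>z. deriv \<eta> a * moeb a z)"
    using moeb_disc_hol[OF a(1)] by (auto simp: disc_hol_def intro: continuous_intros)
  show "moeb a (\<eta> w) = deriv \<eta> a * moeb a w" if "w \<in> ball 0 1" for w
    using schwarz_fixed_point(2)[of \<eta> a w] h disc_map_interior[OF h a] a one that
    by (simp add: disc_map_def)
qed

text \<open>Invariance of domain makes the image of the open ball open, hence part of the interior
  of \<open>disc\<close>; the same argument for the inverse gives equality.\<close>

lemma disc_homeo_ball:
  assumes h: "homeomorphism disc disc f g"
  shows "f ` ball 0 1 = ball (0::complex) 1"
proof -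
  have sub: "f ` ball 0 1 \<subseteq> ball 0 1" if "homeomorphism disc disc f g" for f g :: "complex \<Rightarrow> complex"
  proof -
    have "inj_on f disc" using that by (metis homeomorphism_def inj_on_inverseI)
    then have "inj_on f (ball 0 1)" by (rule inj_on_subset) auto
    moreover have "continuous_on (ball 0 1) f"
      using that by (auto simp: homeomorphism_def intro: continuous_on_subset)
    ultimately have "open (f ` ball 0 1)" using invariance_of_domain[of "ball 0 1" f] by auto
    moreover have "f ` ball 0 1 \<subseteq> disc" using that by (force simp: homeomorphism_def)
    ultimately have "f ` ball 0 1 \<subseteq> interior disc" by (rule interior_maximal[rotated])
    then show ?thesis by (simp add: interior_cball)
  qed
  have "g ` ball 0 1 \<subseteq> ball 0 1" using sub[OF homeomorphism_symD[OF h]] .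
  moreover have "f (g z) = z" if "z \<in> ball 0 1" for z using h that by (auto simp: homeomorphism_def)
  ultimately have "ball 0 1 \<subseteq> f ` ball 0 1" by (metis image_eqI image_subset_iff subsetI)
  then show ?thesis using sub[OF h] by auto
qed

text \<open>An injective analytic function has an analytic inverse on its image, and by
  \<open>disc_homeo_ball\<close> this image is the whole open ball.\<close>

lemma disc_homeo_inverse_hol:
  assumes h: "homeomorphism disc disc f g" and f: "f holomorphic_on ball 0 1"
  shows "g holomorphic_on ball 0 1" "\<And>z. z \<in> ball 0 1 \<Longrightarrow> deriv f z * deriv g (f z) = 1"
proof -
  have "inj_on f disc" using h by (metis homeomorphism_def inj_on_inverseI)
  then have "inj_on f (ball 0 1)" by (rule inj_on_subset) auto
  then obtain g' where g': "g' holomorphic_on (f ` ball 0 1)"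
    "\<And>z. z \<in> ball 0 1 \<Longrightarrow> deriv f z * deriv g' (f z) = 1" "\<And>z. z \<in> ball 0 1 \<Longrightarrow> g' (f z) = z"
    using holomorphic_has_inverse[OF f open_ball] by metis
  have eq: "g' w = g w" if "w \<in> ball 0 1" for w
  proof -
    have "w \<in> f ` ball 0 1" using that by (simp only: disc_homeo_ball[OF h])
    then obtain z where z: "z \<in> ball 0 1" "w = f z" by blast
    have "g (f z) = z" using h z(1) by (simp add: homeomorphism_def)
    then show ?thesis using g'(3)[OF z(1)] z(2) by simp
  qed
  show "g holomorphic_on ball 0 1"
    using g'(1) eq unfolding disc_homeo_ball[OF h] by (metis holomorphic_transform)
  fix z :: complex assume z: "z \<in> ball 0 1"
  have "f z \<in> f ` ball 0 1" using z by blast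
  then have "f z \<in> ball 0 1" by (simp only: disc_homeo_ball[OF h])
  then have "\<forall>\<^sub>F w in nhds (f z). w \<in> ball 0 1" by (intro eventually_nhds_in_open) auto
  then have "\<forall>\<^sub>F w in nhds (f z). g' w = g w" by eventually_elim (rule eq)
  then have "deriv g' (f z) = deriv g (f z)" by (rule deriv_cong_ev) simp
  then show "deriv f z * deriv g (f z) = 1" using g'(2)[OF z] by simp
qed

text \<open>The Schwarz bound holds for the map and for its inverse, and their derivatives at the
  fixed point multiply to 1.\<close>

lemma disc_homeo_fixed_point_deriv:
  assumes h: "homeomorphism disc disc f g" and f: "f holomorphic_on ball 0 1" and a: "cmod a < 1" "f a = a"
  shows "cmod (deriv f a) = 1"
proof -
  have ga: "g a = a" using h a by (metis homeomorphism_def mem_cball_0 less_imp_le)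
  have "cmod (deriv f a) \<le> 1"
    using schwarz_fixed_point(1)[OF f _ a] disc_homeo_ball[OF h] by simp
  moreover have "cmod (deriv g a) \<le> 1"
    using schwarz_fixed_point(1)[OF disc_homeo_inverse_hol(1)[OF h f] _ a(1) ga]
      disc_homeo_ball[OF homeomorphism_symD[OF h]] by simp
  moreover have "cmod (deriv f a) * cmod (deriv g a) = 1"
    using disc_homeo_inverse_hol(2)[OF h f, of a] a by (simp add: norm_mult[symmetric])
  ultimately show ?thesis
    by (metis mult_left_le norm_ge_zero order_antisym mult.commute)
qed

section \<open>Isomorphisms between the disc subalgebras\<close>

locale disc_conjugacy = topological_conjugacy_algebra disc_space \<eta> A \<iota> E\<^sub>0
  for \<eta> :: "complex \<Rightarrow> complex" and A :: "('a, 'm) normed_alg_scheme" (structure)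
    and \<iota> :: "(nat \<Rightarrow> complex \<Rightarrow> complex) \<Rightarrow> 'a" and E\<^sub>0 :: "'a \<Rightarrow> complex \<Rightarrow> complex" +
  assumes eta_disc_map: "disc_map \<eta>"

sublocale disc_conjugacy \<subseteq> conjugacy_subalgebra disc_space \<eta> A \<iota> E\<^sub>0 disc_algebra
proof
  show "disc_algebra \<subseteq> carrier (cont_alg disc_space)" by (auto simp: disc_algebra_def)
  show "\<one>\<^bsub>cont_alg disc_space\<^esub> \<in> disc_algebra"
    using restrict_disc_algebra[of "\<lambda>_. 1"] by (simp add: cont_alg_def disc_hol_def)
  show "f \<oplus>\<^bsub>cont_alg disc_space\<^esub> g \<in> disc_algebra" "f \<otimes>\<^bsub>cont_alg disc_space\<^esub> g \<in> disc_algebra"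
    if "f \<in> disc_algebra" "g \<in> disc_algebra" for f g
    using that restrict_disc_algebra[OF disc_hol_ops(1)[of f g]] restrict_disc_algebra[OF disc_hol_ops(2)[of f g]]
    by (simp_all add: cont_alg_def disc_algebra_iff)
  show "c \<odot>\<^bsub>cont_alg disc_space\<^esub> f \<in> disc_algebra" if "f \<in> disc_algebra" for c f
    using that restrict_disc_algebra[OF disc_hol_ops(2)[of "\<lambda>_. c" f]]
    by (simp add: cont_alg_def disc_algebra_iff disc_hol_ops(4)[of f f])
  show "restrict (f \<circ> \<eta>) (topspace disc_space) \<in> disc_algebra" if "f \<in> disc_algebra" for f
    using that restrict_disc_algebra[OF disc_hol_comp[OF _ eta_disc_map], of f]
    by (simp add: disc_algebra_iff o_def)
  show "f \<in> disc_algebra" if "f \<in> carrier (cont_alg disc_space)"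
      "\<And>e. e > 0 \<Longrightarrow> \<exists>g\<in>disc_algebra. \<forall>x\<in>topspace disc_space. cmod (f x - g x) < e" for f
  proof -
    have "disc_hol f"
    proof (rule disc_hol_uniform_limit)
      fix e :: real assume "e > 0"
      from that(2)[OF this] show "\<exists>g. disc_hol g \<and> (\<forall>z\<in>disc. cmod (f z - g z) < e)"
        by (auto simp: disc_algebra_iff)
    qed
    then show ?thesis using that(1) by (simp add: disc_algebra_iff carrier_disc)
  qed
qed

abbreviation idd :: "complex \<Rightarrow> complex" where "idd \<equiv> \<lambda>z\<in>disc. z"

lemma idd_disc_algebra [simp]: "idd \<in> disc_algebra"
  by (intro restrict_disc_algebra disc_hol_ops(5)[of id id]) (auto simp: disc_hol_def)

lemma disc_algebraD: "f \<in> disc_algebra \<Longrightarrow> disc_hol f" "f \<in> disc_algebra \<Longrightarrow> f \<in> extensional disc"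
  by (auto simp: disc_algebra_iff)

section \<open>Evaluation characters pulled back along an isomorphism\<close>

locale disc_iso =
  X: disc_conjugacy \<eta>\<^sub>1 A\<^sub>1 \<iota>\<^sub>1 E\<^sub>1 + Y: disc_conjugacy \<eta>\<^sub>2 A\<^sub>2 \<iota>\<^sub>2 E\<^sub>2
  for \<eta>\<^sub>1 :: "complex \<Rightarrow> complex" and A\<^sub>1 :: "('a, 'm) normed_alg_scheme" and \<iota>\<^sub>1 E\<^sub>1
    and \<eta>\<^sub>2 :: "complex \<Rightarrow> complex" and A\<^sub>2 :: "('b, 'n) normed_alg_scheme" and \<iota>\<^sub>2 E\<^sub>2 +
  fixes h :: "'a \<Rightarrow> 'b"
  assumes h_bij: "bij_betw h X.B Y.B"
    and h_add: "a \<in> X.B \<Longrightarrow> b \<in> X.B \<Longrightarrow> h (a \<oplus>\<^bsub>A\<^sub>1\<^esub> b) = h a \<oplus>\<^bsub>A\<^sub>2\<^esub> h b"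
    and h_mult: "a \<in> X.B \<Longrightarrow> b \<in> X.B \<Longrightarrow> h (a \<otimes>\<^bsub>A\<^sub>1\<^esub> b) = h a \<otimes>\<^bsub>A\<^sub>2\<^esub> h b"
    and h_smult: "a \<in> X.B \<Longrightarrow> h (c \<odot>\<^bsub>A\<^sub>1\<^esub> a) = c \<odot>\<^bsub>A\<^sub>2\<^esub> h a"
    and h_one: "h \<one>\<^bsub>A\<^sub>1\<^esub> = \<one>\<^bsub>A\<^sub>2\<^esub>"
begin

definition inv_h :: "'b \<Rightarrow> 'a" where "inv_h = inv_into X.B h"

lemma h_B [simp]: "a \<in> X.B \<Longrightarrow> h a \<in> Y.B"
  using h_bij by (auto simp: bij_betw_def)

lemma inv_h_B [simp]: "b \<in> Y.B \<Longrightarrow> inv_h b \<in> X.B"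
  unfolding inv_h_def using h_bij by (metis bij_betw_def inv_into_into)

lemma h_inv_h [simp]: "b \<in> Y.B \<Longrightarrow> h (inv_h b) = b"
  unfolding inv_h_def using h_bij by (metis bij_betw_def f_inv_into_f)

lemma inv_h_h [simp]: "a \<in> X.B \<Longrightarrow> inv_h (h a) = a"
  unfolding inv_h_def using h_bij by (metis bij_betw_def inv_into_f_f)

lemma h_inj: "a \<in> X.B \<Longrightarrow> b \<in> X.B \<Longrightarrow> h a = h b \<Longrightarrow> a = b"
  by (metis inv_h_h)

text \<open>Makes everything proved for \<open>h\<close> available with the two systems exchanged;
  later proofs interpret this as \<open>R\<close>.\<close>

lemma swap: "disc_iso \<eta>\<^sub>2 A\<^sub>2 \<iota>\<^sub>2 E\<^sub>2 \<eta>\<^sub>1 A\<^sub>1 \<iota>\<^sub>1 E\<^sub>1 inv_h"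
proof
  show "bij_betw inv_h Y.B X.B" unfolding inv_h_def by (rule bij_betw_inv_into[OF h_bij])
  show "inv_h (a \<oplus>\<^bsub>A\<^sub>2\<^esub> b) = inv_h a \<oplus>\<^bsub>A\<^sub>1\<^esub> inv_h b" if "a \<in> Y.B" "b \<in> Y.B" for a b
    using that by (intro h_inj) (simp_all add: X.B_add Y.B_add h_add)
  show "inv_h (a \<otimes>\<^bsub>A\<^sub>2\<^esub> b) = inv_h a \<otimes>\<^bsub>A\<^sub>1\<^esub> inv_h b" if "a \<in> Y.B" "b \<in> Y.B" for a b
    using that by (intro h_inj) (simp_all add: X.B_mult Y.B_mult h_mult)
  show "inv_h (c \<odot>\<^bsub>A\<^sub>2\<^esub> a) = c \<odot>\<^bsub>A\<^sub>1\<^esub> inv_h a" if "a \<in> Y.B" for c a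
    using that by (intro h_inj) (simp_all add: X.B_smult Y.B_smult h_smult)
  show "inv_h \<one>\<^bsub>A\<^sub>2\<^esub> = \<one>\<^bsub>A\<^sub>1\<^esub>" using inv_h_h[OF X.B_one] h_one by simp
qed

definition alpha :: "complex \<Rightarrow> complex" where "alpha = E\<^sub>2 (h (X.emb idd))"
definition beta :: "complex \<Rightarrow> complex" where "beta = E\<^sub>2 (h X.U)"

lemma hA [simp]: "a \<in> X.B \<Longrightarrow> h a \<in> carrier A\<^sub>2" using Y.B_carrier by simp

lemma embB [simp]: "f \<in> disc_algebra \<Longrightarrow> X.emb f \<in> X.B" by (rule X.emb_B)
lemma UB [simp]: "X.U \<in> X.B" by (rule X.U_B)
lemma embBY [simp]: "f \<in> disc_algebra \<Longrightarrow> Y.emb f \<in> Y.B" by (rule Y.emb_B)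
lemma UBY [simp]: "Y.U \<in> Y.B" by (rule Y.U_B)

lemma alpha_hol: "disc_hol alpha" and beta_hol: "disc_hol beta"
  unfolding alpha_def beta_def by (intro disc_algebraD Y.E0_S h_B embB UB idd_disc_algebra)+

lemma ev_hol: "a \<in> X.B \<Longrightarrow> disc_hol (E\<^sub>2 (h a))"
  by (intro disc_algebraD Y.E0_S h_B)

lemma ev_add: "a \<in> X.B \<Longrightarrow> b \<in> X.B \<Longrightarrow> x \<in> disc \<Longrightarrow> E\<^sub>2 (h (a \<oplus>\<^bsub>A\<^sub>1\<^esub> b)) x = E\<^sub>2 (h a) x + E\<^sub>2 (h b) x"
  by (simp add: h_add Y.E0_add_at)

lemma ev_mult: "a \<in> X.B \<Longrightarrow> b \<in> X.B \<Longrightarrow> x \<in> disc \<Longrightarrow> E\<^sub>2 (h (a \<otimes>\<^bsub>A\<^sub>1\<^esub> b)) x = E\<^sub>2 (h a) x * E\<^sub>2 (h b) x"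
  by (simp add: h_mult Y.E0_mult_at)

lemma ev_smult: "a \<in> X.B \<Longrightarrow> x \<in> disc \<Longrightarrow> E\<^sub>2 (h (c \<odot>\<^bsub>A\<^sub>1\<^esub> a)) x = c * E\<^sub>2 (h a) x"
  by (simp add: h_smult Y.E0_smult_at)

text \<open>Automatic continuity replaces continuity of \<open>h\<close>: the pulled back evaluation
  is a character of the closed subalgebra \<open>X.B\<close>.\<close>

lemma ev_bound: "a \<in> X.B \<Longrightarrow> x \<in> disc \<Longrightarrow> cmod (E\<^sub>2 (h a) x) \<le> nrm A\<^sub>1 a"
  by (rule X.character_contractive[OF X.B_subalgebra X.B_closed]) (simp_all add: ev_add ev_mult ev_smult)

lemma ev_const: "x \<in> disc \<Longrightarrow> E\<^sub>2 (h (X.emb (\<lambda>z\<in>disc. c))) x = c"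
proof -
  assume x: "x \<in> disc"
  have "(\<lambda>z\<in>disc. c) = c \<odot>\<^bsub>cont_alg disc_space\<^esub> \<one>\<^bsub>cont_alg disc_space\<^esub>" by (auto simp: cont_alg_def fun_eq_iff)
  then have "X.emb (\<lambda>z\<in>disc. c) = c \<odot>\<^bsub>A\<^sub>1\<^esub> \<one>\<^bsub>A\<^sub>1\<^esub>" using X.emb_smult[OF X.one_CK, of c] X.emb_one by simp
  then show ?thesis using x by (simp add: ev_smult X.B_one h_one Y.E0_one_at)
qed

lemma ev_emb_add: "f \<in> disc_algebra \<Longrightarrow> g \<in> disc_algebra \<Longrightarrow> x \<in> disc \<Longrightarrow>
  E\<^sub>2 (h (X.emb (\<lambda>z\<in>disc. f z + g z))) x = E\<^sub>2 (h (X.emb f)) x + E\<^sub>2 (h (X.emb g)) x"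
  using X.emb_add[of f g] X.S_CK ev_add[of "X.emb f" "X.emb g" x] by (simp add: cont_alg_def)

lemma ev_emb_mult: "f \<in> disc_algebra \<Longrightarrow> g \<in> disc_algebra \<Longrightarrow> x \<in> disc \<Longrightarrow>
  E\<^sub>2 (h (X.emb (\<lambda>z\<in>disc. f z * g z))) x = E\<^sub>2 (h (X.emb f)) x * E\<^sub>2 (h (X.emb g)) x"
  using X.emb_mult[of f g] X.S_CK ev_mult[of "X.emb f" "X.emb g" x] by (simp add: cont_alg_def)

text \<open>\<open>ev_bound\<close> only gives the norm of the algebra, while the supremum norm is
  wanted. A value \<open>?c\<close> of modulus beyond \<open>M\<close> would make
  \<open>f - ?c\<close> invertible in the disc algebra, yet the character kills it.\<close>

lemma ev_emb_bound:
  assumes f: "f \<in> disc_algebra" and x: "x \<in> disc" and M: "\<And>z. z \<in> disc \<Longrightarrow> cmod (f z) \<le> M"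
  shows "cmod (E\<^sub>2 (h (X.emb f)) x) \<le> M"
proof (rule ccontr)
  let ?c = "E\<^sub>2 (h (X.emb f)) x"
  assume "\<not> cmod ?c \<le> M"
  then have nz: "f z + - ?c \<noteq> 0" if "z \<in> disc" for z using M[OF that] by auto
  have dc: "(\<lambda>z\<in>disc. - ?c) \<in> disc_algebra"
    by (rule restrict_disc_algebra) (simp add: disc_hol_def)
  have d1: "(\<lambda>z\<in>disc. f z + - ?c) \<in> disc_algebra"
    by (rule restrict_disc_algebra, rule disc_hol_ops) (use f disc_algebraD in \<open>auto simp: disc_hol_def\<close>)
  have d2: "(\<lambda>z\<in>disc. 1 / (f z + - ?c)) \<in> disc_algebra"
  proof (rule restrict_disc_algebra)
    show "disc_hol (\<lambda>z. 1 / (f z + - ?c))"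
      using disc_algebraD(1)[OF f] nz unfolding disc_hol_def
      by (auto intro!: continuous_intros holomorphic_intros)
  qed
  have "E\<^sub>2 (h (X.emb (\<lambda>z\<in>disc. f z + - ?c))) x = ?c + - ?c"
    using ev_emb_add[OF f dc x] ev_const[OF x] by (simp cong: restrict_cong)
  moreover have "(\<lambda>z\<in>disc. (\<lambda>z\<in>disc. f z + - ?c) z * (\<lambda>z\<in>disc. 1 / (f z + - ?c)) z) = (\<lambda>z\<in>disc. 1)"
    using nz by (auto simp: fun_eq_iff)
  ultimately have "1 = (?c + - ?c) * E\<^sub>2 (h (X.emb (\<lambda>z\<in>disc. 1 / (f z + - ?c)))) x"
    using ev_emb_mult[OF d1 d2 x] ev_const[OF x, of 1] by (simp only:)
  then show False by simp
qed

lemma alpha_in: "x \<in> disc \<Longrightarrow> alpha x \<in> disc"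
  using ev_emb_bound[of idd x 1] by (simp add: alpha_def)

lemma poly_disc_algebra: "(\<lambda>z\<in>disc. \<Sum>n<N. c n * z ^ n) \<in> disc_algebra"
  by (rule restrict_disc_algebra) (auto simp: disc_hol_def intro!: continuous_intros holomorphic_intros)

lemma ev_poly: "x \<in> disc \<Longrightarrow> E\<^sub>2 (h (X.emb (\<lambda>z\<in>disc. \<Sum>n<N. c n * z ^ n))) x = (\<Sum>n<N. c n * alpha x ^ n)"
proof -
  assume x: "x \<in> disc"
  have mono: "(\<lambda>z\<in>disc. z ^ n) \<in> disc_algebra" for n :: nat
    by (rule restrict_disc_algebra) (auto simp: disc_hol_def intro!: continuous_intros holomorphic_intros)
  have pw: "E\<^sub>2 (h (X.emb (\<lambda>z\<in>disc. z ^ n))) x = alpha x ^ n" for n :: nat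
  proof (induction n)
    case 0 show ?case using ev_const[OF x, of 1] by (simp only: power_0)
  next
    case (Suc n)
    have "(\<lambda>z\<in>disc. idd z * (\<lambda>z\<in>disc. z ^ n) z) = (\<lambda>z\<in>disc. z ^ Suc n)" by (auto simp: fun_eq_iff)
    then show ?case
      using ev_emb_mult[OF idd_disc_algebra mono x, of n] Suc by (simp only: alpha_def power_Suc)
  qed
  show ?thesis
  proof (induction N)
    case 0 show ?case using ev_const[OF x, of 0] by (simp only: lessThan_0 sum.empty)
  next
    case (Suc N)
    have "(\<lambda>z\<in>disc. (\<lambda>z\<in>disc. c N) z * (\<lambda>z\<in>disc. z ^ N) z) = (\<lambda>z\<in>disc. c N * z ^ N)"
      by (auto simp: fun_eq_iff)
    moreover have cN: "(\<lambda>z\<in>disc. c N) \<in> disc_algebra" by (rule restrict_disc_algebra) (simp add: disc_hol_def)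
    ultimately have t: "E\<^sub>2 (h (X.emb (\<lambda>z\<in>disc. c N * z ^ N))) x = c N * alpha x ^ N"
      using ev_emb_mult[OF cN mono x, of N] ev_const[OF x, of "c N"] pw[of N] by (simp only:)
    have tm: "(\<lambda>z\<in>disc. c N * z ^ N) \<in> disc_algebra"
      by (rule restrict_disc_algebra) (auto simp: disc_hol_def intro!: continuous_intros holomorphic_intros)
    have "(\<lambda>z\<in>disc. (\<lambda>z\<in>disc. \<Sum>n<N. c n * z ^ n) z + (\<lambda>z\<in>disc. c N * z ^ N) z) = (\<lambda>z\<in>disc. \<Sum>n<Suc N. c n * z ^ n)"
      by (auto simp: fun_eq_iff)
    then show ?case
      using ev_emb_add[OF poly_disc_algebra tm x, of c N] Suc t by (simp only: sum.lessThan_Suc)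
  qed
qed

text \<open>The coordinate function determines the character on polynomials, and
  \<open>ev_emb_bound\<close> carries this to uniform limits: on the disc algebra the character is
  evaluation at a point.\<close>

lemma ev_emb: 
  assumes f: "f \<in> disc_algebra" and x: "x \<in> disc"
  shows "E\<^sub>2 (h (X.emb f)) x = f (alpha x)"
proof -
  have "cmod (E\<^sub>2 (h (X.emb f)) x - f (alpha x)) \<le> 0 + e" if e: "e > 0" for e
  proof -
    obtain c N where cN: "\<And>z. z \<in> disc \<Longrightarrow> cmod (f z - (\<Sum>n<N. c n * z ^ n)) < e/2"
      using disc_hol_polynomial_approx[OF disc_algebraD(1)[OF f], of "e/2"] e by auto
    let ?p = "\<lambda>z\<in>disc. \<Sum>n<N. c n * z ^ n" and ?q = "\<lambda>z\<in>disc. f z - (\<Sum>n<N. c n * z ^ n)"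
    have q: "?q \<in> disc_algebra"
      by (rule restrict_disc_algebra, rule disc_hol_ops(3)[OF disc_algebraD(1)[OF f]])
        (auto simp: disc_hol_def intro!: continuous_intros holomorphic_intros)
    have "f = (\<lambda>z\<in>disc. ?q z + ?p z)"
      using disc_algebraD(2)[OF f] by (auto simp: fun_eq_iff extensional_def)
    then have "E\<^sub>2 (h (X.emb f)) x = E\<^sub>2 (h (X.emb ?q)) x + E\<^sub>2 (h (X.emb ?p)) x"
      using ev_emb_add[OF q poly_disc_algebra x, of c N] by (simp only:)
    then have "E\<^sub>2 (h (X.emb f)) x - f (alpha x) = E\<^sub>2 (h (X.emb ?q)) x - (f (alpha x) - (\<Sum>n<N. c n * alpha x ^ n))"
      using ev_poly[OF x, of c N] by simp
    also have "cmod \<dots> \<le> e/2 + e/2"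
    proof (rule order_trans[OF norm_triangle_ineq4], rule add_mono)
      show "cmod (E\<^sub>2 (h (X.emb ?q)) x) \<le> e/2"
        using ev_emb_bound[OF q x, of "e/2"] cN by (auto intro: less_imp_le)
      show "cmod (f (alpha x) - (\<Sum>n<N. c n * alpha x ^ n)) \<le> e/2"
        using cN[OF alpha_in[OF x]] by simp
    qed
    finally show ?thesis by simp
  qed
  then have "cmod (E\<^sub>2 (h (X.emb f)) x - f (alpha x)) \<le> 0" by (rule field_le_epsilon)
  then show ?thesis by simp
qed

lemma eta_disc_algebra: "restrict \<eta>\<^sub>1 disc \<in> disc_algebra"
  by (rule restrict_disc_algebra[OF disc_map_hol[OF X.eta_disc_map]])

lemma U_emb_comp: "f \<in> disc_algebra \<Longrightarrow>
    X.U \<otimes>\<^bsub>A\<^sub>1\<^esub> X.emb f = X.emb (\<lambda>z\<in>disc. f (\<eta>\<^sub>1 z)) \<otimes>\<^bsub>A\<^sub>1\<^esub> X.U"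
  using X.U_emb[OF X.S_CK, of f] by (simp add: o_def)

lemma U_idd: "X.U \<otimes>\<^bsub>A\<^sub>1\<^esub> X.emb idd = X.emb (restrict \<eta>\<^sub>1 disc) \<otimes>\<^bsub>A\<^sub>1\<^esub> X.U"
proof -
  have "(\<lambda>z\<in>disc. idd (\<eta>\<^sub>1 z)) = restrict \<eta>\<^sub>1 disc"
    using disc_map_in[OF X.eta_disc_map] by (auto simp: fun_eq_iff restrict_def)
  then show ?thesis using U_emb_comp[OF idd_disc_algebra] by (simp only:)
qed

text \<open>Under a character the relation \<open>U z = \<eta>\<^sub>1 U\<close> becomes
  \<open>beta x * alpha x = \<eta>\<^sub>1 (alpha x) * beta x\<close>, and \<open>beta x\<close>
  cancels.\<close>

lemma beta_fixed: 
  assumes x: "x \<in> disc" and b: "beta x \<noteq> 0"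
  shows "\<eta>\<^sub>1 (alpha x) = alpha x"
proof -
  have "E\<^sub>2 (h (X.U \<otimes>\<^bsub>A\<^sub>1\<^esub> X.emb idd)) x = beta x * alpha x"
    unfolding ev_mult[OF UB embB[OF idd_disc_algebra] x] alpha_def beta_def ..
  moreover have "E\<^sub>2 (h (X.emb (restrict \<eta>\<^sub>1 disc) \<otimes>\<^bsub>A\<^sub>1\<^esub> X.U)) x = restrict \<eta>\<^sub>1 disc (alpha x) * beta x"
    unfolding ev_mult[OF embB[OF eta_disc_algebra] UB x] ev_emb[OF eta_disc_algebra x] beta_def ..
  ultimately have "beta x * alpha x = restrict \<eta>\<^sub>1 disc (alpha x) * beta x"
    unfolding U_idd by (simp only:)
  then show ?thesis using b alpha_in[OF x] by simp
qed

text \<open>The pulled back character is determined by \<open>alpha x\<close> and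
  \<open>beta x\<close>; \<open>G\<close> is a candidate that is to be recognised as this
  character.\<close>

lemma ev_agree:
  assumes a: "a \<in> X.B" and x: "x \<in> disc"
    and G: "\<And>a b. a \<in> X.B \<Longrightarrow> b \<in> X.B \<Longrightarrow> G (a \<oplus>\<^bsub>A\<^sub>1\<^esub> b) = G a + G b" "\<And>a. a \<in> X.B \<Longrightarrow> cmod (G a) \<le> d * nrm A\<^sub>1 a"
    and GS: "\<And>f. f \<in> disc_algebra \<Longrightarrow> G (X.emb f) = f (alpha x)"
    and GU: "\<And>b. b \<in> X.B \<Longrightarrow> G (b \<otimes>\<^bsub>A\<^sub>1\<^esub> X.U) = G b * beta x"
  shows "E\<^sub>2 (h a) x = G a"
  by (rule X.functionals_agree[OF a, where c = 1 and d = d and w = "beta x"])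
    (use x G GS GU in \<open>simp_all add: ev_add ev_bound ev_emb ev_mult beta_def\<close>)

text \<open>\<open>E\<^sub>1\<close> evaluated at \<open>alpha x\<close> is a character that kills
  \<open>U\<close>, as the given one does.\<close>

lemma ev_zero_beta:
  assumes x: "x \<in> disc" and b: "beta x = 0" and a: "a \<in> X.B"
  shows "E\<^sub>2 (h a) x = E\<^sub>1 a (alpha x)"
  by (rule ev_agree[OF a x, where d = 1])
    (use alpha_in[OF x] b X.B_carrier in \<open>simp_all add: X.E0_add_at X.E0_bound X.E0_functions X.S_CK X.E0_multU_at\<close>)

text \<open>Characters with the same data coincide, and at the preimage of the coordinate function
  they return the points themselves.\<close>

lemma ev_same:
  assumes x: "x \<in> disc" "y \<in> disc" and eq: "alpha x = alpha y" "beta x = beta y"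
  shows "x = y"
proof -
  have "E\<^sub>2 (h a) x = E\<^sub>2 (h a) y" if "a \<in> X.B" for a
    by (rule ev_agree[OF that x(1), where d = 1])
      (use x eq ev_bound in \<open>simp_all add: ev_add ev_emb ev_mult beta_def\<close>)
  from this[of "inv_h (Y.emb idd)"] show ?thesis
    using x Y.E0_functions[OF Y.S_CK[OF idd_disc_algebra]] by simp
qed

end

text \<open>In the coordinate \<open>moeb a\<close> the map is multiplication by \<open>l\<close>,
  which can be inverted explicitly.\<close>

lemma rotation_homeomorphism:
  assumes h: "disc_map \<eta>" and a: "cmod a < 1" and l: "cmod l = 1"
    and rot: "\<And>z. z \<in> disc \<Longrightarrow> moeb a (\<eta> z) = l * moeb a z"
  shows "homeomorphism disc disc \<eta> (\<lambda>z. moeb (-a) (inverse l * moeb a z))"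
proof (rule homeomorphismI)
  have na: "cmod (-a) < 1" and l0: "l \<noteq> 0" using a l by auto
  have cancel: "inverse l * (l * w) = w" "l * (inverse l * w) = w" for w using l0 by (simp_all add: field_simps)
  have mem: "inverse l * moeb a z \<in> disc" if "z \<in> disc" for z
    using disc_map_in[OF moeb_disc_map[OF a] that] l by (simp add: norm_mult norm_inverse)
  show "continuous_on disc \<eta>" "\<eta> ` disc \<subseteq> disc" using h unfolding disc_map_def by blast+
  show "continuous_on disc (\<lambda>z. moeb (-a) (inverse l * moeb a z))"
  proof (rule continuous_on_compose2[of disc "moeb (-a)"])
    show "continuous_on disc (moeb (-a))" using moeb_disc_hol[OF na] by (simp add: disc_hol_def)
    show "continuous_on disc (\<lambda>z. inverse l * moeb a z)"
      using moeb_disc_hol[OF a] by (auto simp: disc_hol_def intro: continuous_intros)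
  qed (use mem in blast)
  show "(\<lambda>z. moeb (-a) (inverse l * moeb a z)) ` disc \<subseteq> disc"
    using disc_map_in[OF moeb_disc_map[OF na]] mem by blast
  show "moeb (-a) (inverse l * moeb a (\<eta> z)) = z" if z: "z \<in> disc" for z
    using rot[OF z] moeb_inverse[OF a z] by (simp only: cancel)
  show "\<eta> (moeb (-a) (inverse l * moeb a z)) = z" if z: "z \<in> disc" for z
  proof -
    let ?w = "moeb (-a) (inverse l * moeb a z)"
    have w: "?w \<in> disc" using disc_map_in[OF moeb_disc_map[OF na] mem[OF z]] .
    have "moeb a ?w = inverse l * moeb a z" using moeb_inverse[OF na mem[OF z]] by simp
    then have "moeb a (\<eta> ?w) = moeb a z" using rot[OF w] by (simp only: cancel)
    then show ?thesis
      using moeb_inverse[OF a disc_map_in[OF h w]] moeb_inverse[OF a z] by simp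
  qed
qed

text \<open>Whether \<open>p\<close> is interior or on the boundary, the ball without
  \<open>p\<close> is a nonempty open set on which \<open>f\<close> vanishes.\<close>

lemma disc_hol_zero_at:
  assumes f: "disc_hol f" and p: "p \<in> disc" and z: "\<And>z. z \<in> disc \<Longrightarrow> z \<noteq> p \<Longrightarrow> f z = 0"
  shows "f p = 0"
proof -
  have "(if p = 0 then 1/2 else 0) \<in> ball (0::complex) 1 - {p}" by (auto simp: norm_divide)
  then have ne: "ball (0::complex) 1 - {p} \<noteq> {}" by blast
  show ?thesis
  proof (rule disc_hol_identity[of f "\<lambda>_. 0" "ball 0 1 - {p}" p])
    show "open (ball 0 1 - {p})" by (simp add: open_delete)
    show "f w = 0" if "w \<in> ball 0 1 - {p}" for w using z[of w] that by auto
  qed (use f p ne in \<open>auto simp: disc_hol_def\<close>)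
qed

section \<open>The case \<open>beta = 0\<close>: the two maps are conjugate\<close>

context disc_iso
begin

lemma E1h_mult:
  assumes "a \<in> X.B" "b \<in> X.B" "x \<in> disc"
  shows "E\<^sub>2 (Y.quot (h (a \<otimes>\<^bsub>A\<^sub>1\<^esub> b))) x
    = E\<^sub>2 (Y.quot (h a)) x * E\<^sub>2 (h b) (\<eta>\<^sub>2 x) + E\<^sub>2 (h a) x * E\<^sub>2 (Y.quot (h b)) x"
  using Y.E1_mult[of "h a" "h b" x] assms by (simp add: h_mult)

lemma E1h_add:
  assumes "a \<in> X.B" "b \<in> X.B" "x \<in> disc"
  shows "E\<^sub>2 (Y.quot (h (a \<oplus>\<^bsub>A\<^sub>1\<^esub> b))) x = E\<^sub>2 (Y.quot (h a)) x + E\<^sub>2 (Y.quot (h b)) x"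
  using assms by (simp add: h_add Y.quot_add Y.E0_add_at)

lemma eta2_in: "x \<in> disc \<Longrightarrow> \<eta>\<^sub>2 x \<in> disc"
  using disc_map_in[OF Y.eta_disc_map] .

lemma alpha_disc_map: "disc_map alpha"
  using alpha_hol alpha_in by (auto simp: disc_map_def disc_hol_def)

lemma conjugacy_case:
  assumes b0: "\<And>x. x \<in> disc \<Longrightarrow> beta x = 0"
  shows "\<exists>\<gamma>. disc_homeo \<gamma> \<and> \<gamma> holomorphic_on ball 0 1 \<and> (\<forall>z\<in>disc. \<gamma> (\<eta>\<^sub>1 z) = \<eta>\<^sub>2 (\<gamma> z))"
proof -
  interpret R: disc_iso \<eta>\<^sub>2 A\<^sub>2 \<iota>\<^sub>2 E\<^sub>2 \<eta>\<^sub>1 A\<^sub>1 \<iota>\<^sub>1 E\<^sub>1 inv_h by (rule swap)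
  have ev: "E\<^sub>2 (h a) x = E\<^sub>1 a (alpha x)" if "a \<in> X.B" "x \<in> disc" for a x
    using ev_zero_beta[OF that(2) b0[OF that(2)] that(1)] .
  \<comment> \<open>The preimage of the coordinate function is evaluated in two ways.\<close>
  have left: "R.alpha (alpha x) = x" if x: "x \<in> disc" for x
    using ev[of "inv_h (Y.emb idd)" x] x Y.E0_functions[OF Y.S_CK[OF idd_disc_algebra]]
    by (simp add: R.alpha_def)
  have Rb: "R.beta (alpha x) = 0" if x: "x \<in> disc" for x
    using ev[of "inv_h Y.U" x] x Y.E0_U_at[of x] by (simp add: R.beta_def)
  have inj: "inj_on alpha disc" using left by (rule inj_on_inverseI)
  have op: "open (alpha ` ball 0 1)" by (rule disc_hol_image_open[OF alpha_hol inj_not_constant[OF inj]])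
  have "alpha ` ball 0 1 \<subseteq> disc" using alpha_in by auto
  then have "alpha ` ball 0 1 \<subseteq> interior disc" using op by (rule interior_maximal)
  then have sub: "alpha ` ball 0 1 \<subseteq> ball 0 1" by (simp add: interior_cball)
  \<comment> \<open>So far \<open>R.beta\<close> vanishes on the range of \<open>alpha\<close>.
    Since \<open>alpha\<close> is injective, the image of the open ball is open, and the identity
    theorem does the rest.\<close>
  have Rb0: "R.beta y = 0" if y: "y \<in> disc" for y
  proof (rule disc_hol_identity[OF R.beta_hol _ op _ sub _ y])
    show "disc_hol (\<lambda>_. 0)" by (simp add: disc_hol_def)
    show "R.beta z = 0" if "z \<in> alpha ` ball 0 1" for z using that Rb by force
  qed auto
  have right: "alpha (R.alpha y) = y" if y: "y \<in> disc" for y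
    using R.ev_zero_beta[OF y Rb0[OF y], of "h (X.emb idd)"] y X.E0_functions[OF X.S_CK[OF idd_disc_algebra]]
    by (simp add: alpha_def)
  \<comment> \<open>Compare the off-diagonal entries of \<open>U z = \<eta>\<^sub>1 U\<close> at
    \<open>x\<close>. As \<open>beta\<close> vanishes they give \<open>?g * alpha (\<eta>\<^sub>2 x)
    = \<eta>\<^sub>1 (alpha x) * ?g\<close>, with \<open>?g\<close> the entry of
    \<open>h X.U\<close>; it remains to see that \<open>?g\<close> is not 0.\<close>
  have main: "alpha (\<eta>\<^sub>2 x) = \<eta>\<^sub>1 (alpha x)" if x: "x \<in> disc" for x
  proof -
    let ?g = "E\<^sub>2 (Y.quot (h X.U)) x"
    have e2x: "\<eta>\<^sub>2 x \<in> disc" by (rule eta2_in[OF x])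
    define b where "b = inv_h Y.U"
    have bB: "b \<in> X.B" by (simp add: b_def)
    have "E\<^sub>1 b = \<zero>\<^bsub>cont_alg disc_space\<^esub>"
    proof (rule X.CK_eqI)
      show "E\<^sub>1 b z = \<zero>\<^bsub>cont_alg disc_space\<^esub> z" if "z \<in> topspace disc_space" for z
        using Rb0[of z] that X.zero_at[of z] by (simp add: b_def R.beta_def)
    qed (use X.B_carrier[OF bB] in auto)
    moreover have "b = X.emb (E\<^sub>1 b) \<oplus>\<^bsub>A\<^sub>1\<^esub> X.quot b \<otimes>\<^bsub>A\<^sub>1\<^esub> X.U"
      using X.quot(2)[OF X.B_carrier[OF bB]] .
    \<comment> \<open>The preimage \<open>b\<close> of \<open>Y.U\<close> has no constant
      coefficient, so it is \<open>X.quot b\<close> times \<open>X.U\<close>, and the off-diagonal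
      entry 1 of \<open>Y.U\<close> becomes a multiple of \<open>?g\<close>.\<close>
    ultimately have "Y.U = h (X.emb \<zero>\<^bsub>cont_alg disc_space\<^esub> \<oplus>\<^bsub>A\<^sub>1\<^esub> X.quot b \<otimes>\<^bsub>A\<^sub>1\<^esub> X.U)"
      by (simp add: b_def)
    then have "E\<^sub>2 (Y.quot Y.U) x = E\<^sub>2 (Y.quot (h (X.emb \<zero>\<^bsub>cont_alg disc_space\<^esub>))) x
        + (E\<^sub>2 (Y.quot (h (X.quot b))) x * beta (\<eta>\<^sub>2 x) + E\<^sub>2 (h (X.quot b)) x * ?g)"
      using E1h_add[OF embB[OF X.S_zero] X.B_mult[OF X.quot_B[OF bB] UB] x]
        E1h_mult[OF X.quot_B[OF bB] UB x] by (simp only: beta_def)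
    moreover have "E\<^sub>2 (Y.quot (h (X.emb \<zero>\<^bsub>cont_alg disc_space\<^esub>))) x = 0"
    proof -
      have "\<zero>\<^bsub>cont_alg disc_space\<^esub> = 0 \<odot>\<^bsub>cont_alg disc_space\<^esub> \<zero>\<^bsub>cont_alg disc_space\<^esub>" by (auto simp: cont_alg_def)
      then have "X.emb \<zero>\<^bsub>cont_alg disc_space\<^esub> = 0 \<odot>\<^bsub>A\<^sub>1\<^esub> X.emb \<zero>\<^bsub>cont_alg disc_space\<^esub>"
        using X.emb_smult[OF X.zero_CK, of 0] by simp
      then have "h (X.emb \<zero>\<^bsub>cont_alg disc_space\<^esub>) = 0 \<odot>\<^bsub>A\<^sub>2\<^esub> h (X.emb \<zero>\<^bsub>cont_alg disc_space\<^esub>)"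
        using h_smult[OF embB[OF X.S_zero], of 0] by simp
      then have "E\<^sub>2 (Y.quot (h (X.emb \<zero>\<^bsub>cont_alg disc_space\<^esub>))) x
          = 0 * E\<^sub>2 (Y.quot (h (X.emb \<zero>\<^bsub>cont_alg disc_space\<^esub>))) x"
        using Y.quot_smult[OF hA[OF embB[OF X.S_zero]], of 0]
          Y.E0_smult_at[OF Y.quot_closed[OF hA[OF embB[OF X.S_zero]]], of x 0] x by simp
      then show ?thesis by simp
    qed
    moreover have "E\<^sub>2 (Y.quot Y.U) x = 1" using x by (simp add: Y.quot_U Y.E0_one_at)
    ultimately have g: "?g \<noteq> 0" using b0[OF e2x] by auto
    have "E\<^sub>2 (Y.quot (h (X.U \<otimes>\<^bsub>A\<^sub>1\<^esub> X.emb idd))) x = ?g * alpha (\<eta>\<^sub>2 x)"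
      unfolding E1h_mult[OF UB embB[OF idd_disc_algebra] x]
      using b0[OF x] by (simp add: alpha_def beta_def)
    moreover have "E\<^sub>2 (Y.quot (h (X.emb (restrict \<eta>\<^sub>1 disc) \<otimes>\<^bsub>A\<^sub>1\<^esub> X.U))) x = \<eta>\<^sub>1 (alpha x) * ?g"
      unfolding E1h_mult[OF embB[OF eta_disc_algebra] UB x] ev_emb[OF eta_disc_algebra x]
      using b0[OF e2x] alpha_in[OF x] by (simp add: beta_def)
    ultimately show ?thesis using g unfolding U_idd by simp
  qed
  have hom: "homeomorphism disc disc R.alpha alpha"
    using R.alpha_disc_map alpha_disc_map right left
    by (intro homeomorphismI) (auto simp only: disc_map_def)
  have "R.alpha (\<eta>\<^sub>1 z) = \<eta>\<^sub>2 (R.alpha z)" if z: "z \<in> disc" for z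
    using main[OF R.alpha_in[OF z]] right[OF z] left[OF eta2_in[OF R.alpha_in[OF z]]] by simp
  moreover have "R.alpha holomorphic_on ball 0 1" using R.alpha_hol by (simp add: disc_hol_def)
  ultimately show ?thesis using hom unfolding disc_homeo_def by blast
qed

end

subsection \<open>Characters at the interior fixed point\<close>

context disc_conjugacy
begin

text \<open>
  The coefficient bounds make \<open>\<Sum>n. E\<^sub>n a z\<^sub>1 w\<^sup>n\<close> converge for \<open>\<bar>w\<bar> < r\<close>, where \<open>r\<close> is a
  lower bound for the spectral radius of \<open>U\<close>.
\<close>

lemma coeff_summable:
  assumes z1: "z1 \<in> disc" and r: "\<And>n. r ^ n \<le> nrm A (U [^] n)" and s: "0 \<le> s" "s < r"
  obtains D where "\<And>a. a \<in> carrier A \<Longrightarrow> summable (\<lambda>n. cmod (E\<^sub>0 ((quot ^^ n) a) z1) * s ^ n)"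
    "\<And>a. a \<in> carrier A \<Longrightarrow> (\<Sum>n. cmod (E\<^sub>0 ((quot ^^ n) a) z1) * s ^ n) \<le> D * nrm A a"
proof -
  \<comment> \<open>Chosen so that \<open>e > 1\<close>, as \<open>coeff_growth\<close> demands,
    while \<open>t = 2 * s / (r + s)\<close> stays below 1.\<close>
  define e where "e = 2 * r / (r + s)"
  define t where "t = e * (s / r)"
  have r0: "r > 0" using s by simp
  have e1: "e > 1" using s r0 by (simp add: e_def field_simps)
  have t: "0 \<le> t" "t < 1" using s r0 by (auto simp: t_def e_def field_simps)
  obtain M where M: "M \<ge> 0" "\<And>a. a \<in> carrier A \<Longrightarrow> nrm A (quot a) \<le> M * nrm A a"
    using quot_bounded by metis
  obtain N where N: "\<And>n a x. n \<ge> N \<Longrightarrow> a \<in> carrier A \<Longrightarrow> x \<in> disc \<Longrightarrow>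
      cmod (E\<^sub>0 ((quot ^^ n) a) x) * nrm A (U [^] n) \<le> e ^ n * nrm A a"
    using coeff_growth[OF e1] unfolding eventually_sequentially topspace_euclidean_subtopology by blast
  \<comment> \<open>\<open>coeff_growth\<close> starts at \<open>N\<close>; the finitely many
    earlier terms are controlled by powers of the bound \<open>M\<close> of
    \<open>quot\<close>.\<close>
  define g where "g n = (if n < N then M ^ n * s ^ n else t ^ n)" for n
  have "summable (\<lambda>n. t ^ n)" using t by (simp add: summable_geometric)
  then have gs: "summable g"
    by (rule summable_cong[THEN iffD1, rotated])
      (auto simp: g_def eventually_sequentially intro!: exI[of _ N])
  have le: "cmod (E\<^sub>0 ((quot ^^ n) a) z1) * s ^ n \<le> g n * nrm A a" if a: "a \<in> carrier A" for a n
  proof (cases "n < N")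
    case True
    have "cmod (E\<^sub>0 ((quot ^^ n) a) z1) \<le> M ^ n * nrm A a"
      using E0_bound[OF quot_pow_closed[OF a], of z1 n] quot_pow_bound[OF M a, of n] z1 by simp
    from mult_right_mono[OF this, of "s ^ n"] show ?thesis
      using True s by (simp add: g_def mult_ac)
  next
    case False
    let ?c = "cmod (E\<^sub>0 ((quot ^^ n) a) z1)"
    have "?c * r ^ n \<le> ?c * nrm A (U [^] n)" by (intro mult_left_mono r) simp
    also have "\<dots> \<le> e ^ n * nrm A a" using N[of n a z1] False a z1 by simp
    finally have "?c * r ^ n * (s / r) ^ n \<le> e ^ n * nrm A a * (s / r) ^ n"
      using s by (intro mult_right_mono) auto
    then show ?thesis using False r0 by (simp add: g_def t_def power_mult_distrib power_divide mult_ac)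
  qed
  have sm: "summable (\<lambda>n. cmod (E\<^sub>0 ((quot ^^ n) a) z1) * s ^ n)" if a: "a \<in> carrier A" for a
    by (rule summable_comparison_test[OF _ summable_mult2[OF gs, of "nrm A a"]])
      (use le[OF a] s in \<open>auto simp: abs_mult\<close>)
  have "(\<Sum>n. cmod (E\<^sub>0 ((quot ^^ n) a) z1) * s ^ n) \<le> suminf g * nrm A a" if a: "a \<in> carrier A" for a
    using suminf_le[OF le[OF a] sm[OF a] summable_mult2[OF gs]] suminf_mult2[OF gs, of "nrm A a"] by simp
  then show ?thesis using that sm by blast
qed

end

context disc_iso
begin

text \<open>The series defines a bounded functional with value \<open>f (alpha x)\<close> on
  functions; right multiplication by \<open>U\<close> shifts it and produces the factor
  \<open>beta x\<close>. Hence \<open>ev_agree\<close> identifies it with the character.\<close>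

lemma ev_coeff_series:
  assumes r: "\<And>n. r ^ n \<le> nrm A\<^sub>1 (X.U [^]\<^bsub>A\<^sub>1\<^esub> n)" and x: "x \<in> disc" and bx: "cmod (beta x) < r"
    and a: "a \<in> X.B"
  shows "(\<lambda>n. E\<^sub>1 ((X.quot ^^ n) a) (alpha x) * beta x ^ n) sums E\<^sub>2 (h a) x"
proof -
  let ?z = "alpha x" and ?w = "beta x"
  have z: "?z \<in> disc" by (rule alpha_in[OF x])
  obtain D where D: "\<And>a. a \<in> carrier A\<^sub>1 \<Longrightarrow> summable (\<lambda>n. cmod (E\<^sub>1 ((X.quot ^^ n) a) ?z) * cmod ?w ^ n)"
    "\<And>a. a \<in> carrier A\<^sub>1 \<Longrightarrow> (\<Sum>n. cmod (E\<^sub>1 ((X.quot ^^ n) a) ?z) * cmod ?w ^ n) \<le> D * nrm A\<^sub>1 a"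
    using X.coeff_summable[OF z r norm_ge_zero bx] by blast
  define G where "G a = (\<Sum>n. E\<^sub>1 ((X.quot ^^ n) a) ?z * ?w ^ n)" for a
  have nm: "(\<lambda>n. norm (E\<^sub>1 ((X.quot ^^ n) a) ?z * ?w ^ n)) = (\<lambda>n. cmod (E\<^sub>1 ((X.quot ^^ n) a) ?z) * cmod ?w ^ n)" for a
    by (simp add: norm_mult norm_power)
  have sm: "summable (\<lambda>n. E\<^sub>1 ((X.quot ^^ n) a) ?z * ?w ^ n)" if "a \<in> carrier A\<^sub>1" for a
    by (rule summable_norm_cancel) (use D(1)[OF that] in \<open>simp only: nm\<close>)
  have "E\<^sub>2 (h a) x = G a"
  proof (rule ev_agree[OF a x, where d = D])
    show "G (a \<oplus>\<^bsub>A\<^sub>1\<^esub> b) = G a + G b" if "a \<in> X.B" "b \<in> X.B" for a b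
      unfolding G_def
      using suminf_add[OF sm[OF X.B_carrier[OF that(1)]] sm[OF X.B_carrier[OF that(2)]]] z that X.B_carrier
      by (simp add: X.quot_pow_add X.E0_add_at X.quot_pow_closed distrib_right)
    show "cmod (G a) \<le> D * nrm A\<^sub>1 a" if "a \<in> X.B" for a
      unfolding G_def
      using summable_norm[of "\<lambda>n. E\<^sub>1 ((X.quot ^^ n) a) ?z * ?w ^ n"] D[OF X.B_carrier[OF that]]
      unfolding nm by linarith
    show "G (X.emb f) = f ?z" if f: "f \<in> disc_algebra" for f
    proof -
      have q: "X.quot (X.emb f) = \<zero>\<^bsub>A\<^sub>1\<^esub>" by (rule X.quot_emb[OF X.S_CK[OF f]])
      have q0: "X.quot \<zero>\<^bsub>A\<^sub>1\<^esub> = \<zero>\<^bsub>A\<^sub>1\<^esub>" using X.quot_smult[of "\<zero>\<^bsub>A\<^sub>1\<^esub>" 0] by simp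
      have "(X.quot ^^ Suc n) (X.emb f) = \<zero>\<^bsub>A\<^sub>1\<^esub>" for n by (induction n) (simp_all add: q q0)
      moreover have "E\<^sub>1 \<zero>\<^bsub>A\<^sub>1\<^esub> ?z = 0" using X.E0_smult_at[of "\<zero>\<^bsub>A\<^sub>1\<^esub>" ?z 0] z by simp
      ultimately have "E\<^sub>1 ((X.quot ^^ n) (X.emb f)) ?z * ?w ^ n = (if n = 0 then f ?z else 0)" for n
        using X.E0_functions[OF X.S_CK[OF f]] by (cases n) simp_all
      then show ?thesis
        unfolding G_def using suminf_finite[of "{0}" "\<lambda>n. if n = 0 then f ?z else 0"] by simp
    qed
    show "G (b \<otimes>\<^bsub>A\<^sub>1\<^esub> X.U) = G b * ?w" if b: "b \<in> X.B" for b
    proof -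
      have bc: "b \<in> carrier A\<^sub>1" by (rule X.B_carrier[OF b])
      have bU: "b \<otimes>\<^bsub>A\<^sub>1\<^esub> X.U \<in> carrier A\<^sub>1" by (rule X.B_carrier[OF X.B_mult[OF b UB]])
      have "X.quot (b \<otimes>\<^bsub>A\<^sub>1\<^esub> X.U) = b"
      proof (rule X.decomposition_unique(2)[OF X.zero_CK bc])
        have "0 \<odot>\<^bsub>cont_alg disc_space\<^esub> \<zero>\<^bsub>cont_alg disc_space\<^esub> = \<zero>\<^bsub>cont_alg disc_space\<^esub>" by (auto simp: cont_alg_def)
        then have "X.emb \<zero>\<^bsub>cont_alg disc_space\<^esub> = \<zero>\<^bsub>A\<^sub>1\<^esub>" using X.emb_smult[OF X.zero_CK, of 0] by simp
        then show "b \<otimes>\<^bsub>A\<^sub>1\<^esub> X.U = X.emb \<zero>\<^bsub>cont_alg disc_space\<^esub> \<oplus>\<^bsub>A\<^sub>1\<^esub> b \<otimes>\<^bsub>A\<^sub>1\<^esub> X.U" using bU by simp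
      qed
      then have "(X.quot ^^ Suc n) (b \<otimes>\<^bsub>A\<^sub>1\<^esub> X.U) = (X.quot ^^ n) b" for n by (simp only: funpow_Suc_right o_apply)
      then have "(\<Sum>n. E\<^sub>1 ((X.quot ^^ Suc n) (b \<otimes>\<^bsub>A\<^sub>1\<^esub> X.U)) ?z * ?w ^ Suc n) = G b * ?w"
        unfolding G_def using suminf_mult2[OF sm[OF bc], of ?w] by (simp add: mult_ac)
      moreover have "E\<^sub>1 ((X.quot ^^ 0) (b \<otimes>\<^bsub>A\<^sub>1\<^esub> X.U)) ?z = 0" using X.E0_multU_at[OF bc] z by simp
      ultimately show ?thesis
        using suminf_split_head[OF sm[OF bU]] unfolding G_def by simp
    qed
  qed
  then show ?thesis using summable_sums[OF sm[OF X.B_carrier[OF a]]] unfolding G_def by simp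
qed

text \<open>The character takes the powers of \<open>U\<close> to the powers of
  \<open>beta x\<close> and is contractive. This supplies the lower bound \<open>r\<close> for
  \<open>coeff_summable\<close>.\<close>

lemma beta_pow_le: "x \<in> disc \<Longrightarrow> cmod (beta x) ^ n \<le> nrm A\<^sub>1 (X.U [^]\<^bsub>A\<^sub>1\<^esub> n)"
proof -
  assume x: "x \<in> disc"
  have "X.U [^]\<^bsub>A\<^sub>1\<^esub> n \<in> X.B \<and> E\<^sub>2 (h (X.U [^]\<^bsub>A\<^sub>1\<^esub> n)) x = beta x ^ n"
  proof (induction n)
    case 0 then show ?case using x by (simp add: X.B_one h_one Y.E0_one_at)
  next
    case (Suc n) then show ?case using x by (simp add: X.B_mult ev_mult beta_def mult.commute)
  qed
  then show ?thesis using ev_bound[OF _ x, of "X.U [^]\<^bsub>A\<^sub>1\<^esub> n"] by (simp add: norm_power)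
qed

text \<open>
  The power series of \<open>inv_h U\<close> at \<open>z\<^sub>1\<close> vanishes on the open set \<open>beta ` ball 0 1\<close>, hence at \<open>0\<close>.
\<close>

lemma inverse_U_vanishes:
  assumes z1: "cmod z1 < 1" and al: "\<And>x. x \<in> disc \<Longrightarrow> alpha x = z1"
  shows "E\<^sub>1 (inv_h Y.U) z1 = 0"
proof -
  have inj: "inj_on beta disc" using ev_same al by (intro inj_onI) auto
  have op: "open (beta ` ball 0 1)" by (rule disc_hol_image_open[OF beta_hol inj_not_constant[OF inj]])
  have "continuous_on disc (\<lambda>x. cmod (beta x))"
    using beta_hol by (auto simp: disc_hol_def intro: continuous_intros)
  then obtain x1 where x1: "x1 \<in> disc" "\<And>x. x \<in> disc \<Longrightarrow> cmod (beta x) \<le> cmod (beta x1)"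
    using continuous_attains_sup[of disc "\<lambda>x. cmod (beta x)"] by auto
  \<comment> \<open>The largest modulus of \<open>beta\<close>. The image of the open ball is open,
    so it stays strictly inside this radius, where the series converges.\<close>
  define r where "r = cmod (beta x1)"
  have rle: "r ^ n \<le> nrm A\<^sub>1 (X.U [^]\<^bsub>A\<^sub>1\<^esub> n)" for n unfolding r_def by (rule beta_pow_le[OF x1(1)])
  have "beta ` ball 0 1 \<subseteq> cball 0 r" using x1(2) by (auto simp: r_def)
  then have "beta ` ball 0 1 \<subseteq> interior (cball 0 r)" using op by (rule interior_maximal)
  then have sub: "beta ` ball 0 1 \<subseteq> ball 0 r" by (simp add: interior_cball)
  then have r0: "r > 0" using le_less_trans[OF norm_ge_zero, of "beta 0" r] by force
  define b where "b = inv_h Y.U"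
  have bB: "b \<in> X.B" by (simp add: b_def)
  define e where "e n = E\<^sub>1 ((X.quot ^^ n) b) z1" for n
  define om where "om w = (\<Sum>n. e n * w ^ n)" for w
  have omsum: "(\<lambda>n. e n * w ^ n) sums om w" if w: "cmod w < r" for w
  proof -
    have "z1 \<in> disc" using z1 by simp
    then obtain D where "\<And>a. a \<in> carrier A\<^sub>1 \<Longrightarrow> summable (\<lambda>n. cmod (E\<^sub>1 ((X.quot ^^ n) a) z1) * cmod w ^ n)"
      using X.coeff_summable[OF _ rle norm_ge_zero w] by blast
    then have "summable (\<lambda>n. cmod (e n * w ^ n))"
      using X.B_carrier[OF bB] by (simp add: e_def norm_mult norm_power)
    then show ?thesis unfolding om_def by (rule summable_sums[OF summable_norm_cancel])
  qed
  have hol: "om holomorphic_on ball 0 r"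
    by (rule power_series_holomorphic[of _ _ e]) (use omsum in simp)
  have "om w = 0" if w: "w \<in> beta ` ball 0 1" for w
  proof -
    obtain x where x: "x \<in> ball 0 1" "w = beta x" using w by blast
    have xd: "x \<in> disc" using x by simp
    have "cmod (beta x) < r" using sub x by force
    from ev_coeff_series[OF rle xd this bB] have "(\<lambda>n. e n * w ^ n) sums E\<^sub>2 (h b) x"
      using al[OF xd] x by (simp add: e_def)
    moreover have "E\<^sub>2 (h b) x = 0" using xd Y.E0_U_at[of x] by (simp add: b_def)
    ultimately show ?thesis using sums_unique unfolding om_def by (metis (no_types, lifting))
  qed
  \<comment> \<open>It is not known whether \<open>beta\<close> takes the value 0; but
    \<open>om\<close> is analytic on the whole ball of radius \<open>r\<close>, so the identity
    theorem reaches the centre.\<close>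
  then have "om 0 = 0"
    using analytic_continuation_open[OF op open_ball _ _ sub hol holomorphic_on_const[of 0], of 0] r0 by auto
  moreover have "om 0 = e 0" using omsum[of 0] r0 sums_unique powser_sums_zero[of e] sums_unique2
    by (metis norm_zero)
  ultimately show ?thesis by (simp add: e_def b_def)
qed

end

subsection \<open>The rotation case\<close>

context disc_iso
begin

lemma quot_B_decomp:
  assumes b: "b \<in> X.B" and x: "x \<in> disc"
  shows "E\<^sub>2 (h b) x = E\<^sub>1 b (alpha x) + E\<^sub>2 (h (X.quot b)) x * beta x"
proof -
  have "b = X.emb (E\<^sub>1 b) \<oplus>\<^bsub>A\<^sub>1\<^esub> X.quot b \<otimes>\<^bsub>A\<^sub>1\<^esub> X.U" by (rule X.quot(2)[OF X.B_carrier[OF b]])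
  then have "E\<^sub>2 (h b) x = E\<^sub>2 (h (X.emb (E\<^sub>1 b) \<oplus>\<^bsub>A\<^sub>1\<^esub> X.quot b \<otimes>\<^bsub>A\<^sub>1\<^esub> X.U)) x" by simp
  then show ?thesis
    using ev_add[OF embB[OF X.E0_S[OF b]] X.B_mult[OF X.quot_B[OF b] UB] x]
      ev_mult[OF X.quot_B[OF b] UB x] ev_emb[OF X.E0_S[OF b] x] by (simp only: beta_def)
qed

lemma E1h_decomp:
  assumes b: "b \<in> X.B" and x: "x \<in> disc"
  shows "E\<^sub>2 (Y.quot (h b)) x = E\<^sub>2 (Y.quot (h (X.emb (E\<^sub>1 b)))) x
     + (E\<^sub>2 (Y.quot (h (X.quot b))) x * beta (\<eta>\<^sub>2 x) + E\<^sub>2 (h (X.quot b)) x * E\<^sub>2 (Y.quot (h X.U)) x)"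
proof -
  have "b = X.emb (E\<^sub>1 b) \<oplus>\<^bsub>A\<^sub>1\<^esub> X.quot b \<otimes>\<^bsub>A\<^sub>1\<^esub> X.U" by (rule X.quot(2)[OF X.B_carrier[OF b]])
  then have "E\<^sub>2 (Y.quot (h b)) x = E\<^sub>2 (Y.quot (h (X.emb (E\<^sub>1 b) \<oplus>\<^bsub>A\<^sub>1\<^esub> X.quot b \<otimes>\<^bsub>A\<^sub>1\<^esub> X.U))) x" by simp
  then show ?thesis
    using E1h_add[OF embB[OF X.E0_S[OF b]] X.B_mult[OF X.quot_B[OF b] UB] x]
      E1h_mult[OF X.quot_B[OF b] UB x] by (simp only: beta_def)
qed

lemma emb_mult_disc: "f \<in> disc_algebra \<Longrightarrow> g \<in> disc_algebra \<Longrightarrow>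
    X.emb (\<lambda>z\<in>disc. f z * g z) = X.emb f \<otimes>\<^bsub>A\<^sub>1\<^esub> X.emb g"
  using X.emb_mult[of f g] X.S_CK by (simp add: cont_alg_def)

text \<open>
  With \<open>\<zeta> = z - z\<^sub>1\<close>, comparing \<open>U \<zeta> = (\<eta>\<^sub>1 - z\<^sub>1) U\<close> on both sides of \<open>h\<close> shows that the
  derivation at \<open>x\<close> can be nonzero on \<open>\<zeta>\<close> only if \<open>beta x = \<eta>\<^sub>1' z\<^sub>1 \<cdot> beta (\<eta>\<^sub>2 x)\<close>.
\<close>

lemma derivation_relation:
  assumes z1: "cmod z1 < 1" "\<eta>\<^sub>1 z1 = z1" and al: "\<And>x. x \<in> disc \<Longrightarrow> alpha x = z1" and x: "x \<in> disc"
  shows "E\<^sub>2 (Y.quot (h (X.emb (\<lambda>z\<in>disc. z - z1)))) x * (beta x - deriv \<eta>\<^sub>1 z1 * beta (\<eta>\<^sub>2 x)) = 0"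
proof -
  let ?\<zeta> = "\<lambda>z\<in>disc. z - z1"
  have z1d: "z1 \<in> disc" using z1 by simp
  have e2x: "\<eta>\<^sub>2 x \<in> disc" by (rule eta2_in[OF x])
  have zA: "?\<zeta> \<in> disc_algebra"
    by (rule restrict_disc_algebra) (auto simp: disc_hol_def intro!: continuous_intros holomorphic_intros)
  have dh: "disc_hol (\<lambda>z. \<eta>\<^sub>1 z - z1)"
    by (rule disc_hol_ops(3)[OF disc_map_hol[OF X.eta_disc_map]]) (simp add: disc_hol_def)
  obtain k where k: "disc_hol k" "\<And>z. z \<in> disc \<Longrightarrow> \<eta>\<^sub>1 z - z1 = (z - z1) * k z"
    "k z1 = deriv (\<lambda>z. \<eta>\<^sub>1 z - z1) z1"
    using disc_hol_division[OF dh, of z1] z1 by auto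
  have kz: "k z1 = deriv \<eta>\<^sub>1 z1"
  proof -
    have "(\<eta>\<^sub>1 has_field_derivative deriv \<eta>\<^sub>1 z1) (at z1)"
      using holomorphic_derivI[of \<eta>\<^sub>1 "ball 0 1" z1] X.eta_disc_map z1 by (auto simp: disc_map_def)
    then have "((\<lambda>z. \<eta>\<^sub>1 z - z1) has_field_derivative deriv \<eta>\<^sub>1 z1 - 0) (at z1)"
      by (intro derivative_intros)
    then show ?thesis using k(3) by (simp add: DERIV_imp_deriv)
  qed
  let ?k = "restrict k disc"
  have kA: "?k \<in> disc_algebra" by (rule restrict_disc_algebra[OF k(1)])
  have "(\<lambda>z\<in>disc. ?\<zeta> (\<eta>\<^sub>1 z)) = (\<lambda>z\<in>disc. ?\<zeta> z * ?k z)"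
    using k(2) disc_map_in[OF X.eta_disc_map] by (intro restrict_ext) simp
  then have rel: "X.U \<otimes>\<^bsub>A\<^sub>1\<^esub> X.emb ?\<zeta> = (X.emb ?\<zeta> \<otimes>\<^bsub>A\<^sub>1\<^esub> X.emb ?k) \<otimes>\<^bsub>A\<^sub>1\<^esub> X.U"
    using U_emb_comp[OF zA] emb_mult_disc[OF zA kA] by (simp only:)
  have ez: "E\<^sub>2 (h (X.emb ?\<zeta>)) y = 0" if "y \<in> disc" for y
    unfolding ev_emb[OF zA that] al[OF that] using z1d by simp
  have ek: "E\<^sub>2 (h (X.emb ?k)) y = deriv \<eta>\<^sub>1 z1" if "y \<in> disc" for y
    unfolding ev_emb[OF kA that] al[OF that] using z1d kz by simp
  let ?g = "E\<^sub>2 (Y.quot (h (X.emb ?\<zeta>))) x"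
  have "E\<^sub>2 (Y.quot (h (X.U \<otimes>\<^bsub>A\<^sub>1\<^esub> X.emb ?\<zeta>))) x = beta x * ?g"
    unfolding E1h_mult[OF UB embB[OF zA] x] ez[OF e2x] beta_def by simp
  moreover have "E\<^sub>2 (Y.quot (h ((X.emb ?\<zeta> \<otimes>\<^bsub>A\<^sub>1\<^esub> X.emb ?k) \<otimes>\<^bsub>A\<^sub>1\<^esub> X.U))) x = ?g * deriv \<eta>\<^sub>1 z1 * beta (\<eta>\<^sub>2 x)"
    unfolding E1h_mult[OF X.B_mult[OF embB[OF zA] embB[OF kA]] UB x] E1h_mult[OF embB[OF zA] embB[OF kA] x]
      ev_mult[OF embB[OF zA] embB[OF kA] x] ez[OF x] ek[OF e2x] beta_def by simp
  ultimately have "beta x * ?g = ?g * deriv \<eta>\<^sub>1 z1 * beta (\<eta>\<^sub>2 x)" unfolding rel by (simp only:)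
  then show ?thesis by (simp add: algebra_simps)
qed

text \<open>Let \<open>b\<close> be the preimage of \<open>U\<close>, whose off-diagonal entry is 1.
  By \<open>inverse_U_vanishes\<close> the function \<open>E\<^sub>1 b\<close> is a multiple of
  \<open>z - z1\<close>, so a derivation at \<open>p\<close> that kills \<open>z - z1\<close> kills
  \<open>E\<^sub>1 b\<close> too. The remaining part \<open>X.quot b\<close> times
  \<open>X.U\<close> contributes nothing, because \<open>beta p = 0\<close> and the character of
  \<open>X.quot b\<close> vanishes at \<open>p\<close>.\<close>

lemma derivation_nonzero:
  assumes z1: "cmod z1 < 1" and al: "\<And>x. x \<in> disc \<Longrightarrow> alpha x = z1"
    and p: "p \<in> disc" "\<eta>\<^sub>2 p = p" "beta p = 0"
  shows "E\<^sub>2 (Y.quot (h (X.emb (\<lambda>z\<in>disc. z - z1)))) p \<noteq> 0"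
proof
  let ?\<zeta> = "\<lambda>z\<in>disc. z - z1"
  assume g0: "E\<^sub>2 (Y.quot (h (X.emb ?\<zeta>))) p = 0"
  have z1d: "z1 \<in> disc" using z1 by simp
  have inj: "x = y" if "x \<in> disc" "y \<in> disc" "beta x = beta y" for x y
    using ev_same[OF that(1,2)] that al by simp
  have zA: "?\<zeta> \<in> disc_algebra"
    by (rule restrict_disc_algebra) (auto simp: disc_hol_def intro!: continuous_intros holomorphic_intros)
  define b where "b = inv_h Y.U"
  have bB: "b \<in> X.B" and hb: "h b = Y.U" by (simp_all add: b_def)
  have fA: "E\<^sub>1 b \<in> disc_algebra" by (rule X.E0_S[OF bB])
  have fz: "E\<^sub>1 b z1 = 0" using inverse_U_vanishes[OF z1 al] by (simp add: b_def)
  obtain k where k: "disc_hol k" "\<And>z. z \<in> disc \<Longrightarrow> E\<^sub>1 b z = (z - z1) * k z"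
    using disc_hol_division[OF disc_algebraD(1)[OF fA], of z1] fz z1 by auto
  let ?k = "restrict k disc"
  have kA: "?k \<in> disc_algebra" by (rule restrict_disc_algebra[OF k(1)])
  have "E\<^sub>1 b = (\<lambda>z\<in>disc. ?\<zeta> z * ?k z)"
  proof (rule extensionalityI[OF disc_algebraD(2)[OF fA]])
    show "E\<^sub>1 b z = (\<lambda>z\<in>disc. ?\<zeta> z * ?k z) z" if "z \<in> disc" for z using k(2)[OF that] that by simp
  qed auto
  then have emb: "X.emb (E\<^sub>1 b) = X.emb ?\<zeta> \<otimes>\<^bsub>A\<^sub>1\<^esub> X.emb ?k"
    using emb_mult_disc[OF zA kA] by (simp only:)
  have ez: "E\<^sub>2 (h (X.emb ?\<zeta>)) p = 0"
    unfolding ev_emb[OF zA p(1)] al[OF p(1)] using z1d by simp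
  \<comment> \<open>Away from \<open>p\<close> the injective \<open>beta\<close> is not 0, while
    \<open>X.quot b\<close> times \<open>X.U\<close> is mapped to 0; the value at \<open>p\<close>
    follows from the identity theorem.\<close>
  have q0: "E\<^sub>2 (h (X.quot b)) p = 0"
  proof (rule disc_hol_zero_at[OF ev_hol[OF X.quot_B[OF bB]] p(1)])
    fix x assume x: "x \<in> disc" "x \<noteq> p"
    have "beta x \<noteq> 0" using inj[OF x(1) p(1)] x p by auto
    moreover have "E\<^sub>2 (h (X.quot b)) x * beta x = 0"
      using quot_B_decomp[OF bB x(1)] x Y.E0_U_at[of x] fz unfolding hb al[OF x(1)] by simp
    ultimately show "E\<^sub>2 (h (X.quot b)) x = 0" by simp
  qed
  have "E\<^sub>2 (Y.quot (h (X.emb (E\<^sub>1 b)))) p = 0"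
    unfolding emb E1h_mult[OF embB[OF zA] embB[OF kA] p(1)] g0 ez by simp
  then have "E\<^sub>2 (Y.quot (h b)) p = 0"
    unfolding E1h_decomp[OF bB p(1)] p(2) p(3) q0 by simp
  moreover have "E\<^sub>2 (Y.quot (h b)) p = 1" using p by (simp add: hb Y.quot_U Y.E0_one_at)
  ultimately show False by simp
qed

lemma rotation_case:
  assumes z1: "cmod z1 < 1" "\<eta>\<^sub>1 z1 = z1" and uniq: "\<And>w. w \<in> disc \<Longrightarrow> \<eta>\<^sub>1 w = w \<Longrightarrow> w = z1"
    and x0: "x0 \<in> disc" "beta x0 \<noteq> 0"
  shows "disc_homeo \<eta>\<^sub>1"
    "\<exists>\<gamma> \<theta>. disc_homeo \<gamma> \<and> \<gamma> holomorphic_on ball 0 1 \<and> homeomorphism disc disc \<eta>\<^sub>2 \<theta> \<and>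
       (\<forall>z\<in>disc. \<gamma> (\<eta>\<^sub>1 z) = \<theta> (\<gamma> z))"
proof -
  interpret R: disc_iso \<eta>\<^sub>2 A\<^sub>2 \<iota>\<^sub>2 E\<^sub>2 \<eta>\<^sub>1 A\<^sub>1 \<iota>\<^sub>1 E\<^sub>1 inv_h by (rule swap)
  have z1d: "z1 \<in> disc" using z1 by simp
  have al: "alpha x = z1" if x: "x \<in> disc" for x
  proof -
    have "continuous_on disc beta" using beta_hol by (simp add: disc_hol_def)
    then obtain V where V: "open V" "V \<noteq> {}" "V \<subseteq> ball 0 1" "\<And>w. w \<in> V \<Longrightarrow> beta w \<noteq> 0"
      using disc_hol_nonzero_open x0 by metis
    show ?thesis
    proof (rule disc_hol_identity[OF alpha_hol _ V(1-3) _ x])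
      show "disc_hol (\<lambda>_. z1)" by (simp add: disc_hol_def)
      fix w assume w: "w \<in> V"
      then have "w \<in> disc" using V(3) by auto
      then show "alpha w = z1" using uniq[OF alpha_in] beta_fixed V(4)[OF w] by blast
    qed
  qed
  have inj: "inj_on beta disc" using ev_same al by (intro inj_onI) auto
  define p where "p = R.alpha z1"
  have pd: "p \<in> disc" unfolding p_def by (rule R.alpha_in[OF z1d])
  \<comment> \<open>If \<open>R.beta y\<close> were 0, \<open>y\<close> would equal
    \<open>alpha (R.alpha y)\<close>, but \<open>alpha\<close> takes only the value
    \<open>z1\<close>.\<close>
  have Rb: "R.beta y \<noteq> 0" if y: "y \<in> disc" "y \<noteq> z1" for y
  proof
    assume "R.beta y = 0"
    from R.ev_zero_beta[OF y(1) this, of "h (X.emb idd)"]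
    have "E\<^sub>1 (X.emb idd) y = alpha (R.alpha y)" by (simp add: alpha_def)
    then have "y = z1"
      using al[OF R.alpha_in[OF y(1)]] X.E0_functions[OF X.S_CK[OF idd_disc_algebra]] y by simp
    then show False using y by simp
  qed
  have Rb0: "R.beta z1 = 0" using inverse_U_vanishes[OF z1(1) al] by (simp add: R.beta_def)
  \<comment> \<open>\<open>R.beta_fixed\<close> covers every point except \<open>z1\<close>, where
    the equation follows from the identity theorem.\<close>
  have Rfix: "\<eta>\<^sub>2 (R.alpha y) = R.alpha y" if y: "y \<in> disc" for y
  proof (cases "y = z1")
    case False
    then show ?thesis using R.beta_fixed[OF y Rb[OF y]] by simp
  next
    case True
    have "disc_hol (\<lambda>y. \<eta>\<^sub>2 (R.alpha y) - R.alpha y)"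
      by (rule disc_hol_ops(3)[OF disc_hol_comp[OF disc_map_hol[OF Y.eta_disc_map] R.alpha_disc_map] R.alpha_hol])
    from disc_hol_zero_at[OF this z1d] show ?thesis using R.beta_fixed Rb True by simp
  qed
  have p_fix: "\<eta>\<^sub>2 p = p" unfolding p_def by (rule Rfix[OF z1d])
  have bp: "beta p = 0"
    using R.ev_zero_beta[OF z1d Rb0, of "h X.U"] X.E0_U_at[of z1] z1d
    by (simp add: p_def beta_def)
  let ?l = "deriv \<eta>\<^sub>1 z1"
  have conj: "beta x = ?l * beta (\<eta>\<^sub>2 x)" if x: "x \<in> disc" for x
  proof -
    let ?g = "E\<^sub>2 (Y.quot (h (X.emb (\<lambda>z\<in>disc. z - z1))))"
    have zA: "(\<lambda>z\<in>disc. z - z1) \<in> disc_algebra"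
      by (rule restrict_disc_algebra) (auto simp: disc_hol_def intro!: continuous_intros holomorphic_intros)
    have "continuous_on disc ?g"
      using disc_algebraD(1)[OF Y.E0_S[OF Y.quot_B[OF h_B[OF embB[OF zA]]]]] by (simp add: disc_hol_def)
    then obtain V where V: "open V" "V \<noteq> {}" "V \<subseteq> ball 0 1" "\<And>w. w \<in> V \<Longrightarrow> ?g w \<noteq> 0"
      using disc_hol_nonzero_open pd derivation_nonzero[OF z1(1) al pd p_fix bp] by metis
    show ?thesis
    proof (rule disc_hol_identity[OF beta_hol _ V(1-3) _ x])
      show "disc_hol (\<lambda>x. ?l * beta (\<eta>\<^sub>2 x))"
        by (rule disc_hol_ops(2)[OF _ disc_hol_comp[OF beta_hol Y.eta_disc_map]]) (simp add: disc_hol_def)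
      fix w assume w: "w \<in> V"
      then have "w \<in> disc" using V(3) by auto
      from derivation_relation[OF z1 al this] V(4)[OF w] show "beta w = ?l * beta (\<eta>\<^sub>2 w)" by simp
    qed
  qed
  have sub1: "\<eta>\<^sub>1 ` ball 0 1 \<subseteq> ball 0 1" by (rule disc_map_interior[OF X.eta_disc_map z1])
  have hol1: "\<eta>\<^sub>1 holomorphic_on ball 0 1" and hol2: "\<eta>\<^sub>2 holomorphic_on ball 0 1"
    using X.eta_disc_map Y.eta_disc_map by (auto simp: disc_map_def)
  \<comment> \<open>Iterating \<open>conj\<close> gives
    \<open>beta x0 = ?l ^ n * beta ((\<eta>\<^sub>2 ^^ n) x0)\<close>. As \<open>beta\<close> is
    bounded, a multiplier of modulus below 1 would make \<open>beta x0\<close> vanish.\<close>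
  have l1: "cmod ?l = 1"
  proof (rule ccontr)
    assume "cmod ?l \<noteq> 1"
    then have less: "cmod ?l < 1" using schwarz_fixed_point(1)[OF hol1 sub1 z1] by simp
    have it: "(\<eta>\<^sub>2 ^^ n) x0 \<in> disc \<and> beta x0 = ?l ^ n * beta ((\<eta>\<^sub>2 ^^ n) x0)" for n
    proof (induction n)
      case (Suc n)
      then show ?case using conj[of "(\<eta>\<^sub>2 ^^ n) x0"] eta2_in[of "(\<eta>\<^sub>2 ^^ n) x0"] by (simp add: mult_ac)
    qed (use x0 in simp)
    have "compact (beta ` disc)"
      using beta_hol by (intro compact_continuous_image) (auto simp: disc_hol_def)
    then have "bounded (beta ` disc)" by (rule compact_imp_bounded)
    then obtain C where "\<forall>y\<in>beta ` disc. cmod y \<le> C" unfolding bounded_iff by (rule exE)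
    then have C: "cmod (beta x) \<le> C" if "x \<in> disc" for x using that by (simp only: ball_simps)
    have "cmod (beta x0) \<le> cmod ?l ^ n * C" for n
    proof -
      have "cmod (beta x0) = cmod ?l ^ n * cmod (beta ((\<eta>\<^sub>2 ^^ n) x0))"
        using it[of n] by (metis norm_mult norm_power)
      also have "\<dots> \<le> cmod ?l ^ n * C" using C it[of n] by (intro mult_left_mono) auto
      finally show ?thesis .
    qed
    moreover have "(\<lambda>n. cmod ?l ^ n * C) \<longlonglongrightarrow> 0"
      using tendsto_mult_left_zero[OF LIMSEQ_power_zero[of "cmod ?l"], of C] less by simp
    ultimately have "cmod (beta x0) \<le> 0" by (intro LIMSEQ_le_const[of _ 0]) auto
    then show False using x0 by simp
  qed
  have rot1: "moeb z1 (\<eta>\<^sub>1 z) = ?l * moeb z1 z" if "z \<in> disc" for z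
    by (rule disc_map_rotation[OF X.eta_disc_map z1 l1 that])
  show "disc_homeo \<eta>\<^sub>1"
    using rotation_homeomorphism[OF X.eta_disc_map z1(1) l1 rot1] unfolding disc_homeo_def by blast
  \<comment> \<open>\<open>?l = 1\<close> would make \<open>\<eta>\<^sub>1\<close> the identity,
    which fixes both 0 and 1.\<close>
  have l_ne_1: "?l \<noteq> 1"
  proof
    assume l: "?l = 1"
    have id1: "\<eta>\<^sub>1 z = z" if z: "z \<in> disc" for z
      using rot1[OF z] moeb_inverse[OF z1(1) z] moeb_inverse[OF z1(1) disc_map_in[OF X.eta_disc_map z]] l by simp
    have "(0::complex) = z1" "(1::complex) = z1" using uniq id1 by auto
    then show False by simp
  qed
  \<comment> \<open>At a fixed point \<open>conj\<close> reads \<open>beta x = ?l * beta x\<close>,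
    and the injective \<open>beta\<close> vanishes only at \<open>p\<close>.\<close>
  have fix2: "x = p" if x: "x \<in> disc" "\<eta>\<^sub>2 x = x" for x
  proof -
    have "beta x = ?l * beta x" using conj[OF x(1)] x(2) by simp
    then have "beta x = 0" using l_ne_1 by simp
    then show ?thesis using inj_onD[OF inj, of x p] bp x pd by simp
  qed
  have Ra: "R.alpha y = p" if y: "y \<in> disc" for y using fix2[OF R.alpha_in[OF y] Rfix[OF y]] .
  \<comment> \<open>If \<open>p\<close> were on the circle, \<open>beta\<close> would be a square
    \<open>s * s\<close> in the disc algebra. The preimage of \<open>Y.emb ?s\<close> is killed by
    the character at the fixed point \<open>z1\<close>, so by the product rule the preimage of its
    square has off-diagonal entry 0 there. \<open>X.U\<close> differs from it only by a term with
    entry 0, which contradicts the entry 1 of \<open>X.U\<close>.\<close>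
  have p1: "cmod p < 1"
  proof (rule ccontr)
    assume "\<not> cmod p < 1"
    then have cp: "cmod p = 1" using pd by simp
    have "beta z \<noteq> 0" if "z \<in> disc" "z \<noteq> p" for z using inj_onD[OF inj, of z p] bp that pd by auto
    then obtain s where s: "disc_hol s" "\<And>z. z \<in> disc \<Longrightarrow> beta z = s z * s z" "s p = 0"
      using disc_hol_sqrt[OF beta_hol cp bp] by metis
    let ?s = "restrict s disc"
    have sA: "?s \<in> disc_algebra" by (rule restrict_disc_algebra[OF s(1)])
    define b where "b = h X.U"
    have bB: "b \<in> Y.B" and hb: "inv_h b = X.U" by (simp_all add: b_def)
    have "E\<^sub>2 b = (\<lambda>z\<in>disc. ?s z * ?s z)"
    proof (rule extensionalityI[OF disc_algebraD(2)[OF Y.E0_S[OF bB]]])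
      show "E\<^sub>2 b z = (\<lambda>z\<in>disc. ?s z * ?s z) z" if "z \<in> disc" for z
        using s(2)[OF that] that by (simp add: b_def beta_def)
    qed auto
    then have emb: "Y.emb (E\<^sub>2 b) = Y.emb ?s \<otimes>\<^bsub>A\<^sub>2\<^esub> Y.emb ?s"
      using R.emb_mult_disc[OF sA sA] by (simp only:)
    have es: "E\<^sub>1 (inv_h (Y.emb ?s)) z1 = 0"
      unfolding R.ev_emb[OF sA z1d] Ra[OF z1d] using s(3) pd by simp
    have q0: "E\<^sub>1 (inv_h (Y.quot b)) z1 = 0"
    proof (rule disc_hol_zero_at[OF R.ev_hol[OF Y.quot_B[OF bB]] z1d])
      fix y assume y: "y \<in> disc" "y \<noteq> z1"
      have "E\<^sub>2 b p = 0" using bp by (simp add: b_def beta_def)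
      then have "E\<^sub>1 (inv_h (Y.quot b)) y * R.beta y = 0"
        using R.quot_B_decomp[OF bB y(1)] X.E0_U_at[of y] y unfolding hb Ra[OF y(1)] by simp
      then show "E\<^sub>1 (inv_h (Y.quot b)) y = 0" using Rb[OF y] by simp
    qed
    have "E\<^sub>1 (X.quot (inv_h (Y.emb (E\<^sub>2 b)))) z1 = 0"
      unfolding emb R.E1h_mult[OF embBY[OF sA] embBY[OF sA] z1d] z1(2) es by simp
    then have "E\<^sub>1 (X.quot (inv_h b)) z1 = 0"
      unfolding R.E1h_decomp[OF bB z1d] z1(2) Rb0 q0 by simp
    moreover have "E\<^sub>1 (X.quot (inv_h b)) z1 = 1" using z1d by (simp add: hb X.quot_U X.E0_one_at)
    ultimately show False by simp
  qed
  have pb: "p \<in> ball 0 1" using p1 by simp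
  \<comment> \<open>Chain rule in \<open>conj\<close> at the fixed point \<open>p\<close>;
    \<open>deriv beta p\<close> cancels because an injective analytic function has no critical
    point.\<close>
  have d2: "?l * deriv \<eta>\<^sub>2 p = 1"
  proof -
    have bh: "beta holomorphic_on ball 0 1" using beta_hol by (simp add: disc_hol_def)
    have db: "(beta has_field_derivative deriv beta p) (at p)" by (rule holomorphic_derivI[OF bh open_ball pb])
    have "(\<eta>\<^sub>2 has_field_derivative deriv \<eta>\<^sub>2 p) (at p)" by (rule holomorphic_derivI[OF hol2 open_ball pb])
    moreover have "(beta has_field_derivative deriv beta p) (at (\<eta>\<^sub>2 p))" using db p_fix by simp
    ultimately have "((\<lambda>x. beta (\<eta>\<^sub>2 x)) has_field_derivative deriv beta p * deriv \<eta>\<^sub>2 p) (at p)"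
      by (rule DERIV_chain2[rotated])
    then have "((\<lambda>x. ?l * beta (\<eta>\<^sub>2 x)) has_field_derivative ?l * (deriv beta p * deriv \<eta>\<^sub>2 p)) (at p)"
      by (rule DERIV_cmult)
    moreover have "\<forall>\<^sub>F x in nhds p. beta x = ?l * beta (\<eta>\<^sub>2 x)"
    proof -
      have "\<forall>\<^sub>F x in nhds p. x \<in> ball 0 1" using pb by (intro eventually_nhds_in_open) auto
      then show ?thesis by eventually_elim (use conj in auto)
    qed
    ultimately have "deriv beta p = ?l * (deriv beta p * deriv \<eta>\<^sub>2 p)"
      using db DERIV_cong_ev[of p p beta "\<lambda>x. ?l * beta (\<eta>\<^sub>2 x)"] DERIV_unique by metis
    moreover have "deriv beta p \<noteq> 0"
      by (rule holomorphic_injective_imp_regular[OF bh open_ball _ pb]) (rule inj_on_subset[OF inj], auto)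
    ultimately show ?thesis by (simp add: mult_ac)
  qed
  have d2': "deriv \<eta>\<^sub>2 p = inverse ?l" using d2 by (metis inverse_unique)
  have d21: "cmod (deriv \<eta>\<^sub>2 p) = 1" unfolding d2' using l1 by (simp add: norm_inverse)
  have rot2: "moeb p (\<eta>\<^sub>2 z) = deriv \<eta>\<^sub>2 p * moeb p z" if "z \<in> disc" for z
    by (rule disc_map_rotation[OF Y.eta_disc_map p1 p_fix d21 that])
  define \<theta> where "\<theta> = (\<lambda>z. moeb (-p) (inverse (deriv \<eta>\<^sub>2 p) * moeb p z))"
  have th: "homeomorphism disc disc \<eta>\<^sub>2 \<theta>"
    unfolding \<theta>_def by (rule rotation_homeomorphism[OF Y.eta_disc_map p1 d21 rot2])
  \<comment> \<open>Takes \<open>z1\<close> through 0 to \<open>p\<close>. In these coordinates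
    \<open>\<eta>\<^sub>1\<close> is multiplication by \<open>?l\<close>, and so is the inverse
    \<open>\<theta>\<close> of \<open>\<eta>\<^sub>2\<close>.\<close>
  define \<gamma> where "\<gamma> = (\<lambda>z. moeb (-p) (moeb z1 z))"
  have np: "cmod (-p) < 1" using p1 by simp
  have "homeomorphism disc disc (moeb (-p) \<circ> moeb z1) (moeb (-z1) \<circ> moeb (-(-p)))"
    by (rule homeomorphism_compose[OF moeb_homeo[OF z1(1)] moeb_homeo[OF np]])
  then have gh: "disc_homeo \<gamma>" unfolding disc_homeo_def \<gamma>_def o_def by blast
  have ghol: "\<gamma> holomorphic_on ball 0 1"
    using disc_hol_comp[OF moeb_disc_hol[OF np] moeb_disc_map[OF z1(1)]] by (simp add: \<gamma>_def disc_hol_def)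
  have "\<gamma> (\<eta>\<^sub>1 z) = \<theta> (\<gamma> z)" if z: "z \<in> disc" for z
    using rot1[OF z] moeb_inverse[OF np disc_map_in[OF moeb_disc_map[OF z1(1)] z]]
    by (simp add: \<gamma>_def \<theta>_def d2')
  then show "\<exists>\<gamma> \<theta>. disc_homeo \<gamma> \<and> \<gamma> holomorphic_on ball 0 1 \<and> homeomorphism disc disc \<eta>\<^sub>2 \<theta> \<and>
       (\<forall>z\<in>disc. \<gamma> (\<eta>\<^sub>1 z) = \<theta> (\<gamma> z))"
    using gh ghol th by blast
qed

end

section \<open>The semicrossed product norm\<close>

type_synonym coeffs = "nat \<Rightarrow> complex \<Rightarrow> complex"

text \<open>Elements of the completion are represented by their coefficient sequences. The product
  needs only finite sums, so it makes sense for all sequences, bounded or not.\<close>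

definition coeff_seqs :: "coeffs set" where
  "coeff_seqs = {a. \<forall>n. a n \<in> extensional disc \<and> continuous_on disc (a n)}"

definition cadd :: "coeffs \<Rightarrow> coeffs \<Rightarrow> coeffs" where "cadd a b = (\<lambda>n. \<lambda>x\<in>disc. a n x + b n x)"
definition cdiff :: "coeffs \<Rightarrow> coeffs \<Rightarrow> coeffs" where "cdiff a b = (\<lambda>n. \<lambda>x\<in>disc. a n x - b n x)"
definition csm :: "complex \<Rightarrow> coeffs \<Rightarrow> coeffs" where "csm c a = (\<lambda>n. \<lambda>x\<in>disc. c * a n x)"
definition cunit :: coeffs where "cunit = (\<lambda>n. \<lambda>x\<in>disc. if n = 0 then 1 else 0)"
definition czero :: coeffs where "czero = (\<lambda>n. \<lambda>x\<in>disc. 0)"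
definition cmul :: "(complex \<Rightarrow> complex) \<Rightarrow> coeffs \<Rightarrow> coeffs \<Rightarrow> coeffs" where
  "cmul \<eta> a b = (\<lambda>n. \<lambda>x\<in>disc. \<Sum>i\<le>n. a i x * b (n - i) ((\<eta> ^^ i) x))"
definition cmon :: "(complex \<Rightarrow> complex) \<Rightarrow> nat \<Rightarrow> coeffs" where
  "cmon f n = (\<lambda>m. \<lambda>x\<in>disc. if m = n then f x else 0)"

text \<open>
  The upper triangular \<open>N \<times> N\<close> matrix with entries \<open>a\<^bsub>l-k\<^esub> (\<eta>\<^sup>k x)\<close>, applied to \<open>\<xi>\<close>; the norm
  of \<open>a\<close> is the supremum of the Hilbert space norms of these matrices.
\<close>

definition act :: "(complex \<Rightarrow> complex) \<Rightarrow> coeffs \<Rightarrow> complex \<Rightarrow> nat \<Rightarrow> (nat \<Rightarrow> complex) \<Rightarrow> nat \<Rightarrow> complex" where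
  "act \<eta> a x N \<xi> k = (\<Sum>l\<in>{k..<N}. a (l - k) ((\<eta> ^^ k) x) * \<xi> l)"

definition l2 :: "nat \<Rightarrow> (nat \<Rightarrow> complex) \<Rightarrow> real" where
  "l2 N \<xi> = L2_set (\<lambda>k. cmod (\<xi> k)) {..<N}"

text \<open>Estimates are carried out with this predicate: a sequence without a bound has infinite
  operator norm, while the infimum \<open>cnorm\<close> is a real number in any case.\<close>

definition bnd :: "(complex \<Rightarrow> complex) \<Rightarrow> coeffs \<Rightarrow> real \<Rightarrow> bool" where
  "bnd \<eta> a C \<longleftrightarrow> C \<ge> 0 \<and> (\<forall>x\<in>disc. \<forall>N \<xi>. l2 N (act \<eta> a x N \<xi>) \<le> C * l2 N \<xi>)"

definition cnorm :: "(complex \<Rightarrow> complex) \<Rightarrow> coeffs \<Rightarrow> real" where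
  "cnorm \<eta> a = Inf {C. bnd \<eta> a C}"

lemma l2_nonneg: "l2 N \<xi> \<ge> 0" by (simp add: l2_def)

lemma l2_cong: "(\<And>k. k < N \<Longrightarrow> \<xi> k = \<zeta> k) \<Longrightarrow> l2 N \<xi> = l2 N \<zeta>"
  unfolding l2_def by (intro L2_set_cong) auto

lemma l2_triangle: "l2 N (\<lambda>k. \<xi> k + \<zeta> k) \<le> l2 N \<xi> + l2 N \<zeta>"
proof -
  have "l2 N (\<lambda>k. \<xi> k + \<zeta> k) \<le> L2_set (\<lambda>k. cmod (\<xi> k) + cmod (\<zeta> k)) {..<N}"
    unfolding l2_def by (intro L2_set_mono norm_triangle_ineq) auto
  also have "\<dots> \<le> l2 N \<xi> + l2 N \<zeta>" unfolding l2_def by (rule L2_set_triangle_ineq)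
  finally show ?thesis .
qed

lemma l2_scale: "l2 N (\<lambda>k. c * \<xi> k) = cmod c * l2 N \<xi>"
  unfolding l2_def by (simp add: norm_mult L2_set_right_distrib)

lemma l2_member: "k < N \<Longrightarrow> cmod (\<xi> k) \<le> l2 N \<xi>"
  unfolding l2_def by (rule member_le_L2_set) auto

lemma bndI: "C \<ge> 0 \<Longrightarrow> (\<And>x N \<xi>. x \<in> disc \<Longrightarrow> l2 N (act \<eta> a x N \<xi>) \<le> C * l2 N \<xi>) \<Longrightarrow> bnd \<eta> a C"
  by (simp add: bnd_def)

lemma bndD: "bnd \<eta> a C \<Longrightarrow> x \<in> disc \<Longrightarrow> l2 N (act \<eta> a x N \<xi>) \<le> C * l2 N \<xi>" "bnd \<eta> a C \<Longrightarrow> C \<ge> 0"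
  by (simp_all add: bnd_def)

lemma bnd_mono: "bnd \<eta> a C \<Longrightarrow> C \<le> D \<Longrightarrow> bnd \<eta> a D"
  unfolding bnd_def using l2_nonneg by (meson mult_right_mono order_trans)

lemma bnd_cnorm_le: "bnd \<eta> a C \<Longrightarrow> cnorm \<eta> a \<le> C"
  unfolding cnorm_def by (intro cInf_lower) (auto simp: bnd_def intro: bdd_belowI[of _ 0])

text \<open>For a fixed nonzero vector the admissible \<open>C\<close> are those above a fixed
  quotient, so the infimum of all bounds is itself a bound.\<close>

lemma bnd_cnorm:
  assumes "bnd \<eta> a C"
  shows "bnd \<eta> a (cnorm \<eta> a)"
proof (rule bndI)
  have ne: "{C. bnd \<eta> a C} \<noteq> {}" using assms by auto
  show "cnorm \<eta> a \<ge> 0" unfolding cnorm_def using ne by (intro cInf_greatest) (auto dest: bndD(2))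
  fix x :: complex and N :: nat and \<xi> :: "nat \<Rightarrow> complex" assume x: "x \<in> disc"
  show "l2 N (act \<eta> a x N \<xi>) \<le> cnorm \<eta> a * l2 N \<xi>"
  proof (cases "l2 N \<xi> = 0")
    case True then show ?thesis using bndD(1)[OF assms x, of N \<xi>] by simp
  next
    case False
    then have pos: "l2 N \<xi> > 0" using l2_nonneg[of N \<xi>] by simp
    have "l2 N (act \<eta> a x N \<xi>) / l2 N \<xi> \<le> cnorm \<eta> a"
      unfolding cnorm_def
    proof (rule cInf_greatest[OF ne])
      fix D assume "D \<in> {C. bnd \<eta> a C}"
      then show "l2 N (act \<eta> a x N \<xi>) / l2 N \<xi> \<le> D"
        using bndD(1)[of \<eta> a D x N \<xi>] x pos by (simp add: pos_divide_le_eq)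
    qed
    then show ?thesis using pos by (simp add: pos_divide_le_eq)
  qed
qed

lemma cs_simps [simp]:
  "x \<in> disc \<Longrightarrow> cadd a b n x = a n x + b n x" "x \<in> disc \<Longrightarrow> cdiff a b n x = a n x - b n x"
  "x \<in> disc \<Longrightarrow> csm c a n x = c * a n x" "x \<in> disc \<Longrightarrow> czero n x = 0"
  "x \<in> disc \<Longrightarrow> cunit n x = (if n = 0 then 1 else 0)"
  "x \<in> disc \<Longrightarrow> cmon f m n x = (if n = m then f x else 0)"
  by (simp_all add: cadd_def cdiff_def csm_def cunit_def czero_def cmon_def)

lemma coeff_seqs_eqI: "a \<in> coeff_seqs \<Longrightarrow> b \<in> coeff_seqs \<Longrightarrow> (\<And>n x. x \<in> disc \<Longrightarrow> a n x = b n x) \<Longrightarrow> a = b"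
  unfolding coeff_seqs_def by (intro ext) (metis (mono_tags, lifting) extensional_arb mem_Collect_eq)

lemma coeff_seqsI:
  "(\<And>n. continuous_on disc (f n)) \<Longrightarrow> (\<lambda>n. restrict (f n) disc) \<in> coeff_seqs"
proof -
  assume f: "\<And>n. continuous_on disc (f n)"
  have "continuous_on disc (restrict (f n) disc)" for n
    by (rule continuous_on_eq[OF f]) simp
  then show ?thesis by (simp add: coeff_seqs_def)
qed

lemma coeff_seqs_cont: "a \<in> coeff_seqs \<Longrightarrow> continuous_on disc (a n)" by (simp add: coeff_seqs_def)

lemma coeff_seqs_ops [simp]:
  assumes "a \<in> coeff_seqs" "b \<in> coeff_seqs"
  shows "cadd a b \<in> coeff_seqs" "cdiff a b \<in> coeff_seqs"
  unfolding cadd_def cdiff_def using assms[THEN coeff_seqs_cont]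
  by (auto intro!: coeff_seqsI continuous_intros)

lemma csm_seqs [simp]: "a \<in> coeff_seqs \<Longrightarrow> csm c a \<in> coeff_seqs"
  unfolding csm_def by (intro coeff_seqsI continuous_intros coeff_seqs_cont)

lemma coeff_seqs_consts [simp]: "czero \<in> coeff_seqs" "cunit \<in> coeff_seqs"
  unfolding czero_def cunit_def by (auto intro!: coeff_seqsI continuous_intros)

lemma cmon_seqs [simp]: "continuous_on disc f \<Longrightarrow> cmon f n \<in> coeff_seqs"
  unfolding cmon_def
proof (rule coeff_seqsI)
  fix m assume "continuous_on disc f"
  then show "continuous_on disc (\<lambda>x. if m = n then f x else 0)" by (cases "m = n") simp_all
qed

lemma cshift_seqs [simp]: "a \<in> coeff_seqs \<Longrightarrow> (\<lambda>n. a (Suc n)) \<in> coeff_seqs"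
  by (simp add: coeff_seqs_def)

section \<open>The triangular matrix representation and its bounds\<close>

locale disc_dynamics =
  fixes \<eta> :: "complex \<Rightarrow> complex"
  assumes eta_cont: "continuous_on disc \<eta>" and eta_maps: "\<eta> ` disc \<subseteq> disc"
begin

lemma pow_in: "x \<in> disc \<Longrightarrow> (\<eta> ^^ k) x \<in> disc"
proof (induction k)
  case (Suc k)
  then show ?case using eta_maps by (simp only: funpow.simps o_apply) blast
qed simp

lemma norm_pow_le [simp]: "cmod x \<le> 1 \<Longrightarrow> cmod ((\<eta> ^^ k) x) \<le> 1"
  using pow_in[of x k] by simp

lemma pow_cont: "continuous_on disc (\<eta> ^^ k)"
proof (induction k)
  case (Suc k)
  then show ?case
    unfolding funpow.simps o_def
    by (intro continuous_on_compose2[OF eta_cont]) (auto simp del: mem_cball_0)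
qed (simp add: continuous_on_id)

lemma cmul_seqs [simp]: "a \<in> coeff_seqs \<Longrightarrow> b \<in> coeff_seqs \<Longrightarrow> cmul \<eta> a b \<in> coeff_seqs"
  unfolding cmul_def
  by (intro coeff_seqsI continuous_intros continuous_on_compose2[OF coeff_seqs_cont pow_cont] coeff_seqs_cont) auto

lemma cmul_at: "x \<in> disc \<Longrightarrow> cmul \<eta> a b n x = (\<Sum>i\<le>n. a i x * b (n - i) ((\<eta> ^^ i) x))"
  by (simp add: cmul_def)

lemma act_cadd: "x \<in> disc \<Longrightarrow> act \<eta> (cadd a b) x N \<xi> k = act \<eta> a x N \<xi> k + act \<eta> b x N \<xi> k"
  by (simp add: act_def distrib_right sum.distrib)

lemma act_csm: "x \<in> disc \<Longrightarrow> act \<eta> (csm c a) x N \<xi> k = c * act \<eta> a x N \<xi> k"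
  by (simp add: act_def sum_distrib_left mult.assoc)

lemma act_cunit: "x \<in> disc \<Longrightarrow> k < N \<Longrightarrow> act \<eta> cunit x N \<xi> k = \<xi> k"
proof -
  assume x: "x \<in> disc" and k: "k < N"
  have "act \<eta> cunit x N \<xi> k = (\<Sum>l\<in>{k..<N}. if l = k then \<xi> k else 0)"
    unfolding act_def using x by (intro sum.cong) auto
  then show ?thesis using k by simp
qed

text \<open>Row \<open>k\<close> of the left factor meets column \<open>l\<close> of the right one
  at a middle index \<open>m = k + i\<close>, and
  \<open>(\<eta> ^^ i) ((\<eta> ^^ k) x) = (\<eta> ^^ m) x\<close> makes the sum over
  \<open>m\<close> the twisted convolution.\<close>

lemma act_cmul:
  assumes x: "x \<in> disc"
  shows "act \<eta> (cmul \<eta> a b) x N \<xi> k = act \<eta> a x N (act \<eta> b x N \<xi>) k"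
proof -
  let ?y = "(\<eta> ^^ k) x"
  let ?t = "\<lambda>m l. a (m - k) ?y * (b (l - m) ((\<eta> ^^ m) x) * \<xi> l)"
  have inner: "cmul \<eta> a b (l - k) ?y * \<xi> l = (\<Sum>m | m \<in> {k..<N} \<and> m \<le> l. ?t m l)" if l: "l \<in> {k..<N}" for l
  proof -
    have "cmul \<eta> a b (l - k) ?y * \<xi> l = (\<Sum>i\<le>l - k. a i ?y * (b (l - k - i) ((\<eta> ^^ i) ?y) * \<xi> l))"
      using x by (simp add: cmul_at sum_distrib_right mult.assoc)
    also have "\<dots> = (\<Sum>m | m \<in> {k..<N} \<and> m \<le> l. ?t m l)"
    proof (rule sum.reindex_bij_witness[of _ "\<lambda>m. m - k" "\<lambda>i. i + k"])
      fix i assume "i \<in> {..l - k}"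
      have "(\<eta> ^^ i) ?y = (\<eta> ^^ (i + k)) x" by (simp add: funpow_add)
      then show "?t (i + k) l = a i ?y * (b (l - k - i) ((\<eta> ^^ i) ?y) * \<xi> l)"
        by (simp add: add.commute)
    qed (use l in auto)
    finally show ?thesis .
  qed
  have "act \<eta> (cmul \<eta> a b) x N \<xi> k = (\<Sum>l\<in>{k..<N}. \<Sum>m | m \<in> {k..<N} \<and> m \<le> l. ?t m l)"
    unfolding act_def using inner by (intro sum.cong) auto
  also have "\<dots> = (\<Sum>m\<in>{k..<N}. \<Sum>l | l \<in> {k..<N} \<and> m \<le> l. ?t m l)"
    by (rule sum.swap_restrict) auto
  also have "\<dots> = (\<Sum>m\<in>{k..<N}. a (m - k) ?y * (\<Sum>l\<in>{m..<N}. b (l - m) ((\<eta> ^^ m) x) * \<xi> l))"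
  proof (rule sum.cong[OF refl])
    fix m assume "m \<in> {k..<N}"
    then have "{l. l \<in> {k..<N} \<and> m \<le> l} = {m..<N}" by auto
    then show "(\<Sum>l | l \<in> {k..<N} \<and> m \<le> l. ?t m l) = a (m - k) ?y * (\<Sum>l\<in>{m..<N}. b (l - m) ((\<eta> ^^ m) x) * \<xi> l)"
      by (simp add: sum_distrib_left)
  qed
  finally show ?thesis by (simp add: act_def)
qed

lemma act_basis: "x \<in> disc \<Longrightarrow> act \<eta> a x (Suc n) (\<lambda>l. if l = n then 1 else 0) 0 = a n x"
proof -
  assume x: "x \<in> disc"
  have "act \<eta> a x (Suc n) (\<lambda>l. if l = n then 1 else 0) 0 = (\<Sum>l\<in>{0..<Suc n}. if l = n then a n x else 0)"
    unfolding act_def by (intro sum.cong) auto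
  then show ?thesis by simp
qed

text \<open>The first rows of the matrices contain all coefficients, so the representation is
  faithful and ring laws for \<open>cmul\<close> can be checked on vectors.\<close>

lemma act_inj:
  assumes "a \<in> coeff_seqs" "b \<in> coeff_seqs"
    and "\<And>x N \<xi> k. x \<in> disc \<Longrightarrow> k < N \<Longrightarrow> act \<eta> a x N \<xi> k = act \<eta> b x N \<xi> k"
  shows "a = b"
  using assms(3)[of _ 0 "Suc n" for n] act_basis by (intro coeff_seqs_eqI[OF assms(1,2)]) (metis zero_less_Suc)

lemma act_cong: "(\<And>l. l < N \<Longrightarrow> \<xi> l = \<zeta> l) \<Longrightarrow> act \<eta> a x N \<xi> k = act \<eta> a x N \<zeta> k"
  unfolding act_def by (intro sum.cong) auto

lemma cmul_assoc:
  assumes [simp]: "a \<in> coeff_seqs" "b \<in> coeff_seqs" "c \<in> coeff_seqs"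
  shows "cmul \<eta> (cmul \<eta> a b) c = cmul \<eta> a (cmul \<eta> b c)"
  by (rule act_inj) (auto simp: act_cmul simp del: mem_cball_0 intro: act_cong)

lemma cmul_cunit [simp]:
  assumes [simp]: "a \<in> coeff_seqs"
  shows "cmul \<eta> cunit a = a" "cmul \<eta> a cunit = a"
  by (rule act_inj; auto simp: act_cmul act_cunit simp del: mem_cball_0 intro: act_cong)+

lemma cmul_distrib:
  assumes [simp]: "a \<in> coeff_seqs" "b \<in> coeff_seqs" "c \<in> coeff_seqs"
  shows "cmul \<eta> (cadd a b) c = cadd (cmul \<eta> a c) (cmul \<eta> b c)"
    "cmul \<eta> c (cadd a b) = cadd (cmul \<eta> c a) (cmul \<eta> c b)"
    "cmul \<eta> (csm k a) b = csm k (cmul \<eta> a b)" "cmul \<eta> a (csm k b) = csm k (cmul \<eta> a b)"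
    "cmul \<eta> (cdiff a b) c = cdiff (cmul \<eta> a c) (cmul \<eta> b c)"
    "cmul \<eta> c (cdiff a b) = cdiff (cmul \<eta> c a) (cmul \<eta> c b)"
  by (intro coeff_seqs_eqI cmul_seqs coeff_seqs_ops csm_seqs assms;
      simp add: cmul_at sum.distrib distrib_left distrib_right sum_distrib_left mult_ac
        left_diff_distrib right_diff_distrib sum_subtractf del: mem_cball_0)+

lemma bnd_cadd: "bnd \<eta> a C \<Longrightarrow> bnd \<eta> b D \<Longrightarrow> bnd \<eta> (cadd a b) (C + D)"
proof (rule bndI)
  assume ab: "bnd \<eta> a C" "bnd \<eta> b D"
  show "C + D \<ge> 0" using ab bndD(2) by fastforce
  fix x :: complex and N :: nat and \<xi> :: "nat \<Rightarrow> complex" assume x: "x \<in> disc"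
  have "l2 N (act \<eta> (cadd a b) x N \<xi>) \<le> l2 N (act \<eta> a x N \<xi>) + l2 N (act \<eta> b x N \<xi>)"
    unfolding ext[of "act \<eta> (cadd a b) x N \<xi>", OF act_cadd[OF x]] by (rule l2_triangle)
  also have "\<dots> \<le> (C + D) * l2 N \<xi>"
    using bndD(1)[OF ab(1) x, of N \<xi>] bndD(1)[OF ab(2) x, of N \<xi>] by (simp add: distrib_right)
  finally show "l2 N (act \<eta> (cadd a b) x N \<xi>) \<le> (C + D) * l2 N \<xi>" .
qed

lemma bnd_csm: "bnd \<eta> a C \<Longrightarrow> bnd \<eta> (csm c a) (cmod c * C)"
proof (rule bndI)
  assume a: "bnd \<eta> a C"
  show "cmod c * C \<ge> 0" using bndD(2)[OF a] by simp
  fix x :: complex and N :: nat and \<xi> :: "nat \<Rightarrow> complex" assume x: "x \<in> disc"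
  have "l2 N (act \<eta> (csm c a) x N \<xi>) = cmod c * l2 N (act \<eta> a x N \<xi>)"
    unfolding ext[of "act \<eta> (csm c a) x N \<xi>", OF act_csm[OF x]] by (rule l2_scale)
  then show "l2 N (act \<eta> (csm c a) x N \<xi>) \<le> cmod c * C * l2 N \<xi>"
    using mult_left_mono[OF bndD(1)[OF a x, of N \<xi>], of "cmod c"] by (simp add: mult.assoc)
qed

lemma bnd_cdiff: "bnd \<eta> a C \<Longrightarrow> bnd \<eta> b D \<Longrightarrow> bnd \<eta> (cdiff a b) (C + D)"
proof -
  assume ab: "bnd \<eta> a C" "bnd \<eta> b D"
  have "cdiff a b = cadd a (csm (-1) b)" by (auto simp: cdiff_def cadd_def csm_def fun_eq_iff)
  then show ?thesis using bnd_cadd[OF ab(1) bnd_csm[OF ab(2), of "-1"]] by simp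
qed

lemma bnd_cmul: "bnd \<eta> a C \<Longrightarrow> bnd \<eta> b D \<Longrightarrow> bnd \<eta> (cmul \<eta> a b) (C * D)"
proof (rule bndI)
  assume ab: "bnd \<eta> a C" "bnd \<eta> b D"
  show "C * D \<ge> 0" using ab[THEN bndD(2)] by simp
  fix x :: complex and N :: nat and \<xi> :: "nat \<Rightarrow> complex" assume x: "x \<in> disc"
  have "l2 N (act \<eta> (cmul \<eta> a b) x N \<xi>) = l2 N (act \<eta> a x N (act \<eta> b x N \<xi>))"
    by (rule l2_cong[OF act_cmul[OF x]])
  also have "\<dots> \<le> C * l2 N (act \<eta> b x N \<xi>)" by (rule bndD(1)[OF ab(1) x])
  also have "\<dots> \<le> C * (D * l2 N \<xi>)" by (rule mult_left_mono[OF bndD(1)[OF ab(2) x] bndD(2)[OF ab(1)]])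
  finally show "l2 N (act \<eta> (cmul \<eta> a b) x N \<xi>) \<le> C * D * l2 N \<xi>" by (simp add: mult.assoc)
qed

lemma bnd_coeff: "bnd \<eta> a C \<Longrightarrow> x \<in> disc \<Longrightarrow> cmod (a n x) \<le> C"
proof -
  assume a: "bnd \<eta> a C" and x: "x \<in> disc"
  let ?e = "\<lambda>l. if l = n then 1 else (0::complex)"
  have "l2 (Suc n) ?e = sqrt (\<Sum>k<Suc n. if k = n then 1 else 0)"
    unfolding l2_def L2_set_def by (intro arg_cong[of _ _ sqrt] sum.cong) auto
  then have "l2 (Suc n) ?e = 1" by simp
  then show ?thesis
    using l2_member[of 0 "Suc n" "act \<eta> a x (Suc n) ?e"] bndD(1)[OF a x, of "Suc n" ?e] act_basis[OF x, of a n]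
    by simp
qed

lemma bnd_czero: "bnd \<eta> czero 0"
proof (rule bndI)
  fix x :: complex and N :: nat and \<xi> :: "nat \<Rightarrow> complex" assume x: "x \<in> disc"
  have "act \<eta> czero x N \<xi> k = 0" for k using x by (simp add: act_def)
  then show "l2 N (act \<eta> czero x N \<xi>) \<le> 0 * l2 N \<xi>" by (simp add: l2_def L2_set_def)
qed simp

lemma act_cmon:
  assumes x: "x \<in> disc"
  shows "act \<eta> (cmon f n) x N \<xi> k = (if k + n < N then f ((\<eta> ^^ k) x) * \<xi> (k + n) else 0)"
proof -
  have "act \<eta> (cmon f n) x N \<xi> k = (\<Sum>l\<in>{k..<N}. if l = k + n then f ((\<eta> ^^ k) x) * \<xi> (k + n) else 0)"
    unfolding act_def using x by (intro sum.cong) auto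
  then show ?thesis by simp
qed

text \<open>\<open>f U\<^sup>n\<close> acts as a weighted shift by \<open>n\<close> places with
  weights of modulus at most \<open>M\<close>.\<close>

lemma bnd_cmon:
  assumes f: "\<And>x. x \<in> disc \<Longrightarrow> cmod (f x) \<le> M" and M: "M \<ge> 0"
  shows "bnd \<eta> (cmon f n) M"
proof (rule bndI[OF M])
  fix x :: complex and N :: nat and \<xi> :: "nat \<Rightarrow> complex" assume x: "x \<in> disc"
  have "(\<Sum>k<N. (cmod (act \<eta> (cmon f n) x N \<xi> k))\<^sup>2) \<le> M\<^sup>2 * (\<Sum>k<N. (cmod (\<xi> k))\<^sup>2)"
  proof -
    have "(\<Sum>k<N. (cmod (act \<eta> (cmon f n) x N \<xi> k))\<^sup>2) = (\<Sum>k<N - n. (cmod (f ((\<eta> ^^ k) x) * \<xi> (k + n)))\<^sup>2)"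
      unfolding act_cmon[OF x] by (intro sum.mono_neutral_cong_right) auto
    also have "\<dots> \<le> (\<Sum>k<N - n. M\<^sup>2 * (cmod (\<xi> (k + n)))\<^sup>2)"
      unfolding norm_mult power_mult_distrib
      by (intro sum_mono mult_right_mono power_mono f pow_in x) auto
    also have "\<dots> = M\<^sup>2 * (\<Sum>k<N - n. (cmod (\<xi> (k + n)))\<^sup>2)" by (simp add: sum_distrib_left)
    also have "(\<Sum>k<N - n. (cmod (\<xi> (k + n)))\<^sup>2) = (\<Sum>k\<in>{n..<N}. (cmod (\<xi> k))\<^sup>2)"
      by (rule sum.reindex_bij_witness[of _ "\<lambda>k. k - n" "\<lambda>k. k + n"]) auto
    also have "M\<^sup>2 * \<dots> \<le> M\<^sup>2 * (\<Sum>k<N. (cmod (\<xi> k))\<^sup>2)"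
      by (intro mult_left_mono sum_mono2) auto
    finally show ?thesis .
  qed
  then have "sqrt (\<Sum>k<N. (cmod (act \<eta> (cmon f n) x N \<xi> k))\<^sup>2) \<le> sqrt (M\<^sup>2 * (\<Sum>k<N. (cmod (\<xi> k))\<^sup>2))"
    by (rule real_sqrt_le_mono)
  then show "l2 N (act \<eta> (cmon f n) x N \<xi>) \<le> M * l2 N \<xi>"
    using M by (simp add: l2_def L2_set_def real_sqrt_mult)
qed

lemma bnd_cunit: "bnd \<eta> cunit 1"
proof -
  have "cunit = cmon (\<lambda>_. 1) 0" by (auto simp: cunit_def cmon_def)
  then show ?thesis using bnd_cmon[of "\<lambda>_. 1" 1 0] by simp
qed

text \<open>When the constant coefficient vanishes, dividing by \<open>U\<close> on the right only
  moves columns: the shifted sequence acts on \<open>\<xi>\<close> as the original one acts on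
  \<open>\<xi>\<close> preceded by a 0, in a matrix larger by one.\<close>

lemma bnd_shift:
  assumes a: "bnd \<eta> a C" and a0: "\<And>x. x \<in> disc \<Longrightarrow> a 0 x = 0"
  shows "bnd \<eta> (\<lambda>n. a (Suc n)) C"
proof (rule bndI[OF bndD(2)[OF a]])
  fix x :: complex and N :: nat and \<xi> :: "nat \<Rightarrow> complex" assume x: "x \<in> disc"
  define \<zeta> where "\<zeta> l = (case l of 0 \<Rightarrow> 0 | Suc m \<Rightarrow> \<xi> m)" for l
  have eq: "act \<eta> (\<lambda>n. a (Suc n)) x N \<xi> k = act \<eta> a x (Suc N) \<zeta> k" if k: "k < N" for k
  proof -
    have "act \<eta> a x (Suc N) \<zeta> k = a 0 ((\<eta> ^^ k) x) * \<zeta> k + (\<Sum>l\<in>{Suc k..<Suc N}. a (l - k) ((\<eta> ^^ k) x) * \<zeta> l)"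
      unfolding act_def using k by (subst sum.atLeast_Suc_lessThan) auto
    also have "\<dots> = (\<Sum>l\<in>{k..<N}. a (Suc l - k) ((\<eta> ^^ k) x) * \<zeta> (Suc l))"
      using a0 x unfolding sum.shift_bounds_Suc_ivl by simp
    also have "\<dots> = act \<eta> (\<lambda>n. a (Suc n)) x N \<xi> k"
      unfolding act_def by (intro sum.cong) (auto simp: \<zeta>_def Suc_diff_le)
    finally show ?thesis ..
  qed
  have "l2 N (act \<eta> (\<lambda>n. a (Suc n)) x N \<xi>) = l2 N (act \<eta> a x (Suc N) \<zeta>)" by (rule l2_cong[OF eq])
  also have "\<dots> \<le> l2 (Suc N) (act \<eta> a x (Suc N) \<zeta>)"
    unfolding l2_def L2_set_def by (intro real_sqrt_le_mono sum_mono2) auto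
  also have "\<dots> \<le> C * l2 (Suc N) \<zeta>" by (rule bndD(1)[OF a x])
  also have "l2 (Suc N) \<zeta> = l2 N \<xi>"
    unfolding l2_def L2_set_def sum.lessThan_Suc_shift by (simp add: \<zeta>_def)
  finally show "l2 N (act \<eta> (\<lambda>n. a (Suc n)) x N \<xi>) \<le> C * l2 N \<xi>" .
qed

text \<open>Each matrix is finite, so pointwise convergence of the coefficients carries a common
  bound to the limit.\<close>

lemma bnd_uniform:
  assumes "\<And>i. bnd \<eta> (s i) C" "\<And>n x. x \<in> disc \<Longrightarrow> (\<lambda>i. s i n x) \<longlonglongrightarrow> a n x"
  shows "bnd \<eta> a C"
proof (rule bndI[OF bndD(2)[OF assms(1)]])
  fix x :: complex and N :: nat and \<xi> :: "nat \<Rightarrow> complex" assume x: "x \<in> disc"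
  have "(\<lambda>i. l2 N (act \<eta> (s i) x N \<xi>)) \<longlonglongrightarrow> l2 N (act \<eta> a x N \<xi>)"
    unfolding l2_def L2_set_def act_def using x by (intro tendsto_intros assms(2) pow_in)
  then show "l2 N (act \<eta> a x N \<xi>) \<le> C * l2 N \<xi>"
    by (rule LIMSEQ_le_const2) (use bndD(1)[OF assms(1) x] in blast)
qed

end

section \<open>Completion of the skew polynomials inside the coefficient sequences\<close>

definition cpolys :: "(complex \<Rightarrow> complex) set \<Rightarrow> coeffs set" where
  "cpolys S = {p \<in> coeff_seqs. (\<forall>n. p n \<in> S) \<and> (\<exists>N. \<forall>n\<ge>N. \<forall>x\<in>disc. p n x = 0)}"

lemma cpolys_seqs [simp]: "p \<in> cpolys S \<Longrightarrow> p \<in> coeff_seqs" by (simp add: cpolys_def)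

abbreviation CD :: "(complex \<Rightarrow> complex) set" where "CD \<equiv> carrier (cont_alg disc_space)"

lemma seqs_CD: "a \<in> coeff_seqs \<Longrightarrow> a n \<in> CD" by (simp add: carrier_disc coeff_seqs_def)

lemma cpolys_CD_iff: "p \<in> cpolys CD \<longleftrightarrow> p \<in> coeff_seqs \<and> (\<exists>N. \<forall>n\<ge>N. \<forall>x\<in>disc. p n x = 0)"
  unfolding cpolys_def using seqs_CD by blast

lemma skew_poly_carrier: "carrier (skew_poly disc_space \<eta>) = cpolys CD"
proof -
  have z: "\<zero>\<^bsub>cont_alg disc_space\<^esub> = (\<lambda>x\<in>disc. 0)" by (simp add: cont_alg_def)
  have "(p \<in> carrier (skew_poly disc_space \<eta>)) = (p \<in> cpolys CD)" for p
  proof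
    assume p: "p \<in> carrier (skew_poly disc_space \<eta>)"
    then have "finite {n. p n \<noteq> (\<lambda>x\<in>disc. 0)}" by (simp add: skew_poly_def z)
    then obtain N where "\<forall>n\<in>{n. p n \<noteq> (\<lambda>x\<in>disc. 0)}. n < N" using finite_nat_set_iff_bounded by blast
    then have "\<forall>n\<ge>N. p n = (\<lambda>x\<in>disc. 0)" by force
    then have "\<forall>n\<ge>N. \<forall>x\<in>disc. p n x = 0" by simp
    moreover have "p \<in> coeff_seqs" using p by (simp add: skew_poly_def carrier_disc coeff_seqs_def)
    ultimately show "p \<in> cpolys CD" unfolding cpolys_CD_iff by blast
  next
    assume p: "p \<in> cpolys CD"
    then obtain N where N: "\<forall>n\<ge>N. \<forall>x\<in>disc. p n x = 0" and s: "p \<in> coeff_seqs" unfolding cpolys_CD_iff by blast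
    have "p n = (\<lambda>x\<in>disc. 0)" if "n \<ge> N" for n
      using N that s by (intro extensionalityI[of _ disc]) (auto simp: coeff_seqs_def)
    then have "{n. p n \<noteq> (\<lambda>x\<in>disc. 0)} \<subseteq> {..<N}" by (auto simp: not_le[symmetric])
    then have "finite {n. p n \<noteq> (\<lambda>x\<in>disc. 0)}" using finite_subset by blast
    then show "p \<in> carrier (skew_poly disc_space \<eta>)"
      using seqs_CD[OF s] by (simp add: skew_poly_def z)
  qed
  then show ?thesis by blast
qed

lemma skew_poly_ops:
  "p \<oplus>\<^bsub>skew_poly disc_space \<eta>\<^esub> q = cadd p q" "p \<otimes>\<^bsub>skew_poly disc_space \<eta>\<^esub> q = cmul \<eta> p q"
  "\<one>\<^bsub>skew_poly disc_space \<eta>\<^esub> = cunit" "c \<odot>\<^bsub>skew_poly disc_space \<eta>\<^esub> p = csm c p"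
  by (auto simp: skew_poly_def cont_alg_def cadd_def cmul_def cunit_def csm_def fun_eq_iff)

lemma const_poly_eq: "f \<in> extensional disc \<Longrightarrow> const_poly disc_space f = cmon f 0"
  by (auto simp: const_poly_def cmon_def cont_alg_def fun_eq_iff extensional_def)

lemma var_poly_eq: "var_poly disc_space = cmon (\<lambda>_. 1) 1"
  by (auto simp: var_poly_def cmon_def cont_alg_def fun_eq_iff)

lemma CD_D: "f \<in> CD \<Longrightarrow> f \<in> extensional disc" "f \<in> CD \<Longrightarrow> continuous_on disc f"
  by (auto simp: carrier_disc)

lemma cmon_cpolys: "continuous_on disc f \<Longrightarrow> cmon f n \<in> cpolys CD"
  unfolding cpolys_CD_iff by (intro conjI exI[of _ "Suc n"] allI impI ballI) auto

lemma CD_bounded: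
  assumes "continuous_on disc f"
  obtains M :: real where "M \<ge> 0" "\<And>x. x \<in> disc \<Longrightarrow> cmod (f x) \<le> M"
proof -
  have "bounded (f ` disc)" by (intro compact_imp_bounded compact_continuous_image assms) simp
  then obtain M where M: "\<forall>y\<in>f ` disc. cmod y \<le> M" unfolding bounded_iff by (rule exE)
  then have le: "cmod (f x) \<le> M" if "x \<in> disc" for x using that by (simp only: ball_simps)
  have "M \<ge> 0" using order_trans[OF norm_ge_zero le[of 0]] by simp
  then show ?thesis using that le by blast
qed

context disc_dynamics
begin

definition W :: "coeffs set" where
  "W = {a \<in> coeff_seqs. \<forall>r>0. \<exists>p\<in>cpolys CD. bnd \<eta> (cdiff a p) r}"

lemma W_seqs [simp]: "a \<in> W \<Longrightarrow> a \<in> coeff_seqs" by (simp add: W_def)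

lemma W_approx:
  assumes "a \<in> W" "r > 0"
  obtains p where "p \<in> cpolys CD" "p \<in> coeff_seqs" "bnd \<eta> (cdiff a p) r"
  using assms unfolding W_def using cpolys_seqs by blast

lemma cpolys_bounded:
  assumes "p \<in> cpolys CD"
  obtains C where "bnd \<eta> p C"
proof -
  obtain N where N: "\<forall>n\<ge>N. \<forall>x\<in>disc. p n x = 0" and s: "p \<in> coeff_seqs" using assms unfolding cpolys_CD_iff by blast
  have "\<exists>C. bnd \<eta> p C" using N s
  proof (induction N arbitrary: p)
    case 0
    then have "p = czero" by (intro coeff_seqs_eqI) auto
    then show ?case using bnd_czero by blast
  next
    case (Suc N)
    let ?q = "cdiff p (cmon (p N) N)"
    have c: "continuous_on disc (p N)" using Suc.prems coeff_seqs_cont by blast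
    have q: "?q \<in> coeff_seqs" using Suc.prems c by simp
    have "\<forall>n\<ge>N. \<forall>x\<in>disc. ?q n x = 0"
    proof (intro allI impI ballI)
      fix n x assume "n \<ge> N" and x: "x \<in> disc"
      then show "?q n x = 0" using Suc.prems(1) by (cases "n = N") auto
    qed
    from Suc.IH[OF this q] obtain C where "bnd \<eta> ?q C" by blast
    moreover obtain M where "M \<ge> 0" "\<And>x. x \<in> disc \<Longrightarrow> cmod (p N x) \<le> M" using CD_bounded[OF c] by blast
    then have "bnd \<eta> (cmon (p N) N) M" by (intro bnd_cmon) auto
    ultimately have "bnd \<eta> (cadd ?q (cmon (p N) N)) (C + M)" by (rule bnd_cadd)
    moreover have "cadd ?q (cmon (p N) N) = p"
      by (rule coeff_seqs_eqI) (use Suc.prems c q in auto)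
    ultimately show ?case by auto
  qed
  then show ?thesis using that by blast
qed

lemma W_bounded:
  assumes a: "a \<in> W"
  obtains C where "bnd \<eta> a C"
proof -
  obtain p where p: "p \<in> cpolys CD" "p \<in> coeff_seqs" "bnd \<eta> (cdiff a p) 1" using W_approx[OF a, of 1] by auto
  obtain C where "bnd \<eta> p C" using cpolys_bounded[OF p(1)] by blast
  from bnd_cadd[OF p(3) this] have "bnd \<eta> (cadd (cdiff a p) p) (1 + C)" .
  moreover have "cadd (cdiff a p) p = a" by (rule coeff_seqs_eqI) (use a p in auto)
  ultimately show ?thesis using that by simp
qed

lemma bnd_norm: "a \<in> W \<Longrightarrow> bnd \<eta> a (cnorm \<eta> a)" by (metis W_bounded bnd_cnorm)

lemma cnorm_nonneg: "a \<in> W \<Longrightarrow> cnorm \<eta> a \<ge> 0" using bnd_norm bndD(2) by blast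

lemma cpolys_W: "p \<in> cpolys CD \<Longrightarrow> p \<in> W"
proof -
  assume p: "p \<in> cpolys CD"
  have "cdiff p p = czero" by (rule coeff_seqs_eqI) (use p in auto)
  then have "bnd \<eta> (cdiff p p) r" if "r > 0" for r using bnd_mono[OF bnd_czero] that by simp
  then show ?thesis using p unfolding W_def by auto
qed

lemma cpolys_cadd: "p \<in> cpolys CD \<Longrightarrow> q \<in> cpolys CD \<Longrightarrow> cadd p q \<in> cpolys CD"
proof -
  assume "p \<in> cpolys CD" "q \<in> cpolys CD"
  then obtain N M where "\<forall>n\<ge>N. \<forall>x\<in>disc. p n x = 0" "\<forall>n\<ge>M. \<forall>x\<in>disc. q n x = 0" "p \<in> coeff_seqs" "q \<in> coeff_seqs"
    unfolding cpolys_CD_iff by blast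
  then show ?thesis unfolding cpolys_CD_iff by (intro conjI exI[of _ "max N M"] allI impI ballI) auto
qed

lemma cpolys_csm: "p \<in> cpolys CD \<Longrightarrow> csm c p \<in> cpolys CD"
proof -
  assume "p \<in> cpolys CD"
  then obtain N where "\<forall>n\<ge>N. \<forall>x\<in>disc. p n x = 0" "p \<in> coeff_seqs" unfolding cpolys_CD_iff by blast
  then show ?thesis unfolding cpolys_CD_iff by (intro conjI exI[of _ N] allI impI ballI) auto
qed

lemma cpolys_cmul: "p \<in> cpolys CD \<Longrightarrow> q \<in> cpolys CD \<Longrightarrow> cmul \<eta> p q \<in> cpolys CD"
proof -
  assume "p \<in> cpolys CD" "q \<in> cpolys CD"
  then obtain N M where pq: "\<forall>n\<ge>N. \<forall>x\<in>disc. p n x = 0" "\<forall>n\<ge>M. \<forall>x\<in>disc. q n x = 0" "p \<in> coeff_seqs" "q \<in> coeff_seqs"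
    unfolding cpolys_CD_iff by blast
  have "cmul \<eta> p q n x = 0" if "n \<ge> N + M" "x \<in> disc" for n x
  proof -
    have "p i x * q (n - i) ((\<eta> ^^ i) x) = 0" for i
    proof (cases "i \<ge> N")
      case False
      then have "n - i \<ge> M" using that by simp
      then show ?thesis using pq(2) pow_in[OF that(2)] by simp
    qed (use pq(1) that in simp)
    then show ?thesis unfolding cmul_at[OF that(2)] by (intro sum.neutral ballI)
  qed
  then show ?thesis using pq unfolding cpolys_CD_iff by (intro conjI exI[of _ "N + M"] allI impI ballI) auto
qed

lemma W_cadd [simp]: "a \<in> W \<Longrightarrow> b \<in> W \<Longrightarrow> cadd a b \<in> W"
proof -
  assume ab: "a \<in> W" "b \<in> W"
  have "\<exists>p\<in>cpolys CD. bnd \<eta> (cdiff (cadd a b) p) r" if r: "r > 0" for r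
  proof -
    obtain p q where p: "p \<in> cpolys CD" "bnd \<eta> (cdiff a p) (r/2)" and q: "q \<in> cpolys CD" "bnd \<eta> (cdiff b q) (r/2)"
      using W_approx ab half_gt_zero[OF r] by metis
    have "cdiff (cadd a b) (cadd p q) = cadd (cdiff a p) (cdiff b q)"
      by (rule coeff_seqs_eqI) (use ab p q in auto)
    then have "bnd \<eta> (cdiff (cadd a b) (cadd p q)) r" using bnd_cadd[OF p(2) q(2)] by simp
    then show ?thesis using cpolys_cadd[OF p(1) q(1)] by blast
  qed
  then show ?thesis using ab unfolding W_def by auto
qed

lemma W_csm [simp]: "a \<in> W \<Longrightarrow> csm c a \<in> W"
proof -
  assume a: "a \<in> W"
  have "\<exists>p\<in>cpolys CD. bnd \<eta> (cdiff (csm c a) p) r" if r: "r > 0" for r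
  proof -
    have c1: "cmod c + 1 > 0" by (simp add: add_nonneg_pos)
    obtain p where p: "p \<in> cpolys CD" "bnd \<eta> (cdiff a p) (r / (cmod c + 1))"
      using W_approx[OF a, of "r / (cmod c + 1)"] r c1 by auto
    have "cdiff (csm c a) (csm c p) = csm c (cdiff a p)"
      by (rule coeff_seqs_eqI) (use a p in \<open>auto simp: right_diff_distrib\<close>)
    moreover have "cmod c * (r / (cmod c + 1)) \<le> r" using c1 r by (simp add: field_simps)
    ultimately have "bnd \<eta> (cdiff (csm c a) (csm c p)) r" using bnd_mono[OF bnd_csm[OF p(2)]] by simp
    then show ?thesis using cpolys_csm[OF p(1)] by blast
  qed
  then show ?thesis using a unfolding W_def by auto
qed

lemma cdiff_eq: "cdiff a b = cadd a (csm (-1) b)"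
  by (auto simp: cdiff_def cadd_def csm_def fun_eq_iff)

lemma W_cdiff [simp]: "a \<in> W \<Longrightarrow> b \<in> W \<Longrightarrow> cdiff a b \<in> W"
  by (simp add: cdiff_eq)

lemma W_I:
  assumes a: "a \<in> coeff_seqs" and ap: "\<And>r. r > 0 \<Longrightarrow> \<exists>b\<in>W. bnd \<eta> (cdiff a b) r"
  shows "a \<in> W"
proof -
  have "\<exists>p\<in>cpolys CD. bnd \<eta> (cdiff a p) r" if r: "r > 0" for r
  proof -
    obtain b where b: "b \<in> W" "bnd \<eta> (cdiff a b) (r/2)" using ap[OF half_gt_zero[OF r]] by blast
    obtain p where p: "p \<in> cpolys CD" "bnd \<eta> (cdiff b p) (r/2)" using W_approx[OF b(1) half_gt_zero[OF r]] by blast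
    have "cadd (cdiff a b) (cdiff b p) = cdiff a p"
      by (rule coeff_seqs_eqI) (use a b p in auto)
    then show ?thesis using bnd_cadd[OF b(2) p(2)] p(1) by auto
  qed
  then show ?thesis using a unfolding W_def by auto
qed

lemma W_cmul [simp]: "a \<in> W \<Longrightarrow> b \<in> W \<Longrightarrow> cmul \<eta> a b \<in> W"
proof (rule W_I)
  assume ab: "a \<in> W" "b \<in> W"
  then show "cmul \<eta> a b \<in> coeff_seqs" by simp
  fix r :: real assume r: "r > 0"
  obtain C where C: "bnd \<eta> b C" using W_bounded[OF ab(2)] by blast
  have C1: "C + 1 > 0" using bndD(2)[OF C] by simp
  obtain p where p: "p \<in> cpolys CD" "p \<in> coeff_seqs" "bnd \<eta> (cdiff a p) (r / 2 / (C + 1))"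
    using W_approx[OF ab(1), of "r / 2 / (C + 1)"] r C1 by auto
  obtain D where D: "bnd \<eta> p D" using cpolys_bounded[OF p(1)] by blast
  have D1: "D + 1 > 0" using bndD(2)[OF D] by simp
  obtain q where q: "q \<in> cpolys CD" "q \<in> coeff_seqs" "bnd \<eta> (cdiff b q) (r / 2 / (D + 1))"
    using W_approx[OF ab(2), of "r / 2 / (D + 1)"] r D1 by auto
  have eq: "cdiff (cmul \<eta> a b) (cmul \<eta> p q) = cadd (cmul \<eta> (cdiff a p) b) (cmul \<eta> p (cdiff b q))"
    using ab p q by (intro coeff_seqs_eqI) (auto simp: cmul_distrib)
  have "r / 2 / (C + 1) * C \<le> r / 2" using C1 r bndD(2)[OF C] by (simp add: field_simps)
  moreover have "D * (r / 2 / (D + 1)) \<le> r / 2" using D1 r bndD(2)[OF D] by (simp add: field_simps)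
  ultimately have "r / 2 / (C + 1) * C + D * (r / 2 / (D + 1)) \<le> r" by linarith
  from bnd_mono[OF bnd_cadd[OF bnd_cmul[OF p(3) C] bnd_cmul[OF D q(3)]] this]
  have "bnd \<eta> (cdiff (cmul \<eta> a b) (cmul \<eta> p q)) r" unfolding eq .
  then show "\<exists>c\<in>W. bnd \<eta> (cdiff (cmul \<eta> a b) c) r" using cpolys_W[OF cpolys_cmul[OF p(1) q(1)]] by blast
qed

lemma cmon_W: "continuous_on disc f \<Longrightarrow> cmon f n \<in> W" by (rule cpolys_W[OF cmon_cpolys])

lemma W_consts [simp]: "czero \<in> W" "cunit \<in> W"
proof -
  have "cunit = cmon (\<lambda>_. 1) 0" "czero = cmon (\<lambda>_. 0) 0" by (auto simp: cunit_def czero_def cmon_def)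
  then show "czero \<in> W" "cunit \<in> W" using cmon_W[of "\<lambda>_. 1" 0] cmon_W[of "\<lambda>_. 0" 0] by auto
qed

lemma W_shift:
  assumes a: "a \<in> W"
  shows "(\<lambda>n. a (Suc n)) \<in> W"
proof (rule W_I)
  show "(\<lambda>n. a (Suc n)) \<in> coeff_seqs" using a by simp
  fix r :: real assume r: "r > 0"
  obtain p where p: "p \<in> cpolys CD" "p \<in> coeff_seqs" "bnd \<eta> (cdiff a p) (r/2)" using W_approx[OF a half_gt_zero[OF r]] by blast
  let ?c = "cdiff a p"
  have cs: "?c \<in> coeff_seqs" using a p by simp
  \<comment> \<open>\<open>bnd_shift\<close> requires a vanishing constant coefficient; subtracting
    it at most doubles the bound, hence the \<open>r/2\<close> above.\<close>
  have "bnd \<eta> (cmon (?c 0) 0) (r/2)" using bnd_coeff[OF p(3)] r by (intro bnd_cmon) auto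
  from bnd_cdiff[OF p(3) this] have "bnd \<eta> (cdiff ?c (cmon (?c 0) 0)) r" by simp
  then have "bnd \<eta> (\<lambda>n. cdiff ?c (cmon (?c 0) 0) (Suc n)) r" by (rule bnd_shift) simp
  moreover have "(\<lambda>n. cdiff ?c (cmon (?c 0) 0) (Suc n)) = cdiff (\<lambda>n. a (Suc n)) (\<lambda>n. p (Suc n))"
    by (auto simp: cdiff_def cmon_def fun_eq_iff)
  moreover have "(\<lambda>n. p (Suc n)) \<in> cpolys CD"
  proof -
    obtain N where "\<forall>n\<ge>N. \<forall>x\<in>disc. p n x = 0" using p(1) unfolding cpolys_CD_iff by blast
    then show ?thesis using p(2) unfolding cpolys_CD_iff by (intro conjI exI[of _ N] allI impI ballI) auto
  qed
  ultimately show "\<exists>b\<in>W. bnd \<eta> (cdiff (\<lambda>n. a (Suc n)) b) r" using cpolys_W by auto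
qed

text \<open>Bounds dominate coefficients, so a Cauchy sequence converges uniformly in each
  coefficient; \<open>bnd_uniform\<close> upgrades this to convergence in norm.\<close>

lemma W_complete:
  fixes s :: "nat \<Rightarrow> coeffs"
  assumes s: "\<And>i. s i \<in> W" and C: "\<And>r. r > 0 \<Longrightarrow> \<exists>N. \<forall>m\<ge>N. \<forall>n\<ge>N. bnd \<eta> (cdiff (s m) (s n)) r"
  obtains a where "a \<in> W" "\<And>r. r > 0 \<Longrightarrow> \<exists>N. \<forall>n\<ge>N. bnd \<eta> (cdiff (s n) a) r"
proof -
  define a where "a n = (\<lambda>x\<in>disc. lim (\<lambda>i. s i n x))" for n
  have lim: "(\<lambda>i. s i n x) \<longlonglongrightarrow> a n x" if x: "x \<in> disc" for n x
  proof -
    have "Cauchy (\<lambda>i. s i n x)"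
    proof (rule CauchyI)
      fix r :: real assume r: "r > 0"
      then obtain N where N: "\<forall>m\<ge>N. \<forall>k\<ge>N. bnd \<eta> (cdiff (s m) (s k)) (r/2)" using C[OF half_gt_zero[OF r]] by blast
      have "norm (s m n x - s k n x) < r" if "m \<ge> N" "k \<ge> N" for m k
        using bnd_coeff[of "cdiff (s m) (s k)" "r/2" x n] N that x r by auto
      then show "\<exists>M. \<forall>m\<ge>M. \<forall>k\<ge>M. norm (s m n x - s k n x) < r" by blast
    qed
    then show ?thesis using x by (simp add: a_def Cauchy_convergent_iff convergent_LIMSEQ_iff)
  qed
  have close: "\<exists>N. \<forall>n\<ge>N. bnd \<eta> (cdiff (s n) a) r" if r: "r > 0" for r
  proof -
    obtain N where N: "\<forall>m\<ge>N. \<forall>k\<ge>N. bnd \<eta> (cdiff (s m) (s k)) r" using C[OF r] by blast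
    have "bnd \<eta> (cdiff (s n) a) r" if n: "n \<ge> N" for n
    \<comment> \<open>The tail starts at \<open>N\<close> so that the bound holds for every
      index.\<close>
    proof (rule bnd_uniform[of "\<lambda>i. cdiff (s n) (s (i + N))"])
      show "bnd \<eta> (cdiff (s n) (s (i + N))) r" for i using N n by simp
      show "(\<lambda>i. cdiff (s n) (s (i + N)) m x) \<longlonglongrightarrow> cdiff (s n) a m x" if "x \<in> disc" for m x
        using tendsto_diff[OF tendsto_const LIMSEQ_ignore_initial_segment[OF lim[OF that]]] that by simp
    qed
    then show ?thesis by blast
  qed
  have "a \<in> coeff_seqs"
  proof -
    have "continuous_on disc (a n)" for n
    proof (rule uniform_limit_theorem[of _ "\<lambda>i. s i n"])
      show "\<forall>\<^sub>F i in sequentially. continuous_on disc (s i n)" using s W_seqs coeff_seqs_cont by auto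
      show "uniform_limit disc (\<lambda>i. s i n) (a n) sequentially"
      proof (rule uniform_limitI)
        fix r :: real assume r: "r > 0"
        obtain N where N: "\<forall>i\<ge>N. bnd \<eta> (cdiff (s i) a) (r/2)" using close[OF half_gt_zero[OF r]] by blast
        have "dist (s i n x) (a n x) < r" if "i \<ge> N" "x \<in> disc" for i x
          using bnd_coeff[of "cdiff (s i) a" "r/2" x n] N that r by (auto simp: dist_norm)
        then show "\<forall>\<^sub>F i in sequentially. \<forall>x\<in>disc. dist (s i n x) (a n x) < r"
          unfolding eventually_sequentially by blast
      qed
    qed simp
    then show ?thesis by (simp add: coeff_seqs_def a_def)
  qed
  moreover have "\<exists>b\<in>W. bnd \<eta> (cdiff a b) r" if r: "r > 0" for r
  proof -
    obtain N where N: "\<forall>i\<ge>N. bnd \<eta> (cdiff (s i) a) r" using close[OF r] by blast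
    have "cdiff a (s N) = csm (-1) (cdiff (s N) a)" by (auto simp: cdiff_def csm_def fun_eq_iff)
    then have "bnd \<eta> (cdiff a (s N)) r" using bnd_csm[of "cdiff (s N) a" r "-1"] N by simp
    then show ?thesis using s by blast
  qed
  ultimately have "a \<in> W" by (rule W_I)
  then show ?thesis using that close by blast
qed

end

section \<open>The semicrossed product as a topological conjugacy algebra\<close>

locale semicrossed = disc_dynamics \<eta> for \<eta> +
  fixes e :: "coeffs \<Rightarrow> 'u"
  assumes e_inj: "inj_on e coeff_seqs"
begin

text \<open>Elements of the ambient type serve as names, given by \<open>e\<close>, of coefficient
  sequences; all operations decode, compute and encode again.\<close>

definition dec :: "'u \<Rightarrow> coeffs" where "dec = inv_into coeff_seqs e"

definition alg :: "'u normed_alg" where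
  "alg = \<lparr>carrier = e ` W,
      monoid.mult = (\<lambda>x y. e (cmul \<eta> (dec x) (dec y))),
      monoid.one = e cunit,
      ring.zero = e czero,
      ring.add = (\<lambda>x y. e (cadd (dec x) (dec y))),
      module.smult = (\<lambda>c x. e (csm c (dec x))),
      nrm = (\<lambda>x. cnorm \<eta> (dec x))\<rparr>"

lemma dec_e [simp]: "a \<in> coeff_seqs \<Longrightarrow> dec (e a) = a"
  unfolding dec_def by (rule inv_into_f_f[OF e_inj])

lemma e_eq_iff [simp]: "a \<in> coeff_seqs \<Longrightarrow> b \<in> coeff_seqs \<Longrightarrow> e a = e b \<longleftrightarrow> a = b"
  by (rule inj_on_eq_iff[OF e_inj])

lemma alg_simps [simp]:
  "carrier alg = e ` W" "\<one>\<^bsub>alg\<^esub> = e cunit" "\<zero>\<^bsub>alg\<^esub> = e czero"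
  "a \<in> coeff_seqs \<Longrightarrow> b \<in> coeff_seqs \<Longrightarrow> e a \<otimes>\<^bsub>alg\<^esub> e b = e (cmul \<eta> a b)"
  "a \<in> coeff_seqs \<Longrightarrow> b \<in> coeff_seqs \<Longrightarrow> e a \<oplus>\<^bsub>alg\<^esub> e b = e (cadd a b)"
  "a \<in> coeff_seqs \<Longrightarrow> c \<odot>\<^bsub>alg\<^esub> e a = e (csm c a)"
  "a \<in> coeff_seqs \<Longrightarrow> nrm alg (e a) = cnorm \<eta> a"
  by (simp_all add: alg_def)

lemma cadd_laws:
  "cadd (cadd a b) c = cadd a (cadd b c)" "cadd a b = cadd b a"
  "csm (k + l) a = cadd (csm k a) (csm l a)" "csm k (cadd a b) = cadd (csm k a) (csm k b)"
  "csm (k * l) a = csm k (csm l a)"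
  by (auto simp: cadd_def csm_def fun_eq_iff algebra_simps)

lemma cadd_zero: "a \<in> coeff_seqs \<Longrightarrow> cadd czero a = a" "cadd (csm (-1) a) a = czero"
  "a \<in> coeff_seqs \<Longrightarrow> csm 1 a = a"
  by (auto simp: cadd_def csm_def czero_def fun_eq_iff coeff_seqs_def extensional_def)

lemma cmul_csm:
  assumes "a \<in> coeff_seqs" "b \<in> coeff_seqs"
  shows "cmul \<eta> (csm k a) b = csm k (cmul \<eta> a b)" "cmul \<eta> a (csm k b) = csm k (cmul \<eta> a b)"
  using cmul_distrib(3,4)[OF assms assms(1)] by blast+

lemma ring_alg: "ring alg"
proof (rule ringI)
  show "abelian_group alg"
  proof (rule abelian_groupI)
    show "\<exists>y\<in>carrier alg. y \<oplus>\<^bsub>alg\<^esub> x = \<zero>\<^bsub>alg\<^esub>" if x: "x \<in> carrier alg" for x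
    proof -
      obtain a where a: "a \<in> W" "x = e a" using x by auto
      then have "e (csm (-1) a) \<oplus>\<^bsub>alg\<^esub> x = \<zero>\<^bsub>alg\<^esub>" by (simp add: cadd_zero)
      then show ?thesis using a by (intro bexI[of _ "e (csm (-1) a)"]) simp_all
    qed
  qed (auto simp: cadd_laws(1) cadd_zero intro: cadd_laws(2))
  show "monoid alg"
    by (rule monoidI) (auto simp: cmul_assoc)
qed (auto simp: cmul_distrib)

lemma complex_algebra_alg: "complex_algebra alg"
proof (intro complex_algebra.intro complex_algebra_axioms.intro ring_alg)
  interpret R: ring alg by (rule ring_alg)
  show "Module.module (ring_of_type_algebra :: complex ring) alg"
    by (rule moduleI)
      (auto simp: ring_of_type_algebra_def cadd_laws cadd_zero R.is_abelian_group
        intro: cring_from_type_algebra[unfolded ring_of_type_algebra_def])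
qed (auto simp: cmul_csm)

sublocale CA: complex_algebra alg by (rule complex_algebra_alg)

lemma alg_diff: "a \<in> W \<Longrightarrow> b \<in> W \<Longrightarrow> e a \<ominus>\<^bsub>alg\<^esub> e b = e (cdiff a b)"
proof -
  assume ab: "a \<in> W" "b \<in> W"
  have "\<ominus>\<^bsub>alg\<^esub> e b = e (csm (-1) b)" using CA.smult_minus_1[of "e b"] ab by simp
  then show ?thesis using ab by (simp add: a_minus_def cdiff_eq)
qed

lemma dist_alg: "a \<in> W \<Longrightarrow> b \<in> W \<Longrightarrow> nrm_dist alg (e a) (e b) = cnorm \<eta> (cdiff a b)"
  by (simp add: nrm_dist_def alg_diff)

lemma cnorm_eq_0: "a \<in> W \<Longrightarrow> cnorm \<eta> a = 0 \<longleftrightarrow> a = czero"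
proof
  assume a: "a \<in> W" "cnorm \<eta> a = 0"
  show "a = czero"
  proof (rule coeff_seqs_eqI)
    show "a n x = czero n x" if "x \<in> disc" for n x
      using bnd_coeff[OF bnd_norm[OF a(1)] that, of n] a(2) that by simp
  qed (use a in auto)
next
  assume "a = czero"
  then show "cnorm \<eta> a = 0" using bnd_cnorm_le[OF bnd_czero] cnorm_nonneg[of czero] by simp
qed

lemma cnorm_cadd: "a \<in> W \<Longrightarrow> b \<in> W \<Longrightarrow> cnorm \<eta> (cadd a b) \<le> cnorm \<eta> a + cnorm \<eta> b"
  by (intro bnd_cnorm_le bnd_cadd bnd_norm)

lemma cnorm_csm_le: "a \<in> W \<Longrightarrow> cnorm \<eta> (csm c a) \<le> cmod c * cnorm \<eta> a"
  by (intro bnd_cnorm_le bnd_csm bnd_norm)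

lemma cnorm_csm: "a \<in> W \<Longrightarrow> cnorm \<eta> (csm c a) = cmod c * cnorm \<eta> a"
proof (cases "c = 0")
  case True
  assume "a \<in> W"
  then show ?thesis using True cnorm_csm_le[of a 0] cnorm_nonneg[of "csm 0 a"] by simp
next
  case False
  assume a: "a \<in> W"
  have "csm (1/c) (csm c a) = a" using False a cadd_zero(3)[of a] cadd_laws(5)[of "1/c" c a] by simp
  then have "cnorm \<eta> a \<le> cmod (1/c) * cnorm \<eta> (csm c a)" using cnorm_csm_le[of "csm c a" "1/c"] a by simp
  then have "cmod c * cnorm \<eta> a \<le> cnorm \<eta> (csm c a)" using False by (simp add: norm_divide field_simps)
  then show ?thesis using cnorm_csm_le[OF a, of c] by simp
qed

lemma cnorm_cdiff_commute: "a \<in> W \<Longrightarrow> b \<in> W \<Longrightarrow> cnorm \<eta> (cdiff a b) = cnorm \<eta> (cdiff b a)"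
proof -
  assume ab: "a \<in> W" "b \<in> W"
  have "cdiff a b = csm (-1) (cdiff b a)" by (auto simp: cdiff_def csm_def fun_eq_iff)
  then show ?thesis using cnorm_csm[of "cdiff b a" "-1"] ab by simp
qed

lemma bnd_less: "a \<in> W \<Longrightarrow> cnorm \<eta> a \<le> r \<Longrightarrow> bnd \<eta> a r"
  using bnd_mono[OF bnd_norm] .

lemma banach_alg_alg: "banach_alg alg"
proof (intro banach_alg.intro banach_alg_axioms.intro complex_algebra_alg)
  interpret MS: Metric_space "carrier alg" "nrm_dist alg"
  proof
    show "0 \<le> nrm_dist alg x y" for x y
    proof (cases "x \<in> carrier alg \<and> y \<in> carrier alg")
      case True
      then obtain a b where "a \<in> W" "b \<in> W" "x = e a" "y = e b" by auto
      then show ?thesis using cnorm_nonneg[of "cdiff a b"] by (simp only: dist_alg W_cdiff)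
    qed (auto simp: nrm_dist_def)
    show "nrm_dist alg x y = nrm_dist alg y x" for x y
    proof (cases "x \<in> carrier alg \<and> y \<in> carrier alg")
      case True
      then obtain a b where "a \<in> W" "b \<in> W" "x = e a" "y = e b" by auto
      then show ?thesis using cnorm_cdiff_commute[of a b] by (simp only: dist_alg)
    qed (auto simp: nrm_dist_def)
    show "(nrm_dist alg x y = 0) = (x = y)" if xy: "x \<in> carrier alg" "y \<in> carrier alg" for x y
    proof -
      obtain a b where ab: "a \<in> W" "b \<in> W" "x = e a" "y = e b" using xy by auto
      have "cdiff a b = czero \<longleftrightarrow> a = b"
      proof
        assume eq: "cdiff a b = czero"
        show "a = b"
        proof (rule coeff_seqs_eqI)
          show "a n x = b n x" if "x \<in> disc" for n x
            using fun_cong[OF fun_cong[OF eq, of n], of x] that by simp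
        qed (use ab in auto)
      qed (auto simp: cdiff_def czero_def)
      then show ?thesis using ab cnorm_eq_0[of "cdiff a b"] by (simp add: dist_alg)
    qed
    show "nrm_dist alg x z \<le> nrm_dist alg x y + nrm_dist alg y z"
      if xyz: "x \<in> carrier alg" "y \<in> carrier alg" "z \<in> carrier alg" for x y z
    proof -
      obtain a b c where abc: "a \<in> W" "b \<in> W" "c \<in> W" "x = e a" "y = e b" "z = e c" using xyz by auto
      have "cdiff a c = cadd (cdiff a b) (cdiff b c)" by (auto simp: cdiff_def cadd_def fun_eq_iff)
      then show ?thesis using abc cnorm_cadd[of "cdiff a b" "cdiff b c"] by (simp add: dist_alg)
    qed
  qed
  show "Metric_space.mcomplete (carrier alg) (nrm_dist alg)"
    unfolding MS.mcomplete_def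
  proof (intro allI impI)
    fix \<sigma> assume "MS.MCauchy \<sigma>"
    then have r: "range \<sigma> \<subseteq> e ` W"
      and C: "\<And>r. r > 0 \<Longrightarrow> \<exists>N. \<forall>n n'. N \<le> n \<longrightarrow> N \<le> n' \<longrightarrow> nrm_dist alg (\<sigma> n) (\<sigma> n') < r"
      unfolding MS.MCauchy_def by auto
    define s where "s i = dec (\<sigma> i)" for i
    have sW: "s i \<in> W" and \<sigma>: "\<sigma> i = e (s i)" for i
    proof -
      have "\<sigma> i \<in> e ` W" using r by blast
      then obtain a where "a \<in> W" "\<sigma> i = e a" by blast
      then show "s i \<in> W" "\<sigma> i = e (s i)" by (simp_all add: s_def)
    qed
    have "\<exists>N. \<forall>m\<ge>N. \<forall>n\<ge>N. bnd \<eta> (cdiff (s m) (s n)) r" if "r > 0" for r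
    proof -
      obtain N where N: "\<And>n n'. N \<le> n \<Longrightarrow> N \<le> n' \<Longrightarrow> nrm_dist alg (\<sigma> n) (\<sigma> n') < r"
        using C[OF \<open>r > 0\<close>] by blast
      have "bnd \<eta> (cdiff (s m) (s n)) r" if "m \<ge> N" "n \<ge> N" for m n
        using N[OF that] sW by (intro bnd_less) (simp_all add: \<sigma> dist_alg)
      then show ?thesis by blast
    qed
    then obtain a where a: "a \<in> W" "\<And>r. r > 0 \<Longrightarrow> \<exists>N. \<forall>n\<ge>N. bnd \<eta> (cdiff (s n) a) r"
      using W_complete[of s] sW by blast
    have "limitin MS.mtopology \<sigma> (e a) sequentially"
      unfolding MS.limit_metric_sequentially
    proof (intro conjI allI impI)
      show "e a \<in> carrier alg" using a by simp
      fix r :: real assume r: "r > 0"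
      then obtain N where N: "\<And>n. n \<ge> N \<Longrightarrow> bnd \<eta> (cdiff (s n) a) (r/2)" using a(2)[OF half_gt_zero[OF r]] by blast
      have "\<sigma> n \<in> carrier alg \<and> nrm_dist alg (\<sigma> n) (e a) < r" if "n \<ge> N" for n
        using bnd_cnorm_le[OF N[OF that]] r sW a by (simp add: \<sigma> dist_alg)
      then show "\<exists>N. \<forall>n\<ge>N. \<sigma> n \<in> carrier alg \<and> nrm_dist alg (\<sigma> n) (e a) < r" by blast
    qed
    then show "\<exists>x. limitin MS.mtopology \<sigma> x sequentially" by blast
  qed
qed (auto simp: cnorm_nonneg cnorm_eq_0 cnorm_cadd cnorm_csm intro!: bnd_cnorm_le bnd_cmul bnd_norm)

sublocale BA: banach_alg alg by (rule banach_alg_alg)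

abbreviation E0 :: "'u \<Rightarrow> complex \<Rightarrow> complex" where "E0 \<equiv> \<lambda>x. dec x 0"
abbreviation Uc :: coeffs where "Uc \<equiv> cmon (\<lambda>_. 1) (Suc 0)"

lemma Uc_W [simp]: "Uc \<in> W" by (rule cmon_W) simp
lemma Uc_seqs [simp]: "Uc \<in> coeff_seqs" by simp

lemma cmul_Uc: "x \<in> disc \<Longrightarrow> cmul \<eta> b Uc n x = (case n of 0 \<Rightarrow> 0 | Suc m \<Rightarrow> b m x)"
proof (cases n)
  case (Suc m)
  assume x: "x \<in> disc"
  have "cmul \<eta> b Uc n x = (\<Sum>i\<le>n. if i = m then b m x else 0)"
    unfolding cmul_at[OF x] using x Suc pow_in[OF x] by (intro sum.cong) auto
  then show ?thesis using Suc by simp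
qed (simp add: cmul_at)

text \<open>Right multiplication by \<open>U\<close> is the shift in \<open>cmul_Uc\<close>, so
  existence and uniqueness of the decomposition can be read off coefficientwise; the description
  operator in \<open>coeff_map\<close> needs both.\<close>

lemma decomposition_iff:
  assumes "a \<in> W" "b \<in> W" "f \<in> CD"
  shows "a = cadd (cmon f 0) (cmul \<eta> b Uc) \<longleftrightarrow> a 0 = f \<and> b = (\<lambda>n. a (Suc n))"
proof
  have fs: "cmon f 0 \<in> coeff_seqs" using CD_D(2)[OF assms(3)] by simp
  assume eq: "a = cadd (cmon f 0) (cmul \<eta> b Uc)"
  have at: "a n x = (case n of 0 \<Rightarrow> f x | Suc m \<Rightarrow> b m x)" if "x \<in> disc" for n x
    using that by (subst eq) (simp add: cmul_Uc split: nat.split)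
  have "a 0 = f"
    by (rule extensionalityI[of _ disc]) (use at[of _ 0] CD_D(1)[OF assms(3)] W_seqs[OF assms(1)] in \<open>auto simp: coeff_seqs_def\<close>)
  moreover have "b = (\<lambda>n. a (Suc n))"
    by (rule coeff_seqs_eqI) (use assms at[of _ "Suc n" for n] in auto)
  ultimately show "a 0 = f \<and> b = (\<lambda>n. a (Suc n))" by blast
next
  assume eq: "a 0 = f \<and> b = (\<lambda>n. a (Suc n))"
  show "a = cadd (cmon f 0) (cmul \<eta> b Uc)"
    by (rule coeff_seqs_eqI) (use assms eq CD_D(2)[OF assms(3)] in \<open>auto simp: cmul_Uc split: nat.split\<close>)
qed

lemma coeff_map_alg:
  assumes "a \<in> W"
  shows "coeff_map alg (\<lambda>f. e (const_poly disc_space f)) (e (var_poly disc_space)) E0 n (e a) = a n"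
  using assms
proof (induction n arbitrary: a)
  case 0 then show ?case by simp
next
  case (Suc n)
  have a0: "a 0 \<in> CD" by (rule seqs_CD[OF W_seqs[OF Suc.prems]])
  note f0 = CD_D[OF a0]
  have "(THE b. b \<in> carrier alg \<and> e a = e (const_poly disc_space (E0 (e a))) \<oplus>\<^bsub>alg\<^esub> b \<otimes>\<^bsub>alg\<^esub> e (var_poly disc_space))
      = e (\<lambda>n. a (Suc n))"
  proof (rule the_equality)
    show "e (\<lambda>n. a (Suc n)) \<in> carrier alg \<and>
      e a = e (const_poly disc_space (E0 (e a))) \<oplus>\<^bsub>alg\<^esub> e (\<lambda>n. a (Suc n)) \<otimes>\<^bsub>alg\<^esub> e (var_poly disc_space)"
      using decomposition_iff[OF Suc.prems W_shift[OF Suc.prems] a0] Suc.prems W_shift[OF Suc.prems] f0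
      by (simp add: const_poly_eq var_poly_eq)
    fix y assume y: "y \<in> carrier alg \<and> e a = e (const_poly disc_space (E0 (e a))) \<oplus>\<^bsub>alg\<^esub> y \<otimes>\<^bsub>alg\<^esub> e (var_poly disc_space)"
    then obtain b where b: "b \<in> W" "y = e b" by auto
    then have "a = cadd (cmon (a 0) 0) (cmul \<eta> b Uc)"
      using y Suc.prems f0 by (simp add: const_poly_eq var_poly_eq)
    then show "y = e (\<lambda>n. a (Suc n))" using decomposition_iff[OF Suc.prems b(1) a0] b(2) by blast
  qed
  then show ?case using Suc.IH[OF W_shift[OF Suc.prems]] by simp
qed

lemma nrm_U_pow: "nrm alg (e Uc [^]\<^bsub>alg\<^esub> (n::nat)) \<le> 1 \<and> e Uc [^]\<^bsub>alg\<^esub> n \<in> carrier alg"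
proof (induction n)
  case 0 then show ?case using bnd_cnorm_le[OF bnd_cunit] by simp
next
  case (Suc n)
  have U1: "nrm alg (e Uc) \<le> 1" using bnd_cnorm_le[OF bnd_cmon[of "\<lambda>_. 1" 1 1]] by simp
  have Uin: "e Uc \<in> carrier alg" by simp
  have P: "e Uc [^]\<^bsub>alg\<^esub> Suc n = e Uc [^]\<^bsub>alg\<^esub> n \<otimes>\<^bsub>alg\<^esub> e Uc" by simp
  have "nrm alg (e Uc [^]\<^bsub>alg\<^esub> Suc n) \<le> nrm alg (e Uc [^]\<^bsub>alg\<^esub> n) * nrm alg (e Uc)"
    unfolding P by (rule BA.nrm_mult) (use Suc Uin in blast)+
  also have "\<dots> \<le> 1 * 1"
    using Suc U1 BA.nrm_nonneg[OF Uin] by (intro mult_mono) auto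
  finally show ?case using CA.m_closed[of "e Uc [^]\<^bsub>alg\<^esub> n" "e Uc"] Suc Uin unfolding P by simp
qed

text \<open>Coefficients are matrix entries and \<open>U\<close> acts as a shift, so the coefficient
  maps and the powers of \<open>U\<close> have norm at most 1, which settles the limsup condition.
  Polynomials are already coefficient sequences, hence \<open>e\<close> itself is their
  inclusion.\<close>

theorem semicrossed_product: "topological_conjugacy_algebra disc_space \<eta> alg e E0"
proof (intro topological_conjugacy_algebra.intro topological_conjugacy_algebra_axioms.intro banach_alg_alg)
  show "compact_space disc_space" by (simp add: compact_space_subtopology)
  show "Hausdorff_space disc_space" by (simp add: Hausdorff_space_subtopology)
  show "continuous_map disc_space disc_space \<eta>" using eta_cont eta_maps by auto
  show "e \<in> alg_hom (skew_poly disc_space \<eta>) alg"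
    unfolding alg_hom_def
    by (auto simp: skew_poly_carrier skew_poly_ops cpolys_W intro!: ring_hom_memI)
  show "inj_on e (carrier (skew_poly disc_space \<eta>))"
    unfolding skew_poly_carrier by (rule inj_on_subset[OF e_inj]) auto
  show "nrm_topology alg closure_of e ` carrier (skew_poly disc_space \<eta>) = carrier alg"
  proof -
    have sub: "e ` cpolys CD \<subseteq> carrier alg" using cpolys_W by auto
    have "y \<in> nrm_topology alg closure_of (e ` cpolys CD)" if y: "y \<in> carrier alg" for y
      unfolding BA.closure_iff[OF sub]
    proof (intro conjI y allI impI)
      fix r :: real assume r: "r > 0"
      obtain a where a: "a \<in> W" "y = e a" using y by auto
      obtain p where p: "p \<in> cpolys CD" "bnd \<eta> (cdiff a p) (r/2)" using W_approx[OF a(1) half_gt_zero[OF r]] by blast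
      have "nrm alg (y \<ominus>\<^bsub>alg\<^esub> e p) < r"
        using bnd_cnorm_le[OF p(2)] r a cpolys_W[OF p(1)] by (simp add: alg_diff)
      then show "\<exists>s\<in>e ` cpolys CD. nrm alg (y \<ominus>\<^bsub>alg\<^esub> s) < r" using p(1) by blast
    qed
    then show ?thesis unfolding skew_poly_carrier using BA.closure_iff[OF sub] by blast
  qed
  show "closedin (nrm_topology alg) ((\<lambda>f. e (const_poly disc_space f)) ` carrier (cont_alg disc_space))"
    unfolding BA.closed_iff
  proof (intro conjI ballI impI)
    show "(\<lambda>f. e (const_poly disc_space f)) ` CD \<subseteq> carrier alg"
      using CD_D const_poly_eq cmon_W by auto
    fix y assume y: "y \<in> carrier alg"
      and lim: "\<forall>r>0. \<exists>s\<in>(\<lambda>f. e (const_poly disc_space f)) ` CD. nrm alg (y \<ominus>\<^bsub>alg\<^esub> s) < r"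
    obtain a where a: "a \<in> W" "y = e a" using y by auto
    \<comment> \<open>Functions have no higher coefficients, and coefficients are dominated by the
      norm.\<close>
    have z: "a n x = 0" if n: "n > 0" and x: "x \<in> disc" for n x
    proof -
      have "cmod (a n x) \<le> 0 + r" if r: "r > 0" for r
      proof -
        obtain f where f: "f \<in> CD" "nrm alg (y \<ominus>\<^bsub>alg\<^esub> e (const_poly disc_space f)) < r" using lim r by blast
        have fW: "cmon f 0 \<in> W" using CD_D(2)[OF f(1)] by (rule cmon_W)
        have "cnorm \<eta> (cdiff a (cmon f 0)) < r"
          using f(2) a fW CD_D(1)[OF f(1)] by (simp add: const_poly_eq alg_diff)
        then have "cmod (cdiff a (cmon f 0) n x) < r"
          using bnd_coeff[OF bnd_norm[of "cdiff a (cmon f 0)"] x, of n] a fW by simp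
        then show ?thesis using n x by simp
      qed
      then have "cmod (a n x) \<le> 0" by (rule field_le_epsilon)
      then show ?thesis by simp
    qed
    have a0: "a 0 \<in> CD" by (rule seqs_CD[OF W_seqs[OF a(1)]])
    have "a = cmon (a 0) 0" by (rule coeff_seqs_eqI) (use a z CD_D(2)[OF a0] in auto)
    then have "y = e (const_poly disc_space (a 0))" using a CD_D(1)[OF a0] by (simp add: const_poly_eq)
    then show "y \<in> (\<lambda>f. e (const_poly disc_space f)) ` CD" using a0 by blast
  qed
  show "E0 \<in> alg_hom alg (cont_alg disc_space)"
    unfolding alg_hom_def
  proof (intro CollectI conjI allI ballI ring_hom_memI)
    show "E0 x \<in> CD" if "x \<in> carrier alg" for x using that by (auto intro: seqs_CD)
    show "E0 (x \<otimes>\<^bsub>alg\<^esub> y) = E0 x \<otimes>\<^bsub>cont_alg disc_space\<^esub> E0 y" if "x \<in> carrier alg" "y \<in> carrier alg" for x y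
      using that by (auto; simp add: cmul_def cont_alg_def)
    show "E0 (x \<oplus>\<^bsub>alg\<^esub> y) = E0 x \<oplus>\<^bsub>cont_alg disc_space\<^esub> E0 y" if "x \<in> carrier alg" "y \<in> carrier alg" for x y
      using that by (auto; simp add: cadd_def cont_alg_def)
    show "E0 \<one>\<^bsub>alg\<^esub> = \<one>\<^bsub>cont_alg disc_space\<^esub>" by (simp, simp add: cunit_def cont_alg_def)
    show "E0 (c \<odot>\<^bsub>alg\<^esub> x) = c \<odot>\<^bsub>cont_alg disc_space\<^esub> E0 x" if "x \<in> carrier alg" for c x
      using that by (auto; simp add: csm_def cont_alg_def)
  qed
  show "E0 (e (const_poly disc_space f)) = f" if f: "f \<in> CD" for f
  proof -
    have "cmon f 0 0 = f" using CD_D(1)[OF f] by (auto simp: cmon_def fun_eq_iff extensional_def)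
    then show ?thesis using CD_D[OF f] by (simp add: const_poly_eq)
  qed
  show "{a \<in> carrier alg. E0 a = \<zero>\<^bsub>cont_alg disc_space\<^esub>} = (\<lambda>b. b \<otimes>\<^bsub>alg\<^esub> e (var_poly disc_space)) ` carrier alg"
  proof (intro equalityI subsetI)
    fix y assume "y \<in> {a \<in> carrier alg. E0 a = \<zero>\<^bsub>cont_alg disc_space\<^esub>}"
    then obtain a where a: "a \<in> W" "y = e a" "a 0 = (\<lambda>x\<in>disc. 0)" by (auto simp: cont_alg_def)
    have "a = cmul \<eta> (\<lambda>n. a (Suc n)) Uc"
      by (rule coeff_seqs_eqI) (use a in \<open>auto simp: cmul_Uc split: nat.split\<close>)
    then have "y = e (\<lambda>n. a (Suc n)) \<otimes>\<^bsub>alg\<^esub> e (var_poly disc_space)"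
      using a by (simp add: var_poly_eq)
    then show "y \<in> (\<lambda>b. b \<otimes>\<^bsub>alg\<^esub> e (var_poly disc_space)) ` carrier alg" using W_shift[OF a(1)] by simp
  next
    fix y assume "y \<in> (\<lambda>b. b \<otimes>\<^bsub>alg\<^esub> e (var_poly disc_space)) ` carrier alg"
    then obtain b where b: "b \<in> W" "y = e b \<otimes>\<^bsub>alg\<^esub> e (var_poly disc_space)" by auto
    then have y: "y = e (cmul \<eta> b Uc)" by (simp add: var_poly_eq)
    have "cmul \<eta> b Uc 0 = (\<lambda>x\<in>disc. 0)"
      unfolding cmul_def by (auto simp: fun_eq_iff)
    then show "y \<in> {a \<in> carrier alg. E0 a = \<zero>\<^bsub>cont_alg disc_space\<^esub>}"
      unfolding y using b(1) by (simp add: cont_alg_def)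
  qed
  show "y = \<zero>\<^bsub>alg\<^esub>" if y: "y \<in> carrier alg" "y \<otimes>\<^bsub>alg\<^esub> e (var_poly disc_space) = \<zero>\<^bsub>alg\<^esub>" for y
  proof -
    obtain b where b: "b \<in> W" "y = e b" using y by auto
    then have eq: "cmul \<eta> b Uc = czero" using y(2) by (simp add: var_poly_eq)
    have "b = czero"
    proof (rule coeff_seqs_eqI)
      show "b n x = czero n x" if "x \<in> disc" for n x
        using fun_cong[OF fun_cong[OF eq, of "Suc n"], of x] cmul_Uc[OF that, of b "Suc n"] that by simp
    qed (use b in auto)
    then show ?thesis using b by simp
  qed
  show "limsup (\<lambda>n. ereal_root n (op_nrm alg (cont_alg disc_space)
      (coeff_map alg (\<lambda>f. e (const_poly disc_space f)) (e (var_poly disc_space)) E0 n)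
      * ereal (nrm alg (e (var_poly disc_space) [^]\<^bsub>alg\<^esub> n)))) \<le> 1"
  proof (rule Limsup_bounded, rule always_eventually, rule allI)
    fix n
    let ?op = "op_nrm alg (cont_alg disc_space) (coeff_map alg (\<lambda>f. e (const_poly disc_space f)) (e (var_poly disc_space)) E0 n)"
    let ?u = "nrm alg (e (var_poly disc_space) [^]\<^bsub>alg\<^esub> n)"
    have u: "0 \<le> ?u" "?u \<le> 1" using nrm_U_pow[of n] BA.nrm_nonneg by (auto simp: var_poly_eq)
    have le1: "ereal (nrm (cont_alg disc_space) (coeff_map alg (\<lambda>f. e (const_poly disc_space f)) (e (var_poly disc_space)) E0 n y)) \<le> 1"
      and ge0: "0 \<le> ereal (nrm (cont_alg disc_space) (coeff_map alg (\<lambda>f. e (const_poly disc_space f)) (e (var_poly disc_space)) E0 n y))"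
      if y: "y \<in> carrier alg" "nrm alg y \<le> 1" for y
    proof -
      obtain a where a: "a \<in> W" "y = e a" using y by auto
      have "bnd \<eta> a 1" using a y by (intro bnd_less) auto
      then have le: "cmod (a n x) \<le> 1" if "x \<in> disc" for x using bnd_coeff that by blast
      have ne: "disc \<noteq> {}" by auto
      have "(SUP x\<in>disc. cmod (a n x)) \<le> 1" by (rule cSUP_least[OF ne]) (rule le)
      moreover have "0 \<le> (SUP x\<in>disc. cmod (a n x))"
        by (rule cSUP_upper2[of _ _ 0]) (use le in \<open>auto intro!: bdd_aboveI2[of _ _ 1]\<close>)
      moreover have "coeff_map alg (\<lambda>f. e (const_poly disc_space f)) (e (var_poly disc_space)) E0 n y = a n"
        unfolding a(2) by (rule coeff_map_alg[OF a(1)])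
      ultimately show "ereal (nrm (cont_alg disc_space) (coeff_map alg (\<lambda>f. e (const_poly disc_space f)) (e (var_poly disc_space)) E0 n y)) \<le> 1"
        "0 \<le> ereal (nrm (cont_alg disc_space) (coeff_map alg (\<lambda>f. e (const_poly disc_space f)) (e (var_poly disc_space)) E0 n y))"
        by (simp_all add: cont_alg_def)
    qed
    have op1: "?op \<le> 1" unfolding op_nrm_def by (rule SUP_least) (use le1 in auto)
    have op0: "0 \<le> ?op"
      unfolding op_nrm_def
      by (rule SUP_upper2[of "\<zero>\<^bsub>alg\<^esub>"]) (use ge0[of "\<zero>\<^bsub>alg\<^esub>"] cnorm_eq_0[of czero] in auto)
    obtain r where r: "?op = ereal r" "0 \<le> r" "r \<le> 1" using op0 op1 by (cases ?op) auto
    have "r * ?u \<le> 1 * 1" by (rule mult_mono) (use r u in auto)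
    then have "root n (r * ?u) \<le> 1"
      using real_root_le_mono[of n "r * ?u" 1] by (cases "n = 0") auto
    then show "ereal_root n (?op * ereal ?u) \<le> 1" using r by (simp add: ereal_root_def one_ereal_def)
  qed
qed

end

section \<open>Isomorphisms of semicrossed products\<close>

lemma cpolys_iff: "p \<in> cpolys disc_algebra \<longleftrightarrow>
    (\<forall>n. p n \<in> disc_algebra) \<and> (\<exists>N. \<forall>n\<ge>N. \<forall>x\<in>disc. p n x = 0)"
proof -
  have "(\<forall>n. p n \<in> disc_algebra) \<Longrightarrow> p \<in> coeff_seqs"
    by (simp add: coeff_seqs_def disc_algebra_iff disc_hol_def)
  then show ?thesis unfolding cpolys_def by blast
qed

lemma cpolys_disc_CD: "p \<in> cpolys disc_algebra \<Longrightarrow> p \<in> cpolys CD"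
  unfolding cpolys_def using seqs_CD by blast

context disc_dynamics
begin

text \<open>The counterpart of \<open>W\<close> for coefficients in the disc algebra;
  \<open>uniform_subalgebra_alg\<close> relates it to the subalgebra in question.\<close>

definition Bs :: "coeffs set" where
  "Bs = {a \<in> coeff_seqs. \<forall>r>0. \<exists>p\<in>cpolys disc_algebra. bnd \<eta> (cdiff a p) r}"

lemma Bs_W: "a \<in> Bs \<Longrightarrow> a \<in> W"
  unfolding Bs_def W_def using cpolys_disc_CD by blast

lemma Bs_I:
  assumes a: "a \<in> coeff_seqs" and ap: "\<And>r. r > 0 \<Longrightarrow> \<exists>b\<in>Bs. bnd \<eta> (cdiff a b) r"
  shows "a \<in> Bs"
proof -
  have "\<exists>p\<in>cpolys disc_algebra. bnd \<eta> (cdiff a p) r" if r: "r > 0" for r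
  proof -
    obtain b where b: "b \<in> Bs" "bnd \<eta> (cdiff a b) (r/2)" using ap[OF half_gt_zero[OF r]] by blast
    obtain p where p: "p \<in> cpolys disc_algebra" "bnd \<eta> (cdiff b p) (r/2)"
      using b(1) half_gt_zero[OF r] unfolding Bs_def by blast
    have "cadd (cdiff a b) (cdiff b p) = cdiff a p"
      by (rule coeff_seqs_eqI) (use a W_seqs[OF Bs_W[OF b(1)]] p in auto)
    then show ?thesis using bnd_cadd[OF b(2) p(2)] p(1) by auto
  qed
  then show ?thesis using a unfolding Bs_def by auto
qed

lemma cpolys_Bs: "p \<in> cpolys disc_algebra \<Longrightarrow> p \<in> Bs"
proof -
  assume p: "p \<in> cpolys disc_algebra"
  have "cdiff p p = czero" by (rule coeff_seqs_eqI) (use p in auto)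
  then have "bnd \<eta> (cdiff p p) r" if "r > 0" for r using bnd_mono[OF bnd_czero] that by simp
  then show ?thesis using p unfolding Bs_def by auto
qed

end

lemma (in semicrossed) disc_conjugacy_alg: "disc_map \<eta> \<Longrightarrow> disc_conjugacy \<eta> alg e E0"
  by (intro disc_conjugacy.intro semicrossed_product disc_conjugacy_axioms.intro)

text \<open>Approximation in the norm and approximation by \<open>bnd\<close> amount to the same,
  since the norm is itself a bound; halving \<open>r\<close> restores the strict inequality.\<close>

lemma (in semicrossed) uniform_subalgebra_alg:
  assumes "disc_map \<eta>"
  shows "uniform_subalgebra alg e disc_space \<eta> disc_algebra = alg\<lparr>carrier := e ` Bs\<rparr>"
proof -
  interpret D: disc_conjugacy \<eta> alg e E0 by (rule disc_conjugacy_alg[OF assms])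
  have "p \<in> {p \<in> cpolys CD. \<forall>n. p n \<in> disc_algebra} \<longleftrightarrow> p \<in> cpolys disc_algebra" for p
    using cpolys_disc_CD[of p] unfolding cpolys_def by blast
  then have PS: "D.PS = cpolys disc_algebra"
    unfolding D.PS_def skew_poly_carrier by blast
  have "D.B = e ` Bs"
  proof (intro equalityI subsetI)
    fix y assume y: "y \<in> D.B"
    then have "y \<in> carrier alg" by (rule D.B_carrier)
    then obtain a where a: "a \<in> W" "y = e a" by auto
    have "\<exists>p\<in>cpolys disc_algebra. bnd \<eta> (cdiff a p) r" if r: "r > 0" for r
    proof -
      obtain p where p: "p \<in> cpolys disc_algebra" "nrm alg (y \<ominus>\<^bsub>alg\<^esub> e p) < r"
        using D.B_iff[of y] y r unfolding PS by blast
      have pW: "p \<in> W" using cpolys_W[OF cpolys_disc_CD[OF p(1)]] .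
      then have "bnd \<eta> (cdiff a p) r" using p a by (intro bnd_less) (simp_all add: alg_diff)
      then show ?thesis using p by blast
    qed
    then have "a \<in> Bs" using a unfolding Bs_def by auto
    then show "y \<in> e ` Bs" using a by blast
  next
    fix y assume "y \<in> e ` Bs"
    then obtain a where a: "a \<in> Bs" "y = e a" by blast
    have aW: "a \<in> W" by (rule Bs_W[OF a(1)])
    have "\<exists>p\<in>cpolys disc_algebra. nrm alg (y \<ominus>\<^bsub>alg\<^esub> e p) < r" if r: "r > 0" for r
    proof -
      obtain p where p: "p \<in> cpolys disc_algebra" "bnd \<eta> (cdiff a p) (r/2)"
        using a(1) half_gt_zero[OF r] unfolding Bs_def by blast
      have pW: "p \<in> W" using cpolys_W[OF cpolys_disc_CD[OF p(1)]] .
      have "nrm alg (y \<ominus>\<^bsub>alg\<^esub> e p) < r" using bnd_cnorm_le[OF p(2)] r aW pW a(2) by (simp add: alg_diff)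
      then show ?thesis using p by blast
    qed
    then show "y \<in> D.B" using a aW unfolding D.B_iff PS by simp
  qed
  then show ?thesis using D.uniform_subalgebra_eq by simp
qed

text \<open>
  A set \<open>Q\<close> of pairs of polynomials that is closed under the operations, isometric, and dense on
  both sides extends to an isomorphism of the closures.
\<close>

locale approx_iso = L: disc_dynamics \<eta> + R: disc_dynamics \<eta>' for \<eta> \<eta>' +
  fixes Q :: "(coeffs \<times> coeffs) set"
  assumes map: "disc_map \<eta>" and map': "disc_map \<eta>'"
    and Q_polys: "(p, q) \<in> Q \<Longrightarrow> p \<in> cpolys disc_algebra \<and> q \<in> cpolys disc_algebra"
    and Q_unit: "(cunit, cunit) \<in> Q"
    and Q_cadd: "(p, q) \<in> Q \<Longrightarrow> (p', q') \<in> Q \<Longrightarrow> (cadd p p', cadd q q') \<in> Q"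
    and Q_csm: "(p, q) \<in> Q \<Longrightarrow> (csm c p, csm c q) \<in> Q"
    and Q_cmul: "(p, q) \<in> Q \<Longrightarrow> (p', q') \<in> Q \<Longrightarrow> (cmul \<eta> p p', cmul \<eta>' q q') \<in> Q"
    and Q_isometric: "(p, q) \<in> Q \<Longrightarrow> bnd \<eta> p C \<longleftrightarrow> bnd \<eta>' q C"
    and Q_dense: "p \<in> cpolys disc_algebra \<Longrightarrow> r > 0 \<Longrightarrow> \<exists>(p', q')\<in>Q. bnd \<eta> (cdiff p p') r"
    and Q_dense': "q \<in> cpolys disc_algebra \<Longrightarrow> r > 0 \<Longrightarrow> \<exists>(p', q')\<in>Q. bnd \<eta>' (cdiff q q') r"
begin

text \<open>The closure of \<open>Q\<close> under simultaneous approximation; it turns out to be the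
  graph of the isomorphism.\<close>

definition rel :: "coeffs \<Rightarrow> coeffs \<Rightarrow> bool" where
  "rel a b \<longleftrightarrow> a \<in> coeff_seqs \<and> b \<in> coeff_seqs \<and>
     (\<forall>r>0. \<exists>p q. (p, q) \<in> Q \<and> bnd \<eta> (cdiff a p) r \<and> bnd \<eta>' (cdiff b q) r)"

lemma Q_seqs: "(p, q) \<in> Q \<Longrightarrow> p \<in> coeff_seqs \<and> q \<in> coeff_seqs"
  using Q_polys cpolys_seqs by blast

lemma Q_cdiff: "(p, q) \<in> Q \<Longrightarrow> (p', q') \<in> Q \<Longrightarrow> (cdiff p p', cdiff q q') \<in> Q"
  unfolding L.cdiff_eq by (intro Q_cadd Q_csm)

lemma swap_approx: "approx_iso \<eta>' \<eta> (Q\<inverse>)"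
proof unfold_locales
  show "\<exists>(p', q')\<in>Q\<inverse>. bnd \<eta>' (cdiff p p') r" if "p \<in> cpolys disc_algebra" "r > 0" for p r
    using Q_dense'[OF that] by auto
  show "\<exists>(p', q')\<in>Q\<inverse>. bnd \<eta> (cdiff p q') r" if "p \<in> cpolys disc_algebra" "r > 0" for p r
    using Q_dense[OF that] by auto
qed (use map map' Q_polys Q_unit Q_cadd Q_csm Q_cmul Q_isometric in auto)

lemma rel_Bs: "rel a b \<Longrightarrow> a \<in> L.Bs" "rel a b \<Longrightarrow> b \<in> R.Bs"
proof -
  assume r: "rel a b"
  show "a \<in> L.Bs"
    by (rule L.Bs_I) (use r Q_polys L.cpolys_Bs in \<open>unfold rel_def, blast+\<close>)
  show "b \<in> R.Bs"
    by (rule R.Bs_I) (use r Q_polys R.cpolys_Bs in \<open>unfold rel_def, blast+\<close>)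
qed

text \<open>\<open>a\<close> is approximated by first components of pairs. Isometry makes the second
  components a Cauchy sequence, and its limit is the partner of \<open>a\<close>.\<close>

lemma rel_exists:
  assumes a: "a \<in> L.Bs"
  shows "\<exists>b. rel a b"
proof -
  have as: "a \<in> coeff_seqs" using a by (simp add: L.Bs_def)
  have "\<exists>p q. (p, q) \<in> Q \<and> bnd \<eta> (cdiff a p) r" if r: "r > 0" for r
  proof -
    obtain p where p: "p \<in> cpolys disc_algebra" "bnd \<eta> (cdiff a p) (r/2)"
      using a half_gt_zero[OF r] unfolding L.Bs_def by blast
    obtain p' q' where q: "(p', q') \<in> Q" "bnd \<eta> (cdiff p p') (r/2)"
      using Q_dense[OF p(1) half_gt_zero[OF r]] by blast
    have "cadd (cdiff a p) (cdiff p p') = cdiff a p'"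
      by (rule coeff_seqs_eqI) (use as p Q_seqs[OF q(1)] in auto)
    then show ?thesis using L.bnd_cadd[OF p(2) q(2)] q(1) by auto
  qed
  then have "\<forall>i::nat. \<exists>pq. pq \<in> Q \<and> bnd \<eta> (cdiff a (fst pq)) (inverse (real (Suc i)))" by fastforce
  then obtain s where s: "\<And>i::nat. s i \<in> Q" "\<And>i. bnd \<eta> (cdiff a (fst (s i))) (inverse (real (Suc i)))"
    by metis
  define p q where "p i = fst (s i)" and "q i = snd (s i)" for i
  have pq: "(p i, q i) \<in> Q" "bnd \<eta> (cdiff a (p i)) (inverse (real (Suc i)))" for i
    using s by (simp_all add: p_def q_def)
  have ps: "p i \<in> coeff_seqs" "q i \<in> coeff_seqs" for i using Q_seqs[OF pq(1)] by auto
  have small: "\<exists>N. \<forall>i\<ge>N. inverse (real (Suc i)) \<le> r" if r: "r > 0" for r :: real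
  proof -
    obtain N where N: "inverse (real (Suc N)) < r" using reals_Archimedean[OF r] by blast
    have "inverse (real (Suc i)) \<le> r" if "i \<ge> N" for i
    proof -
      have "inverse (real (Suc i)) \<le> inverse (real (Suc N))" using that by (intro le_imp_inverse_le) auto
      then show ?thesis using N by linarith
    qed
    then show ?thesis by blast
  qed
  have "\<exists>N. \<forall>m\<ge>N. \<forall>n\<ge>N. bnd \<eta>' (cdiff (q m) (q n)) r" if r: "r > 0" for r
  proof -
    obtain N where N: "\<forall>i\<ge>N. inverse (real (Suc i)) \<le> r/2" using small[OF half_gt_zero[OF r]] by blast
    have "bnd \<eta>' (cdiff (q m) (q n)) r" if mn: "m \<ge> N" "n \<ge> N" for m n
    proof -
      have "bnd \<eta> (cdiff (cdiff a (p n)) (cdiff a (p m))) (inverse (real (Suc n)) + inverse (real (Suc m)))"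
        by (rule L.bnd_cdiff[OF pq(2) pq(2)])
      moreover have "cdiff (cdiff a (p n)) (cdiff a (p m)) = cdiff (p m) (p n)"
        by (rule coeff_seqs_eqI) (use as ps in auto)
      moreover have "inverse (real (Suc n)) + inverse (real (Suc m)) \<le> r" using N mn by (metis add_mono field_sum_of_halves)
      ultimately have "bnd \<eta> (cdiff (p m) (p n)) r" using bnd_mono by metis
      then show ?thesis using Q_isometric[OF Q_cdiff[OF pq(1) pq(1)]] by blast
    qed
    then show ?thesis by blast
  qed
  moreover have "q i \<in> R.W" for i using Q_polys[OF pq(1)] R.cpolys_W cpolys_disc_CD by blast
  ultimately obtain b where b: "b \<in> R.W" "\<And>r. r > 0 \<Longrightarrow> \<exists>N. \<forall>n\<ge>N. bnd \<eta>' (cdiff (q n) b) r"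
    using R.W_complete[of q] by blast
  have "\<exists>p q. (p, q) \<in> Q \<and> bnd \<eta> (cdiff a p) r \<and> bnd \<eta>' (cdiff b q) r" if r: "r > 0" for r
  proof -
    obtain N where N: "\<forall>i\<ge>N. inverse (real (Suc i)) \<le> r" using small[OF r] by blast
    obtain M where M: "\<forall>n\<ge>M. bnd \<eta>' (cdiff (q n) b) r" using b(2)[OF r] by blast
    let ?i = "max N M"
    have "bnd \<eta> (cdiff a (p ?i)) r" using bnd_mono[OF pq(2)] N by simp
    moreover have "cdiff b (q ?i) = csm (-1) (cdiff (q ?i) b)" by (auto simp: cdiff_def csm_def fun_eq_iff)
    then have "bnd \<eta>' (cdiff b (q ?i)) r" using R.bnd_csm[of "cdiff (q ?i) b" r "-1"] M by simp
    ultimately show ?thesis using pq(1) by blast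
  qed
  then have "rel a b" unfolding rel_def using as b(1) by auto
  then show ?thesis by blast
qed

lemma rel_unique:
  assumes b: "rel a b" and b': "rel a b'"
  shows "b = b'"
proof -
  have s: "a \<in> coeff_seqs" "b \<in> coeff_seqs" "b' \<in> coeff_seqs" using b b' by (auto simp: rel_def)
  show ?thesis
  proof (rule coeff_seqs_eqI[OF s(2,3)])
    fix n x assume x: "x \<in> disc"
    have "cmod (b n x - b' n x) \<le> 0 + r" if r: "r > 0" for r
    proof -
      have r4: "r/4 > 0" using r by simp
      obtain p q where pq: "(p, q) \<in> Q" "bnd \<eta> (cdiff a p) (r/4)" "bnd \<eta>' (cdiff b q) (r/4)"
        using b r4 unfolding rel_def by blast
      obtain p' q' where pq': "(p', q') \<in> Q" "bnd \<eta> (cdiff a p') (r/4)" "bnd \<eta>' (cdiff b' q') (r/4)"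
        using b' r4 unfolding rel_def by blast
      note sq = Q_seqs[OF pq(1)] Q_seqs[OF pq'(1)]
      have "cdiff (cdiff a p') (cdiff a p) = cdiff p p'" by (rule coeff_seqs_eqI) (use s sq in auto)
      then have "bnd \<eta> (cdiff p p') (r/4 + r/4)" using L.bnd_cdiff[OF pq'(2) pq(2)] by simp
      then have "bnd \<eta>' (cdiff q q') (r/4 + r/4)" using Q_isometric[OF Q_cdiff[OF pq(1) pq'(1)]] by blast
      from R.bnd_cdiff[OF R.bnd_cadd[OF pq(3) this] pq'(3)]
      have "bnd \<eta>' (cdiff (cadd (cdiff b q) (cdiff q q')) (cdiff b' q')) r" by simp
      moreover have "cdiff (cadd (cdiff b q) (cdiff q q')) (cdiff b' q') = cdiff b b'"
        by (rule coeff_seqs_eqI) (use s sq in auto)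
      ultimately show ?thesis using R.bnd_coeff[of "cdiff b b'" r x n] x by simp
    qed
    then have "cmod (b n x - b' n x) \<le> 0" by (rule field_le_epsilon)
    then show "b n x = b' n x" by simp
  qed
qed

lemma rel_cadd: "rel a b \<Longrightarrow> rel c d \<Longrightarrow> rel (cadd a c) (cadd b d)"
proof -
  assume ab: "rel a b" and cd: "rel c d"
  have s: "a \<in> coeff_seqs" "b \<in> coeff_seqs" "c \<in> coeff_seqs" "d \<in> coeff_seqs" using ab cd by (auto simp: rel_def)
  have "\<exists>p q. (p, q) \<in> Q \<and> bnd \<eta> (cdiff (cadd a c) p) r \<and> bnd \<eta>' (cdiff (cadd b d) q) r" if r: "r > 0" for r
  proof -
    obtain p q where pq: "(p, q) \<in> Q" "bnd \<eta> (cdiff a p) (r/2)" "bnd \<eta>' (cdiff b q) (r/2)"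
      using ab half_gt_zero[OF r] unfolding rel_def by blast
    obtain p' q' where pq': "(p', q') \<in> Q" "bnd \<eta> (cdiff c p') (r/2)" "bnd \<eta>' (cdiff d q') (r/2)"
      using cd half_gt_zero[OF r] unfolding rel_def by blast
    note sq = Q_seqs[OF pq(1)] Q_seqs[OF pq'(1)]
    have eq: "cdiff (cadd a c) (cadd p p') = cadd (cdiff a p) (cdiff c p')"
      "cdiff (cadd b d) (cadd q q') = cadd (cdiff b q) (cdiff d q')"
      by (rule coeff_seqs_eqI; use s sq in auto)+
    have "bnd \<eta> (cdiff (cadd a c) (cadd p p')) r" "bnd \<eta>' (cdiff (cadd b d) (cadd q q')) r"
      unfolding eq using L.bnd_cadd[OF pq(2) pq'(2)] R.bnd_cadd[OF pq(3) pq'(3)] by simp_all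
    then show ?thesis using Q_cadd[OF pq(1) pq'(1)] by blast
  qed
  then show ?thesis using s unfolding rel_def by auto
qed

lemma rel_csm: "rel a b \<Longrightarrow> rel (csm k a) (csm k b)"
proof -
  assume ab: "rel a b"
  have s: "a \<in> coeff_seqs" "b \<in> coeff_seqs" using ab by (auto simp: rel_def)
  have "\<exists>p q. (p, q) \<in> Q \<and> bnd \<eta> (cdiff (csm k a) p) r \<and> bnd \<eta>' (cdiff (csm k b) q) r" if r: "r > 0" for r
  proof -
    have c1: "cmod k + 1 > 0" by (simp add: add_nonneg_pos)
    then have "r / (cmod k + 1) > 0" using r by simp
    then obtain p q where pq: "(p, q) \<in> Q" "bnd \<eta> (cdiff a p) (r / (cmod k + 1))" "bnd \<eta>' (cdiff b q) (r / (cmod k + 1))"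
      using ab unfolding rel_def by blast
    note sq = Q_seqs[OF pq(1)]
    have eq: "cdiff (csm k a) (csm k p) = csm k (cdiff a p)" "cdiff (csm k b) (csm k q) = csm k (cdiff b q)"
      by (rule coeff_seqs_eqI; use s sq in \<open>auto simp: right_diff_distrib\<close>)+
    have "cmod k * (r / (cmod k + 1)) \<le> r" using c1 r by (simp add: field_simps)
    then have "bnd \<eta> (cdiff (csm k a) (csm k p)) r" "bnd \<eta>' (cdiff (csm k b) (csm k q)) r"
      unfolding eq using bnd_mono[OF L.bnd_csm[OF pq(2)]] bnd_mono[OF R.bnd_csm[OF pq(3)]] by blast+
    then show ?thesis using Q_csm[OF pq(1)] by blast
  qed
  then show ?thesis using s unfolding rel_def by auto
qed

lemma rel_cunit: "rel cunit cunit"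
proof -
  have "cdiff cunit cunit = czero" by (rule coeff_seqs_eqI) auto
  then have "bnd \<eta> (cdiff cunit cunit) r \<and> bnd \<eta>' (cdiff cunit cunit) r" if "r > 0" for r
    using bnd_mono[OF L.bnd_czero] bnd_mono[OF R.bnd_czero] that by simp
  then show ?thesis unfolding rel_def using Q_unit by auto
qed

lemma rel_cmul: "rel a b \<Longrightarrow> rel c d \<Longrightarrow> rel (cmul \<eta> a c) (cmul \<eta>' b d)"
proof -
  assume ab: "rel a b" and cd: "rel c d"
  have s: "a \<in> coeff_seqs" "b \<in> coeff_seqs" "c \<in> coeff_seqs" "d \<in> coeff_seqs" using ab cd by (auto simp: rel_def)
  obtain K1 K2 K3 K4 where K: "bnd \<eta> a K1" "bnd \<eta>' b K2" "bnd \<eta> c K3" "bnd \<eta>' d K4"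
    using L.W_bounded[OF L.Bs_W[OF rel_Bs(1)[OF ab]]] L.W_bounded[OF L.Bs_W[OF rel_Bs(1)[OF cd]]]
      R.W_bounded[OF R.Bs_W[OF rel_Bs(2)[OF ab]]] R.W_bounded[OF R.Bs_W[OF rel_Bs(2)[OF cd]]] by metis
  define K where "K = max (max K1 K2) (max K3 K4)"
  have KK: "bnd \<eta> a K" "bnd \<eta>' b K" "bnd \<eta> c K" "bnd \<eta>' d K"
    by (rule bnd_mono[OF K(1)] bnd_mono[OF K(2)] bnd_mono[OF K(3)] bnd_mono[OF K(4)]; simp add: K_def)+
  have K0: "K \<ge> 0" by (rule bndD(2)[OF KK(1)])
  have "\<exists>p q. (p, q) \<in> Q \<and> bnd \<eta> (cdiff (cmul \<eta> a c) p) r \<and> bnd \<eta>' (cdiff (cmul \<eta>' b d) q) r" if r: "r > 0" for r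
  proof -
    \<comment> \<open>The error of the product is at most \<open>t * K + (t + K) * t\<close>, where
      \<open>t + K\<close> bounds the approximants; for \<open>t \<le> 1\<close> this is at most
      \<open>t * (2 * K + 2)\<close>.\<close>
    define t where "t = min 1 (r / (2 * K + 2))"
    have "r / (2 * K + 2) > 0" using r K0 by simp
    then have t: "t > 0" "t \<le> 1" by (auto simp: t_def)
    have "t * (2 * K + 2) \<le> r"
      using K0 mult_right_mono[of t "r / (2 * K + 2)" "2 * K + 2"] by (simp add: t_def)
    moreover have "t * K + (t + K) * t \<le> t * (2 * K + 2)"
    proof -
      have "t * t \<le> t * 1" using t by (intro mult_left_mono) auto
      then show ?thesis using t by (simp add: algebra_simps)
    qed
    ultimately have tr: "t * K + (t + K) * t \<le> r" by simp
    obtain p q where pq: "(p, q) \<in> Q" "bnd \<eta> (cdiff a p) t" "bnd \<eta>' (cdiff b q) t"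
      using ab t(1) unfolding rel_def by blast
    obtain p' q' where pq': "(p', q') \<in> Q" "bnd \<eta> (cdiff c p') t" "bnd \<eta>' (cdiff d q') t"
      using cd t(1) unfolding rel_def by blast
    have sq: "p \<in> coeff_seqs" "q \<in> coeff_seqs" "p' \<in> coeff_seqs" "q' \<in> coeff_seqs"
      using Q_seqs[OF pq(1)] Q_seqs[OF pq'(1)] by auto
    have "cdiff a (cdiff a p) = p" "cdiff b (cdiff b q) = q"
      by (rule coeff_seqs_eqI; use s sq in auto)+
    then have pb: "bnd \<eta> p (t + K)" "bnd \<eta>' q (t + K)"
      using L.bnd_cdiff[OF KK(1) pq(2)] R.bnd_cdiff[OF KK(2) pq(3)] by (simp_all add: add.commute)
    have eq: "cdiff (cmul \<eta> a c) (cmul \<eta> p p') = cadd (cmul \<eta> (cdiff a p) c) (cmul \<eta> p (cdiff c p'))"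
      "cdiff (cmul \<eta>' b d) (cmul \<eta>' q q') = cadd (cmul \<eta>' (cdiff b q) d) (cmul \<eta>' q (cdiff d q'))"
      by (rule coeff_seqs_eqI; use s sq in \<open>auto simp: L.cmul_distrib R.cmul_distrib\<close>)+
    have "bnd \<eta> (cdiff (cmul \<eta> a c) (cmul \<eta> p p')) r" "bnd \<eta>' (cdiff (cmul \<eta>' b d) (cmul \<eta>' q q')) r"
      unfolding eq
      by (rule bnd_mono[OF L.bnd_cadd[OF L.bnd_cmul[OF pq(2) KK(3)] L.bnd_cmul[OF pb(1) pq'(2)]] tr],
          rule bnd_mono[OF R.bnd_cadd[OF R.bnd_cmul[OF pq(3) KK(4)] R.bnd_cmul[OF pb(2) pq'(3)]] tr])
    then show ?thesis using Q_cmul[OF pq(1) pq'(1)] by blast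
  qed
  then show ?thesis using s unfolding rel_def by auto
qed

lemma rel_swap: "rel a b \<longleftrightarrow> approx_iso.rel \<eta>' \<eta> (Q\<inverse>) b a"
  unfolding rel_def approx_iso.rel_def[OF swap_approx] converse_iff by meson

text \<open>\<open>rel\<close> is total and single-valued on the closure; the same facts for the
  converse of \<open>Q\<close> make the resulting map bijective.\<close>

theorem subalgebras_isomorphic:
  assumes e: "inj_on (e :: coeffs \<Rightarrow> 'u) coeff_seqs"
  shows "alg_isomorphic (uniform_subalgebra (semicrossed.alg \<eta> e) e disc_space \<eta> disc_algebra)
    (uniform_subalgebra (semicrossed.alg \<eta>' e) e disc_space \<eta>' disc_algebra)"
proof -
  interpret SL: semicrossed \<eta> e by unfold_locales (rule e)
  interpret SR: semicrossed \<eta>' e by unfold_locales (rule e)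
  interpret SW: approx_iso \<eta>' \<eta> "Q\<inverse>" by (rule swap_approx)
  define \<Phi> where "\<Phi> a = (THE b. rel a b)" for a
  have rel\<Phi>: "rel a (\<Phi> a)" if "a \<in> L.Bs" for a
    unfolding \<Phi>_def using rel_exists[OF that] rel_unique by (metis theI)
  have \<Phi>_eq: "\<Phi> a = b" if "rel a b" for a b
    using rel_unique[OF rel\<Phi>[OF rel_Bs(1)[OF that]] that] .
  have sL: "a \<in> coeff_seqs" if "a \<in> L.Bs" for a using that by (simp add: L.Bs_def)
  have sR: "a \<in> coeff_seqs" if "a \<in> R.Bs" for a using that by (simp add: R.Bs_def)
  have \<Phi>B: "\<Phi> a \<in> R.Bs" if "a \<in> L.Bs" for a using rel_Bs(2)[OF rel\<Phi>[OF that]] .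
  define h where "h = (\<lambda>y. e (\<Phi> (SL.dec y)))"
  have he: "h (e a) = e (\<Phi> a)" if "a \<in> L.Bs" for a using sL[OF that] by (simp add: h_def)
  have "bij_betw h (e ` L.Bs) (e ` R.Bs)"
    unfolding bij_betw_def
  proof
    show "inj_on h (e ` L.Bs)"
    proof (rule inj_onI, elim imageE)
      fix x y a b assume xy: "h x = h y" "x = e a" "y = e b" "a \<in> L.Bs" "b \<in> L.Bs"
      then have eq: "\<Phi> a = \<Phi> b" using he sR \<Phi>B by simp
      have "a = b"
        by (rule SW.rel_unique[of "\<Phi> a"]) (use rel\<Phi> xy eq rel_swap in metis)+
      then show "x = y" using xy by simp
    qed
    show "h ` e ` L.Bs = e ` R.Bs"
    proof (intro equalityI subsetI)
      fix y assume "y \<in> h ` e ` L.Bs"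
      then show "y \<in> e ` R.Bs" using he \<Phi>B by auto
    next
      fix y assume "y \<in> e ` R.Bs"
      then obtain b where b: "b \<in> R.Bs" "y = e b" by blast
      then obtain a where "SW.rel b a" using SW.rel_exists by blast
      then have r: "rel a b" using rel_swap by blast
      then have "y = h (e a)" using he[OF rel_Bs(1)[OF r]] \<Phi>_eq[OF r] b by simp
      then show "y \<in> h ` e ` L.Bs" using rel_Bs(1)[OF r] by blast
    qed
  qed
  moreover have "h \<in> alg_hom (SL.alg\<lparr>carrier := e ` L.Bs\<rparr>) (SR.alg\<lparr>carrier := e ` R.Bs\<rparr>)"
    unfolding alg_hom_def
  proof (intro CollectI conjI allI ballI ring_hom_memI)
    fix x assume "x \<in> carrier (SL.alg\<lparr>carrier := e ` L.Bs\<rparr>)"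
    then obtain a where a: "a \<in> L.Bs" "x = e a" by auto
    show "h x \<in> carrier (SR.alg\<lparr>carrier := e ` R.Bs\<rparr>)" using a he \<Phi>B by simp
    have r: "rel (csm c a) (csm c (\<Phi> a))" for c by (rule rel_csm[OF rel\<Phi>[OF a(1)]])
    show "h (c \<odot>\<^bsub>SL.alg\<lparr>carrier := e ` L.Bs\<rparr>\<^esub> x) = c \<odot>\<^bsub>SR.alg\<lparr>carrier := e ` R.Bs\<rparr>\<^esub> h x" for c
      using he[OF rel_Bs(1)[OF r]] \<Phi>_eq[OF r] a he[OF a(1)] sL[OF a(1)] sR[OF \<Phi>B[OF a(1)]] by simp
    fix y assume "y \<in> carrier (SL.alg\<lparr>carrier := e ` L.Bs\<rparr>)"
    then obtain b where b: "b \<in> L.Bs" "y = e b" by auto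
    have r1: "rel (cadd a b) (cadd (\<Phi> a) (\<Phi> b))" by (rule rel_cadd[OF rel\<Phi>[OF a(1)] rel\<Phi>[OF b(1)]])
    have r2: "rel (cmul \<eta> a b) (cmul \<eta>' (\<Phi> a) (\<Phi> b))" by (rule rel_cmul[OF rel\<Phi>[OF a(1)] rel\<Phi>[OF b(1)]])
    show "h (x \<otimes>\<^bsub>SL.alg\<lparr>carrier := e ` L.Bs\<rparr>\<^esub> y) = h x \<otimes>\<^bsub>SR.alg\<lparr>carrier := e ` R.Bs\<rparr>\<^esub> h y"
      using he[OF rel_Bs(1)[OF r2]] \<Phi>_eq[OF r2] a b he[OF a(1)] he[OF b(1)] sL[OF a(1)] sL[OF b(1)]
        sR[OF \<Phi>B[OF a(1)]] sR[OF \<Phi>B[OF b(1)]] by simp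
    show "h (x \<oplus>\<^bsub>SL.alg\<lparr>carrier := e ` L.Bs\<rparr>\<^esub> y) = h x \<oplus>\<^bsub>SR.alg\<lparr>carrier := e ` R.Bs\<rparr>\<^esub> h y"
      using he[OF rel_Bs(1)[OF r1]] \<Phi>_eq[OF r1] a b he[OF a(1)] he[OF b(1)] sL[OF a(1)] sL[OF b(1)]
        sR[OF \<Phi>B[OF a(1)]] sR[OF \<Phi>B[OF b(1)]] by simp
  next
    show "h \<one>\<^bsub>SL.alg\<lparr>carrier := e ` L.Bs\<rparr>\<^esub> = \<one>\<^bsub>SR.alg\<lparr>carrier := e ` R.Bs\<rparr>\<^esub>"
      using he[OF rel_Bs(1)[OF rel_cunit]] \<Phi>_eq[OF rel_cunit] by simp
  qed
  ultimately show ?thesis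
    unfolding SL.uniform_subalgebra_alg[OF map] SR.uniform_subalgebra_alg[OF map'] alg_isomorphic_def by auto
qed

end

lemma disc_map_dynamics: "disc_map \<eta> \<Longrightarrow> disc_dynamics \<eta>"
  by (simp add: disc_dynamics_def disc_map_def)

lemma disc_hol_pow: "disc_hol f \<Longrightarrow> disc_map \<eta> \<Longrightarrow> disc_hol (\<lambda>x. f ((\<eta> ^^ i) x))"
proof (induction i)
  case (Suc i)
  from disc_hol_comp[OF Suc.IH[OF Suc.prems] Suc.prems(2)] show ?case by (simp add: funpow_swap1)
qed simp

lemma disc_hol_sum:
  fixes F :: "nat \<Rightarrow> complex \<Rightarrow> complex"
  shows "(\<And>i. disc_hol (F i)) \<Longrightarrow> disc_hol (\<lambda>x. \<Sum>i\<le>n. F i x)"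
proof (induction n)
  case (Suc n)
  then show ?case using disc_hol_ops(1)[OF Suc.IH[OF Suc.prems] Suc.prems[of "Suc n"]] by simp
qed simp

lemma cpolys_disc_ops:
  assumes p: "p \<in> cpolys disc_algebra" and q: "q \<in> cpolys disc_algebra"
  shows "cadd p q \<in> cpolys disc_algebra" "csm c p \<in> cpolys disc_algebra"
    "disc_map \<eta> \<Longrightarrow> cmul \<eta> p q \<in> cpolys disc_algebra"
proof -
  obtain N M where z: "\<forall>n\<ge>N. \<forall>x\<in>disc. p n x = 0" "\<forall>n\<ge>M. \<forall>x\<in>disc. q n x = 0"
    and A: "\<And>n. p n \<in> disc_algebra" "\<And>n. q n \<in> disc_algebra"
    using p q unfolding cpolys_iff by blast
  have hol: "disc_hol (p n)" "disc_hol (q n)" for n using A disc_algebraD by blast+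
  show "cadd p q \<in> cpolys disc_algebra"
    unfolding cpolys_iff
  proof (intro conjI allI exI[of _ "max N M"] impI ballI)
    show "cadd p q n \<in> disc_algebra" for n
      unfolding cadd_def by (rule restrict_disc_algebra[OF disc_hol_ops(1)[OF hol]])
  qed (use z in auto)
  show "csm c p \<in> cpolys disc_algebra"
    unfolding cpolys_iff
  proof (intro conjI allI exI[of _ N] impI ballI)
    show "csm c p n \<in> disc_algebra" for n
      unfolding csm_def by (rule restrict_disc_algebra[OF disc_hol_ops(2)[OF disc_hol_ops(4)[OF hol] hol(1)]])
  qed (use z in auto)
  assume h: "disc_map \<eta>"
  interpret disc_dynamics \<eta> by (rule disc_map_dynamics[OF h])
  have "cmul \<eta> p q \<in> cpolys CD"
    by (rule cpolys_cmul) (use p q cpolys_disc_CD in blast)+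
  moreover have "cmul \<eta> p q n \<in> disc_algebra" for n
    unfolding cmul_def
    by (intro restrict_disc_algebra disc_hol_sum disc_hol_ops(2) hol disc_hol_pow h)
  ultimately show "cmul \<eta> p q \<in> cpolys disc_algebra" unfolding cpolys_iff cpolys_def by blast
qed

lemma cunit_cpolys: "cunit \<in> cpolys disc_algebra"
  unfolding cpolys_iff
proof (intro conjI allI exI[of _ 1] impI ballI)
  show "cunit n \<in> disc_algebra" for n
    unfolding cunit_def by (rule restrict_disc_algebra) (simp add: disc_hol_def)
qed auto

subsection \<open>Conjugate maps\<close>

text \<open>Composing coefficients with the inverse \<open>\<delta>\<close> of
  \<open>\<gamma>\<close> makes the matrix of \<open>\<Psi> p\<close> at \<open>x\<close> that of
  \<open>p\<close> at \<open>\<delta> x\<close>; as \<open>x\<close> runs over the disc the bounds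
  are the same.\<close>

lemma conjugate_subalgebras_isomorphic:
  assumes h: "disc_map \<eta>" and h': "disc_map \<eta>'" and g: "homeomorphism disc disc \<gamma> \<delta>"
    and hol: "\<gamma> holomorphic_on ball 0 1" and conj: "\<And>z. z \<in> disc \<Longrightarrow> \<gamma> (\<eta> z) = \<eta>' (\<gamma> z)"
    and e: "inj_on (e :: coeffs \<Rightarrow> 'u) coeff_seqs"
  shows "alg_isomorphic (uniform_subalgebra (semicrossed.alg \<eta> e) e disc_space \<eta> disc_algebra)
    (uniform_subalgebra (semicrossed.alg \<eta>' e) e disc_space \<eta>' disc_algebra)"
proof -
  interpret L: disc_dynamics \<eta> by (rule disc_map_dynamics[OF h])
  interpret R: disc_dynamics \<eta>' by (rule disc_map_dynamics[OF h'])
  have gm: "disc_map \<gamma>" and dm: "disc_map \<delta>"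
    using g hol disc_homeo_inverse_hol(1)[OF g hol] by (auto simp: disc_map_def homeomorphism_def)
  have dg: "\<delta> (\<gamma> z) = z" and gd: "\<gamma> (\<delta> z) = z" if "z \<in> disc" for z
    using g that unfolding homeomorphism_def by blast+
  have dconj: "\<delta> (\<eta>' x) = \<eta> (\<delta> x)" if x: "x \<in> disc" for x
    using conj[OF disc_map_in[OF dm x]] gd[OF x] dg[OF disc_map_in[OF h disc_map_in[OF dm x]]] by simp
  have dpow: "\<delta> ((\<eta>' ^^ i) x) = (\<eta> ^^ i) (\<delta> x)" if x: "x \<in> disc" for i x
    by (induction i) (use dconj R.pow_in[OF x] in simp_all)
  define \<Psi> where "\<Psi> p = (\<lambda>n. \<lambda>x\<in>disc. p n (\<delta> x))" for p :: coeffs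
  have \<Psi>_at: "\<Psi> p n x = p n (\<delta> x)" if "x \<in> disc" for p n x using that by (simp add: \<Psi>_def)
  have \<Psi>p: "\<Psi> p \<in> cpolys disc_algebra" if p: "p \<in> cpolys disc_algebra" for p
  proof -
    obtain N where N: "\<forall>n\<ge>N. \<forall>x\<in>disc. p n x = 0" and A: "\<And>n. p n \<in> disc_algebra" using p unfolding cpolys_iff by blast
    have "\<Psi> p n \<in> disc_algebra" for n
      unfolding \<Psi>_def by (rule restrict_disc_algebra[OF disc_hol_comp[OF disc_algebraD(1)[OF A] dm]])
    moreover have "\<forall>n\<ge>N. \<forall>x\<in>disc. \<Psi> p n x = 0" using N \<Psi>_at disc_map_in[OF dm] by metis
    ultimately show ?thesis unfolding cpolys_iff by blast
  qed
  define Q where "Q = {(p, \<Psi> p) | p. p \<in> cpolys disc_algebra}"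
  have ops: "\<Psi> (cadd p q) = cadd (\<Psi> p) (\<Psi> q)" "\<Psi> (csm c p) = csm c (\<Psi> p)" "\<Psi> cunit = cunit"
    "\<Psi> (cmul \<eta> p q) = cmul \<eta>' (\<Psi> p) (\<Psi> q)" for p q c
  proof -
    have d: "x \<in> disc \<Longrightarrow> \<delta> x \<in> disc" for x by (rule disc_map_in[OF dm])
    have ex: "f = g" if "\<And>n. f n \<in> extensional disc" "\<And>n. g n \<in> extensional disc" "\<And>n x. x \<in> disc \<Longrightarrow> f n x = g n x"
      for f g :: coeffs
      using that by (intro ext) (metis extensional_arb)
    show "\<Psi> (cadd p q) = cadd (\<Psi> p) (\<Psi> q)"
    proof (rule ex)
      show "\<Psi> (cadd p q) n x = cadd (\<Psi> p) (\<Psi> q) n x" if "x \<in> disc" for n x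
        unfolding \<Psi>_at[OF that] cs_simps(1)[OF that] cs_simps(1)[OF d[OF that]] ..
    qed (simp_all add: \<Psi>_def cadd_def)
    show "\<Psi> (csm c p) = csm c (\<Psi> p)"
    proof (rule ex)
      show "\<Psi> (csm c p) n x = csm c (\<Psi> p) n x" if "x \<in> disc" for n x
        unfolding \<Psi>_at[OF that] cs_simps(3)[OF that] cs_simps(3)[OF d[OF that]] ..
    qed (simp_all add: \<Psi>_def csm_def)
    show "\<Psi> cunit = cunit"
    proof (rule ex)
      show "\<Psi> cunit n x = cunit n x" if "x \<in> disc" for n x
        unfolding \<Psi>_at[OF that] cs_simps(5)[OF that] cs_simps(5)[OF d[OF that]] ..
    qed (simp_all add: \<Psi>_def cunit_def)
    show "\<Psi> (cmul \<eta> p q) = cmul \<eta>' (\<Psi> p) (\<Psi> q)"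
    proof (rule ex)
      show "\<Psi> (cmul \<eta> p q) n x = cmul \<eta>' (\<Psi> p) (\<Psi> q) n x" if x: "x \<in> disc" for n x
        unfolding \<Psi>_at[OF x] L.cmul_at[OF d[OF x]] R.cmul_at[OF x]
        by (intro sum.cong refl) (simp only: \<Psi>_at[OF x] \<Psi>_at[OF R.pow_in[OF x]] dpow[OF x])
    qed (simp_all add: \<Psi>_def cmul_def)
  qed
  have act: "act \<eta>' (\<Psi> p) x N \<xi> k = act \<eta> p (\<delta> x) N \<xi> k" if "x \<in> disc" for p x N \<xi> k
    unfolding act_def by (intro sum.cong refl) (simp only: \<Psi>_at[OF R.pow_in[OF that]] dpow[OF that])
  have iso: "bnd \<eta> p C \<longleftrightarrow> bnd \<eta>' (\<Psi> p) C" for p C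
  proof
    assume b: "bnd \<eta> p C"
    show "bnd \<eta>' (\<Psi> p) C"
      by (rule bndI[OF bndD(2)[OF b]]) (simp only: ext[OF act] bndD(1)[OF b disc_map_in[OF dm]])
  next
    assume b: "bnd \<eta>' (\<Psi> p) C"
    show "bnd \<eta> p C"
    proof (rule bndI[OF bndD(2)[OF b]])
      fix x :: complex and N :: nat and \<xi> :: "nat \<Rightarrow> complex" assume x: "x \<in> disc"
      have "act \<eta> p x N \<xi> = act \<eta>' (\<Psi> p) (\<gamma> x) N \<xi>"
        by (rule ext) (simp only: act[OF disc_map_in[OF gm x]] dg[OF x])
      then show "l2 N (act \<eta> p x N \<xi>) \<le> C * l2 N \<xi>" using bndD(1)[OF b disc_map_in[OF gm x]] by simp
    qed
  qed
  interpret approx_iso \<eta> \<eta>' Q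
  proof unfold_locales
    \<comment> \<open>Every polynomial occurs in \<open>Q\<close> on either side, so density only
      asks for approximation of a polynomial by itself.\<close>
    have self: "bnd h0 (cdiff p p) r" if "p \<in> cpolys disc_algebra" "r > 0" "disc_dynamics h0" for p r h0
    proof -
      have "cdiff p p = czero" by (rule coeff_seqs_eqI) (use that in auto)
      then show ?thesis using bnd_mono[OF disc_dynamics.bnd_czero[OF that(3)]] that by simp
    qed
    show "\<exists>(p', q')\<in>Q. bnd \<eta> (cdiff p p') r" if "p \<in> cpolys disc_algebra" "r > 0" for p r
      using self[OF that L.disc_dynamics_axioms] that unfolding Q_def by blast
    show "\<exists>(p', q')\<in>Q. bnd \<eta>' (cdiff q q') r" if q: "q \<in> cpolys disc_algebra" "r > 0" for q r
    proof -
      define p where "p = (\<lambda>n. \<lambda>x\<in>disc. q n (\<gamma> x))"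
      obtain N where N: "\<forall>n\<ge>N. \<forall>x\<in>disc. q n x = 0" and A: "\<And>n. q n \<in> disc_algebra" using q(1) unfolding cpolys_iff by blast
      have "p n \<in> disc_algebra" for n
        unfolding p_def by (rule restrict_disc_algebra[OF disc_hol_comp[OF disc_algebraD(1)[OF A] gm]])
      moreover have "\<forall>n\<ge>N. \<forall>x\<in>disc. p n x = 0"
      proof (intro allI impI ballI)
        fix n x assume "n \<ge> N" and x: "x \<in> disc"
        then have "q n (\<gamma> x) = 0" using N disc_map_in[OF gm x] by blast
        then show "p n x = 0" using x by (simp add: p_def)
      qed
      ultimately have pA: "p \<in> cpolys disc_algebra" unfolding cpolys_iff by blast
      have "\<Psi> p = q"
      proof (rule coeff_seqs_eqI)
        show "\<Psi> p n x = q n x" if x: "x \<in> disc" for n x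
          unfolding \<Psi>_at[OF x] p_def using disc_map_in[OF dm x] gd[OF x] by simp
      qed (use \<Psi>p[OF pA] q in auto)
      then have "(p, q) \<in> Q" unfolding Q_def using pA by blast
      then show ?thesis using self[OF q R.disc_dynamics_axioms] by blast
    qed
  qed (use h h' \<Psi>p iso cunit_cpolys cpolys_disc_ops ops in \<open>auto simp: Q_def\<close>)
  show ?thesis by (rule subalgebras_isomorphic[OF e])
qed

subsection \<open>Inverse rotations\<close>

text \<open>Orthogonality of the characters of the cyclic group of order \<open>R\<close>; the
  factor \<open>c\<close> of modulus one drops out. For polynomials of degree below \<open>R\<close>
  a finite sum thus replaces integration over the circle.\<close>

lemma parseval_roots:
  fixes g :: "nat \<Rightarrow> complex"
  assumes R: "R > 0" and c: "cmod c = 1"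
  shows "(\<Sum>t<R. (cmod (\<Sum>i<R. g i * (c * exp (2 * of_real pi * \<i> * of_nat t / of_nat R)) ^ i))\<^sup>2)
    = real R * (\<Sum>i<R. (cmod (g i))\<^sup>2)"
proof -
  define w where "w t = exp (2 * of_real pi * \<i> * of_nat t / of_nat R)" for t :: nat
  have wn: "cmod (w t) = 1" for t
  proof -
    have "w t = exp (\<i> * of_real (2 * pi * real t / real R))" by (simp add: w_def mult_ac)
    then show ?thesis by (simp only: norm_exp_i_times)
  qed
  have wsym: "w t ^ i = w i ^ t" for t i
    unfolding w_def exp_of_nat_mult[symmetric] by (simp add: mult_ac)
  have wR: "w i ^ R = 1" for i
    using complex_root_unity[of R i] R by (simp add: w_def)
  have winj: "i = j" if "i < R" "j < R" "w i = w j" for i j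
    using complex_root_unity_eq[of R i j] that R by (simp add: w_def)
  have cnj1: "z * cnj z = 1" if "cmod z = 1" for z :: complex
    using complex_norm_square[of z] that by simp
  have orth: "(\<Sum>t<R. w t ^ i * cnj (w t ^ j)) = (if i = j then of_nat R else 0)" if ij: "i < R" "j < R" for i j
  proof -
    define z where "z = w i * cnj (w j)"
    have "(\<Sum>t<R. w t ^ i * cnj (w t ^ j)) = (\<Sum>t<R. z ^ t)"
    proof (intro sum.cong refl)
      show "w t ^ i * cnj (w t ^ j) = z ^ t" for t
        unfolding wsym[of t i] wsym[of t j] z_def power_mult_distrib complex_cnj_power ..
    qed
    also have "\<dots> = (if i = j then of_nat R else 0)"
    proof (cases "i = j")
      case True
      then have "z = 1" using cnj1[OF wn] by (simp add: z_def)
      then show ?thesis using True by simp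
    next
      case False
      have "z \<noteq> 1"
      proof
        assume "z = 1"
        then have "w i * (cnj (w j) * w j) = w j" by (simp add: z_def mult.assoc[symmetric])
        then have "w i = w j" using cnj1[OF wn[of j]] by (simp add: mult.commute)
        then show False using winj[OF ij] False by simp
      qed
      moreover have "z ^ R = 1" unfolding z_def power_mult_distrib by (simp add: wR complex_cnj_power[symmetric] del: complex_cnj_power)
      ultimately show ?thesis using False by (simp add: geometric_sum)
    qed
    finally show ?thesis .
  qed
  have cc: "c ^ i * cnj (c ^ i) = 1" for i using cnj1[of "c ^ i"] c by (simp add: norm_power)
  have "complex_of_real (\<Sum>t<R. (cmod (\<Sum>i<R. g i * (c * w t) ^ i))\<^sup>2)
      = (\<Sum>t<R. (\<Sum>i<R. g i * (c * w t) ^ i) * (\<Sum>j<R. cnj (g j * (c * w t) ^ j)))"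
    unfolding of_real_sum complex_norm_square cnj_sum ..
  also have "\<dots> = (\<Sum>t<R. \<Sum>i<R. \<Sum>j<R. (g i * c ^ i * cnj (g j * c ^ j)) * (w t ^ i * cnj (w t ^ j)))"
    unfolding sum_product by (intro sum.cong refl) (simp add: power_mult_distrib mult_ac)
  also have "\<dots> = (\<Sum>i<R. \<Sum>t<R. \<Sum>j<R. (g i * c ^ i * cnj (g j * c ^ j)) * (w t ^ i * cnj (w t ^ j)))"
    by (rule sum.swap)
  also have "\<dots> = (\<Sum>i<R. \<Sum>j<R. \<Sum>t<R. (g i * c ^ i * cnj (g j * c ^ j)) * (w t ^ i * cnj (w t ^ j)))"
    by (intro sum.cong refl sum.swap)
  also have "\<dots> = (\<Sum>i<R. \<Sum>j<R. (g i * c ^ i * cnj (g j * c ^ j)) * (if i = j then of_nat R else 0))"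
    by (intro sum.cong refl) (simp only: sum_distrib_left[symmetric] orth lessThan_iff)
  also have "\<dots> = (\<Sum>i<R. (g i * c ^ i * cnj (g i * c ^ i)) * of_nat R)"
    by (intro sum.cong refl) (simp add: if_distrib[of "\<lambda>x. _ * x"] cong: if_cong)
  also have "\<dots> = (\<Sum>i<R. (g i * cnj (g i)) * of_nat R)"
  proof (intro sum.cong refl)
    fix i
    have "g i * c ^ i * cnj (g i * c ^ i) = g i * cnj (g i) * (c ^ i * cnj (c ^ i))" by (simp add: mult_ac)
    then show "g i * c ^ i * cnj (g i * c ^ i) * of_nat R = g i * cnj (g i) * of_nat R" by (simp only: cc mult_1_right)
  qed
  also have "\<dots> = complex_of_real (real R * (\<Sum>i<R. (cmod (g i))\<^sup>2))"
    unfolding of_real_mult of_real_sum complex_norm_square sum_distrib_left by (simp add: mult_ac)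
  finally show ?thesis unfolding w_def by (simp only: of_real_eq_iff)
qed

lemma l2_sq: "(l2 N \<xi>)\<^sup>2 = (\<Sum>k<N. (cmod (\<xi> k))\<^sup>2)"
  unfolding l2_def L2_set_def by (rule real_sqrt_pow2) (simp add: sum_nonneg)

abbreviation rot :: "complex \<Rightarrow> complex \<Rightarrow> complex" where "rot l \<equiv> \<lambda>z. l * z"

lemma rot_pow: "(rot l ^^ k) x = l ^ k * x"
  by (induction k) (simp_all add: mult_ac)

lemma rot_disc_map: "cmod l = 1 \<Longrightarrow> disc_map (rot l)"
  by (auto simp: disc_map_def norm_mult intro!: continuous_intros holomorphic_intros)

definition zmon :: "nat \<Rightarrow> nat \<Rightarrow> coeffs" where "zmon m n = cmon (\<lambda>z. z ^ m) n"

lemma zmon_cpolys: "zmon m n \<in> cpolys disc_algebra"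
  unfolding cpolys_iff zmon_def
proof (intro conjI allI exI[of _ "Suc n"] impI ballI)
  show "cmon (\<lambda>z. z ^ m) n k \<in> disc_algebra" for k
    unfolding cmon_def by (rule restrict_disc_algebra)
      (cases "k = n"; auto simp: disc_hol_def intro!: continuous_intros holomorphic_intros)
qed auto

lemma zmon_seqs [simp]: "zmon m n \<in> coeff_seqs" using zmon_cpolys by (rule cpolys_seqs)

lemma zmon_at: "x \<in> disc \<Longrightarrow> zmon m n k x = (if k = n then x ^ m else 0)"
  unfolding zmon_def by simp

text \<open>
  Exchanging \<open>z\<close> and \<open>U\<close> sends \<open>z\<^sup>m U\<^sup>n\<close> to \<open>U\<^sup>m z\<^sup>n = l\<^sup>-\<^sup>m\<^sup>n z\<^sup>n U\<^sup>m\<close>, where \<open>U z = l\<^sup>-\<^sup>1 z U\<close> on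
  the right-hand side.
\<close>

inductive_set swap_pairs :: "complex \<Rightarrow> (coeffs \<times> coeffs) set" for l where
  zero: "(czero, czero) \<in> swap_pairs l"
| add: "(a, b) \<in> swap_pairs l \<Longrightarrow>
    (cadd a (csm c (zmon m n)), cadd b (csm (c * inverse l ^ (m * n)) (zmon n m))) \<in> swap_pairs l"

lemma czero_cpolys: "czero \<in> cpolys disc_algebra"
proof -
  have "csm 0 cunit = czero" by (auto simp: csm_def czero_def fun_eq_iff)
  then show ?thesis using cpolys_disc_ops(2)[OF cunit_cpolys cunit_cpolys, of 0] by simp
qed

lemma swap_pairs_cpolys: "(a, b) \<in> swap_pairs l \<Longrightarrow> a \<in> cpolys disc_algebra \<and> b \<in> cpolys disc_algebra"
proof (induction rule: swap_pairs.induct)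
  case zero then show ?case using czero_cpolys by simp
next
  case (add a b c m n)
  then show ?case
    using cpolys_disc_ops(1) cpolys_disc_ops(2)[OF zmon_cpolys zmon_cpolys] by blast
qed

lemma swap_pairs_seqs: "(a, b) \<in> swap_pairs l \<Longrightarrow> a \<in> coeff_seqs" "(a, b) \<in> swap_pairs l \<Longrightarrow> b \<in> coeff_seqs"
  using swap_pairs_cpolys cpolys_seqs by blast+

lemma cadd_assoc: "cadd (cadd a b) c = cadd a (cadd b c)"
  by (auto simp: cadd_def fun_eq_iff)

lemma cadd_czero: "a \<in> coeff_seqs \<Longrightarrow> cadd a czero = a" "a \<in> coeff_seqs \<Longrightarrow> cadd czero a = a"
  by (rule coeff_seqs_eqI; auto)+

lemma csm_cadd: "csm k (cadd a b) = cadd (csm k a) (csm k b)" and csm_csm: "csm k (csm c a) = csm (k * c) a"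
  and csm_czero: "csm k czero = czero"
  by (auto simp: cadd_def csm_def czero_def fun_eq_iff distrib_left)

lemma swap_pairs_mon: "(csm c (zmon m n), csm (c * inverse l ^ (m * n)) (zmon n m)) \<in> swap_pairs l"
  using swap_pairs.add[OF swap_pairs.zero, of c m n l] by (simp add: cadd_czero)

lemma swap_pairs_cadd:
  assumes "(a, b) \<in> swap_pairs l" "(a', b') \<in> swap_pairs l"
  shows "(cadd a a', cadd b b') \<in> swap_pairs l"
  using assms(2)
proof (induction rule: swap_pairs.induct)
  case zero then show ?case using assms(1) swap_pairs_seqs[OF assms(1)] by (simp add: cadd_czero)
next
  case (add a' b' c m n)
  show ?case using swap_pairs.add[OF add.IH, of c m n] by (simp only: cadd_assoc)
qed

lemma swap_pairs_csm: "(a, b) \<in> swap_pairs l \<Longrightarrow> (csm k a, csm k b) \<in> swap_pairs l"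
proof (induction rule: swap_pairs.induct)
  case zero then show ?case using swap_pairs.zero by (simp add: csm_czero)
next
  case (add a b c m n)
  show ?case using swap_pairs.add[OF add.IH, of "k * c" m n] by (simp only: csm_cadd csm_csm mult.assoc)
qed

text \<open>Moving \<open>U\<^sup>n\<close> past \<open>z\<^sup>p\<close> costs the factor
  \<open>l ^ (n * p)\<close>.\<close>

lemma cmul_zmon:
  assumes l: "cmod l = 1"
  shows "cmul (rot l) (csm c (zmon m n)) (csm d (zmon p q)) = csm (c * d * l ^ (n * p)) (zmon (m + p) (n + q))"
proof -
  interpret disc_dynamics "rot l" by (rule disc_map_dynamics[OF rot_disc_map[OF l]])
  show ?thesis
  proof (rule coeff_seqs_eqI)
    fix k x assume x: "x \<in> disc"
    have "cmul (rot l) (csm c (zmon m n)) (csm d (zmon p q)) k x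
       = (\<Sum>i\<le>k. if i = n then (if k = n + q then c * d * l ^ (n * p) * x ^ (m + p) else 0) else 0)"
      unfolding cmul_at[OF x]
    proof (intro sum.cong refl)
      fix i assume i: "i \<in> {..k}"
      have px: "l ^ i * x \<in> disc" using pow_in[OF x, of i] unfolding rot_pow .
      show "csm c (zmon m n) i x * csm d (zmon p q) (k - i) ((rot l ^^ i) x)
         = (if i = n then (if k = n + q then c * d * l ^ (n * p) * x ^ (m + p) else 0) else 0)"
        unfolding rot_pow cs_simps(3)[OF x] cs_simps(3)[OF px] zmon_at[OF x] zmon_at[OF px]
        using i by (auto simp: power_mult_distrib power_add power_mult[symmetric] mult_ac)
    qed
    also have "\<dots> = csm (c * d * l ^ (n * p)) (zmon (m + p) (n + q)) k x"
      unfolding cs_simps(3)[OF x] zmon_at[OF x] by simp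
    finally show "cmul (rot l) (csm c (zmon m n)) (csm d (zmon p q)) k x
      = csm (c * d * l ^ (n * p)) (zmon (m + p) (n + q)) k x" .
  qed auto
qed

lemma cmul_czero: "cmul \<eta> czero a = czero" and cmul_czero': "(\<And>x k. x \<in> disc \<Longrightarrow> (\<eta> ^^ k) x \<in> disc) \<Longrightarrow> cmul \<eta> a czero = czero"
  unfolding cmul_def by (auto simp: czero_def fun_eq_iff restrict_def)

lemma swap_pairs_cmul:
  assumes l: "cmod l = 1" and ab: "(a, b) \<in> swap_pairs l" and ab': "(a', b') \<in> swap_pairs l"
  shows "(cmul (rot l) a a', cmul (rot (inverse l)) b b') \<in> swap_pairs l"
proof -
  have l': "cmod (inverse l) = 1" using l by (simp add: norm_inverse)
  have l0: "l \<noteq> 0" using l by auto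
  interpret L: disc_dynamics "rot l" by (rule disc_map_dynamics[OF rot_disc_map[OF l]])
  interpret R: disc_dynamics "rot (inverse l)" by (rule disc_map_dynamics[OF rot_disc_map[OF l']])
  have mon: "(cmul (rot l) (csm c (zmon m n)) a', cmul (rot (inverse l)) (csm (c * inverse l ^ (m * n)) (zmon n m)) b') \<in> swap_pairs l"
    for c m n
    using ab'
  proof (induction rule: swap_pairs.induct)
    case zero
    show ?case using swap_pairs.zero cmul_czero'[OF L.pow_in] cmul_czero'[OF R.pow_in] by metis
  next
    case (add a' b' d p q)
    note s = swap_pairs_seqs[OF add.hyps]
    \<comment> \<open>The left product contributes \<open>l ^ (n * p)\<close>, the right one
      \<open>inverse l ^ (m * q)\<close>; expanding \<open>(m + p) * (n + q)\<close> shows that the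
      two products again form a pair.\<close>
    have coeff: "c * inverse l ^ (m * n) * (d * inverse l ^ (p * q)) * inverse l ^ (m * q)
       = c * d * l ^ (n * p) * inverse l ^ ((m + p) * (n + q))"
    proof -
      have exponent: "(m + p) * (n + q) = m * n + m * q + n * p + p * q" by (simp add: algebra_simps)
      have 1: "l ^ (n * p) * inverse l ^ (n * p) = 1" using l0 by (simp add: power_mult_distrib[symmetric])
      have "c * d * P * (I1 * I2 * I3 * I4) = c * I1 * (d * I4) * I2 * (P * I3)" for P I1 I2 I3 I4
        by (simp only: mult_ac)
      then show ?thesis unfolding exponent power_add by (simp only: 1 mult_1_right)
    qed
    have "cmul (rot l) (csm c (zmon m n)) (cadd a' (csm d (zmon p q)))
        = cadd (cmul (rot l) (csm c (zmon m n)) a') (csm (c * d * l ^ (n * p)) (zmon (m + p) (n + q)))"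
      unfolding cmul_zmon[OF l, symmetric] by (rule L.cmul_distrib(2)) (use s in auto)
    moreover have "cmul (rot (inverse l)) (csm (c * inverse l ^ (m * n)) (zmon n m)) (cadd b' (csm (d * inverse l ^ (p * q)) (zmon q p)))
        = cadd (cmul (rot (inverse l)) (csm (c * inverse l ^ (m * n)) (zmon n m)) b')
            (csm (c * d * l ^ (n * p) * inverse l ^ ((m + p) * (n + q))) (zmon (n + q) (m + p)))"
      unfolding coeff[symmetric] cmul_zmon[OF l', symmetric] by (rule R.cmul_distrib(2)) (use s in auto)
    ultimately show ?case using swap_pairs.add[OF add.IH] by simp
  qed
  show ?thesis using ab
  proof (induction rule: swap_pairs.induct)
    case zero then show ?case using swap_pairs.zero by (simp add: cmul_czero)
  next
    case (add a b c m n)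
    have "cmul (rot l) (cadd a (csm c (zmon m n))) a' = cadd (cmul (rot l) a a') (cmul (rot l) (csm c (zmon m n)) a')"
      by (rule L.cmul_distrib(1)) (use swap_pairs_seqs[OF add.hyps] swap_pairs_seqs[OF ab'] in auto)
    moreover have "cmul (rot (inverse l)) (cadd b (csm (c * inverse l ^ (m * n)) (zmon n m))) b'
       = cadd (cmul (rot (inverse l)) b b') (cmul (rot (inverse l)) (csm (c * inverse l ^ (m * n)) (zmon n m)) b')"
      by (rule R.cmul_distrib(1)) (use swap_pairs_seqs[OF add.hyps] swap_pairs_seqs[OF ab'] in auto)
    ultimately show ?case using swap_pairs_cadd[OF add.IH mon[of c m n]] by simp
  qed
qed

lemma swap_pairs_swap:
  assumes l: "l \<noteq> 0" and ab: "(a, b) \<in> swap_pairs l"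
  shows "(b, a) \<in> swap_pairs (inverse l)"
  using ab
proof (induction rule: swap_pairs.induct)
  case zero then show ?case by (rule swap_pairs.zero)
next
  case (add a b c m n)
  have "inverse l ^ (m * n) * inverse (inverse l) ^ (n * m) = 1"
    using l by (simp add: mult.commute[of n m] power_mult_distrib[symmetric])
  then have "c * inverse l ^ (m * n) * inverse (inverse l) ^ (n * m) = c"
    by (simp only: mult.assoc mult_1_right)
  then show ?case using swap_pairs.add[OF add.IH, of "c * inverse l ^ (m * n)" n m] by (simp only:)
qed

text \<open>The leading coefficient is split off and approximated by a polynomial in
  \<open>z\<close>; half of \<open>r\<close> is spent on it and half on the rest.\<close>

lemma swap_pairs_dense:
  assumes d: "disc_dynamics \<eta>" and p: "p \<in> cpolys disc_algebra" and r: "r > 0"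
  shows "\<exists>a b. (a, b) \<in> swap_pairs l \<and> bnd \<eta> (cdiff p a) r"
proof -
  interpret disc_dynamics \<eta> by (rule d)
  obtain N where N: "\<forall>n\<ge>N. \<forall>x\<in>disc. p n x = 0" using p unfolding cpolys_iff by blast
  then show ?thesis using p r
  proof (induction N arbitrary: p r)
    case 0
    then have "cdiff p czero = czero" by (intro coeff_seqs_eqI) auto
    then show ?case using swap_pairs.zero bnd_mono[OF bnd_czero, of r] 0 by fastforce
  next
    case (Suc N)
    have pA: "p N \<in> disc_algebra" using Suc.prems(2) unfolding cpolys_iff by blast
    let ?q = "cdiff p (cmon (p N) N)"
    have mA: "cmon (p N) N \<in> cpolys disc_algebra"
      unfolding cpolys_iff
    proof (intro conjI allI exI[of _ "Suc N"] impI ballI)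
      show "cmon (p N) N k \<in> disc_algebra" for k
        unfolding cmon_def by (rule restrict_disc_algebra)
          (cases "k = N"; use disc_algebraD(1)[OF pA] in \<open>auto simp: disc_hol_def\<close>)
    qed auto
    have q: "?q \<in> cpolys disc_algebra"
      unfolding cdiff_eq by (intro cpolys_disc_ops(1) Suc.prems cpolys_disc_ops(2)[OF mA mA])
    have "\<forall>n\<ge>N. \<forall>x\<in>disc. ?q n x = 0"
    proof (intro allI impI ballI)
      fix n x assume "n \<ge> N" and x: "x \<in> disc"
      then show "?q n x = 0" using Suc.prems(1) by (cases "n = N") auto
    qed
    from Suc.IH[OF this q half_gt_zero[OF Suc.prems(3)]] obtain a b where
      ab: "(a, b) \<in> swap_pairs l" "bnd \<eta> (cdiff ?q a) (r/2)" by blast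
    obtain c M where cM: "\<And>z. z \<in> disc \<Longrightarrow> cmod (p N z - (\<Sum>m<M. c m * z ^ m)) < r/2"
      using disc_hol_polynomial_approx[OF disc_algebraD(1)[OF pA] half_gt_zero[OF Suc.prems(3)]] by blast
    define g where "g z = (\<Sum>m<M. c m * z ^ m)" for z
    have "\<exists>b'. (cmon (\<lambda>z. \<Sum>m<M'. c m * z ^ m) N, b') \<in> swap_pairs l" for M'
    proof (induction M')
      case 0
      have "cmon (\<lambda>z. \<Sum>m<0. c m * z ^ m) N = czero" by (auto simp: cmon_def czero_def fun_eq_iff)
      then show ?case using swap_pairs.zero by metis
    next
      case (Suc M')
      then obtain b' where "(cmon (\<lambda>z. \<Sum>m<M'. c m * z ^ m) N, b') \<in> swap_pairs l" by blast
      from swap_pairs.add[OF this, of "c M'" M' N]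
      have "(cadd (cmon (\<lambda>z. \<Sum>m<M'. c m * z ^ m) N) (csm (c M') (zmon M' N)),
         cadd b' (csm (c M' * inverse l ^ (M' * N)) (zmon N M'))) \<in> swap_pairs l" .
      moreover have "cadd (cmon (\<lambda>z. \<Sum>m<M'. c m * z ^ m) N) (csm (c M') (zmon M' N)) = cmon (\<lambda>z. \<Sum>m<Suc M'. c m * z ^ m) N"
        by (auto simp: cadd_def csm_def zmon_def cmon_def fun_eq_iff)
      ultimately show ?case by auto
    qed
    then obtain b' where b': "(cmon g N, b') \<in> swap_pairs l" unfolding g_def by blast
    have "bnd \<eta> (cmon (\<lambda>z. p N z - g z) N) (r/2)"
      by (rule bnd_cmon) (use cM Suc.prems(3) in \<open>auto simp: g_def intro: less_imp_le\<close>)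
    from bnd_cadd[OF ab(2) this] have "bnd \<eta> (cadd (cdiff ?q a) (cmon (\<lambda>z. p N z - g z) N)) r" by simp
    moreover have "cadd (cdiff ?q a) (cmon (\<lambda>z. p N z - g z) N) = cdiff p (cadd a (cmon g N))"
      by (auto simp: cadd_def cdiff_def cmon_def fun_eq_iff)
    ultimately show ?case using swap_pairs_cadd[OF ab(1) b'] by metis
  qed
qed


text \<open>
  A vector \<open>\<xi>\<close> becomes the trigonometric polynomial \<open>\<Sum>k. \<xi>\<^sub>k w\<^sup>-\<^sup>k\<close> on the unit circle; under this
  correspondence the two representations of a pair in \<open>swap_pairs l\<close> agree.
\<close>

lemma swap_pairs_intertwine:
  fixes N :: nat and \<xi> :: "nat \<Rightarrow> complex"
  assumes l: "cmod l = 1" and y: "y \<in> disc" and ab: "(a, b) \<in> swap_pairs l"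
  defines "F \<equiv> \<lambda>w. \<Sum>k<N. \<xi> k * cnj w ^ k"
  shows "\<exists>D0. \<forall>D\<ge>D0. \<exists>g. (\<forall>w. cmod w = 1 \<longrightarrow>
      w ^ N * (\<Sum>n<D. a n w * y ^ n * F (l ^ n * w)) = (\<Sum>i<N + 1 + D. g i * w ^ i)) \<and>
    (\<forall>j<N. g (N - j) = act (rot (inverse l)) b y N \<xi> j)"
  using ab
proof (induction rule: swap_pairs.induct)
  case zero
  have "act (rot (inverse l)) czero y N \<xi> j = 0" for j
    unfolding act_def using y l by (intro sum.neutral) (auto simp: rot_pow norm_mult norm_power norm_inverse)
  then show ?case by (intro exI[of _ 0] allI impI exI[of _ "\<lambda>_. 0"]) simp
next
  case (add a b c m n)
  have l': "cmod (inverse l) = 1" using l by (simp add: norm_inverse)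
  have cl: "cnj l = inverse l" using complex_norm_square[of l] l by (intro inverse_unique[symmetric]) simp
  interpret R: disc_dynamics "rot (inverse l)" by (rule disc_map_dynamics[OF rot_disc_map[OF l']])
  obtain D0 where D0: "\<And>D. D \<ge> D0 \<Longrightarrow> \<exists>g. (\<forall>w. cmod w = 1 \<longrightarrow>
      w ^ N * (\<Sum>n<D. a n w * y ^ n * F (l ^ n * w)) = (\<Sum>i<N + 1 + D. g i * w ^ i)) \<and>
    (\<forall>j<N. g (N - j) = act (rot (inverse l)) b y N \<xi> j)" using add.IH by blast
  show ?case
  \<comment> \<open>\<open>D\<close> must exceed \<open>n\<close> for the new summand to be counted,
    and \<open>m\<close> for the exponents \<open>N + m - k\<close> to stay below
    \<open>N + 1 + D\<close>.\<close>
  proof (intro exI[of _ "Max {D0, Suc m, Suc n}"] allI impI)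
    fix D assume D: "D \<ge> Max {D0, Suc m, Suc n}"
    then have D: "D \<ge> D0" "m < D" "n < D" by auto
    obtain g where g: "\<And>w. cmod w = 1 \<Longrightarrow>
        w ^ N * (\<Sum>n<D. a n w * y ^ n * F (l ^ n * w)) = (\<Sum>i<N + 1 + D. g i * w ^ i)"
      and gb: "\<And>j. j < N \<Longrightarrow> g (N - j) = act (rot (inverse l)) b y N \<xi> j" using D0[OF D(1)] by blast
    \<comment> \<open>The new monomial contributes \<open>t k * w ^ (N + m - k)\<close>, since
      \<open>cnj w\<close> is the inverse of \<open>w\<close> on the circle. The factor
      \<open>w ^ N\<close> keeps exponents nonnegative, so index \<open>N - j\<close> of
      \<open>g\<close> stands for the frequency \<open>-j\<close>.\<close>
    define t where "t k = c * y ^ n * inverse l ^ (n * k) * \<xi> k" for k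
    define g' where "g' i = g i + (\<Sum>k<N. if N + m - k = i then t k else 0)" for i
    have "w ^ N * (\<Sum>i<D. cadd a (csm c (zmon m n)) i w * y ^ i * F (l ^ i * w)) = (\<Sum>i<N + 1 + D. g' i * w ^ i)"
      if w: "cmod w = 1" for w
    proof -
      have wd: "w \<in> disc" using w by simp
      have wc: "w * cnj w = 1" using complex_norm_square[of w] w by simp
      have "(\<Sum>i<D. cadd a (csm c (zmon m n)) i w * y ^ i * F (l ^ i * w))
          = (\<Sum>i<D. a i w * y ^ i * F (l ^ i * w) + (if i = n then c * w ^ m * y ^ n * F (l ^ n * w) else 0))"
        unfolding cs_simps(1,3)[OF wd] zmon_at[OF wd] by (intro sum.cong) (auto simp: distrib_right)
      also have "\<dots> = (\<Sum>i<D. a i w * y ^ i * F (l ^ i * w)) + c * w ^ m * y ^ n * F (l ^ n * w)"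
        unfolding sum.distrib using D(3) by simp
      finally have 1: "w ^ N * (\<Sum>i<D. cadd a (csm c (zmon m n)) i w * y ^ i * F (l ^ i * w))
          = (\<Sum>i<N + 1 + D. g i * w ^ i) + w ^ N * (c * w ^ m * y ^ n * F (l ^ n * w))"
        unfolding g[OF w, symmetric] by (simp add: distrib_left)
      have "w ^ N * (c * w ^ m * y ^ n * F (l ^ n * w)) = (\<Sum>k<N. t k * w ^ (N + m - k))"
        unfolding F_def sum_distrib_left
      proof (rule sum.cong[OF refl])
        fix k assume k: "k \<in> {..<N}"
        have "w ^ (N + m - k) * (w ^ k * cnj w ^ k) = w ^ (N + m - k)"
          unfolding power_mult_distrib[symmetric] wc by simp
        moreover have "w ^ N * w ^ m = w ^ (N + m - k) * w ^ k" using k by (simp add: power_add[symmetric])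
        ultimately have 2: "w ^ N * w ^ m * cnj w ^ k = w ^ (N + m - k)" by (simp only: mult.assoc)
        have "w ^ N * (c * w ^ m * y ^ n * (\<xi> k * cnj (l ^ n * w) ^ k))
            = c * y ^ n * (cnj (l ^ n)) ^ k * \<xi> k * (w ^ N * w ^ m * cnj w ^ k)"
          by (simp only: complex_cnj_mult power_mult_distrib mult_ac)
        also have "\<dots> = t k * w ^ (N + m - k)"
          unfolding 2 t_def complex_cnj_power cl power_mult[symmetric] ..
        finally show "w ^ N * (c * w ^ m * y ^ n * (\<xi> k * cnj (l ^ n * w) ^ k)) = t k * w ^ (N + m - k)" .
      qed
      also have "\<dots> = (\<Sum>k<N. \<Sum>i<N + 1 + D. (if N + m - k = i then t k else 0) * w ^ i)"
      proof (rule sum.cong[OF refl])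
        fix k assume k: "k \<in> {..<N}"
        have "(\<Sum>i<N + 1 + D. (if N + m - k = i then t k else 0) * w ^ i)
            = (\<Sum>i<N + 1 + D. if N + m - k = i then t k * w ^ (N + m - k) else 0)"
          by (intro sum.cong) auto
        also have "\<dots> = t k * w ^ (N + m - k)" using D(2) by (subst sum.delta') auto
        finally show "t k * w ^ (N + m - k) = (\<Sum>i<N + 1 + D. (if N + m - k = i then t k else 0) * w ^ i)" by (rule sym)
      qed
      also have "\<dots> = (\<Sum>i<N + 1 + D. \<Sum>k<N. (if N + m - k = i then t k else 0) * w ^ i)" by (rule sum.swap)
      finally have 3: "w ^ N * (c * w ^ m * y ^ n * F (l ^ n * w)) =
         (\<Sum>i<N + 1 + D. \<Sum>k<N. (if N + m - k = i then t k else 0) * w ^ i)" .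
      show ?thesis unfolding 1 3 g'_def distrib_right sum.distrib sum_distrib_right ..
    qed
    moreover have "g' (N - j) = act (rot (inverse l)) (cadd b (csm (c * inverse l ^ (m * n)) (zmon n m))) y N \<xi> j"
      if j: "j < N" for j
    proof -
      have "(\<Sum>k<N. if N + m - k = N - j then t k else 0) = (\<Sum>k<N. if k = j + m then t k else 0)"
        using j by (intro sum.cong) auto
      also have "\<dots> = (if j + m < N then t (j + m) else 0)" by simp
      also have "\<dots> = c * inverse l ^ (m * n) * act (rot (inverse l)) (zmon n m) y N \<xi> j"
        unfolding zmon_def R.act_cmon[OF y] rot_pow t_def
        by (simp add: power_mult_distrib power_mult[symmetric] power_add distrib_left mult_ac)
      finally show ?thesis
        unfolding g'_def gb[OF j] R.act_cadd[OF y] R.act_csm[OF y] by simp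
    qed
    ultimately show "\<exists>g. (\<forall>w. cmod w = 1 \<longrightarrow>
        w ^ N * (\<Sum>i<D. cadd a (csm c (zmon m n)) i w * y ^ i * F (l ^ i * w)) = (\<Sum>i<N + 1 + D. g i * w ^ i)) \<and>
      (\<forall>j<N. g (N - j) = act (rot (inverse l)) (cadd b (csm (c * inverse l ^ (m * n)) (zmon n m))) y N \<xi> j)"
      by (intro exI[of _ g']) blast
  qed
qed

text \<open>The terms decrease, so their averages do. With \<open>r = (cmod y)\<^sup>2\<close> this
  compares truncations of lengths \<open>L\<close> and \<open>L + D\<close> at the cost of a factor
  \<open>(L + D) / L\<close>, uniformly in \<open>y\<close>.\<close>

lemma geometric_average_decreasing:
  fixes r :: real
  assumes r: "0 \<le> r" "r \<le> 1"
  shows "real L * (\<Sum>k<L + D. r ^ k) \<le> real (L + D) * (\<Sum>k<L. r ^ k)"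
proof -
  have 1: "real L * r ^ L \<le> (\<Sum>k<L. r ^ k)"
    using sum_mono[of "{..<L}" "\<lambda>_. r ^ L" "\<lambda>k. r ^ k"] power_decreasing[OF _ r] by auto
  show ?thesis
  proof (induction D)
    case (Suc D)
    have "real L * r ^ (L + D) \<le> real L * r ^ L" by (intro mult_left_mono power_decreasing r) auto
    then show ?case using Suc 1 by (simp add: algebra_simps)
  qed simp
qed

text \<open>The bound for \<open>a\<close> is tested at the points \<open>x t\<close> on the vectors
  \<open>y ^ k * F (l ^ k * x t)\<close> and summed over the roots of unity. Parseval turns the left
  side into squared coefficients of the transformed polynomial, among them the entries for
  \<open>b\<close>, and the right side into the norm of \<open>\<xi>\<close>. Both carry weights
  \<open>r ^ k\<close>, over \<open>L\<close> and \<open>L + D\<close> indices; letting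
  \<open>L\<close> grow removes this difference.\<close>

lemma swap_pairs_bnd:
  assumes l: "cmod l = 1" and ab: "(a, b) \<in> swap_pairs l" and C: "bnd (rot l) a C"
  shows "bnd (rot (inverse l)) b C"
proof (rule bndI[OF bndD(2)[OF C]])
  fix y :: complex and N :: nat and \<xi> :: "nat \<Rightarrow> complex" assume y: "y \<in> disc"
  interpret disc_dynamics "rot l" by (rule disc_map_dynamics[OF rot_disc_map[OF l]])
  define F where "F = (\<lambda>w. \<Sum>k<N. \<xi> k * cnj w ^ k)"
  obtain D1 where D1: "\<And>n x. n \<ge> D1 \<Longrightarrow> x \<in> disc \<Longrightarrow> a n x = 0"
    using swap_pairs_cpolys[OF ab] unfolding cpolys_iff by blast
  obtain D0 where D0: "\<And>D. D \<ge> D0 \<Longrightarrow> \<exists>g. (\<forall>w. cmod w = 1 \<longrightarrow>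
      w ^ N * (\<Sum>n<D. a n w * y ^ n * F (l ^ n * w)) = (\<Sum>i<N + 1 + D. g i * w ^ i)) \<and>
    (\<forall>j<N. g (N - j) = act (rot (inverse l)) b y N \<xi> j)"
    using swap_pairs_intertwine[OF l y ab, where N = N and \<xi> = \<xi>] unfolding F_def by blast
  define D where "D = max D0 D1"
  \<comment> \<open>As many roots of unity as there are coefficients \<open>g i\<close>, and at
    least the \<open>N\<close> terms of \<open>F\<close>, so Parseval is exact for both
    polynomials.\<close>
  define R where "R = N + 1 + D"
  have R: "R > 0" "N \<le> R" by (simp_all add: R_def)
  obtain g where g: "\<And>w. cmod w = 1 \<Longrightarrow> w ^ N * (\<Sum>n<D. a n w * y ^ n * F (l ^ n * w)) = (\<Sum>i<R. g i * w ^ i)"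
    and gb: "\<And>j. j < N \<Longrightarrow> g (N - j) = act (rot (inverse l)) b y N \<xi> j"
    using D0[of D] unfolding R_def D_def by auto
  define G where "G = (\<Sum>i<R. (cmod (g i))\<^sup>2)"
  define r where "r = (cmod y)\<^sup>2"
  have r: "0 \<le> r" "r \<le> 1" using y by (simp_all add: r_def power_le_one)
  define x where "x t = exp (2 * of_real pi * \<i> * of_nat t / of_nat R)" for t :: nat
  have xn: "cmod (x t) = 1" for t
  proof -
    have "x t = exp (\<i> * of_real (2 * pi * real t / real R))" by (simp add: x_def mult_ac)
    then show ?thesis by (simp only: norm_exp_i_times)
  qed
  have wn: "cmod (l ^ k * x t) = 1" for k t using l xn by (simp add: norm_mult norm_power)
  have pars: "(\<Sum>t<R. (cmod (\<Sum>i<R. h i * (l ^ k * x t) ^ i))\<^sup>2) = real R * (\<Sum>i<R. (cmod (h i))\<^sup>2)" for h k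
    unfolding x_def by (rule parseval_roots[OF R(1)]) (simp add: norm_power l)
  have Fsum: "(\<Sum>t<R. (cmod (F (l ^ k * x t)))\<^sup>2) = real R * (l2 N \<xi>)\<^sup>2" for k
  proof -
    define h where "h i = (if i < N then cnj (\<xi> i) else 0)" for i
    have "cmod (F w) = cmod (\<Sum>i<R. h i * w ^ i)" for w
    proof -
      have "(\<Sum>i<R. h i * w ^ i) = (\<Sum>i<N. h i * w ^ i)"
        using R(2) by (intro sum.mono_neutral_right) (auto simp: h_def)
      also have "\<dots> = cnj (F w)" by (simp add: F_def h_def)
      finally show ?thesis by simp
    qed
    moreover have "(\<Sum>i<R. (cmod (h i))\<^sup>2) = (l2 N \<xi>)\<^sup>2"
    proof -
      have "(\<Sum>i<R. (cmod (h i))\<^sup>2) = (\<Sum>i<N. (cmod (h i))\<^sup>2)"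
        using R(2) by (intro sum.mono_neutral_right) (auto simp: h_def)
      then show ?thesis by (simp add: l2_sq h_def)
    qed
    ultimately show ?thesis using pars[of h k] by simp
  qed
  have main: "(\<Sum>k<L. r ^ k) * G \<le> C\<^sup>2 * ((\<Sum>k<L + D. r ^ k) * (l2 N \<xi>)\<^sup>2)" for L
  proof -
    define \<Xi> where "\<Xi> t k = y ^ k * F (l ^ k * x t)" for t k
    \<comment> \<open>In a row \<open>k < L\<close> all nonzero entries lie in columns below
      \<open>k + D\<close>, so a matrix of size \<open>L + D\<close> contains them all.\<close>
    have act_eq: "(cmod (act (rot l) a (x t) (L + D) (\<Xi> t) k))\<^sup>2 = r ^ k * (cmod (\<Sum>i<R. g i * (l ^ k * x t) ^ i))\<^sup>2"
      if k: "k < L" for t k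
    proof -
      let ?w = "l ^ k * x t"
      have "act (rot l) a (x t) (L + D) (\<Xi> t) k = (\<Sum>m\<in>{k..<k + D}. a (m - k) ?w * \<Xi> t m)"
        unfolding act_def rot_pow
        by (rule sum.mono_neutral_right) (use k D1[of _ ?w] wn in \<open>auto simp: D_def\<close>)
      also have "\<dots> = (\<Sum>n<D. a n ?w * \<Xi> t (k + n))"
        by (rule sum.reindex_bij_witness[of _ "\<lambda>n. k + n" "\<lambda>m. m - k"]) auto
      also have "\<dots> = y ^ k * (\<Sum>n<D. a n ?w * y ^ n * F (l ^ n * ?w))"
        unfolding sum_distrib_left \<Xi>_def by (simp add: power_add mult_ac)
      finally have "cmod (act (rot l) a (x t) (L + D) (\<Xi> t) k)
          = cmod y ^ k * cmod (?w ^ N * (\<Sum>n<D. a n ?w * y ^ n * F (l ^ n * ?w)))"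
        using wn[of k t] by (simp add: norm_mult norm_power)
      then show ?thesis unfolding g[OF wn] r_def by (simp add: power_mult_distrib power_mult[symmetric] mult.commute)
    qed
    have "real R * ((\<Sum>k<L. r ^ k) * G) = (\<Sum>k<L. r ^ k * (real R * G))"
      by (simp add: sum_distrib_right mult_ac sum_distrib_left)
    also have "\<dots> = (\<Sum>k<L. \<Sum>t<R. r ^ k * (cmod (\<Sum>i<R. g i * (l ^ k * x t) ^ i))\<^sup>2)"
      by (intro sum.cong refl) (simp only: sum_distrib_left[symmetric] pars G_def)
    also have "\<dots> = (\<Sum>k<L. \<Sum>t<R. (cmod (act (rot l) a (x t) (L + D) (\<Xi> t) k))\<^sup>2)"
      by (intro sum.cong refl) (simp only: act_eq lessThan_iff)
    also have "\<dots> = (\<Sum>t<R. \<Sum>k<L. (cmod (act (rot l) a (x t) (L + D) (\<Xi> t) k))\<^sup>2)" by (rule sum.swap)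
    also have "\<dots> \<le> (\<Sum>t<R. \<Sum>k<L + D. (cmod (act (rot l) a (x t) (L + D) (\<Xi> t) k))\<^sup>2)"
      by (intro sum_mono sum_mono2) auto
    also have "\<dots> \<le> (\<Sum>t<R. C\<^sup>2 * (\<Sum>k<L + D. (cmod (\<Xi> t k))\<^sup>2))"
    proof (rule sum_mono)
      fix t
      have "x t \<in> disc" using xn by simp
      from power_mono[OF bndD(1)[OF C this, of "L + D" "\<Xi> t"] l2_nonneg, of 2]
      show "(\<Sum>k<L + D. (cmod (act (rot l) a (x t) (L + D) (\<Xi> t) k))\<^sup>2) \<le> C\<^sup>2 * (\<Sum>k<L + D. (cmod (\<Xi> t k))\<^sup>2)"
        unfolding power_mult_distrib l2_sq .
    qed
    also have "\<dots> = C\<^sup>2 * (\<Sum>k<L + D. \<Sum>t<R. (cmod (\<Xi> t k))\<^sup>2)"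
      unfolding sum_distrib_left[symmetric] by (subst sum.swap) (rule refl)
    also have "\<dots> = C\<^sup>2 * (\<Sum>k<L + D. r ^ k * (\<Sum>t<R. (cmod (F (l ^ k * x t)))\<^sup>2))"
      unfolding \<Xi>_def r_def norm_mult norm_power power_mult_distrib sum_distrib_left power_mult[symmetric]
      by (simp add: mult_ac)
    also have "\<dots> = real R * (C\<^sup>2 * ((\<Sum>k<L + D. r ^ k) * (l2 N \<xi>)\<^sup>2))"
      unfolding Fsum sum_distrib_right[symmetric] by (simp add: mult_ac)
    finally show ?thesis using R(1) by (simp only: mult_le_cancel_left_pos of_nat_0_less_iff)
  qed
  have avg: "real L * G \<le> real (L + D) * (C\<^sup>2 * (l2 N \<xi>)\<^sup>2)" if L: "L > 0" for L
  proof -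
    let ?S = "\<lambda>L. \<Sum>k<L. r ^ k"
    have S: "?S L > 0"
    proof -
      have "r ^ 0 \<le> ?S L" by (rule member_le_sum) (use L r in auto)
      then show ?thesis by simp
    qed
    have "?S L * (real L * G) = real L * (?S L * G)" by simp
    also have "\<dots> \<le> real L * (C\<^sup>2 * (?S (L + D) * (l2 N \<xi>)\<^sup>2))" by (intro mult_left_mono main) simp
    also have "\<dots> = (real L * ?S (L + D)) * (C\<^sup>2 * (l2 N \<xi>)\<^sup>2)" by (simp only: mult_ac)
    also have "\<dots> \<le> (real (L + D) * ?S L) * (C\<^sup>2 * (l2 N \<xi>)\<^sup>2)"
      by (intro mult_right_mono geometric_average_decreasing r) simp
    also have "\<dots> = ?S L * (real (L + D) * (C\<^sup>2 * (l2 N \<xi>)\<^sup>2))" by (simp only: mult_ac)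
    finally show ?thesis using S by (simp only: mult_le_cancel_left_pos)
  qed
  \<comment> \<open>This is \<open>avg\<close> divided by \<open>L\<close>, as \<open>L\<close>
    tends to infinity.\<close>
  have G: "G \<le> C\<^sup>2 * (l2 N \<xi>)\<^sup>2"
  proof (rule ccontr)
    let ?X = "C\<^sup>2 * (l2 N \<xi>)\<^sup>2"
    assume "\<not> G \<le> ?X"
    then have pos: "G - ?X > 0" by simp
    obtain L :: nat where L: "real D * ?X < real L * (G - ?X)" using reals_Archimedean3[OF pos] by blast
    have "0 \<le> real D * ?X" by simp
    then have "L > 0" using L by (intro gr0I notI) (simp only: of_nat_0 mult_zero_left not_less[symmetric])
    then show False using avg[of L] L by (simp add: algebra_simps)
  qed
  have "(l2 N (act (rot (inverse l)) b y N \<xi>))\<^sup>2 = (\<Sum>j<N. (cmod (g (N - j)))\<^sup>2)"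
    unfolding l2_sq by (simp add: gb)
  also have "\<dots> = (\<Sum>i\<in>(\<lambda>j. N - j) ` {..<N}. (cmod (g i))\<^sup>2)"
    by (subst sum.reindex) (auto simp: inj_on_def)
  also have "\<dots> \<le> G" unfolding G_def by (rule sum_mono2) (auto simp: R_def)
  also have "\<dots> \<le> (C * l2 N \<xi>)\<^sup>2" using G by (simp add: power_mult_distrib)
  finally show "l2 N (act (rot (inverse l)) b y N \<xi>) \<le> C * l2 N \<xi>"
    by (rule power2_le_imp_le) (use bndD(2)[OF C] l2_nonneg in simp)
qed


theorem inverse_rotation_subalgebras_isomorphic:
  assumes l: "cmod l = 1" and e: "inj_on (e :: coeffs \<Rightarrow> 'u) coeff_seqs"
  shows "alg_isomorphic (uniform_subalgebra (semicrossed.alg (rot l) e) e disc_space (rot l) disc_algebra)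
    (uniform_subalgebra (semicrossed.alg (rot (inverse l)) e) e disc_space (rot (inverse l)) disc_algebra)"
proof -
  have l': "cmod (inverse l) = 1" using l by (simp add: norm_inverse)
  have l0: "l \<noteq> 0" using l by auto
  note dyn = disc_map_dynamics[OF rot_disc_map[OF l]] disc_map_dynamics[OF rot_disc_map[OF l']]
  have "approx_iso_axioms (rot l) (rot (inverse l)) (swap_pairs l)"
  proof
    show "(cunit, cunit) \<in> swap_pairs l"
    proof -
      have "csm 1 (zmon 0 0) = cunit" by (rule coeff_seqs_eqI) (auto simp: zmon_at)
      then show ?thesis using swap_pairs_mon[of 1 0 0 l] by simp
    qed
    show "bnd (rot l) p C \<longleftrightarrow> bnd (rot (inverse l)) q C" if "(p, q) \<in> swap_pairs l" for p q C
      using swap_pairs_bnd[OF l that] swap_pairs_bnd[OF l' swap_pairs_swap[OF l0 that]]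
      unfolding inverse_inverse_eq by blast
    show "\<exists>(p', q')\<in>swap_pairs l. bnd (rot l) (cdiff p p') r" if "p \<in> cpolys disc_algebra" "r > 0" for p r
      using swap_pairs_dense[OF dyn(1) that] unfolding Bex_def split_paired_Ex prod.case by blast
    show "\<exists>(p', q')\<in>swap_pairs l. bnd (rot (inverse l)) (cdiff q q') r" if q: "q \<in> cpolys disc_algebra" "r > 0" for q r
    proof -
      obtain a b where "(a, b) \<in> swap_pairs (inverse l)" "bnd (rot (inverse l)) (cdiff q a) r"
        using swap_pairs_dense[OF dyn(2) q] by blast
      moreover from this(1) have "(b, a) \<in> swap_pairs l"
        using swap_pairs_swap[of "inverse l" a b] l0 by (simp only: inverse_inverse_eq) simp
      ultimately show ?thesis unfolding Bex_def split_paired_Ex prod.case by blast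
    qed
  qed (fact rot_disc_map[OF l] rot_disc_map[OF l'] | erule swap_pairs_cpolys | erule (1) swap_pairs_cadd
      | erule swap_pairs_csm | erule (1) swap_pairs_cmul[OF l])+
  then interpret approx_iso "rot l" "rot (inverse l)" "swap_pairs l"
    using dyn by (intro approx_iso.intro)
  show ?thesis by (rule subalgebras_isomorphic[OF e])
qed

section \<open>Conjugacy of elliptic disc maps\<close>

lemma alg_isomorphic_trans:
  assumes "alg_isomorphic A B" "alg_isomorphic B C"
  shows "alg_isomorphic A C"
proof -
  obtain h k where h: "h \<in> alg_hom A B" "bij_betw h (carrier A) (carrier B)"
    and k: "k \<in> alg_hom B C" "bij_betw k (carrier B) (carrier C)"
    using assms unfolding alg_isomorphic_def by blast
  have "k \<circ> h \<in> alg_hom A C"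
    using h(1) k(1) ring_hom_trans[of h A B k C] ring_hom_closed[of h A B] unfolding alg_hom_def by simp
  then show ?thesis using bij_betw_trans[OF h(2) k(2)] unfolding alg_isomorphic_def by blast
qed

text \<open>A real number is coded by a set of naturals through \<open>t\<close>, and countably many
  such sets fit into one when their elements are tagged with the indices \<open>n\<close>,
  \<open>i\<close> and a flag \<open>b\<close> for real or imaginary part.\<close>

lemma ex_inj_nat_complex_functions: "\<exists>f :: (nat \<Rightarrow> nat \<Rightarrow> complex) \<Rightarrow> complex. inj f"
proof -
  obtain t :: "nat set \<Rightarrow> real" where t: "bij t"
    using nat_sets_eqpoll_reals unfolding eqpoll_def by blast
  define S where "S f = to_nat ` {(n, i, b, k). k \<in> inv_into UNIV t (if b then Re (f n i) else Im (f n i))}"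
    for f :: "nat \<Rightarrow> nat \<Rightarrow> complex"
  have "inj S"
  proof (rule injI)
    fix f g assume "S f = S g"
    then have eq: "{(n, i, b, k). k \<in> inv_into UNIV t (if b then Re (f n i) else Im (f n i))}
        = {(n, i, b, k). k \<in> inv_into UNIV t (if b then Re (g n i) else Im (g n i))}"
      unfolding S_def inj_image_eq_iff[OF inj_to_nat] .
    have "inv_into UNIV t (if b then Re (f n i) else Im (f n i)) = inv_into UNIV t (if b then Re (g n i) else Im (g n i))" for n i b
    proof (rule Set.set_eqI)
      show "k \<in> inv_into UNIV t (if b then Re (f n i) else Im (f n i)) \<longleftrightarrow> k \<in> inv_into UNIV t (if b then Re (g n i) else Im (g n i))" for k
        using arg_cong[OF eq, of "\<lambda>A. (n, i, b, k) \<in> A"] by (simp only: mem_Collect_eq prod.case)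
    qed
    from injD[OF bij_is_inj[OF bij_imp_bij_inv[OF t]] this]
    have same: "(if b then Re (f n i) else Im (f n i)) = (if b then Re (g n i) else Im (g n i))" for n i b .
    show "f = g"
    proof (intro ext complex_eqI)
      show "Re (f n i) = Re (g n i)" "Im (f n i) = Im (g n i)" for n i
        using same[of True n i] same[of False n i] by simp_all
    qed
  qed
  then have "inj (complex_of_real \<circ> (t \<circ> S))"
    by (intro inj_compose bij_is_inj[OF t] inj_of_real)
  then show ?thesis by blast
qed

text \<open>Continuous functions on the disc are determined by their values on a countable dense
  set, so a coefficient sequence amounts to a doubly indexed family of complex numbers.\<close>

lemma coeff_seqs_encoding:
  assumes j: "inj (j :: complex \<Rightarrow> 'u)"
  shows "\<exists>e :: coeffs \<Rightarrow> 'u. inj_on e coeff_seqs"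
proof -
  obtain T :: "complex set" where T: "countable T" "T \<subseteq> disc" "disc \<subseteq> closure T" using separable by blast
  have cl: "closure T = disc" using T closure_minimal[OF T(2)] by simp
  have "0 \<in> closure T" unfolding cl by simp
  then have T0: "T \<noteq> {}" by auto
  obtain f :: "(nat \<Rightarrow> nat \<Rightarrow> complex) \<Rightarrow> complex" where f: "inj f" using ex_inj_nat_complex_functions by blast
  define d where "d a = (\<lambda>n i. a n (from_nat_into T i))" for a :: coeffs
  have "inj_on d coeff_seqs"
  proof (rule inj_onI)
    fix a b assume a: "a \<in> coeff_seqs" and b: "b \<in> coeff_seqs" and eq: "d a = d b"
    show "a = b"
    proof (rule coeff_seqs_eqI[OF a b])
      fix n x assume x: "x \<in> disc"
      have on: "a n z - b n z = 0" if z: "z \<in> T" for z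
      proof -
        obtain i where "z = from_nat_into T i" using from_nat_into_surj[OF T(1) z] by metis
        then show ?thesis using fun_cong[OF fun_cong[OF eq, of n], of i] by (simp add: d_def)
      qed
      have "continuous_on (closure T) (\<lambda>z. a n z - b n z)"
        unfolding cl by (intro continuous_on_diff coeff_seqs_cont a b)
      from continuous_constant_on_closure[OF this on] x show "a n x = b n x" unfolding cl by auto
    qed
  qed
  then have "inj_on (j \<circ> f \<circ> d) coeff_seqs"
    by (intro comp_inj_on inj_on_subset[OF inj_compose[OF j f]]) auto
  then show ?thesis by blast
qed

section \<open>From isomorphism to conjugacy and back\<close>

lemma disc_iso_exists:
  fixes A\<^sub>1 A\<^sub>2 :: "'u normed_alg"
  assumes map: "disc_map \<eta>\<^sub>1" "disc_map \<eta>\<^sub>2"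
    and "topological_conjugacy_algebra disc_space \<eta>\<^sub>1 A\<^sub>1 \<iota>\<^sub>1 E\<^sub>1"
    and "topological_conjugacy_algebra disc_space \<eta>\<^sub>2 A\<^sub>2 \<iota>\<^sub>2 E\<^sub>2"
    and iso: "alg_isomorphic (uniform_subalgebra A\<^sub>1 \<iota>\<^sub>1 disc_space \<eta>\<^sub>1 disc_algebra)
      (uniform_subalgebra A\<^sub>2 \<iota>\<^sub>2 disc_space \<eta>\<^sub>2 disc_algebra)"
  shows "\<exists>h. disc_iso \<eta>\<^sub>1 A\<^sub>1 \<iota>\<^sub>1 E\<^sub>1 \<eta>\<^sub>2 A\<^sub>2 \<iota>\<^sub>2 E\<^sub>2 h"
proof -
  interpret X: disc_conjugacy \<eta>\<^sub>1 A\<^sub>1 \<iota>\<^sub>1 E\<^sub>1 by (intro disc_conjugacy.intro disc_conjugacy_axioms.intro assms)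
  interpret Y: disc_conjugacy \<eta>\<^sub>2 A\<^sub>2 \<iota>\<^sub>2 E\<^sub>2 by (intro disc_conjugacy.intro disc_conjugacy_axioms.intro assms)
  obtain h where h: "h \<in> alg_hom (A\<^sub>1\<lparr>carrier := X.B\<rparr>) (A\<^sub>2\<lparr>carrier := Y.B\<rparr>)" and bij: "bij_betw h X.B Y.B"
    using iso unfolding alg_isomorphic_def X.uniform_subalgebra_eq Y.uniform_subalgebra_eq by auto
  have rh: "h \<in> ring_hom (A\<^sub>1\<lparr>carrier := X.B\<rparr>) (A\<^sub>2\<lparr>carrier := Y.B\<rparr>)"
    and sm: "h (c \<odot>\<^bsub>A\<^sub>1\<^esub> a) = c \<odot>\<^bsub>A\<^sub>2\<^esub> h a" if "a \<in> X.B" for a c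
    using h that unfolding alg_hom_def by auto
  have rh: "h \<in> ring_hom (A\<^sub>1\<lparr>carrier := X.B\<rparr>) (A\<^sub>2\<lparr>carrier := Y.B\<rparr>)"
    using h unfolding alg_hom_def by blast
  have "disc_iso \<eta>\<^sub>1 A\<^sub>1 \<iota>\<^sub>1 E\<^sub>1 \<eta>\<^sub>2 A\<^sub>2 \<iota>\<^sub>2 E\<^sub>2 h"
  proof
    show "bij_betw h X.B Y.B" by (rule bij)
    show "h \<one>\<^bsub>A\<^sub>1\<^esub> = \<one>\<^bsub>A\<^sub>2\<^esub>" using ring_hom_one[OF rh] by simp
    show "h (a \<oplus>\<^bsub>A\<^sub>1\<^esub> b) = h a \<oplus>\<^bsub>A\<^sub>2\<^esub> h b" "h (a \<otimes>\<^bsub>A\<^sub>1\<^esub> b) = h a \<otimes>\<^bsub>A\<^sub>2\<^esub> h b"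
      if "a \<in> X.B" "b \<in> X.B" for a b
      using ring_hom_add[OF rh, of a b] ring_hom_mult[OF rh, of a b] that by simp_all
  qed (rule sm)
  then show ?thesis by blast
qed

text \<open>The cases are \<open>beta = 0\<close> and \<open>beta\<close> not identically 0. The
  second alternative carries \<open>disc_homeo \<eta>\<^sub>1\<close>, so it disappears when
  \<open>\<eta>\<^sub>1\<close> is not a homeomorphism.\<close>

lemma isomorphic_imp_conjugate:
  assumes map: "disc_map \<eta>\<^sub>1" "disc_map \<eta>\<^sub>2" and ell: "elliptic \<eta>\<^sub>1"
    and iso: "conjugacy_algebras_isomorphic TYPE('u) \<eta>\<^sub>1 \<eta>\<^sub>2"
  shows "(\<exists>\<gamma>. disc_homeo \<gamma> \<and> \<gamma> holomorphic_on ball 0 1 \<and> (\<forall>z\<in>disc. \<gamma> (\<eta>\<^sub>1 z) = \<eta>\<^sub>2 (\<gamma> z))) \<or>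
    disc_homeo \<eta>\<^sub>1 \<and> (\<exists>\<gamma> \<theta>. disc_homeo \<gamma> \<and> \<gamma> holomorphic_on ball 0 1 \<and>
      homeomorphism disc disc \<eta>\<^sub>2 \<theta> \<and> (\<forall>z\<in>disc. \<gamma> (\<eta>\<^sub>1 z) = \<theta> (\<gamma> z)))"
proof -
  obtain A\<^sub>1 A\<^sub>2 :: "'u normed_alg" and \<iota>\<^sub>1 E\<^sub>1 \<iota>\<^sub>2 E\<^sub>2 h where "disc_iso \<eta>\<^sub>1 A\<^sub>1 \<iota>\<^sub>1 E\<^sub>1 \<eta>\<^sub>2 A\<^sub>2 \<iota>\<^sub>2 E\<^sub>2 h"
    using iso disc_iso_exists[OF map] unfolding conjugacy_algebras_isomorphic_def by blast
  then interpret disc_iso \<eta>\<^sub>1 A\<^sub>1 \<iota>\<^sub>1 E\<^sub>1 \<eta>\<^sub>2 A\<^sub>2 \<iota>\<^sub>2 E\<^sub>2 h .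
  obtain z1 where z1: "z1 \<in> ball 0 1" "{w \<in> disc. \<eta>\<^sub>1 w = w} = {z1}" using ell unfolding elliptic_def by blast
  have z1': "cmod z1 < 1" "\<eta>\<^sub>1 z1 = z1" "\<And>w. w \<in> disc \<Longrightarrow> \<eta>\<^sub>1 w = w \<Longrightarrow> w = z1"
    using z1 by (simp, blast, blast)
  show ?thesis
  proof (cases "\<forall>x\<in>disc. beta x = 0")
    case True
    then show ?thesis using conjugacy_case by blast
  next
    case False
    then obtain x0 where "x0 \<in> disc" "beta x0 \<noteq> 0" by blast
    from rotation_case[OF z1' this] show ?thesis by blast
  qed
qed

lemma conjugacy_algebras_isomorphicI:
  assumes map: "disc_map \<eta>\<^sub>1" "disc_map \<eta>\<^sub>2" and e: "inj_on (e :: coeffs \<Rightarrow> 'u) coeff_seqs"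
    and "alg_isomorphic (uniform_subalgebra (semicrossed.alg \<eta>\<^sub>1 e) e disc_space \<eta>\<^sub>1 disc_algebra)
      (uniform_subalgebra (semicrossed.alg \<eta>\<^sub>2 e) e disc_space \<eta>\<^sub>2 disc_algebra)"
  shows "conjugacy_algebras_isomorphic TYPE('u) \<eta>\<^sub>1 \<eta>\<^sub>2"
  unfolding conjugacy_algebras_isomorphic_def
  using assms(4) map[THEN disc_map_dynamics, THEN semicrossed.intro, OF semicrossed_axioms.intro[OF e],
      THEN semicrossed.semicrossed_product] by blast

text \<open>A chain of isomorphisms leads from \<open>\<eta>\<^sub>1\<close> to its rotation
  \<open>rot l\<close>, by the exchange of \<open>z\<close> and \<open>U\<close> to
  \<open>rot (inverse l)\<close>, and from there to \<open>\<eta>\<^sub>2\<close>, which is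
  conjugate to the inverse of \<open>\<eta>\<^sub>1\<close>.\<close>

lemma inverse_conjugate_isomorphic:
  assumes map: "disc_map \<eta>\<^sub>1" "disc_map \<eta>\<^sub>2" and ell: "elliptic \<eta>\<^sub>1" and homeo: "disc_homeo \<eta>\<^sub>1"
    and g: "disc_homeo \<gamma>" "\<gamma> holomorphic_on ball 0 1" and th: "homeomorphism disc disc \<eta>\<^sub>2 \<theta>"
    and conj: "\<And>z. z \<in> disc \<Longrightarrow> \<gamma> (\<eta>\<^sub>1 z) = \<theta> (\<gamma> z)"
    and e: "inj_on (e :: coeffs \<Rightarrow> 'u) coeff_seqs"
  shows "alg_isomorphic (uniform_subalgebra (semicrossed.alg \<eta>\<^sub>1 e) e disc_space \<eta>\<^sub>1 disc_algebra)
    (uniform_subalgebra (semicrossed.alg \<eta>\<^sub>2 e) e disc_space \<eta>\<^sub>2 disc_algebra)"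
proof -
  obtain a where a: "cmod a < 1" "\<eta>\<^sub>1 a = a" using ell unfolding elliptic_def by fastforce
  obtain \<eta>' where \<eta>': "homeomorphism disc disc \<eta>\<^sub>1 \<eta>'" using homeo unfolding disc_homeo_def by blast
  obtain \<delta> where \<delta>: "homeomorphism disc disc \<gamma> \<delta>" using g(1) unfolding disc_homeo_def by blast
  have hol: "\<eta>\<^sub>1 holomorphic_on ball 0 1" using map(1) by (simp add: disc_map_def)
  define l where "l = deriv \<eta>\<^sub>1 a"
  have l: "cmod l = 1" unfolding l_def by (rule disc_homeo_fixed_point_deriv[OF \<eta>' hol a])
  then have l': "cmod (inverse l) = 1" and l0: "l \<noteq> 0" by (auto simp: norm_inverse)
  have rotation: "moeb a (\<eta>\<^sub>1 z) = l * moeb a z" if "z \<in> disc" for z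
    unfolding l_def by (rule disc_map_rotation[OF map(1) a _ that]) (use l in \<open>simp add: l_def\<close>)
  have a': "cmod (- a) < 1" using a by simp
  have m: "homeomorphism disc disc (moeb a) (moeb (- a))" "homeomorphism disc disc (moeb (- a)) (moeb a)"
    using moeb_homeo[OF a(1)] moeb_homeo[OF a'] by simp_all
  have mhol: "moeb b holomorphic_on ball 0 1" if "cmod b < 1" for b
    using moeb_disc_map[OF that] by (simp add: disc_map_def)
  have "(\<gamma> \<circ> moeb (- a)) holomorphic_on ball 0 1"
    by (rule holomorphic_on_compose_gen[OF mhol[OF a'] g(2)]) (use disc_homeo_ball[OF m(2)] in blast)
  moreover have "(\<gamma> \<circ> moeb (- a)) (rot (inverse l) w) = \<eta>\<^sub>2 ((\<gamma> \<circ> moeb (- a)) w)" if w: "w \<in> disc" for w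
  proof -
    have "moeb (- a) w \<in> disc" using disc_map_in[OF moeb_disc_map[OF a'] w] .
    \<comment> \<open>\<open>conj\<close> speaks of the inverse \<open>\<theta>\<close>; to use it
      for \<open>\<eta>\<^sub>2\<close> the point is written as a value of
      \<open>\<eta>\<^sub>1\<close>.\<close>
    then obtain z where z: "z \<in> disc" "\<eta>\<^sub>1 z = moeb (- a) w" using homeomorphism_image1[OF \<eta>'] by (metis imageE)
    have "moeb a (moeb (- a) w) = w" by (rule homeomorphism_apply2[OF m(1) w])
    then have "w = l * moeb a z" using rotation[OF z(1)] unfolding z(2) by simp
    then have "moeb a z = inverse l * w" using l0 by simp
    then have "z = moeb (- a) (inverse l * w)" using homeomorphism_apply1[OF m(1) z(1)] by simp
    moreover have "\<eta>\<^sub>2 (\<gamma> (\<eta>\<^sub>1 z)) = \<gamma> z"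
    proof -
      have "\<gamma> z \<in> disc" using homeomorphism_image1[OF \<delta>] z(1) by blast
      then show ?thesis unfolding conj[OF z(1)] by (rule homeomorphism_apply2[OF th])
    qed
    ultimately show ?thesis unfolding o_def z(2) by simp
  qed
  ultimately have last: "alg_isomorphic
      (uniform_subalgebra (semicrossed.alg (rot (inverse l)) e) e disc_space (rot (inverse l)) disc_algebra)
      (uniform_subalgebra (semicrossed.alg \<eta>\<^sub>2 e) e disc_space \<eta>\<^sub>2 disc_algebra)"
    by (rule conjugate_subalgebras_isomorphic[OF rot_disc_map[OF l'] map(2) homeomorphism_compose[OF m(2) \<delta>] _ _ e])
  have first: "alg_isomorphic (uniform_subalgebra (semicrossed.alg \<eta>\<^sub>1 e) e disc_space \<eta>\<^sub>1 disc_algebra)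
      (uniform_subalgebra (semicrossed.alg (rot l) e) e disc_space (rot l) disc_algebra)"
    by (rule conjugate_subalgebras_isomorphic[OF map(1) rot_disc_map[OF l] m(1) mhol[OF a(1)] rotation e])
  show ?thesis
    by (rule alg_isomorphic_trans[OF first alg_isomorphic_trans[OF inverse_rotation_subalgebras_isomorphic[OF l e] last]])
qed

theorem theorem5p17:
  fixes \<eta>\<^sub>1 \<eta>\<^sub>2 :: "complex \<Rightarrow> complex"
  assumes ambient_type: "\<exists>j :: complex \<Rightarrow> 'u. inj j"
    and map1: "disc_map \<eta>\<^sub>1" and map2: "disc_map \<eta>\<^sub>2"
    and elliptic1: "elliptic \<eta>\<^sub>1"
  shows "(disc_homeo \<eta>\<^sub>1 \<longrightarrow>
           (conjugacy_algebras_isomorphic TYPE('u) \<eta>\<^sub>1 \<eta>\<^sub>2 \<longleftrightarrow>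
            (\<exists>\<gamma>. disc_homeo \<gamma> \<and> \<gamma> holomorphic_on ball 0 1 \<and>
               ((\<forall>z\<in>disc. \<gamma> (\<eta>\<^sub>1 z) = \<eta>\<^sub>2 (\<gamma> z)) \<or>
                (\<exists>\<theta>. homeomorphism disc disc \<eta>\<^sub>2 \<theta> \<and> (\<forall>z\<in>disc. \<gamma> (\<eta>\<^sub>1 z) = \<theta> (\<gamma> z)))))))
       \<and> (\<not> disc_homeo \<eta>\<^sub>1 \<longrightarrow>
           (conjugacy_algebras_isomorphic TYPE('u) \<eta>\<^sub>1 \<eta>\<^sub>2 \<longleftrightarrow>
            (\<exists>\<gamma>. disc_homeo \<gamma> \<and> \<gamma> holomorphic_on ball 0 1 \<and>
               (\<forall>z\<in>disc. \<gamma> (\<eta>\<^sub>1 z) = \<eta>\<^sub>2 (\<gamma> z)))))"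
proof -
  obtain e :: "coeffs \<Rightarrow> 'u" where e: "inj_on e coeff_seqs"
    using ambient_type coeff_seqs_encoding by blast
  note iso = conjugacy_algebras_isomorphicI[OF map1 map2 e]
  have conj: "conjugacy_algebras_isomorphic TYPE('u) \<eta>\<^sub>1 \<eta>\<^sub>2"
    if "disc_homeo \<gamma>" "\<gamma> holomorphic_on ball 0 1" "\<forall>z\<in>disc. \<gamma> (\<eta>\<^sub>1 z) = \<eta>\<^sub>2 (\<gamma> z)" for \<gamma>
  proof -
    have "\<exists>\<delta>. homeomorphism disc disc \<gamma> \<delta>" using that(1) unfolding disc_homeo_def .
    then obtain \<delta> where "homeomorphism disc disc \<gamma> \<delta>" ..
    from conjugate_subalgebras_isomorphic[OF map1 map2 this that(2) _ e] that(3) show ?thesis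
      by (intro iso) blast
  qed
  have inv_conj: "conjugacy_algebras_isomorphic TYPE('u) \<eta>\<^sub>1 \<eta>\<^sub>2"
    if "disc_homeo \<eta>\<^sub>1" "disc_homeo \<gamma>" "\<gamma> holomorphic_on ball 0 1" "homeomorphism disc disc \<eta>\<^sub>2 \<theta>"
      "\<forall>z\<in>disc. \<gamma> (\<eta>\<^sub>1 z) = \<theta> (\<gamma> z)" for \<gamma> \<theta>
    by (rule iso[OF inverse_conjugate_isomorphic[OF map1 map2 elliptic1 that(1-4) _ e]]) (use that(5) in blast)
  note imp = isomorphic_imp_conjugate[OF map1 map2 elliptic1]
  show ?thesis
  proof (intro conjI impI iffI)
    assume "conjugacy_algebras_isomorphic TYPE('u) \<eta>\<^sub>1 \<eta>\<^sub>2"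
    from imp[OF this] show "\<exists>\<gamma>. disc_homeo \<gamma> \<and> \<gamma> holomorphic_on ball 0 1 \<and>
       ((\<forall>z\<in>disc. \<gamma> (\<eta>\<^sub>1 z) = \<eta>\<^sub>2 (\<gamma> z)) \<or>
        (\<exists>\<theta>. homeomorphism disc disc \<eta>\<^sub>2 \<theta> \<and> (\<forall>z\<in>disc. \<gamma> (\<eta>\<^sub>1 z) = \<theta> (\<gamma> z))))" by blast
  next
    assume "disc_homeo \<eta>\<^sub>1" "\<exists>\<gamma>. disc_homeo \<gamma> \<and> \<gamma> holomorphic_on ball 0 1 \<and>
       ((\<forall>z\<in>disc. \<gamma> (\<eta>\<^sub>1 z) = \<eta>\<^sub>2 (\<gamma> z)) \<or>
        (\<exists>\<theta>. homeomorphism disc disc \<eta>\<^sub>2 \<theta> \<and> (\<forall>z\<in>disc. \<gamma> (\<eta>\<^sub>1 z) = \<theta> (\<gamma> z))))"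
    then show "conjugacy_algebras_isomorphic TYPE('u) \<eta>\<^sub>1 \<eta>\<^sub>2" using conj inv_conj by blast
  next
    assume "\<not> disc_homeo \<eta>\<^sub>1" "conjugacy_algebras_isomorphic TYPE('u) \<eta>\<^sub>1 \<eta>\<^sub>2"
    then show "\<exists>\<gamma>. disc_homeo \<gamma> \<and> \<gamma> holomorphic_on ball 0 1 \<and> (\<forall>z\<in>disc. \<gamma> (\<eta>\<^sub>1 z) = \<eta>\<^sub>2 (\<gamma> z))"
      using imp by blast
  next
    assume "\<exists>\<gamma>. disc_homeo \<gamma> \<and> \<gamma> holomorphic_on ball 0 1 \<and> (\<forall>z\<in>disc. \<gamma> (\<eta>\<^sub>1 z) = \<eta>\<^sub>2 (\<gamma> z))"
    then show "conjugacy_algebras_isomorphic TYPE('u) \<eta>\<^sub>1 \<eta>\<^sub>2" using conj by blast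
  qed
qed

end
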